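(* Let $f,g\in A^2(\mathbb{D})$. Then $T_fT_g^*$ is bounded on $A^2(\mathbb{D})$ if and only if the operator $$P^+_{f,g}u(z)=|f(z)|\int_{\mathbb{D}}\frac{|g(\zeta)|u(\zeta)}{|1-\bar\zeta z|^2}\,dA(\zeta)$$ is bounded on $L^2(\mathbb{D})$.
   Context: $\mathbb{D}$ is the open unit disc, $dA$ the area measure normalized so that $A(\mathbb{D})=1$, $L^2(\mathbb{D})=L^2(\mathbb{D},dA)$, and $A^2(\mathbb{D})$ its closed subspace of analytic functions. $P_B$ is the Bergman projection $P_Bf(z)=\int_{\mathbb{D}}\frac{f(\zeta)}{(1-\bar\zeta z)^2}dA(\zeta)$; for $f\in L^2(\mathbb{D})$ the densely defined Toeplitz operator on $A^2(\mathbb{D})$ is $T_fu=P_B(fu)$, and $T_g^*$ is the adjoint of $T_g$. *)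

theory Defs
  imports "HOL-Analysis.Analysis"
begin

definition disc :: "complex set" where
  "disc = ball 0 1"

definition dA :: "complex measure" where
  "dA = density (restrict_space lborel disc) (\<lambda>_. ennreal (1 / pi))"

definition L2 :: "(complex \<Rightarrow> complex) \<Rightarrow> bool" where
  "L2 u \<longleftrightarrow> u \<in> borel_measurable dA \<and> integrable dA (\<lambda>z. (cmod (u z))\<^sup>2)"

definition l2norm :: "(complex \<Rightarrow> complex) \<Rightarrow> real" where
  "l2norm u = sqrt (\<integral>z. (cmod (u z))\<^sup>2 \<partial>dA)"

definition l2inner :: "(complex \<Rightarrow> complex) \<Rightarrow> (complex \<Rightarrow> complex) \<Rightarrow> complex" where
  "l2inner u v = (\<integral>z. u z * cnj (v z) \<partial>dA)"

definition A2 :: "(complex \<Rightarrow> complex) \<Rightarrow> bool" where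
  "A2 u \<longleftrightarrow> L2 u \<and> u holomorphic_on disc"

definition bergman_proj :: "(complex \<Rightarrow> complex) \<Rightarrow> complex \<Rightarrow> complex" where
  "bergman_proj h z = (\<integral>\<zeta>. h \<zeta> / (1 - cnj \<zeta> * z)\<^sup>2 \<partial>dA)"

definition toeplitz_dom :: "(complex \<Rightarrow> complex) \<Rightarrow> (complex \<Rightarrow> complex) set" where
  "toeplitz_dom f = {u. A2 u \<and> L2 (\<lambda>z. f z * u z)}"

definition toeplitz :: "(complex \<Rightarrow> complex) \<Rightarrow> (complex \<Rightarrow> complex) \<Rightarrow> complex \<Rightarrow> complex" where
  "toeplitz f u = bergman_proj (\<lambda>\<zeta>. f \<zeta> * u \<zeta>)"

definition adjoint_rel :: "(complex \<Rightarrow> complex) \<Rightarrow> (complex \<Rightarrow> complex) \<Rightarrow> (complex \<Rightarrow> complex) \<Rightarrow> bool" where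
  "adjoint_rel g v w \<longleftrightarrow> A2 w \<and> (\<forall>u\<in>toeplitz_dom g. l2inner (toeplitz g u) v = l2inner u w)"

definition toeplitz_adj_dom :: "(complex \<Rightarrow> complex) \<Rightarrow> (complex \<Rightarrow> complex) set" where
  "toeplitz_adj_dom g = {v. A2 v \<and> (\<exists>w. adjoint_rel g v w)}"

definition toeplitz_adj :: "(complex \<Rightarrow> complex) \<Rightarrow> (complex \<Rightarrow> complex) \<Rightarrow> complex \<Rightarrow> complex" where
  "toeplitz_adj g v = (SOME w. adjoint_rel g v w)"

definition prod_dom :: "(complex \<Rightarrow> complex) \<Rightarrow> (complex \<Rightarrow> complex) \<Rightarrow> (complex \<Rightarrow> complex) set" where
  "prod_dom f g = {v \<in> toeplitz_adj_dom g. toeplitz_adj g v \<in> toeplitz_dom f}"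

definition TfTgstar_bounded :: "(complex \<Rightarrow> complex) \<Rightarrow> (complex \<Rightarrow> complex) \<Rightarrow> bool" where
  "TfTgstar_bounded f g \<longleftrightarrow>
     (\<exists>C. \<forall>v\<in>prod_dom f g. l2norm (toeplitz f (toeplitz_adj g v)) \<le> C * l2norm v)"

definition Pplus :: "(complex \<Rightarrow> complex) \<Rightarrow> (complex \<Rightarrow> complex) \<Rightarrow> (complex \<Rightarrow> complex) \<Rightarrow> complex \<Rightarrow> complex" where
  "Pplus f g u z = complex_of_real (cmod (f z)) *
     (\<integral>\<zeta>. complex_of_real (cmod (g \<zeta>)) * u \<zeta> / complex_of_real ((cmod (1 - cnj \<zeta> * z))\<^sup>2) \<partial>dA)"

definition Pplus_bounded :: "(complex \<Rightarrow> complex) \<Rightarrow> (complex \<Rightarrow> complex) \<Rightarrow> bool" where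
  "Pplus_bounded f g \<longleftrightarrow>
     (\<exists>C. \<forall>u. L2 u \<longrightarrow> L2 (Pplus f g u) \<and> l2norm (Pplus f g u) \<le> C * l2norm u)"

end

theory Submission
  imports Defs "HOL-Complex_Analysis.Complex_Analysis"
begin

text \<open>Boundedness of the positive operator dominates \<open>T_f T_g^*\<close> pointwise. Conversely, bound the
  positive operator with \<open>g\<close> and \<open>f\<close> interchanged on \<open>k \<ge> 0\<close>, bounded with compact support. Integrating a
  suitable \<open>dbar\<close>-derivative gives a Hardy type inequality, which bounds the weighted norm of the
  positive potential \<open>P = \<integral> a / |1 - cnj w z|^2\<close>, \<open>a = |f| k\<close>, by that of its analytic counterpart and of
  \<open>S = \<integral> rho^2 a / |1 - cnj w z|^4\<close>. The bands \<open>c t < S \<le> 2 c t\<close> with a large constant \<open>c\<close> and dyadic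
  \<open>t\<close> are hyperbolically far from the set \<open>S \<le> t\<close>, so a second application of the inequality, with a
  cutoff depending on \<open>S\<close>, is free of the term \<open>S\<close>; by duality each band is bounded by the mass of \<open>k^2\<close> on
  finitely many dyadic levels of \<open>S\<close> close to \<open>t\<close>, and the bands can be summed.\<close>

section \<open>The normalized area measure\<close>

text \<open>With \<open>k = 1/(1 - cnj w z)\<close> one has
  \<open>4 (Re k)^2 = 2 |k|^2 + 2 Re (k^2)\<close>. For points whose distance is small, but large
  compared with their heights \<open>rho\<close>, \<open>1 - cnj w z\<close> is almost imaginary and
  \<open>k^2\<close> is almost \<open>-|k|^2\<close>; up to a bounded term the positive and the
  analytic kernel therefore part only through terms of type \<open>rho^2 |k|^4\<close>. If the
  height is that of z, such a term is controlled by a variance, which is gained by integrating the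
  \<open>dbar\<close>-derivative of \<open>rho^2 * d(|f|^2 N^2)\<close>, with N the positive
  potential. If it is the height of the source, the term is \<open>S\<close>. The obstacle is that
  \<open>S\<close> can be as large as the positive potential and so cannot simply be absorbed. When
  z has a low level of \<open>S\<close> and the sources a much higher one, each factor
  \<open>rho |k|\<close> at a source is at most 1/8, and absorption works. Boundedness of the
  operator is used through three facts: \<open>Fbd f g\<close>, its adjoint \<open>Fbd g f\<close>,
  and a pointwise bound for \<open>|f|^2\<close> times the Berezin transform of
  \<open>|g|^2\<close>.\<close>

lemma space_dA [simp]: "space dA = disc"
  by (simp add: dA_def space_restrict_space)

lemma sets_dA: "sets dA = sets (restrict_space borel disc)"
  by (simp add: dA_def cong: sets_restrict_space_cong)

lemma disc_iff: "z \<in> disc \<longleftrightarrow> cmod z < 1"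
  by (simp add: disc_def)

lemma open_disc [simp]: "open disc"
  by (simp add: disc_def)

lemma disc_borel [measurable, simp]: "disc \<in> sets borel"
  by (simp add: disc_def)

lemma measurable_dA_borel: "F \<in> borel_measurable borel \<Longrightarrow> F \<in> borel_measurable dA"
  by (simp add: measurable_restrict_space1 measurable_cong_sets[OF sets_dA refl])

lemma measurable_dA_id: "(\<lambda>z. z) \<in> borel_measurable dA"
  by (rule measurable_dA_borel) simp

lemma measurable_dA_continuous:
  "continuous_on disc F \<Longrightarrow> F \<in> borel_measurable dA"
  by (simp add: borel_measurable_continuous_on_restrict measurable_cong_sets[OF sets_dA refl])

lemma nn_integral_dA:
  assumes "F \<in> borel_measurable dA"
  shows "(\<integral>\<^sup>+z. F z \<partial>dA) = ennreal (1/pi) * (\<integral>\<^sup>+z. F z * indicator disc z \<partial>lborel)"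
proof -
  have F: "F \<in> borel_measurable (restrict_space lborel disc)"
    using assms by (simp add: measurable_cong_sets[OF sets_dA refl]
        measurable_cong_sets[OF sets_restrict_space_cong[OF sets_lborel] refl])
  have "(\<integral>\<^sup>+z. F z \<partial>dA) = (\<integral>\<^sup>+z. ennreal (1/pi) * F z \<partial>restrict_space lborel disc)"
    unfolding dA_def by (rule nn_integral_density) (use F in auto)
  also have "\<dots> = ennreal (1/pi) * (\<integral>\<^sup>+z. F z \<partial>restrict_space lborel disc)"
    by (rule nn_integral_cmult) (rule F)
  also have "(\<integral>\<^sup>+z. F z \<partial>restrict_space lborel disc) = (\<integral>\<^sup>+z. F z * indicator disc z \<partial>lborel)"
    by (rule nn_integral_restrict_space) simp
  finally show ?thesis .
qed

lemma emeasure_dA_disc: "emeasure dA disc = 1"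
proof -
  have "emeasure dA disc = (\<integral>\<^sup>+z. 1 \<partial>dA)"
    using nn_integral_indicator[of disc dA] by (simp add: sets.top[of dA, simplified])
  also have "\<dots> = ennreal (1/pi) * (\<integral>\<^sup>+z. 1 * indicator disc z \<partial>lborel)"
    by (rule nn_integral_dA) simp
  also have "(\<integral>\<^sup>+z. 1 * indicator disc z \<partial>lborel) = emeasure lborel (disc :: complex set)"
    by simp
  also have "\<dots> = ennreal pi"
    unfolding disc_def by (subst emeasure_ball) (auto simp: unit_ball_vol_2)
  also have "ennreal (1/pi) * ennreal pi = 1"
    by (simp flip: ennreal_mult)
  finally show ?thesis .
qed

interpretation dA: finite_measure dA
  by (rule finite_measureI) (simp add: emeasure_dA_disc)

lemma measure_dA_disc [simp]: "measure dA disc = 1"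
  by (simp add: measure_def emeasure_dA_disc)

lemma emeasure_dA_ball:
  assumes "r \<ge> 0"
  shows "emeasure dA (ball c r \<inter> disc) \<le> ennreal (r\<^sup>2)"
proof -
  have m: "ball c r \<inter> disc \<in> sets dA"
    by (simp add: sets_dA sets_restrict_space_iff)
  have "emeasure dA (ball c r \<inter> disc) = (\<integral>\<^sup>+z. indicator (ball c r \<inter> disc) z \<partial>dA)"
    using m by simp
  also have "\<dots> = ennreal (1/pi) * (\<integral>\<^sup>+z. indicator (ball c r \<inter> disc) z * indicator disc z \<partial>lborel)"
    by (rule nn_integral_dA) (use m in simp)
  also have "(\<integral>\<^sup>+z. indicator (ball c r \<inter> disc) z * indicator disc z \<partial>lborel)
      \<le> (\<integral>\<^sup>+z. indicator (ball c r) z \<partial>lborel)"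
    by (rule nn_integral_mono) (auto simp: indicator_def)
  also have "\<dots> = ennreal (pi * r\<^sup>2)"
    using assms by (simp add: emeasure_ball unit_ball_vol_2)
  finally have "emeasure dA (ball c r \<inter> disc) \<le> ennreal (1/pi) * ennreal (pi * r\<^sup>2)"
    by (simp add: mult_left_mono)
  also have "\<dots> = ennreal (r\<^sup>2)"
    by (simp flip: ennreal_mult)
  finally show ?thesis .
qed

lemma integral_dA:
  fixes F :: "complex \<Rightarrow> complex"
  assumes "F \<in> borel_measurable dA"
  shows "(\<integral>z. F z \<partial>dA) = (1/pi) *\<^sub>R (\<integral>z. indicator disc z *\<^sub>R F z \<partial>lborel)"
proof -
  have F: "F \<in> borel_measurable (restrict_space lborel disc)"
    using assms by (simp add: measurable_cong_sets[OF sets_dA refl]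
        measurable_cong_sets[OF sets_restrict_space_cong[OF sets_lborel] refl])
  have "(\<integral>z. F z \<partial>dA) = (\<integral>z. (1/pi) *\<^sub>R F z \<partial>restrict_space lborel disc)"
    unfolding dA_def by (rule integral_density) (use F in auto)
  also have "\<dots> = (1/pi) *\<^sub>R (\<integral>z. F z \<partial>restrict_space lborel disc)"
    by simp
  also have "(\<integral>z. F z \<partial>restrict_space lborel disc) = (\<integral>z. indicator disc z *\<^sub>R F z \<partial>lborel)"
    by (simp add: integral_restrict_space)
  finally show ?thesis .
qed

text \<open>Valid for every \<open>U\<close>: if \<open>U\<close> is not measurable, neither
  integrand is integrable and both integrals take the default value 0.\<close>

lemma integral_translation_invariant:
  fixes U :: "complex \<Rightarrow> complex"
  shows "(\<integral>z. U (z + h) \<partial>lborel) = (\<integral>z. U z \<partial>lborel)"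
proof -
  have "(\<integral>z. U z \<partial>lborel) = (\<integral>z. U z \<partial>distr lborel borel ((+) h))"
    by (simp add: lborel_distr_plus)
  also have "\<dots> = (\<integral>z. U (h + z) \<partial>lborel)"
  proof (cases "U \<in> borel_measurable borel")
    case True
    then show ?thesis by (subst integral_distr) auto
  next
    case False
    have "\<not> integrable (distr lborel borel ((+) h)) U"
      using False by (auto dest: borel_measurable_integrable)
    moreover have "(\<lambda>z. U (h + z)) \<notin> borel_measurable borel"
    proof
      assume "(\<lambda>z. U (h + z)) \<in> borel_measurable borel"
      then have "(\<lambda>z. U (h + z)) \<circ> (\<lambda>z. z - h) \<in> borel_measurable borel"
        by (rule measurable_comp[rotated]) simp
      then show False using False by (simp add: o_def)
    qed
    then have "\<not> integrable lborel (\<lambda>z. U (h + z))"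
      by (auto dest: borel_measurable_integrable)
    ultimately show ?thesis
      by (simp add: not_integrable_integral_eq)
  qed
  finally show ?thesis by (simp add: add.commute)
qed

section \<open>Wirtinger derivatives and integration by parts\<close>

text \<open>\<open>p\<close> and \<open>q\<close> are the Wirtinger derivatives d/dz and d/dbar z.
  They are packaged in one relation with real differentiability, so that a product or chain rule
  computes both at once.\<close>

definition wirt :: "(complex \<Rightarrow> complex) \<Rightarrow> complex \<Rightarrow> complex \<Rightarrow> complex \<Rightarrow> bool" where
  "wirt U z p q \<longleftrightarrow> (U has_derivative (\<lambda>h. p * h + q * cnj h)) (at z)"

lemma wirt_const: "wirt (\<lambda>_. c) z 0 0"
  by (simp add: wirt_def)

lemma wirt_add: "wirt U z p q \<Longrightarrow> wirt V z p' q' \<Longrightarrow> wirt (\<lambda>z. U z + V z) z (p + p') (q + q')"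
  unfolding wirt_def by (drule (1) has_derivative_add) (simp add: algebra_simps)

lemma wirt_mult: "wirt U z p q \<Longrightarrow> wirt V z p' q' \<Longrightarrow>
    wirt (\<lambda>z. U z * V z) z (p * V z + U z * p') (q * V z + U z * q')"
  unfolding wirt_def by (drule (1) has_derivative_mult) (simp add: algebra_simps)

lemma wirt_cnj: "wirt U z p q \<Longrightarrow> wirt (\<lambda>z. cnj (U z)) z (cnj q) (cnj p)"
  unfolding wirt_def by (drule has_derivative_cnj) (simp add: algebra_simps)

lemma wirt_holo: "(U has_field_derivative p) (at z) \<Longrightarrow> wirt U z p 0"
  by (simp add: wirt_def has_field_derivative_def)

lemma wirt_cong_at:
  assumes "wirt U z p q" "open S" "z \<in> S" "\<And>w. w \<in> S \<Longrightarrow> U w = V w"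
  shows "wirt V z p q"
  using has_derivative_transform_within_open[OF assms(1)[unfolded wirt_def] assms(2,3), of V] assms(4)
  by (simp add: wirt_def)

lemma wirt_continuous: "wirt U z p q \<Longrightarrow> continuous (at z within A) U"
  unfolding wirt_def by (rule continuous_at_imp_continuous_at_within, rule has_derivative_continuous)

lemma wirt_imp_continuous_on:
  assumes "\<And>z. z \<in> A \<Longrightarrow> wirt U z (p z) (q z)"
  shows "continuous_on A U"
  unfolding continuous_on_eq_continuous_within
proof
  fix z assume "z \<in> A"
  from wirt_continuous[OF assms[OF this]] show "continuous (at z within A) U" .
qed

lemma wirt_id: "wirt (\<lambda>z. z) z 1 0"
  by (rule wirt_holo) (auto intro!: derivative_eq_intros)

text \<open>Since \<open>Y\<close> is real, its differential \<open>p * h + q * cnj h\<close> is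
  real for every \<open>h\<close>, and a real factor \<open>d\<close> multiplies both
  coefficients.\<close>

lemma wirt_real_compose:
  fixes Y :: "complex \<Rightarrow> real" and \<xi> :: "real \<Rightarrow> real"
  assumes "wirt (\<lambda>z. of_real (Y z)) z p q" and "(\<xi> has_real_derivative d) (at (Y z))"
  shows "wirt (\<lambda>z. of_real (\<xi> (Y z))) z (d * p) (d * q)"
proof -
  have im: "Im (p * h + q * cnj h) = 0" for h
  proof -
    have "((\<lambda>z. Im (of_real (Y z))) has_derivative (\<lambda>h. Im (p * h + q * cnj h))) (at z)"
      using assms(1) unfolding wirt_def by (rule bounded_linear.has_derivative[OF bounded_linear_Im])
    moreover have "((\<lambda>z. Im (of_real (Y z))) has_derivative (\<lambda>h. 0)) (at z)"
      by simp
    ultimately show ?thesis by (metis has_derivative_unique)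
  qed
  have "((\<lambda>z. Re (of_real (Y z))) has_derivative (\<lambda>h. Re (p * h + q * cnj h))) (at z)"
    using assms(1) unfolding wirt_def by (rule bounded_linear.has_derivative[OF bounded_linear_Re])
  then have Y: "(Y has_derivative (\<lambda>h. Re (p * h + q * cnj h))) (at z)"
    by simp
  have "((\<lambda>z. \<xi> (Y z)) has_derivative (\<lambda>h. Re (p * h + q * cnj h) * d)) (at z)"
    using has_derivative_compose[OF Y assms(2)[unfolded has_field_derivative_def]]
    by (simp add: mult.commute)
  then have "((\<lambda>z. complex_of_real (\<xi> (Y z))) has_derivative (\<lambda>h. of_real (Re (p * h + q * cnj h) * d))) (at z)"
    by (rule bounded_linear.has_derivative[OF bounded_linear_of_real])
  moreover have "of_real (Re (p * h + q * cnj h) * d) = d * p * h + d * q * cnj h" for h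
  proof -
    have "of_real (Re (p * h + q * cnj h)) = p * h + q * cnj h"
      using im[of h] by (simp only: complex_eq_iff Re_complex_of_real Im_complex_of_real)
    then have "of_real (Re (p * h + q * cnj h) * d) = (p * h + q * cnj h) * of_real d"
      by (simp only: of_real_mult)
    also have "\<dots> = d * p * h + d * q * cnj h"
      by (simp add: algebra_simps)
    finally show ?thesis .
  qed
  ultimately show ?thesis
    by (simp add: wirt_def)
qed

lemma wirt_norm_le: "norm (p * h + q * cnj h) \<le> (cmod p + cmod q) * norm h"
  by (rule order_trans[OF norm_triangle_ineq]) (simp add: norm_mult algebra_simps)

text \<open>Difference quotients in the direction \<open>e\<close> integrate to 0 by translation
  invariance. The Lipschitz bound and the compact support dominate them, so the derivative inherits
  the integral 0.\<close>

lemma integral_directional_derivative: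
  fixes U :: "complex \<Rightarrow> complex"
  assumes U: "\<And>z. wirt U z (p z) (q z)"
    and bnd: "\<And>z. cmod (p z) + cmod (q z) \<le> M"
    and supp: "\<And>z. R \<le> cmod z \<Longrightarrow> U z = 0"
    and e: "cmod e = 1" and R: "R \<ge> 0"
  shows "integrable lborel (\<lambda>z. p z * e + q z * cnj e)"
    and "(\<integral>z. (p z * e + q z * cnj e) \<partial>lborel) = 0"
proof -
  define s where "s n z = of_nat (Suc n) * (U (z + e / of_nat (Suc n)) - U z)" for n z
  have M0: "M \<ge> 0" using bnd[of 0] by (meson add_nonneg_nonneg norm_ge_zero order_trans)
  have "continuous_on UNIV U"
    by (rule wirt_imp_continuous_on) (rule U)
  then have Um [measurable]: "U \<in> borel_measurable borel"
    by (rule borel_measurable_continuous_onI)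
  have lip: "cmod (U (z + h) - U z) \<le> M * cmod h" for z h
  proof -
    have "cmod (U (z + h) - U z) \<le> M * cmod (z + h - z)"
    proof (rule differentiable_bound[of UNIV U "\<lambda>z h. p z * h + q z * cnj h"])
      show "(U has_derivative (\<lambda>h. p x * h + q x * cnj h)) (at x within UNIV)" for x
        using U[of x] by (simp add: wirt_def)
      show "onorm (\<lambda>h. p x * h + q x * cnj h) \<le> M" for x
      proof (rule onorm_le)
        fix h
        have "norm (p x * h + q x * cnj h) \<le> (cmod (p x) + cmod (q x)) * norm h"
          by (rule wirt_norm_le)
        also have "\<dots> \<le> M * norm h"
          by (intro mult_right_mono bnd norm_ge_zero)
        finally show "norm (p x * h + q x * cnj h) \<le> M * norm h" .
      qed
    qed auto
    then show ?thesis by simp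
  qed
  have lim: "(\<lambda>n. s n z) \<longlonglongrightarrow> p z * e + q z * cnj e" for z
  proof -
    define L where "L h = p z * h + q z * cnj h" for h
    define hh where "hh n = e / of_nat (Suc n)" for n
    have e0: "e \<noteq> 0" using e by auto
    have "((\<lambda>h. cmod (U (z + h) - U z - L h) / cmod h) \<longlongrightarrow> 0) (at 0)"
      using U[of z] unfolding wirt_def has_derivative_at L_def by blast
    moreover have "hh \<longlonglongrightarrow> 0"
      unfolding hh_def using LIMSEQ_Suc[OF lim_const_over_n[of e]] by simp
    moreover have "hh n \<noteq> 0" for n
      using e0 by (simp add: hh_def del: of_nat_Suc)
    ultimately have "((\<lambda>h. cmod (U (z + h) - U z - L h) / cmod h) \<circ> hh) \<longlonglongrightarrow> 0"
      unfolding tendsto_at_iff_sequentially by auto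
    moreover have "((\<lambda>h. cmod (U (z + h) - U z - L h) / cmod h) \<circ> hh) = (\<lambda>n. cmod (s n z - L e))"
    proof
      fix n
      define N :: complex where "N = of_nat (Suc n)"
      have N: "N \<noteq> 0" "cnj N = N" unfolding N_def by (simp_all del: of_nat_Suc)
      have hN: "hh n = e / N" by (simp add: hh_def N_def)
      have L: "N * L (hh n) = L e"
        using N by (simp add: hN L_def field_simps)
      have "s n z = N * (U (z + hh n) - U z)"
        by (simp add: s_def hh_def N_def)
      then have eq: "s n z - L e = N * (U (z + hh n) - U z - L (hh n))"
        using L by (simp add: algebra_simps)
      have "cmod (hh n) = 1 / cmod N"
        by (simp add: hN norm_divide e)
      then show "((\<lambda>h. cmod (U (z + h) - U z - L h) / cmod h) \<circ> hh) n = cmod (s n z - L e)"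
        unfolding eq norm_mult by simp
    qed
    ultimately have "(\<lambda>n. cmod (s n z - L e)) \<longlonglongrightarrow> 0"
      by simp
    then show ?thesis
      by (simp add: L_def tendsto_norm_zero_iff LIM_zero_iff)
  qed
  \<comment> \<open>The shifts have length at most 1, so every quotient vanishes outside the ball of
    radius \<open>R + 2\<close>.\<close>
  have dom: "cmod (s n z) \<le> M * indicator (ball 0 (R + 2)) z" for n z
  proof (cases "z \<in> ball 0 (R + 2)")
    case True
    have "cmod (s n z) = real (Suc n) * cmod (U (z + e / of_nat (Suc n)) - U z)"
      by (simp add: s_def norm_mult del: of_nat_Suc)
    also have "\<dots> \<le> real (Suc n) * (M * cmod (e / of_nat (Suc n)))"
      by (intro mult_left_mono lip) auto
    also have "\<dots> = M" by (simp add: norm_divide e del: of_nat_Suc)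
    finally show ?thesis using True by simp
  next
    case False
    then have z: "cmod z \<ge> R + 2" by simp
    have "cmod (e / of_nat (Suc n)) \<le> 1" by (simp add: norm_divide e del: of_nat_Suc)
    moreover have "cmod z - cmod (e / of_nat (Suc n)) \<le> cmod (z + e / of_nat (Suc n))"
      by (metis norm_diff_ineq)
    ultimately have "R \<le> cmod (z + e / of_nat (Suc n))" "R \<le> cmod z"
      using z by linarith+
    then show ?thesis using supp False by (simp add: s_def)
  qed
  have w: "integrable lborel (\<lambda>z::complex. M * indicator (ball 0 (R + 2)) z)"
    using R by (intro integrable_mult_right integrable_real_indicator) (auto simp: emeasure_ball)
  have sm: "s n \<in> borel_measurable lborel" for n
    unfolding s_def by (intro borel_measurable_times borel_measurable_diff borel_measurable_const)
      (use measurable_compose[OF _ Um, of "\<lambda>z. z + e / of_nat (Suc n)" lborel] Um in auto)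
  have lm: "(\<lambda>z. p z * e + q z * cnj e) \<in> borel_measurable lborel"
    by (rule borel_measurable_LIMSEQ_metric[OF sm lim])
  show "integrable lborel (\<lambda>z. p z * e + q z * cnj e)"
    by (rule integrable_dominated_convergence[OF lm sm w AE_I2 AE_I2]) (rule lim, rule dom)
  have "(\<lambda>n. \<integral>z. s n z \<partial>lborel) \<longlonglongrightarrow> (\<integral>z. (p z * e + q z * cnj e) \<partial>lborel)"
    by (rule integral_dominated_convergence[OF lm sm w AE_I2 AE_I2]) (rule lim, rule dom)
  moreover have "(\<integral>z. s n z \<partial>lborel) = 0" for n
  proof -
    have w': "integrable lborel (\<lambda>z::complex. (M * (2 * R + 1)) * indicator (cball 0 R) z)"
      using R by (intro integrable_mult_right integrable_real_indicator) (auto simp: emeasure_cball)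
    have Ub: "cmod (U z) \<le> M * (2 * R + 1)" if "cmod z \<le> R" for z
    proof -
      \<comment> \<open>A zero of \<open>U\<close> from which the Lipschitz bound turns into a bound
        for \<open>U\<close> itself.\<close>
      have "U (of_real (R + 1)) = 0"
        by (rule supp) (use R in simp)
      then have "cmod (U z) = cmod (U (of_real (R + 1) + (z - of_real (R + 1))) - U (of_real (R + 1)))"
        by simp
      also have "\<dots> \<le> M * cmod (z - of_real (R + 1))"
        by (rule lip)
      also have "cmod (z - of_real (R + 1)) \<le> 2 * R + 1"
        using norm_triangle_ineq4[of z "of_real (R + 1)"] that R by (simp del: of_real_add)
      finally show ?thesis using M0 by (simp add: mult_left_mono)
    qed
    have iU: "integrable lborel U"
    proof (rule Bochner_Integration.integrable_bound[OF w'])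
      show "AE z in lborel. cmod (U z) \<le> norm ((M * (2 * R + 1)) * indicator (cball 0 R) z)"
        using Ub supp R M0 by (intro AE_I2) (auto simp: indicator_def)
    qed simp
    have iUs: "integrable lborel (\<lambda>z. U (z + h))" for h
    proof -
      have "integrable (distr lborel borel ((+) h)) U"
        using iU by (simp add: lborel_distr_plus)
      then have "integrable lborel (\<lambda>z. U (h + z))"
        by (subst (asm) integrable_distr_eq) auto
      then show ?thesis by (simp add: add.commute)
    qed
    show ?thesis
      unfolding s_def using iU iUs by (simp add: integral_translation_invariant)
  qed
  ultimately have "(\<lambda>n::nat. 0) \<longlonglongrightarrow> (\<integral>z. (p z * e + q z * cnj e) \<partial>lborel)"
    by simp
  then show "(\<integral>z. (p z * e + q z * cnj e) \<partial>lborel) = 0"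
    by (simp add: LIMSEQ_const_iff)
qed

text \<open>Green's formula without boundary term. After extension by 0, the directional derivatives
  along 1 and \<open>\<i>\<close> are combined so that \<open>p\<close> drops out.\<close>

lemma integral_dbar_eq_0:
  fixes U :: "complex \<Rightarrow> complex"
  assumes U: "\<And>z. z \<in> disc \<Longrightarrow> wirt U z (p z) (q z)"
    and cont: "continuous_on disc p" "continuous_on disc q"
    and R: "0 \<le> R" "R < 1"
    and supp: "\<And>z. R < cmod z \<Longrightarrow> cmod z < 1 \<Longrightarrow> U z = 0 \<and> p z = 0 \<and> q z = 0"
  shows "integrable dA q" and "(\<integral>z. q z \<partial>dA) = 0"
proof -
  define U' where "U' z = (if z \<in> disc then U z else 0)" for z
  define p' where "p' z = (if z \<in> disc then p z else 0)" for z
  define q' where "q' z = (if z \<in> disc then q z else 0)" for z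
  have sub: "cball 0 R \<subseteq> disc" using R by (auto simp: disc_def)
  have out: "U' z = 0 \<and> p' z = 0 \<and> q' z = 0" if "z \<notin> cball 0 R" for z
    using that supp[of z] by (auto simp: U'_def p'_def q'_def disc_iff)
  have w: "wirt U' z (p' z) (q' z)" for z
  proof (cases "z \<in> disc")
    case True
    show ?thesis
      by (rule wirt_cong_at[OF _ open_disc True]) (use U[OF True] True in \<open>auto simp: U'_def p'_def q'_def\<close>)
  next
    case False
    then have z: "z \<in> - cball 0 R" using sub by auto
    have "wirt (\<lambda>_. 0) z 0 0" by (rule wirt_const)
    then have "wirt U' z 0 0"
      by (rule wirt_cong_at[where S = "- cball 0 R"]) (use z out in auto)
    then show ?thesis using out z by simp
  qed
  have "bounded (p ` cball 0 R)" "bounded (q ` cball 0 R)"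
    by (intro compact_imp_bounded compact_continuous_image continuous_on_subset[OF cont(1) sub]
        continuous_on_subset[OF cont(2) sub] compact_cball)+
  then obtain B C where B: "\<And>z. z \<in> cball 0 R \<Longrightarrow> cmod (p z) \<le> B" and C: "\<And>z. z \<in> cball 0 R \<Longrightarrow> cmod (q z) \<le> C"
    unfolding bounded_iff by fastforce
  have "0 \<in> cball (0::complex) R" using R by simp
  from order_trans[OF norm_ge_zero B[OF this]] order_trans[OF norm_ge_zero C[OF this]]
  have BC: "B \<ge> 0" "C \<ge> 0" .
  have bnd: "cmod (p' z) + cmod (q' z) \<le> B + C" for z
  proof (cases "z \<in> cball 0 R")
    case True
    then show ?thesis using B C sub by (auto simp: p'_def q'_def intro!: add_mono)
  next
    case False
    then show ?thesis using out[OF False] BC by simp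
  qed
  have s: "U' z = 0" if "(R + 1) / 2 \<le> cmod z" for z
    using out[of z] that R by auto
  have R': "0 \<le> (R + 1) / 2" using R by simp
  note * = integral_directional_derivative[OF w bnd s _ R']
  have 1: "integrable lborel (\<lambda>z. p' z * 1 + q' z * cnj 1)" "(\<integral>z. (p' z * 1 + q' z * cnj 1) \<partial>lborel) = 0"
    by (rule *; simp)+
  have 2: "integrable lborel (\<lambda>z. p' z * \<i> + q' z * cnj \<i>)" "(\<integral>z. (p' z * \<i> + q' z * cnj \<i>) \<partial>lborel) = 0"
    by (rule *; simp)+
  \<comment> \<open>The two directions give \<open>p + q\<close> and \<open>\<i> * (p - q)\<close>;
    this combination leaves \<open>2 * q\<close>.\<close>
  have q'eq: "q' z = ((p' z * 1 + q' z * cnj 1) + \<i> * (p' z * \<i> + q' z * cnj \<i>)) / 2" for z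
    by (simp add: algebra_simps)
  have "(\<integral>z. q' z \<partial>lborel) = ((\<integral>z. (p' z * 1 + q' z * cnj 1) \<partial>lborel) + \<i> * (\<integral>z. (p' z * \<i> + q' z * cnj \<i>) \<partial>lborel)) / 2"
    by (subst q'eq[abs_def]) (use 1 2 in \<open>simp del: complex_cnj_i complex_cnj_one mult_1_right\<close>)
  then have 0: "(\<integral>z. q' z \<partial>lborel) = 0"
    unfolding 1 2 by simp
  have qm: "q \<in> borel_measurable dA" by (rule measurable_dA_continuous) fact
  have ind: "(\<lambda>z. indicator disc z *\<^sub>R q z) = q'"
    by (auto simp: q'_def indicator_def)
  show "(\<integral>z. q z \<partial>dA) = 0"
    using integral_dA[OF qm] 0 by (simp add: ind)
  show "integrable dA q"
  proof (rule dA.integrable_const_bound[of _ C])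
    show "AE z in dA. cmod (q z) \<le> C"
      using C BC supp by (intro AE_I2) (force simp: disc_iff)
  qed fact
qed

section \<open>The Bergman kernel and the reproducing formula\<close>

definition rho :: "complex \<Rightarrow> real" where
  "rho z = 1 - (cmod z)\<^sup>2"

text \<open>Behaves like a Euclidean distance enlarged by the heights: it satisfies the triangle
  inequality and dominates \<open>|z - w|\<close>, but \<open>dd z z = rho z\<close> instead of
  0.\<close>

definition dd :: "complex \<Rightarrow> complex \<Rightarrow> real" where
  "dd z w = cmod (1 - cnj w * z)"

lemma rho_pos: "z \<in> disc \<Longrightarrow> 0 < rho z"
  by (simp add: rho_def disc_iff abs_square_less_1)

lemma rho_le_1: "rho z \<le> 1"
  by (simp add: rho_def)

lemma dd_commute: "dd z w = dd w z"
proof -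
  have "cmod (1 - cnj w * z) = cmod (cnj (1 - cnj w * z))" by (rule complex_mod_cnj[symmetric])
  then show ?thesis by (simp add: dd_def mult.commute)
qed

lemma dd_square: "(dd z w)\<^sup>2 = (cmod (z - w))\<^sup>2 + rho z * rho w"
proof -
  obtain a b c d where "z = Complex a b" "w = Complex c d" by (cases z, cases w) auto
  then show ?thesis
    unfolding dd_def rho_def cmod_power2
    by (simp add: power2_diff power2_sum power_mult_distrib algebra_simps)
qed

lemma norm_diff_le_dd: "z \<in> disc \<Longrightarrow> w \<in> disc \<Longrightarrow> cmod (z - w) \<le> dd z w"
  by (rule power2_le_imp_le) (simp_all add: dd_square rho_pos less_imp_le, simp add: dd_def)

text \<open>Replacing \<open>u\<close> by \<open>w\<close> costs at most \<open>|u - w|\<close>,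
  which \<open>dd u w\<close> dominates.\<close>

lemma dd_triangle:
  assumes "z \<in> disc" "u \<in> disc" "w \<in> disc"
  shows "dd z w \<le> dd z u + dd u w"
proof -
  have "1 - cnj w * z = (1 - cnj u * z) + cnj (u - w) * z" by (simp add: algebra_simps)
  moreover have "cmod (cnj (u - w) * z) = cmod (u - w) * cmod z"
    by (simp only: norm_mult complex_mod_cnj)
  ultimately have "dd z w \<le> dd z u + cmod (u - w) * cmod z"
    using norm_triangle_ineq[of "1 - cnj u * z" "cnj (u - w) * z"] by (simp only: dd_def)
  also have "cmod (u - w) * cmod z \<le> cmod (u - w) * 1"
    using assms(1) by (intro mult_left_mono) (auto simp: disc_iff)
  also have "\<dots> \<le> dd u w" using norm_diff_le_dd[OF assms(2,3)] by simp
  finally show ?thesis by simp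
qed

lemma dd_ge_1_minus: "cmod z \<le> 1 \<Longrightarrow> cmod w \<le> s \<Longrightarrow> 1 - s \<le> dd z w"
proof -
  assume z: "cmod z \<le> 1" and w: "cmod w \<le> s"
  have "cmod (cnj w * z) \<le> s * 1"
    unfolding norm_mult by (rule mult_mono) (use z w norm_ge_zero[of w] in auto, use norm_ge_zero[of w] w in linarith)
  then show ?thesis
    unfolding dd_def using norm_triangle_ineq2[of 1 "cnj w * z"] by simp
qed

lemma rho_le_2_1_minus: "cmod z \<le> 1 \<Longrightarrow> rho z \<le> 2 * (1 - cmod z)"
  using zero_le_power2[of "1 - cmod z"] by (simp add: rho_def power2_eq_square algebra_simps)

lemma rho_le_dd: "z \<in> disc \<Longrightarrow> w \<in> disc \<Longrightarrow> rho w \<le> 2 * dd z w"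
  using dd_ge_1_minus[of z w "cmod w"] rho_le_2_1_minus[of w] by (auto simp: disc_iff)

lemma rho_le_dd': "z \<in> disc \<Longrightarrow> w \<in> disc \<Longrightarrow> rho z \<le> 2 * dd z w"
  using rho_le_dd[of w z] by (simp add: dd_commute)

lemma dd_pos: "z \<in> disc \<Longrightarrow> w \<in> disc \<Longrightarrow> 0 < dd z w"
  using rho_le_dd[of z w] rho_pos[of w] by linarith

lemma dd_nonneg [simp]: "0 \<le> dd z w"
  by (simp add: dd_def)

lemma one_minus_nonzero: "z \<in> disc \<Longrightarrow> w \<in> disc \<Longrightarrow> 1 - cnj w * z \<noteq> 0"
  using dd_pos[of z w] by (auto simp: dd_def)

section \<open>Cutoffs near the circle and the reproducing formula\<close>

lemma wirt_rho: "wirt (\<lambda>z. of_real (rho z)) z (- cnj z) (- z)"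
proof -
  have "wirt (\<lambda>z. 1 + (-1) * (z * cnj z)) z (0 + (0 * (z * cnj z) + (-1) * (1 * cnj z + z * cnj 0)))
      (0 + (0 * (z * cnj z) + (-1) * (0 * cnj z + z * cnj 1)))"
    by (intro wirt_add wirt_mult wirt_const wirt_id wirt_cnj)
  moreover have "(\<lambda>z. 1 + (-1) * (z * cnj z)) = (\<lambda>z. of_real (rho z))"
    by (simp add: rho_def fun_eq_iff flip: complex_norm_square)
  ultimately show ?thesis by simp
qed

text \<open>Squaring removes the corner of the positive part; this is why all cutoffs below appear
  squared in the integrations by parts.\<close>

lemma has_derivative_max0_square:
  "((\<lambda>t::real. (max 0 t)\<^sup>2) has_real_derivative 2 * max 0 t) (at t)"
proof -
  consider "t < 0" | "t = 0" | "t > 0" by linarith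
  then show ?thesis
  proof cases
    case 1
    have "((\<lambda>t::real. 0) has_real_derivative 0) (at t)" by simp
    then show ?thesis
      using 1 by (subst DERIV_cong_ev[OF refl _ refl, where g = "\<lambda>_. 0"])
        (auto intro!: eventually_mono[OF eventually_nhds_in_open[of "{..<0}" t]])
  next
    case 3
    have "((\<lambda>t::real. t\<^sup>2) has_real_derivative 2 * t) (at t)" by (auto intro!: derivative_eq_intros)
    then show ?thesis
      using 3 by (subst DERIV_cong_ev[OF refl _ refl, where g = "\<lambda>t. t\<^sup>2"])
        (auto intro!: eventually_mono[OF eventually_nhds_in_open[of "{0<..}" t]])
  next
    case 2
    have "((\<lambda>h::real. (max 0 h)\<^sup>2 / h) \<longlongrightarrow> 0) (at 0)"
    proof (rule Lim_null_comparison)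
      show "\<forall>\<^sub>F h in at 0. norm ((max 0 h)\<^sup>2 / h) \<le> \<bar>h::real\<bar>"
        by (intro always_eventually allI) (auto simp: max_def power2_eq_square)
      show "((\<lambda>h::real. \<bar>h\<bar>) \<longlongrightarrow> 0) (at 0)"
        by (intro tendsto_eq_intros) auto
    qed
    then show ?thesis using 2 by (simp add: DERIV_def)
  qed
qed

text \<open>The cutoff vanishes for \<open>rho z <= \<epsilon>\<close>. Its derivative is of order
  \<open>\<epsilon> / rho^2\<close>, so one factor \<open>rho\<close> in the function to be cut off
  keeps the error bounded.\<close>

lemma rho_cutoff_wirt:
  assumes "z \<in> disc" "\<epsilon> > 0"
  shows "wirt (\<lambda>z. of_real ((max 0 (1 - \<epsilon> / rho z))\<^sup>2)) z
    (of_real (2 * max 0 (1 - \<epsilon> / rho z) * (\<epsilon> / (rho z)\<^sup>2)) * (- cnj z))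
    (of_real (2 * max 0 (1 - \<epsilon> / rho z) * (\<epsilon> / (rho z)\<^sup>2)) * (- z))"
proof -
  have r: "rho z \<noteq> 0" using rho_pos[OF assms(1)] by simp
  have "((\<lambda>t. 1 - \<epsilon> / t) has_real_derivative (\<epsilon> / (rho z)\<^sup>2)) (at (rho z))"
    using r by (auto intro!: derivative_eq_intros simp: power2_eq_square)
  from DERIV_chain2[OF has_derivative_max0_square this]
  show ?thesis by (intro wirt_real_compose[OF wirt_rho, where \<xi> = "\<lambda>t. (max 0 (1 - \<epsilon> / t))\<^sup>2"])
qed

lemma continuous_on_rho [continuous_intros]: "continuous_on A rho"
  unfolding rho_def[abs_def] by (intro continuous_intros)

lemma continuous_on_cnj' [continuous_intros]: "continuous_on A f \<Longrightarrow> continuous_on A (\<lambda>x. cnj (f x))"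
  by (rule continuous_on_cnj)

lemma holomorphic_disc_deriv:
  assumes "G holomorphic_on disc" "z \<in> disc"
  shows "(G has_field_derivative deriv G z) (at z)"
  using holomorphic_derivI[OF assms(1) open_disc assms(2)] .

lemma continuous_on_deriv_disc: "G holomorphic_on disc \<Longrightarrow> continuous_on disc (deriv G)"
  by (intro holomorphic_on_imp_continuous_on holomorphic_deriv) auto

lemma wirt_conj_kernel:
  assumes "\<zeta> \<in> disc" "z \<in> disc"
  shows "wirt (\<lambda>\<zeta>. 1 / (1 - cnj \<zeta> * z)) \<zeta> 0 (z / (1 - cnj \<zeta> * z)\<^sup>2)"
proof -
  have nz: "1 - \<zeta> * cnj z \<noteq> 0"
    using one_minus_nonzero[of \<zeta> z] assms by (simp add: mult.commute)
  have "((\<lambda>\<zeta>. 1 / (1 - \<zeta> * cnj z)) has_field_derivative (cnj z / (1 - \<zeta> * cnj z)\<^sup>2)) (at \<zeta>)"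
    using nz by (auto intro!: derivative_eq_intros simp: power2_eq_square)
  from wirt_cnj[OF wirt_holo[OF this]] show ?thesis by (simp add: mult.commute)
qed

text \<open>Up to sign the integrand is the \<open>dbar\<close>-derivative of
  \<open>G * rho / (1 - cnj \<zeta> * z)\<close>, and \<open>rho\<close> vanishes on the circle. The
  cutoff \<open>X n\<close> makes the integration by parts legitimate and is then removed by
  dominated convergence.\<close>

lemma integral_vanishing_factor:
  assumes G: "G holomorphic_on disc" "integrable dA G" and z: "z \<in> disc"
  shows "(\<integral>\<zeta>. G \<zeta> * (\<zeta> - z) / (1 - cnj \<zeta> * z)\<^sup>2 \<partial>dA) = 0"
proof -
  define \<epsilon> where "\<epsilon> n = 1 / real (n + 2)" for n
  define X where "X n \<zeta> = max 0 (1 - \<epsilon> n / rho \<zeta>)" for n \<zeta>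
  define k where "k \<zeta> = 1 / (1 - cnj \<zeta> * z)" for \<zeta>
  define q where "q n \<zeta> = - (G \<zeta> * (of_real ((X n \<zeta>)\<^sup>2) * (of_real (rho \<zeta>) * (z / (1 - cnj \<zeta> * z)\<^sup>2) + (- \<zeta>) * k \<zeta>)
        + of_real (2 * X n \<zeta> * (\<epsilon> n / (rho \<zeta>)\<^sup>2)) * (- \<zeta>) * (of_real (rho \<zeta>) * k \<zeta>)))" for n \<zeta>
  have \<epsilon>: "0 < \<epsilon> n" "\<epsilon> n < 1" for n by (auto simp: \<epsilon>_def)
  have q0: "integrable dA (q n) \<and> (\<integral>\<zeta>. q n \<zeta> \<partial>dA) = 0" for n
  proof -
    define c where "c \<zeta> = complex_of_real (2 * X n \<zeta> * (\<epsilon> n / (rho \<zeta>)\<^sup>2))" for \<zeta>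
    define x where "x \<zeta> = complex_of_real ((X n \<zeta>)\<^sup>2)" for \<zeta>
    define r where "r \<zeta> = complex_of_real (rho \<zeta>)" for \<zeta>
    define k' where "k' \<zeta> = z / (1 - cnj \<zeta> * z)\<^sup>2" for \<zeta>
    define p where "p \<zeta> = deriv G \<zeta> * (x \<zeta> * (r \<zeta> * k \<zeta>)) + G \<zeta> * (c \<zeta> * (- cnj \<zeta>) * (r \<zeta> * k \<zeta>)
          + x \<zeta> * (- cnj \<zeta> * k \<zeta> + r \<zeta> * 0))" for \<zeta>
    define q' where "q' \<zeta> = 0 * (x \<zeta> * (r \<zeta> * k \<zeta>)) + G \<zeta> * (c \<zeta> * (- \<zeta>) * (r \<zeta> * k \<zeta>)
          + x \<zeta> * (- \<zeta> * k \<zeta> + r \<zeta> * k' \<zeta>))" for \<zeta>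
    define U where "U \<zeta> = G \<zeta> * (x \<zeta> * (r \<zeta> * k \<zeta>))" for \<zeta>
    have qq: "q n = (\<lambda>\<zeta>. - q' \<zeta>)"
      unfolding q_def q'_def x_def[symmetric] r_def[symmetric] c_def[symmetric] k'_def[symmetric]
      by (simp only: mult_zero_left add_0_left) (simp only: ac_simps)
    define R where "R = sqrt (1 - \<epsilon> n)"
    have nz: "\<zeta> \<in> disc \<Longrightarrow> 1 - cnj \<zeta> * z \<noteq> 0" "\<zeta> \<in> disc \<Longrightarrow> rho \<zeta> \<noteq> 0" for \<zeta>
      using one_minus_nonzero[of z \<zeta>] rho_pos[of \<zeta>] z by auto
    have cG: "continuous_on disc G" "continuous_on disc (deriv G)"
      using G holomorphic_on_imp_continuous_on continuous_on_deriv_disc by auto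
    have w: "wirt U \<zeta> (p \<zeta>) (q' \<zeta>)" if "\<zeta> \<in> disc" for \<zeta>
      unfolding U_def[abs_def] p_def q'_def x_def c_def r_def k_def k'_def X_def
      by (intro wirt_mult wirt_holo holomorphic_disc_deriv G that rho_cutoff_wirt \<epsilon> wirt_rho wirt_conj_kernel z)
    have cX: "continuous_on disc (\<lambda>\<zeta>. X n \<zeta>)"
      unfolding X_def using nz by (intro continuous_intros) auto
    have ck: "continuous_on disc k" "continuous_on disc k'"
      unfolding k_def[abs_def] k'_def[abs_def] using nz by (intro continuous_intros; auto)+
    have cc: "continuous_on disc c" "continuous_on disc x" "continuous_on disc r"
      unfolding c_def[abs_def] x_def[abs_def] r_def[abs_def] using nz by (intro continuous_intros cX; auto)+
    have c: "continuous_on disc p" "continuous_on disc q'"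
      unfolding p_def[abs_def] q'_def[abs_def]
      by (intro continuous_intros cG ck cc)+
    have supp: "U \<zeta> = 0 \<and> p \<zeta> = 0 \<and> q' \<zeta> = 0" if "R < cmod \<zeta>" "cmod \<zeta> < 1" for \<zeta>
    proof -
      have "R\<^sup>2 < (cmod \<zeta>)\<^sup>2"
        using that(1) \<epsilon>[of n] by (intro power_strict_mono) (auto simp: R_def)
      then have "rho \<zeta> < \<epsilon> n" "0 < rho \<zeta>"
        using that rho_pos[of \<zeta>] \<epsilon>[of n] by (auto simp: rho_def disc_iff R_def)
      then have "X n \<zeta> = 0" by (simp add: X_def field_simps max_def)
      then show ?thesis by (simp add: U_def p_def q'_def x_def c_def)
    qed
    have R: "0 \<le> R" "R < 1" using \<epsilon>[of n] by (auto simp: R_def)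
    show ?thesis
      using integral_dbar_eq_0[OF w c R supp] unfolding qq by simp
  qed
  define C where "C = 1 / (1 - cmod z)"
  have kC: "cmod (k \<zeta>) \<le> C" if "\<zeta> \<in> disc" for \<zeta>
  proof -
    have "1 - cmod z \<le> dd z \<zeta>"
      using dd_ge_1_minus[of \<zeta> z "cmod z"] that by (simp add: disc_iff dd_commute)
    then show ?thesis
      using z by (simp add: k_def C_def norm_divide flip: dd_def) (simp add: disc_iff frac_le)
  qed
  have C0: "C > 0" using z by (simp add: C_def disc_iff)
  have lim: "(\<lambda>n. q n \<zeta>) \<longlonglongrightarrow> G \<zeta> * (\<zeta> - z) / (1 - cnj \<zeta> * z)\<^sup>2" if "\<zeta> \<in> disc" for \<zeta>
  proof -
    have "\<epsilon> \<longlonglongrightarrow> 0"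
      unfolding \<epsilon>_def using LIMSEQ_ignore_initial_segment[OF lim_1_over_n, of 2] by simp
    then have "(\<lambda>n. q n \<zeta>) \<longlonglongrightarrow> - (G \<zeta> * (of_real ((max 0 (1 - 0 / rho \<zeta>))\<^sup>2) * (of_real (rho \<zeta>) * (z / (1 - cnj \<zeta> * z)\<^sup>2) + (- \<zeta>) * k \<zeta>)
        + of_real (2 * max 0 (1 - 0 / rho \<zeta>) * (0 / (rho \<zeta>)\<^sup>2)) * (- \<zeta>) * (of_real (rho \<zeta>) * k \<zeta>)))"
      unfolding q_def X_def using rho_pos[OF that] by (intro tendsto_intros) auto
    moreover have "- (of_real (rho \<zeta>) * (z / (1 - cnj \<zeta> * z)\<^sup>2) + (- \<zeta>) * k \<zeta>) = (\<zeta> - z) / (1 - cnj \<zeta> * z)\<^sup>2"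
    proof -
      have nz: "1 - cnj \<zeta> * z \<noteq> 0" using one_minus_nonzero[of z \<zeta>] that z by simp
      have r: "complex_of_real (rho \<zeta>) = 1 - \<zeta> * cnj \<zeta>" by (simp add: rho_def flip: complex_norm_square)
      have "\<zeta> * k \<zeta> = \<zeta> * (1 - cnj \<zeta> * z) / (1 - cnj \<zeta> * z)\<^sup>2"
          using nz by (simp add: k_def power2_eq_square)
      then have "- (of_real (rho \<zeta>) * (z / (1 - cnj \<zeta> * z)\<^sup>2) + (- \<zeta>) * k \<zeta>)
          = - ((of_real (rho \<zeta>) * z - \<zeta> * (1 - cnj \<zeta> * z)) / (1 - cnj \<zeta> * z)\<^sup>2)"
        by (simp add: diff_divide_distrib)
      also have "of_real (rho \<zeta>) * z - \<zeta> * (1 - cnj \<zeta> * z) = - (\<zeta> - z)"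
        by (simp add: r algebra_simps)
      finally show ?thesis by (simp add: minus_divide_left)
    qed
    moreover have "- (G \<zeta> * (of_real ((max 0 (1 - 0 / rho \<zeta>))\<^sup>2) * (of_real (rho \<zeta>) * (z / (1 - cnj \<zeta> * z)\<^sup>2) + (- \<zeta>) * k \<zeta>)
        + of_real (2 * max 0 (1 - 0 / rho \<zeta>) * (0 / (rho \<zeta>)\<^sup>2)) * (- \<zeta>) * (of_real (rho \<zeta>) * k \<zeta>)))
        = G \<zeta> * - (of_real (rho \<zeta>) * (z / (1 - cnj \<zeta> * z)\<^sup>2) + (- \<zeta>) * k \<zeta>)" by (simp only: minus_mult_right) simp
    ultimately show ?thesis by simp
  qed
  have dom: "cmod (q n \<zeta>) \<le> cmod (G \<zeta>) * (C\<^sup>2 + 3 * C)" if "\<zeta> \<in> disc" for n \<zeta>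
  proof -
    have r: "0 < rho \<zeta>" "rho \<zeta> \<le> 1" using rho_pos[OF that] rho_le_1 by auto
    have X: "0 \<le> X n \<zeta>" "X n \<zeta> \<le> 1" using \<epsilon>[of n] r by (auto simp: X_def)
    have \<zeta>: "cmod \<zeta> \<le> 1" "cmod z \<le> 1" using that z by (auto simp: disc_iff)
    have b1: "cmod (of_real ((X n \<zeta>)\<^sup>2) * (of_real (rho \<zeta>) * (z / (1 - cnj \<zeta> * z)\<^sup>2) + (- \<zeta>) * k \<zeta>)) \<le> C\<^sup>2 + C"
    proof -
      have "cmod (of_real (rho \<zeta>) * (z / (1 - cnj \<zeta> * z)\<^sup>2)) = rho \<zeta> * cmod z * (cmod (k \<zeta>))\<^sup>2"
        using r by (simp add: k_def norm_mult norm_divide norm_power power_divide)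
      also have "\<dots> \<le> 1 * 1 * C\<^sup>2"
        using r \<zeta> kC[OF that] by (intro mult_mono power_mono) auto
      finally have 1: "cmod (of_real (rho \<zeta>) * (z / (1 - cnj \<zeta> * z)\<^sup>2)) \<le> C\<^sup>2" by simp
      have "cmod ((- \<zeta>) * k \<zeta>) \<le> 1 * C"
        unfolding norm_mult using \<zeta> kC[OF that] by (intro mult_mono) auto
      with 1 have "cmod (of_real (rho \<zeta>) * (z / (1 - cnj \<zeta> * z)\<^sup>2) + (- \<zeta>) * k \<zeta>) \<le> C\<^sup>2 + C"
        by (intro norm_triangle_le) simp
      moreover have "(X n \<zeta>)\<^sup>2 \<le> 1" using X by (simp add: power_le_one)
      ultimately show ?thesis
        unfolding norm_mult norm_of_real using C0 mult_mono[of "(X n \<zeta>)\<^sup>2" 1 _ "C\<^sup>2 + C"]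
        by (simp only: abs_power2 mult_1_left norm_ge_zero)
    qed
    have b2: "cmod (of_real (2 * X n \<zeta> * (\<epsilon> n / (rho \<zeta>)\<^sup>2)) * (- \<zeta>) * (of_real (rho \<zeta>) * k \<zeta>)) \<le> 2 * C"
    proof (cases "X n \<zeta> = 0")
      case True
      then show ?thesis using C0 by simp
    next
      case False
      \<comment> \<open>Where the cutoff is positive, \<open>rho\<close> times its derivative is at
        most 2, uniformly in \<open>n\<close>.\<close>
      then have "\<epsilon> n / rho \<zeta> \<le> 1" by (auto simp: X_def max_def split: if_splits)
      then have "2 * X n \<zeta> * (\<epsilon> n / rho \<zeta>) * cmod \<zeta> * cmod (k \<zeta>) \<le> 2 * 1 * 1 * 1 * C"
        using X \<zeta> kC[OF that] C0 \<epsilon>[of n] r by (intro mult_mono mult_nonneg_nonneg) auto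
      moreover have "cmod (of_real (2 * X n \<zeta> * (\<epsilon> n / (rho \<zeta>)\<^sup>2)) * (- \<zeta>) * (of_real (rho \<zeta>) * k \<zeta>))
          = 2 * X n \<zeta> * (\<epsilon> n / rho \<zeta>) * cmod \<zeta> * cmod (k \<zeta>)"
        using X \<epsilon>[of n] r unfolding norm_mult norm_of_real norm_minus_cancel
        by (simp add: power2_eq_square abs_mult)
      ultimately show ?thesis by simp
    qed
    have "cmod (q n \<zeta>) \<le> cmod (G \<zeta>) * (C\<^sup>2 + C + 2 * C)"
      unfolding q_def norm_minus_cancel norm_mult[of "G \<zeta>"]
      by (intro mult_left_mono norm_triangle_le add_mono b1 b2) auto
    then show ?thesis by (simp add: add.commute)
  qed
  have "(\<lambda>n. \<integral>\<zeta>. q n \<zeta> \<partial>dA) \<longlonglongrightarrow> (\<integral>\<zeta>. G \<zeta> * (\<zeta> - z) / (1 - cnj \<zeta> * z)\<^sup>2 \<partial>dA)"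
  proof (rule integral_dominated_convergence[where w = "\<lambda>\<zeta>. cmod (G \<zeta>) * (C\<^sup>2 + 3 * C)"])
    show "(\<lambda>\<zeta>. G \<zeta> * (\<zeta> - z) / (1 - cnj \<zeta> * z)\<^sup>2) \<in> borel_measurable dA"
      using one_minus_nonzero[of z] z
      by (intro measurable_dA_continuous continuous_intros holomorphic_on_imp_continuous_on G) auto
    show "q n \<in> borel_measurable dA" for n
      using q0[of n] by (auto dest: borel_measurable_integrable)
    show "integrable dA (\<lambda>\<zeta>. cmod (G \<zeta>) * (C\<^sup>2 + 3 * C))"
      by (intro integrable_mult_left integrable_norm G)
  qed (use lim dom in \<open>auto intro!: AE_I2\<close>)
  then show ?thesis using q0 by (simp add: LIMSEQ_const_iff)
qed

text \<open>Dividing the zero of \<open>G \<zeta> - G z\<close> out leaves a holomorphic and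
  integrable \<open>H\<close>, to which \<open>integral_vanishing_factor\<close> applies.\<close>

lemma reproducing_difference:
  assumes G: "G holomorphic_on disc" "integrable dA G" and z: "z \<in> disc"
  shows "(\<integral>\<zeta>. (G \<zeta> - G z) / (1 - cnj \<zeta> * z)\<^sup>2 \<partial>dA) = 0"
proof -
  define H where "H \<zeta> = (if \<zeta> = z then deriv G z else (G \<zeta> - G z) / (\<zeta> - z))" for \<zeta>
  have hH: "H holomorphic_on disc"
    unfolding H_def[abs_def] by (rule pole_lemma) (use G z in \<open>auto simp: interior_open\<close>)
  obtain r where r: "r > 0" "cball z r \<subseteq> disc"
    using z open_disc open_contains_cball by blast
  have "bounded (H ` cball z r)"
    by (intro compact_imp_bounded compact_continuous_image holomorphic_on_imp_continuous_on
        holomorphic_on_subset[OF hH r(2)]) auto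
  then obtain B where B: "\<And>\<zeta>. \<zeta> \<in> cball z r \<Longrightarrow> cmod (H \<zeta>) \<le> B"
    unfolding bounded_iff by fastforce
  have B0: "B \<ge> 0" using B[of z] r norm_ge_zero[of "H z"] by (simp add: less_imp_le order_trans[OF norm_ge_zero])
  have Hm: "H \<in> borel_measurable dA"
    by (intro measurable_dA_continuous holomorphic_on_imp_continuous_on hH)
  have "integrable dA (\<lambda>\<zeta>. B + (cmod (G \<zeta>) + cmod (G z)) / r)"
    using G by (intro Bochner_Integration.integrable_add integrable_divide integrable_norm) auto
  then have iH: "integrable dA H"
  proof (rule Bochner_Integration.integrable_bound[OF _ Hm], intro AE_I2)
    fix \<zeta>
    have 0: "(cmod (G \<zeta>) + cmod (G z)) / r \<ge> 0" using r by simp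
    show "cmod (H \<zeta>) \<le> norm (B + (cmod (G \<zeta>) + cmod (G z)) / r)"
    proof (cases "\<zeta> \<in> cball z r")
      case True
      then show ?thesis using B[OF True] 0 B0 by simp
    next
      case False
      then have d: "r \<le> cmod (\<zeta> - z)" "\<zeta> \<noteq> z" using r by (auto simp: dist_norm norm_minus_commute)
      have "cmod (H \<zeta>) = cmod (G \<zeta> - G z) / cmod (\<zeta> - z)" using d by (simp add: H_def norm_divide)
      also have "\<dots> \<le> (cmod (G \<zeta>) + cmod (G z)) / r"
        using d r by (intro frac_le norm_triangle_ineq4) auto
      finally show ?thesis using B0 0 by simp
    qed
  qed
  have "(\<integral>\<zeta>. H \<zeta> * (\<zeta> - z) / (1 - cnj \<zeta> * z)\<^sup>2 \<partial>dA) = 0"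
    by (rule integral_vanishing_factor[OF hH iH z])
  moreover have "H \<zeta> * (\<zeta> - z) = G \<zeta> - G z" for \<zeta> by (simp add: H_def)
  ultimately show ?thesis by simp
qed

lemma integrable_mult_bounded:
  fixes h G :: "complex \<Rightarrow> complex"
  assumes "integrable dA G" "h \<in> borel_measurable dA" "\<And>\<zeta>. \<zeta> \<in> disc \<Longrightarrow> cmod (h \<zeta>) \<le> C"
  shows "integrable dA (\<lambda>\<zeta>. G \<zeta> * h \<zeta>)"
proof (rule Bochner_Integration.integrable_bound)
  show "integrable dA (\<lambda>\<zeta>. C * cmod (G \<zeta>))" using assms by auto
  show "AE \<zeta> in dA. cmod (G \<zeta> * h \<zeta>) \<le> norm (C * cmod (G \<zeta>))"
  proof (rule AE_I2)
    fix \<zeta> assume "\<zeta> \<in> space dA"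
    then have c: "cmod (h \<zeta>) \<le> C" using assms by simp
    then have "C \<ge> 0" using norm_ge_zero order_trans by blast
    with c show "cmod (G \<zeta> * h \<zeta>) \<le> norm (C * cmod (G \<zeta>))"
      by (simp add: norm_mult mult.commute[of "cmod (G \<zeta>)"] mult_right_mono abs_mult)
  qed
qed (use assms in measurable)

lemma kernel_square_bound:
  assumes "cmod \<zeta> \<le> s" "s < 1" "z \<in> disc"
  shows "cmod (1 / (1 - cnj \<zeta> * z)\<^sup>2) \<le> 1 / (1 - s)\<^sup>2"
proof -
  have "1 - s \<le> dd z \<zeta>" using dd_ge_1_minus[of z \<zeta> s] assms by (auto simp: disc_iff)
  then show ?thesis using assms unfolding norm_divide norm_power dd_def[symmetric]
    by (simp add: frac_le power_mono)
qed

lemma kernel_square_bound':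
  assumes "\<zeta> \<in> disc" "z \<in> disc"
  shows "cmod (1 / (1 - cnj \<zeta> * z)\<^sup>2) \<le> 1 / (1 - cmod z)\<^sup>2"
proof -
  have "1 - cmod z \<le> dd z \<zeta>" using dd_ge_1_minus[of \<zeta> z "cmod z"] assms by (auto simp: disc_iff dd_commute)
  then show ?thesis using assms unfolding norm_divide norm_power dd_def[symmetric]
    by (auto simp: disc_iff intro!: frac_le power_mono)
qed

lemma measurable_kernel_square:
  assumes "z \<in> disc"
  shows "(\<lambda>\<zeta>. 1 / (1 - cnj \<zeta> * z)\<^sup>2) \<in> borel_measurable dA"
  using one_minus_nonzero[OF assms] by (intro measurable_dA_continuous continuous_intros) auto

text \<open>What remains after \<open>reproducing_difference\<close> is that the kernel has integral
  1. Its conjugate \<open>h\<close> is holomorphic in \<zeta>, so the same lemma, used at the point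
  0 for \<open>h\<close>, gives this.\<close>

lemma reproducing_formula:
  assumes G: "G holomorphic_on disc" "integrable dA G" and z: "z \<in> disc"
  shows "(\<integral>\<zeta>. G \<zeta> / (1 - cnj \<zeta> * z)\<^sup>2 \<partial>dA) = G z"
proof -
  have intk: "integrable dA (\<lambda>\<zeta>. H \<zeta> * (1 / (1 - cnj \<zeta> * z)\<^sup>2))" if "integrable dA H" for H
    by (rule integrable_mult_bounded[OF that measurable_kernel_square[OF z] kernel_square_bound'[OF _ z]])
  define h where "h \<zeta> = 1 / (1 - \<zeta> * cnj z)\<^sup>2" for \<zeta>
  have nz: "\<zeta> \<in> disc \<Longrightarrow> 1 - \<zeta> * cnj z \<noteq> 0" for \<zeta>
    using one_minus_nonzero[of \<zeta> z] z by (simp add: mult.commute)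
  have hh: "h holomorphic_on disc"
    unfolding h_def using nz by (intro holomorphic_intros) auto
  have hc: "h = (\<lambda>\<zeta>. cnj (1 * (1 / (1 - cnj \<zeta> * z)\<^sup>2)))" by (simp add: h_def fun_eq_iff)
  have ih: "integrable dA h" unfolding hc by (intro integrable_cnj intk) auto
  have h0: "h 0 = 1" by (simp add: h_def)
  have "(\<integral>\<zeta>. (h \<zeta> - h 0) / (1 - cnj \<zeta> * 0)\<^sup>2 \<partial>dA) = 0"
    by (rule reproducing_difference[OF hh ih]) (simp add: disc_iff)
  then have "(\<integral>\<zeta>. h \<zeta> \<partial>dA) = 1"
    using ih by (simp add: h0)
  then have "(\<integral>\<zeta>. cnj (h \<zeta>) \<partial>dA) = 1" by (simp add: integral_bounded_linear[OF bounded_linear_cnj ih])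
  then have 1: "(\<integral>\<zeta>. 1 / (1 - cnj \<zeta> * z)\<^sup>2 \<partial>dA) = 1" by (simp add: hc)
  have "0 = (\<integral>\<zeta>. G \<zeta> * (1 / (1 - cnj \<zeta> * z)\<^sup>2) - G z * (1 * (1 / (1 - cnj \<zeta> * z)\<^sup>2)) \<partial>dA)"
    using reproducing_difference[OF assms] by (simp add: diff_divide_distrib)
  also have "\<dots> = (\<integral>\<zeta>. G \<zeta> * (1 / (1 - cnj \<zeta> * z)\<^sup>2) \<partial>dA) - (\<integral>\<zeta>. G z * (1 * (1 / (1 - cnj \<zeta> * z)\<^sup>2)) \<partial>dA)"
    by (intro Bochner_Integration.integral_diff intk integrable_mult_right G) auto
  also have "(\<integral>\<zeta>. G z * (1 * (1 / (1 - cnj \<zeta> * z)\<^sup>2)) \<partial>dA) = G z * 1"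
    by (subst integral_mult_right_zero) (simp add: 1)
  finally show ?thesis by simp
qed

section \<open>Potentials of compactly supported densities\<close>

definition csupp :: "real \<Rightarrow> (complex \<Rightarrow> complex) \<Rightarrow> bool" where
  "csupp s \<nu> \<longleftrightarrow> integrable dA \<nu> \<and> s < 1 \<and> (\<forall>\<zeta>. s < cmod \<zeta> \<longrightarrow> \<nu> \<zeta> = 0)"

definition kern :: "complex \<Rightarrow> complex \<Rightarrow> complex" where
  "kern z \<zeta> = 1 / (1 - cnj \<zeta> * z)"

text \<open>The indices (2, 0) give the Bergman projection and (1, 1) the positive kernel. Both are
  left free because differentiation raises them and multiplies the density by \<zeta> or its
  conjugate.\<close>

definition pot :: "(complex \<Rightarrow> complex) \<Rightarrow> nat \<Rightarrow> nat \<Rightarrow> complex \<Rightarrow> complex" where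
  "pot \<nu> i j z = (\<integral>\<zeta>. \<nu> \<zeta> * (kern z \<zeta> ^ i * cnj (kern z \<zeta>) ^ j) \<partial>dA)"

lemma norm_kern: "cmod (kern z \<zeta>) = 1 / dd z \<zeta>"
  by (simp add: kern_def dd_def norm_divide)

lemma norm_kern_le:
  assumes "cmod \<zeta> \<le> s" "s < 1" "z \<in> disc"
  shows "cmod (kern z \<zeta>) \<le> 1 / (1 - s)"
  using dd_ge_1_minus[of z \<zeta> s] assms by (auto simp: norm_kern disc_iff intro!: frac_le)

lemma measurable_kern: "z \<in> disc \<Longrightarrow> kern z \<in> borel_measurable dA"
  unfolding kern_def[abs_def] using one_minus_nonzero[of z]
  by (intro measurable_dA_continuous continuous_intros) auto

lemma csupp_integrable: "csupp s \<nu> \<Longrightarrow> integrable dA \<nu>"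
  by (simp add: csupp_def)

lemma csupp_mult:
  assumes "csupp s \<nu>" "h \<in> borel_measurable dA" "\<And>\<zeta>. \<zeta> \<in> disc \<Longrightarrow> cmod (h \<zeta>) \<le> C"
  shows "csupp s (\<lambda>\<zeta>. h \<zeta> * \<nu> \<zeta>)"
  using integrable_mult_bounded[of \<nu> h C] assms by (auto simp: csupp_def mult.commute)

lemma csupp_mult_id: "csupp s \<nu> \<Longrightarrow> csupp s (\<lambda>\<zeta>. \<zeta> * \<nu> \<zeta>)"
  by (rule csupp_mult[where C = 1]) (auto simp: measurable_dA_id disc_iff)

lemma csupp_mult_cnj: "csupp s \<nu> \<Longrightarrow> csupp s (\<lambda>\<zeta>. cnj \<zeta> * \<nu> \<zeta>)"
  by (rule csupp_mult[where C = 1]) (auto simp: disc_iff intro!: measurable_dA_continuous continuous_intros)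

lemma norm_kern_power_le:
  assumes "cmod \<zeta> \<le> s" "s < 1" "z \<in> disc"
  shows "cmod (kern z \<zeta> ^ i * cnj (kern z \<zeta>) ^ j) \<le> (1 / (1 - s)) ^ (i + j)"
  unfolding norm_mult norm_power complex_mod_cnj power_add[symmetric]
  by (intro power_mono norm_kern_le assms) auto

lemma integrable_pot:
  assumes "csupp s \<nu>" "z \<in> disc"
  shows "integrable dA (\<lambda>\<zeta>. \<nu> \<zeta> * (kern z \<zeta> ^ i * cnj (kern z \<zeta>) ^ j))"
proof (rule Bochner_Integration.integrable_bound)
  show "integrable dA (\<lambda>\<zeta>. (1 / (1 - s)) ^ (i + j) * cmod (\<nu> \<zeta>))"
    using csupp_integrable[OF assms(1)] by auto
  have [measurable]: "kern z \<in> borel_measurable dA" by (rule measurable_kern[OF assms(2)])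
  have [measurable]: "\<nu> \<in> borel_measurable dA" using csupp_integrable[OF assms(1)] by auto
  have [measurable]: "(\<lambda>\<zeta>. cnj (kern z \<zeta>)) \<in> borel_measurable dA"
    by (rule measurable_compose[OF measurable_kern[OF assms(2)]]) (simp add: borel_measurable_continuous_onI continuous_on_cnj')
  show "(\<lambda>\<zeta>. \<nu> \<zeta> * (kern z \<zeta> ^ i * cnj (kern z \<zeta>) ^ j)) \<in> borel_measurable dA"
    by measurable
  show "AE \<zeta> in dA. cmod (\<nu> \<zeta> * (kern z \<zeta> ^ i * cnj (kern z \<zeta>) ^ j)) \<le> norm ((1 / (1 - s)) ^ (i + j) * cmod (\<nu> \<zeta>))"
  proof (rule AE_I2)
    fix \<zeta>
    have s: "s < 1" using assms by (simp add: csupp_def)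
    show "cmod (\<nu> \<zeta> * (kern z \<zeta> ^ i * cnj (kern z \<zeta>) ^ j)) \<le> norm ((1 / (1 - s)) ^ (i + j) * cmod (\<nu> \<zeta>))"
    proof (cases "cmod \<zeta> \<le> s")
      case True
      from mult_right_mono[OF norm_kern_power_le[OF True s assms(2), of i j] norm_ge_zero[of "\<nu> \<zeta>"]]
      show ?thesis using s by (simp add: norm_mult mult.commute abs_mult)
    next
      case False
      then have "\<nu> \<zeta> = 0" using assms by (simp add: csupp_def)
      then show ?thesis by simp
    qed
  qed
qed

lemma norm_pot_le:
  assumes "csupp s \<nu>" "z \<in> disc"
  shows "cmod (pot \<nu> i j z) \<le> (1 / (1 - s)) ^ (i + j) * (\<integral>\<zeta>. cmod (\<nu> \<zeta>) \<partial>dA)"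
proof -
  have s: "s < 1" using assms by (simp add: csupp_def)
  have "cmod (pot \<nu> i j z) \<le> (\<integral>\<zeta>. cmod (\<nu> \<zeta> * (kern z \<zeta> ^ i * cnj (kern z \<zeta>) ^ j)) \<partial>dA)"
    unfolding pot_def by (rule integral_norm_bound)
  also have "\<dots> \<le> (\<integral>\<zeta>. (1 / (1 - s)) ^ (i + j) * cmod (\<nu> \<zeta>) \<partial>dA)"
  proof (rule integral_mono)
    fix \<zeta>
    show "cmod (\<nu> \<zeta> * (kern z \<zeta> ^ i * cnj (kern z \<zeta>) ^ j)) \<le> (1 / (1 - s)) ^ (i + j) * cmod (\<nu> \<zeta>)"
    proof (cases "cmod \<zeta> \<le> s")
      case True
      from mult_right_mono[OF norm_kern_power_le[OF True s assms(2), of i j] norm_ge_zero[of "\<nu> \<zeta>"]]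
      show ?thesis by (simp add: norm_mult mult.commute)
    next
      case False
      then have "\<nu> \<zeta> = 0" using assms by (simp add: csupp_def)
      then show ?thesis by simp
    qed
  qed (use integrable_norm[OF integrable_pot[OF assms]] csupp_integrable[OF assms(1)] in auto)
  finally show ?thesis by simp
qed

lemma wirt_kern:
  assumes "\<zeta> \<in> disc" "z \<in> disc"
  shows "wirt (\<lambda>z. kern z \<zeta>) z (cnj \<zeta> * kern z \<zeta> ^ 2) 0"
proof -
  have "1 - cnj \<zeta> * z \<noteq> 0" by (rule one_minus_nonzero[OF assms(2,1)])
  then have "((\<lambda>z. kern z \<zeta>) has_field_derivative (cnj \<zeta> * kern z \<zeta> ^ 2)) (at z)"
    unfolding kern_def by (auto intro!: derivative_eq_intros simp: power2_eq_square)
  then show ?thesis by (rule wirt_holo)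
qed

lemma wirt_power:
  assumes "wirt U z p q"
  shows "wirt (\<lambda>z. U z ^ n) z (of_nat n * U z ^ (n - 1) * p) (of_nat n * U z ^ (n - 1) * q)"
proof (induction n)
  case 0
  show ?case using wirt_const[of 1] by simp
next
  case (Suc n)
  have "U z * (of_nat n * U z ^ (n - 1)) = of_nat n * U z ^ n"
    by (cases n) (simp_all del: of_nat_Suc)
  then have eq: "r * U z ^ n + U z * (of_nat n * U z ^ (n - 1) * r) = of_nat (Suc n) * U z ^ (Suc n - 1) * r" for r
    by (simp add: algebra_simps)
  show ?case
    using wirt_mult[OF assms Suc.IH] unfolding eq by simp
qed

lemma wirt_kern_power:
  assumes "\<zeta> \<in> disc" "z \<in> disc"
  shows "wirt (\<lambda>z. kern z \<zeta> ^ i * cnj (kern z \<zeta>) ^ j) z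
    (of_nat i * (cnj \<zeta> * (kern z \<zeta> ^ Suc i * cnj (kern z \<zeta>) ^ j)))
    (of_nat j * (\<zeta> * (kern z \<zeta> ^ i * cnj (kern z \<zeta>) ^ Suc j)))"
proof -
  have e: "of_nat n * c ^ (n - 1) * (b * c ^ 2) = of_nat n * (b * c ^ Suc n)" for n and b c :: complex
    by (cases n) (simp_all add: power2_eq_square)
  have 1: "wirt (\<lambda>z. kern z \<zeta> ^ i) z (of_nat i * (cnj \<zeta> * kern z \<zeta> ^ Suc i)) 0"
    using wirt_power[OF wirt_kern[OF assms], of i] unfolding e by simp
  have 2: "wirt (\<lambda>z. cnj (kern z \<zeta>) ^ j) z 0 (of_nat j * (\<zeta> * cnj (kern z \<zeta>) ^ Suc j))"
    using wirt_power[OF wirt_cnj[OF wirt_kern[OF assms]], of j]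
    unfolding complex_cnj_mult complex_cnj_power complex_cnj_cnj complex_cnj_zero e by simp
  show ?thesis using wirt_mult[OF 1 2] by (simp add: algebra_simps)
qed

text \<open>Differentiation under the integral sign. On the support of \<nu> the kernels are
  Lipschitz in z with a constant \<open>M\<close> not depending on \<zeta>, so the difference
  quotients of the remainder are dominated by \<open>2 * M * cmod (\<nu> \<zeta>)\<close>.\<close>

lemma wirt_pot:
  assumes c: "csupp s \<nu>" and z: "z \<in> disc"
  shows "wirt (pot \<nu> i j) z (of_nat i * pot (\<lambda>\<zeta>. cnj \<zeta> * \<nu> \<zeta>) (Suc i) j z)
    (of_nat j * pot (\<lambda>\<zeta>. \<zeta> * \<nu> \<zeta>) i (Suc j) z)"
proof -
  have s: "s < 1" using c by (simp add: csupp_def)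
  define \<kappa> where "\<kappa> z \<zeta> = kern z \<zeta> ^ i * cnj (kern z \<zeta>) ^ j" for z \<zeta>
  define p where "p z \<zeta> = of_nat i * (cnj \<zeta> * (kern z \<zeta> ^ Suc i * cnj (kern z \<zeta>) ^ j))" for z \<zeta>
  define q where "q z \<zeta> = of_nat j * (\<zeta> * (kern z \<zeta> ^ i * cnj (kern z \<zeta>) ^ Suc j))" for z \<zeta>
  define L where "L h \<zeta> = p z \<zeta> * h + q z \<zeta> * cnj h" for h \<zeta>
  define M where "M = real i * (1 / (1 - s)) ^ Suc (i + j) + real j * (1 / (1 - s)) ^ Suc (i + j)"
  have pq: "cmod (p y \<zeta>) + cmod (q y \<zeta>) \<le> M" if "cmod \<zeta> \<le> s" "y \<in> disc" for y \<zeta>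
  proof -
    have \<zeta>: "cmod \<zeta> \<le> 1" using that s by simp
    have a: "r * (c * x) \<le> r * b" if "0 \<le> c" "c \<le> 1" "0 \<le> x" "x \<le> b" "0 \<le> r" for r c x b :: real
      using that mult_mono[of c 1 x b] by (auto intro!: mult_left_mono)
    have "cmod (p y \<zeta>) \<le> real i * (1 / (1 - s)) ^ Suc (i + j)"
      unfolding p_def norm_mult[of "of_nat i"] norm_mult[of "cnj \<zeta>"] norm_of_nat complex_mod_cnj
      by (rule a) (use \<zeta> norm_kern_power_le[OF that(1) s that(2), of "Suc i" j, unfolded add_Suc] in \<open>simp_all only: norm_ge_zero of_nat_0_le_iff\<close>)
    moreover have "cmod (q y \<zeta>) \<le> real j * (1 / (1 - s)) ^ Suc (i + j)"
      unfolding q_def norm_mult[of "of_nat j"] norm_mult[of \<zeta>] norm_of_nat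
      by (rule a) (use \<zeta> norm_kern_power_le[OF that(1) s that(2), of i "Suc j", unfolded add_Suc_right] in \<open>simp_all only: norm_ge_zero of_nat_0_le_iff\<close>)
    ultimately show ?thesis by (simp add: M_def)
  qed
  have wk: "wirt (\<lambda>z. \<kappa> z \<zeta>) y (p y \<zeta>) (q y \<zeta>)" if "\<zeta> \<in> disc" "y \<in> disc" for y \<zeta>
    unfolding \<kappa>_def p_def q_def by (rule wirt_kern_power[OF that])
  have lip: "cmod (\<kappa> y \<zeta> - \<kappa> z \<zeta>) \<le> M * cmod (y - z)" if "cmod \<zeta> \<le> s" "y \<in> disc" for y \<zeta>
  proof (rule differentiable_bound[of disc "\<lambda>z. \<kappa> z \<zeta>" "\<lambda>z h. p z \<zeta> * h + q z \<zeta> * cnj h"])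
    show "convex disc" by (simp add: disc_def)
    show "((\<lambda>z. \<kappa> z \<zeta>) has_derivative (\<lambda>h. p x \<zeta> * h + q x \<zeta> * cnj h)) (at x within disc)" if "x \<in> disc" for x
      using wk[of \<zeta> x] that \<open>cmod \<zeta> \<le> s\<close> s by (auto simp: wirt_def disc_iff intro: has_derivative_at_withinI)
    show "onorm (\<lambda>h. p x \<zeta> * h + q x \<zeta> * cnj h) \<le> M" if "x \<in> disc" for x
    proof (rule onorm_le)
      fix h
      have "norm (p x \<zeta> * h + q x \<zeta> * cnj h) \<le> (cmod (p x \<zeta>) + cmod (q x \<zeta>)) * norm h"
        by (rule wirt_norm_le)
      also have "\<dots> \<le> M * norm h"
        by (intro mult_right_mono pq norm_ge_zero that \<open>cmod \<zeta> \<le> s\<close>)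
      finally show "norm (p x \<zeta> * h + q x \<zeta> * cnj h) \<le> M * norm h" .
    qed
  qed (use that z in auto)
  have int\<kappa>: "integrable dA (\<lambda>\<zeta>. \<nu> \<zeta> * \<kappa> y \<zeta>)" if "y \<in> disc" for y
    unfolding \<kappa>_def by (rule integrable_pot[OF c that])
  have intp: "integrable dA (\<lambda>\<zeta>. \<nu> \<zeta> * p z \<zeta>)"
    using integrable_mult_right[OF integrable_pot[OF csupp_mult_cnj[OF c] z, of "Suc i" j], of "of_nat i"]
    by (simp add: p_def algebra_simps)
  have intq: "integrable dA (\<lambda>\<zeta>. \<nu> \<zeta> * q z \<zeta>)"
    using integrable_mult_right[OF integrable_pot[OF csupp_mult_id[OF c] z, of i "Suc j"], of "of_nat j"]
    by (simp add: q_def algebra_simps)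
  have ip: "(\<integral>\<zeta>. \<nu> \<zeta> * p z \<zeta> \<partial>dA) = of_nat i * pot (\<lambda>\<zeta>. cnj \<zeta> * \<nu> \<zeta>) (Suc i) j z"
    unfolding pot_def integral_mult_right_zero[symmetric] p_def by (rule Bochner_Integration.integral_cong) (auto simp: algebra_simps)
  have iq: "(\<integral>\<zeta>. \<nu> \<zeta> * q z \<zeta> \<partial>dA) = of_nat j * pot (\<lambda>\<zeta>. \<zeta> * \<nu> \<zeta>) i (Suc j) z"
    unfolding pot_def integral_mult_right_zero[symmetric] q_def by (rule Bochner_Integration.integral_cong) (auto simp: algebra_simps)
  define P where "P = of_nat i * pot (\<lambda>\<zeta>. cnj \<zeta> * \<nu> \<zeta>) (Suc i) j z"
  define Q where "Q = of_nat j * pot (\<lambda>\<zeta>. \<zeta> * \<nu> \<zeta>) i (Suc j) z"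
  have "(pot \<nu> i j has_derivative (\<lambda>h. P * h + Q * cnj h)) (at z within disc)"
    unfolding has_derivative_within
  proof
    show "bounded_linear (\<lambda>h. P * h + Q * cnj h)"
      by (intro bounded_linear_add bounded_linear_const_mult bounded_linear_ident bounded_linear_cnj)
    show "((\<lambda>y. (1 / norm (y - z)) *\<^sub>R (pot \<nu> i j y - (pot \<nu> i j z + (P * (y - z) + Q * cnj (y - z))))) \<longlongrightarrow> 0) (at z within disc)"
      unfolding tendsto_at_iff_sequentially o_def
    proof (intro allI impI)
      fix Y :: "nat \<Rightarrow> complex" assume Y: "\<forall>n. Y n \<in> disc - {z}" "Y \<longlonglongrightarrow> z"
      define r where "r n \<zeta> = \<nu> \<zeta> * ((1 / norm (Y n - z)) *\<^sub>R (\<kappa> (Y n) \<zeta> - (\<kappa> z \<zeta> + L (Y n - z) \<zeta>)))" for n \<zeta>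
      have Yd: "Y n \<in> disc" "Y n \<noteq> z" for n using Y(1) by auto
      have ir: "integrable dA (r n) \<and> (\<integral>\<zeta>. r n \<zeta> \<partial>dA) = (1 / norm (Y n - z)) *\<^sub>R (pot \<nu> i j (Y n) - (pot \<nu> i j z + (P * (Y n - z) + Q * cnj (Y n - z))))" for n
      proof -
        have e: "r n = (\<lambda>\<zeta>. (1 / norm (Y n - z)) *\<^sub>R (\<nu> \<zeta> * \<kappa> (Y n) \<zeta> - (\<nu> \<zeta> * \<kappa> z \<zeta> + (\<nu> \<zeta> * p z \<zeta> * (Y n - z) + \<nu> \<zeta> * q z \<zeta> * cnj (Y n - z)))))"
          by (simp add: r_def L_def fun_eq_iff scaleR_conv_of_real ring_distribs mult_ac)
        have "has_bochner_integral dA (r n) ((1 / norm (Y n - z)) *\<^sub>R ((\<integral>\<zeta>. \<nu> \<zeta> * \<kappa> (Y n) \<zeta> \<partial>dA) - ((\<integral>\<zeta>. \<nu> \<zeta> * \<kappa> z \<zeta> \<partial>dA) + ((\<integral>\<zeta>. \<nu> \<zeta> * p z \<zeta> \<partial>dA) * (Y n - z) + (\<integral>\<zeta>. \<nu> \<zeta> * q z \<zeta> \<partial>dA) * cnj (Y n - z)))))"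
          unfolding e
          by (intro has_bochner_integral_scaleR_right has_bochner_integral_diff has_bochner_integral_add has_bochner_integral_mult_left
              has_bochner_integral_integrable int\<kappa> Yd z intp intq)
        then have "has_bochner_integral dA (r n) ((1 / norm (Y n - z)) *\<^sub>R (pot \<nu> i j (Y n) - (pot \<nu> i j z + (P * (Y n - z) + Q * cnj (Y n - z)))))"
          by (simp only: ip iq P_def Q_def \<kappa>_def pot_def)
        then show ?thesis by (auto simp: has_bochner_integral_iff)
      qed
      have dom: "cmod (r n \<zeta>) \<le> 2 * M * cmod (\<nu> \<zeta>)" for n \<zeta>
      proof (cases "cmod \<zeta> \<le> s")
        case False
        then have "\<nu> \<zeta> = 0" using c by (simp add: csupp_def)
        then show ?thesis by (simp add: r_def)
      next
        case True
        define h where "h = Y n - z"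
        have h: "cmod h > 0" using Yd by (simp add: h_def)
        have "cmod (L h \<zeta>) \<le> M * cmod h"
          unfolding L_def using wirt_norm_le[of "p z \<zeta>" h "q z \<zeta>"] mult_right_mono[OF pq[OF True z] norm_ge_zero[of h]] by linarith
        moreover have "cmod (\<kappa> (Y n) \<zeta> - \<kappa> z \<zeta>) \<le> M * cmod h" unfolding h_def by (rule lip[OF True Yd(1)])
        ultimately have "cmod (\<kappa> (Y n) \<zeta> - \<kappa> z \<zeta> - L h \<zeta>) \<le> 2 * M * cmod h"
          using norm_triangle_ineq4[of "\<kappa> (Y n) \<zeta> - \<kappa> z \<zeta>" "L h \<zeta>"] by linarith
        then have "cmod ((1 / norm h) *\<^sub>R (\<kappa> (Y n) \<zeta> - (\<kappa> z \<zeta> + L h \<zeta>))) \<le> 2 * M"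
          using h unfolding norm_scaleR diff_diff_eq by (simp add: divide_le_eq)
        from mult_left_mono[OF this norm_ge_zero[of "\<nu> \<zeta>"]] show ?thesis
          unfolding r_def h_def[symmetric] norm_mult by (simp add: mult_ac)
      qed
      have lim: "(\<lambda>n. r n \<zeta>) \<longlonglongrightarrow> 0" if "\<zeta> \<in> disc" for \<zeta>
      proof -
        have "((\<lambda>y. (1 / norm (y - z)) *\<^sub>R (\<kappa> y \<zeta> - (\<kappa> z \<zeta> + (p z \<zeta> * (y - z) + q z \<zeta> * cnj (y - z))))) \<longlongrightarrow> 0) (at z)"
          using wk[OF that z] unfolding wirt_def has_derivative_within by blast
        then have "((\<lambda>y. (1 / norm (y - z)) *\<^sub>R (\<kappa> y \<zeta> - (\<kappa> z \<zeta> + (p z \<zeta> * (y - z) + q z \<zeta> * cnj (y - z))))) \<circ> Y) \<longlonglongrightarrow> 0"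
          unfolding tendsto_at_iff_sequentially using Y by auto
        then have "(\<lambda>n. \<nu> \<zeta> * ((1 / norm (Y n - z)) *\<^sub>R (\<kappa> (Y n) \<zeta> - (\<kappa> z \<zeta> + L (Y n - z) \<zeta>)))) \<longlonglongrightarrow> \<nu> \<zeta> * 0"
          unfolding o_def L_def by (intro tendsto_mult_left)
        then show ?thesis by (simp add: r_def)
      qed
      have "(\<lambda>n. \<integral>\<zeta>. r n \<zeta> \<partial>dA) \<longlonglongrightarrow> (\<integral>\<zeta>. 0 \<partial>dA)"
      proof (rule integral_dominated_convergence[where w = "\<lambda>\<zeta>. 2 * M * cmod (\<nu> \<zeta>)"])
        show "r n \<in> borel_measurable dA" for n using ir[of n] by auto
        show "integrable dA (\<lambda>\<zeta>. 2 * M * cmod (\<nu> \<zeta>))" using csupp_integrable[OF c] by auto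
      qed (use dom lim in \<open>auto intro!: AE_I2\<close>)
      then show "(\<lambda>n. (1 / norm (Y n - z)) *\<^sub>R (pot \<nu> i j (Y n) - (pot \<nu> i j z + (P * (Y n - z) + Q * cnj (Y n - z))))) \<longlonglongrightarrow> 0"
        using ir by simp
    qed
  qed
  then show ?thesis
    unfolding wirt_def P_def Q_def using at_within_open[OF z open_disc] by simp
qed

lemma continuous_on_pot: "csupp s \<nu> \<Longrightarrow> continuous_on disc (pot \<nu> i j)"
  by (rule wirt_imp_continuous_on) (rule wirt_pot)

section \<open>Toeplitz operators and their adjoints\<close>

lemma integral_Cauchy_Schwarz:
  fixes u v :: "'a \<Rightarrow> real"
  assumes [measurable]: "u \<in> borel_measurable M" "v \<in> borel_measurable M"
    and u: "integrable M (\<lambda>x. (u x)\<^sup>2)" and v: "integrable M (\<lambda>x. (v x)\<^sup>2)"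
  shows "integrable M (\<lambda>x. u x * v x)"
    and "(\<integral>x. \<bar>u x * v x\<bar> \<partial>M)\<^sup>2 \<le> (\<integral>x. (u x)\<^sup>2 \<partial>M) * (\<integral>x. (v x)\<^sup>2 \<partial>M)"
proof -
  show i: "integrable M (\<lambda>x. u x * v x)"
  proof (rule Bochner_Integration.integrable_bound)
    show "integrable M (\<lambda>x. (u x)\<^sup>2 + (v x)\<^sup>2)" using u v by simp
    have "\<bar>a * b\<bar> \<le> a\<^sup>2 + b\<^sup>2" for a b :: real
    proof -
      have "2 * \<bar>a * b\<bar> \<le> a\<^sup>2 + b\<^sup>2"
        using sum_squares_bound[of "\<bar>a\<bar>" "\<bar>b\<bar>"] by (simp add: abs_mult)
      then show ?thesis using abs_ge_zero[of "a * b"] by linarith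
    qed
    then show "AE x in M. norm (u x * v x) \<le> norm ((u x)\<^sup>2 + (v x)\<^sup>2)"
      by (intro AE_I2) simp
  qed simp
  have ai: "integrable M (\<lambda>x. \<bar>u x * v x\<bar>)" using i by simp
  have "ennreal ((\<integral>x. \<bar>u x * v x\<bar> \<partial>M)\<^sup>2) = (\<integral>\<^sup>+x. ennreal \<bar>u x\<bar> * ennreal \<bar>v x\<bar> \<partial>M)\<^sup>2"
    using nn_integral_eq_integral[OF ai] by (simp add: ennreal_power abs_mult ennreal_mult)
  also have "\<dots> \<le> (\<integral>\<^sup>+x. (ennreal \<bar>u x\<bar>)\<^sup>2 \<partial>M) * (\<integral>\<^sup>+x. (ennreal \<bar>v x\<bar>)\<^sup>2 \<partial>M)"
    by (rule Cauchy_Schwarz_nn_integral) auto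
  also have "\<dots> = ennreal ((\<integral>x. (u x)\<^sup>2 \<partial>M) * (\<integral>x. (v x)\<^sup>2 \<partial>M))"
    using nn_integral_eq_integral[OF u] nn_integral_eq_integral[OF v] by (simp add: ennreal_power ennreal_mult)
  finally show "(\<integral>x. \<bar>u x * v x\<bar> \<partial>M)\<^sup>2 \<le> (\<integral>x. (u x)\<^sup>2 \<partial>M) * (\<integral>x. (v x)\<^sup>2 \<partial>M)"
    by (simp add: ennreal_le_iff integral_nonneg_AE)
qed

lemma cnj_integral: "cnj (\<integral>x. F x \<partial>M) = (\<integral>x. cnj (F x) \<partial>M)"
  by simp

definition sqn :: "(complex \<Rightarrow> complex) \<Rightarrow> real" where
  "sqn u = (\<integral>z. (cmod (u z))\<^sup>2 \<partial>dA)"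

lemma sqn_nonneg [simp]: "0 \<le> sqn u"
  by (simp add: sqn_def)

lemma sqn_cong: "(\<And>z. z \<in> disc \<Longrightarrow> cmod (u z) = cmod (v z)) \<Longrightarrow> sqn u = sqn v"
  unfolding sqn_def by (rule Bochner_Integration.integral_cong) auto

lemma l2norm_eq: "l2norm u = sqrt (sqn u)"
  by (simp add: l2norm_def sqn_def)

lemma L2_measurable: "L2 u \<Longrightarrow> u \<in> borel_measurable dA"
  by (simp add: L2_def)

lemma L2_integrable_square: "L2 u \<Longrightarrow> integrable dA (\<lambda>z. (cmod (u z))\<^sup>2)"
  by (simp add: L2_def)

lemma L2_bound:
  assumes "L2 v" "u \<in> borel_measurable dA" "\<And>z. z \<in> disc \<Longrightarrow> cmod (u z) \<le> cmod (v z)"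
  shows "L2 u" "sqn u \<le> sqn v"
proof -
  have *: "(cmod (u z))\<^sup>2 \<le> (cmod (v z))\<^sup>2" if "z \<in> disc" for z
    using assms(3)[OF that] by (simp add: power_mono)
  have i: "integrable dA (\<lambda>z. (cmod (u z))\<^sup>2)"
    by (rule Bochner_Integration.integrable_bound[OF L2_integrable_square[OF assms(1)]])
       (use assms(2) * in \<open>auto intro!: AE_I2\<close>)
  then show "L2 u" using assms(2) by (simp add: L2_def)
  show "sqn u \<le> sqn v"
    unfolding sqn_def by (rule integral_mono[OF i L2_integrable_square[OF assms(1)]]) (use * in auto)
qed

lemma L2_bounded:
  assumes "u \<in> borel_measurable dA" "\<And>z. z \<in> disc \<Longrightarrow> cmod (u z) \<le> B"
  shows "L2 u"
  by (rule L2_bound(1)[of "\<lambda>_. of_real (max B 0)"]) (use assms in \<open>auto simp: L2_def le_max_iff_disj\<close>)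

lemma L2_integrable: "L2 u \<Longrightarrow> integrable dA u"
proof (rule Bochner_Integration.integrable_bound)
  assume u: "L2 u"
  then show "integrable dA (\<lambda>z. 1 + (cmod (u z))\<^sup>2)" by (simp add: L2_def)
  show "u \<in> borel_measurable dA" using u by (simp add: L2_def)
  have "x \<le> 1 + x\<^sup>2" for x :: real
    using zero_le_power2[of "x - 1/2"] by (simp add: power2_eq_square algebra_simps)
  then show "AE z in dA. cmod (u z) \<le> norm (1 + (cmod (u z))\<^sup>2)"
    by (intro AE_I2) (simp add: abs_of_nonneg)
qed

lemma L2_integrable_mult:
  assumes "L2 u" "L2 v"
  shows "integrable dA (\<lambda>z. u z * v z)"
proof -
  have "integrable dA (\<lambda>z. cmod (u z) * cmod (v z))"
    by (rule integral_Cauchy_Schwarz) (use assms in \<open>auto simp: L2_def\<close>)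
  then show ?thesis
    by (rule Bochner_Integration.integrable_bound) (use assms in \<open>auto simp: L2_def norm_mult\<close>)
qed

lemma L2_cnj: "L2 u \<Longrightarrow> L2 (\<lambda>z. cnj (u z))"
  unfolding L2_def
  by (auto intro: measurable_compose[OF _ borel_measurable_continuous_onI[OF continuous_on_cnj'[OF continuous_on_id]]])

lemma L2_Cauchy_Schwarz:
  assumes "L2 u" "L2 v"
  shows "(cmod (\<integral>z. u z * v z \<partial>dA))\<^sup>2 \<le> sqn u * sqn v"
proof -
  have "cmod (\<integral>z. u z * v z \<partial>dA) \<le> (\<integral>z. cmod (u z * v z) \<partial>dA)"
    by (rule integral_norm_bound)
  also have "\<dots> = (\<integral>z. \<bar>cmod (u z) * cmod (v z)\<bar> \<partial>dA)"
    by (simp add: norm_mult)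
  finally have "(cmod (\<integral>z. u z * v z \<partial>dA))\<^sup>2 \<le> (\<integral>z. \<bar>cmod (u z) * cmod (v z)\<bar> \<partial>dA)\<^sup>2"
    by (rule power_mono) simp
  also have "\<dots> \<le> sqn u * sqn v"
    unfolding sqn_def by (rule integral_Cauchy_Schwarz) (use assms in \<open>auto simp: L2_def\<close>)
  finally show ?thesis .
qed

lemma A2_L2: "A2 u \<Longrightarrow> L2 u" and A2_holomorphic: "A2 u \<Longrightarrow> u holomorphic_on disc"
  by (simp_all add: A2_def)

lemma A2_integrable: "A2 u \<Longrightarrow> integrable dA u"
  by (intro L2_integrable A2_L2)

text \<open>The class of test densities: it is stable under multiplication by functions continuous
  on the disc, and its members have bounded Bergman projections.\<close>

definition bcs :: "real \<Rightarrow> (complex \<Rightarrow> complex) \<Rightarrow> bool" where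
  "bcs s h \<longleftrightarrow> h \<in> borel_measurable dA \<and> s < 1 \<and> (\<exists>B. \<forall>\<zeta>\<in>disc. cmod (h \<zeta>) \<le> B) \<and> (\<forall>\<zeta>. s < cmod \<zeta> \<longrightarrow> h \<zeta> = 0)"

lemma bcs_L2: "bcs s h \<Longrightarrow> L2 h"
  unfolding bcs_def using L2_bounded by blast

lemma bcs_csupp:
  assumes "bcs s h"
  shows "csupp s h"
proof -
  have "s < 1" "\<forall>\<zeta>. s < cmod \<zeta> \<longrightarrow> h \<zeta> = 0" using assms unfolding bcs_def by blast+
  with L2_integrable[OF bcs_L2[OF assms]] show ?thesis unfolding csupp_def by blast
qed

lemma bcs_mult_cont:
  assumes h: "bcs s h" and g: "continuous_on disc g"
  shows "bcs s (\<lambda>\<zeta>. g \<zeta> * h \<zeta>)"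
proof -
  have s: "s < 1" using h by (simp add: bcs_def)
  have "bounded (g ` cball 0 s)"
    by (intro compact_imp_bounded compact_continuous_image continuous_on_subset[OF g]) (use s in \<open>auto simp: disc_iff\<close>)
  then obtain A where A: "\<And>\<zeta>. \<zeta> \<in> cball 0 s \<Longrightarrow> cmod (g \<zeta>) \<le> A"
    unfolding bounded_iff by fastforce
  obtain B where B: "\<And>\<zeta>. \<zeta> \<in> disc \<Longrightarrow> cmod (h \<zeta>) \<le> B" using h by (auto simp: bcs_def)
  have "cmod (g \<zeta> * h \<zeta>) \<le> \<bar>A\<bar> * \<bar>B\<bar>" if "\<zeta> \<in> disc" for \<zeta>
  proof (cases "cmod \<zeta> \<le> s")
    case True
    then show ?thesis
      unfolding norm_mult using A[of \<zeta>] B[OF that] by (intro mult_mono) auto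
  next
    case False
    then have "h \<zeta> = 0" using h by (simp add: bcs_def)
    then show ?thesis by simp
  qed
  moreover have "(\<lambda>\<zeta>. g \<zeta> * h \<zeta>) \<in> borel_measurable dA"
    using measurable_dA_continuous[OF g] h by (auto simp: bcs_def)
  ultimately show ?thesis using h by (auto simp: bcs_def)
qed

section \<open>The Bergman projection of compactly supported densities\<close>

lemma bergman_proj_pot: "bergman_proj h z = pot h 2 0 z"
  by (simp add: bergman_proj_def pot_def kern_def power_divide)

lemma bergman_proj_A2:
  assumes "csupp s h"
  shows "A2 (bergman_proj h)" "\<exists>B. \<forall>z\<in>disc. cmod (bergman_proj h z) \<le> B"
proof -
  have "(bergman_proj h has_field_derivative (2 * pot (\<lambda>\<zeta>. cnj \<zeta> * h \<zeta>) 3 0 z)) (at z)" if "z \<in> disc" for z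
    using wirt_pot[OF assms that, of 2 0]
    by (simp add: wirt_def has_field_derivative_def bergman_proj_pot[abs_def] numeral_3_eq_3 flip: Suc_1)
  then have h: "bergman_proj h holomorphic_on disc"
    unfolding holomorphic_on_open[OF open_disc] by blast
  show b: "\<exists>B. \<forall>z\<in>disc. cmod (bergman_proj h z) \<le> B"
    unfolding bergman_proj_pot using norm_pot_le[OF assms] by blast
  then obtain B where "\<And>z. z \<in> disc \<Longrightarrow> cmod (bergman_proj h z) \<le> B" by blast
  then have "L2 (bergman_proj h)"
    by (intro L2_bounded measurable_dA_continuous holomorphic_on_imp_continuous_on h)
  with h show "A2 (bergman_proj h)" by (simp add: A2_def)
qed

lemma bergman_proj_reproducing:
  "A2 G \<Longrightarrow> z \<in> disc \<Longrightarrow> bergman_proj G z = G z"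
  unfolding bergman_proj_def by (rule reproducing_formula) (auto simp: A2_holomorphic A2_integrable)

interpretation dA2: pair_sigma_finite dA dA
  by (intro pair_sigma_finite.intro dA.sigma_finite_measure_axioms)

lemma measurable_dA_fst: "fst \<in> borel_measurable (dA \<Otimes>\<^sub>M dA)"
  and measurable_dA_snd: "snd \<in> borel_measurable (dA \<Otimes>\<^sub>M dA)"
  using measurable_compose[OF measurable_fst measurable_dA_id] measurable_compose[OF measurable_snd measurable_dA_id]
  by auto

lemma measurable_cnj: "F \<in> borel_measurable M \<Longrightarrow> (\<lambda>x. cnj (F x)) \<in> borel_measurable M"
  by (erule measurable_compose) (intro borel_measurable_continuous_onI continuous_intros)

text \<open>The kernel is bounded only where \<open>b\<close> is nonzero; this suffices, and it fits
  kernels that blow up at the circle when \<open>b\<close> has compact support.\<close>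

lemma fubini_kernel:
  fixes a b :: "complex \<Rightarrow> complex"
  assumes a: "integrable dA a" and b: "integrable dA b"
    and K[measurable]: "case_prod K \<in> borel_measurable (dA \<Otimes>\<^sub>M dA)"
    and bnd: "\<And>z \<zeta>. z \<in> disc \<Longrightarrow> \<zeta> \<in> disc \<Longrightarrow> b \<zeta> \<noteq> 0 \<Longrightarrow> cmod (K z \<zeta>) \<le> B"
  shows "(\<integral>z. a z * (\<integral>\<zeta>. b \<zeta> * K z \<zeta> \<partial>dA) \<partial>dA) = (\<integral>\<zeta>. b \<zeta> * (\<integral>z. a z * K z \<zeta> \<partial>dA) \<partial>dA)"
proof -
  have [measurable]: "a \<in> borel_measurable dA" "b \<in> borel_measurable dA" using a b by auto
  define F where "F z \<zeta> = a z * b \<zeta> * K z \<zeta>" for z \<zeta>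
  have Fm: "case_prod F \<in> borel_measurable (dA \<Otimes>\<^sub>M dA)"
    unfolding F_def by measurable
  have Kz: "(\<lambda>\<zeta>. K z \<zeta>) \<in> borel_measurable dA" if "z \<in> disc" for z
    using measurable_compose[OF measurable_Pair1'[of z dA dA] K] that by simp
  have dom: "norm (F z \<zeta>) \<le> \<bar>B\<bar> * (cmod (a z) * cmod (b \<zeta>))" if "z \<in> disc" "\<zeta> \<in> disc" for z \<zeta>
  proof (cases "b \<zeta> = 0")
    case False
    then have "cmod (K z \<zeta>) \<le> \<bar>B\<bar>" using bnd[OF that] by linarith
    from mult_left_mono[OF this, of "cmod (a z * b \<zeta>)"] show ?thesis
      by (simp add: F_def norm_mult mult_ac)
  qed (simp add: F_def)
  have iz: "integrable dA (F z)" if "z \<in> disc" for z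
  proof (rule Bochner_Integration.integrable_bound)
    show "integrable dA (\<lambda>\<zeta>. \<bar>B\<bar> * (cmod (a z) * cmod (b \<zeta>)))" using b by auto
    show "AE \<zeta> in dA. norm (F z \<zeta>) \<le> norm (\<bar>B\<bar> * (cmod (a z) * cmod (b \<zeta>)))"
      using dom[OF that] by (intro AE_I2) (simp add: abs_mult)
    show "F z \<in> borel_measurable dA" unfolding F_def[abs_def] using Kz[OF that] by simp
  qed
  have iF: "integrable (dA \<Otimes>\<^sub>M dA) (case_prod F)"
  proof (rule dA2.Fubini_integrable[OF Fm])
    show "AE x in dA. integrable dA (\<lambda>y. case (x, y) of (z, \<zeta>) \<Rightarrow> F z \<zeta>)"
      using iz by (intro AE_I2) auto
    show "integrable dA (\<lambda>x. \<integral>y. norm (case (x, y) of (z, \<zeta>) \<Rightarrow> F z \<zeta>) \<partial>dA)"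
    proof (rule Bochner_Integration.integrable_bound)
      show "integrable dA (\<lambda>z. \<bar>B\<bar> * (cmod (a z) * (\<integral>\<zeta>. cmod (b \<zeta>) \<partial>dA)))" using a by auto
      show "(\<lambda>x. \<integral>y. norm (case (x, y) of (z, \<zeta>) \<Rightarrow> F z \<zeta>) \<partial>dA) \<in> borel_measurable dA"
        using Fm by measurable
      show "AE x in dA. norm (\<integral>y. norm (case (x, y) of (z, \<zeta>) \<Rightarrow> F z \<zeta>) \<partial>dA)
         \<le> norm (\<bar>B\<bar> * (cmod (a x) * (\<integral>\<zeta>. cmod (b \<zeta>) \<partial>dA)))"
      proof (rule AE_I2)
        fix z assume "z \<in> space dA"
        then have z: "z \<in> disc" by simp
        have "(\<integral>\<zeta>. norm (F z \<zeta>) \<partial>dA) \<le> (\<integral>\<zeta>. \<bar>B\<bar> * (cmod (a z) * cmod (b \<zeta>)) \<partial>dA)"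
          using iz[OF z] b dom[OF z] by (intro integral_mono) auto
        also have "\<dots> = \<bar>B\<bar> * (cmod (a z) * (\<integral>\<zeta>. cmod (b \<zeta>) \<partial>dA))" by simp
        finally show "norm (\<integral>y. norm (case (z, y) of (z, \<zeta>) \<Rightarrow> F z \<zeta>) \<partial>dA)
         \<le> norm (\<bar>B\<bar> * (cmod (a z) * (\<integral>\<zeta>. cmod (b \<zeta>) \<partial>dA)))"
          by simp
      qed
    qed
  qed
  have "(\<integral>z. a z * (\<integral>\<zeta>. b \<zeta> * K z \<zeta> \<partial>dA) \<partial>dA) = (\<integral>z. (\<integral>\<zeta>. F z \<zeta> \<partial>dA) \<partial>dA)"
    by (simp add: F_def mult.assoc)
  also have "\<dots> = (\<integral>\<zeta>. (\<integral>z. F z \<zeta> \<partial>dA) \<partial>dA)"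
    by (rule dA2.Fubini_integral[OF iF, symmetric])
  also have "\<dots> = (\<integral>\<zeta>. b \<zeta> * (\<integral>z. a z * K z \<zeta> \<partial>dA) \<partial>dA)"
    by (simp add: F_def mult_ac flip: integral_mult_right_zero)
  finally show ?thesis .
qed

text \<open>The projection is moved to \<open>G\<close> by exchanging integrals, which the compact
  support of \<open>h\<close> permits, and there it acts as the identity.\<close>

lemma l2inner_bergman_proj:
  assumes G: "A2 G" and h: "bcs s h"
  shows "l2inner G (bergman_proj h) = (\<integral>z. G z * cnj (h z) \<partial>dA)"
proof -
  have s: "s < 1" using h by (simp add: bcs_def)
  define K where "K z \<zeta> = 1 / (1 - cnj z * \<zeta>)\<^sup>2" for z \<zeta>
  have Km: "case_prod K \<in> borel_measurable (dA \<Otimes>\<^sub>M dA)"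
    unfolding K_def case_prod_unfold
    by (intro borel_measurable_divide borel_measurable_power borel_measurable_diff borel_measurable_times
        measurable_cnj measurable_dA_fst measurable_dA_snd borel_measurable_const)
  have "l2inner G (bergman_proj h) = (\<integral>z. G z * (\<integral>\<zeta>. cnj (h \<zeta>) * K z \<zeta> \<partial>dA) \<partial>dA)"
    unfolding l2inner_def bergman_proj_def cnj_integral by (simp del: Bochner_Integration.integral_cnj add: K_def mult.commute)
  also have "\<dots> = (\<integral>\<zeta>. cnj (h \<zeta>) * (\<integral>z. G z * K z \<zeta> \<partial>dA) \<partial>dA)"
  proof (rule fubini_kernel[OF A2_integrable[OF G] _ Km])
    show "integrable dA (\<lambda>\<zeta>. cnj (h \<zeta>))"
      using L2_integrable[OF bcs_L2[OF h]] by simp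
    fix z \<zeta> assume z: "z \<in> disc" "\<zeta> \<in> disc" and "cnj (h \<zeta>) \<noteq> 0"
    then have "cmod \<zeta> \<le> s" using h by (auto simp: bcs_def not_less[symmetric])
    from kernel_square_bound[OF this s z(1)]
    have "cmod (cnj (1 / (1 - cnj \<zeta> * z)\<^sup>2)) \<le> 1 / (1 - s)\<^sup>2" by (simp only: complex_mod_cnj)
    then show "cmod (K z \<zeta>) \<le> 1 / (1 - s)\<^sup>2" by (simp add: K_def mult.commute)
  qed
  also have "\<dots> = (\<integral>\<zeta>. cnj (h \<zeta>) * G \<zeta> \<partial>dA)"
    by (rule Bochner_Integration.integral_cong)
       (auto simp: K_def reproducing_formula[OF A2_holomorphic[OF G] A2_integrable[OF G]])
  finally show ?thesis by (simp add: mult.commute)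
qed

lemma l2inner_self: "L2 v \<Longrightarrow> l2inner v v = of_real (sqn v)"
  unfolding l2inner_def sqn_def complex_norm_square[symmetric] by (rule integral_complex_of_real)

lemma le_of_square_le_mult: "0 \<le> a \<Longrightarrow> a\<^sup>2 \<le> a * b \<Longrightarrow> 0 \<le> b \<Longrightarrow> a \<le> (b::real)"
  by (cases "a = 0") (auto simp: power2_eq_square)

text \<open>The squared norm of the projection equals its inner product with \<open>h\<close>;
  Cauchy-Schwarz then loses one factor of the norm.\<close>

lemma bergman_proj_contractive:
  assumes "bcs s h"
  shows "sqn (bergman_proj h) \<le> sqn h"
proof -
  let ?v = "bergman_proj h"
  have v: "A2 ?v" by (rule bergman_proj_A2[OF bcs_csupp[OF assms]])
  have "of_real (sqn ?v) = (\<integral>z. ?v z * cnj (h z) \<partial>dA)"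
    using l2inner_bergman_proj[OF v assms] l2inner_self[OF A2_L2[OF v]] by simp
  from arg_cong[OF this, of cmod] have "sqn ?v = cmod (\<integral>z. ?v z * cnj (h z) \<partial>dA)"
    by (simp only: norm_of_real abs_of_nonneg[OF sqn_nonneg])
  then have "(sqn ?v)\<^sup>2 \<le> sqn ?v * sqn h"
    using L2_Cauchy_Schwarz[OF A2_L2[OF v] L2_cnj[OF bcs_L2[OF assms]]] by (simp add: sqn_def)
  then show ?thesis by (rule le_of_square_le_mult[OF sqn_nonneg _ sqn_nonneg])
qed

section \<open>Toeplitz operators with analytic symbol and their adjoints\<close>

lemma toeplitz_eq:
  assumes "A2 f" "w \<in> toeplitz_dom f" "z \<in> disc"
  shows "toeplitz f w z = f z * w z"
proof -
  have "A2 (\<lambda>z. f z * w z)"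
    using assms by (auto simp: toeplitz_dom_def A2_def intro!: holomorphic_intros)
  from bergman_proj_reproducing[OF this assms(3)] show ?thesis by (simp add: toeplitz_def)
qed

lemma bounded_in_toeplitz_dom:
  assumes f: "A2 f" and w: "w holomorphic_on disc" "\<And>z. z \<in> disc \<Longrightarrow> cmod (w z) \<le> B"
  shows "w \<in> toeplitz_dom f"
proof -
  have wm: "w \<in> borel_measurable dA"
    by (intro measurable_dA_continuous holomorphic_on_imp_continuous_on w)
  have fm: "f \<in> borel_measurable dA" using f by (simp add: A2_def L2_def)
  have "A2 w" using L2_bounded[OF wm w(2)] w(1) by (simp add: A2_def)
  moreover have "L2 (\<lambda>z. f z * w z)"
  proof (rule L2_bound(1))
    show "L2 (\<lambda>z. of_real \<bar>B\<bar> * f z)" using A2_L2[OF f] by (auto simp: L2_def norm_mult power_mult_distrib)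
    show "(\<lambda>z. f z * w z) \<in> borel_measurable dA" using wm fm by simp
    fix z assume "z \<in> disc"
    from w(2)[OF this] have "cmod (w z) \<le> \<bar>B\<bar>" by simp
    from mult_left_mono[OF this norm_ge_zero[of "f z"]]
    show "cmod (f z * w z) \<le> cmod (of_real \<bar>B\<bar> * f z)" by (simp add: norm_mult mult.commute)
  qed
  ultimately show ?thesis by (simp add: toeplitz_dom_def)
qed

text \<open>The adjoint relation is tested on reproducing kernels, which are bounded and hence in
  the domain of the Toeplitz operator. In particular \<open>w\<close> is determined on the disc, so
  the choice made in \<open>toeplitz_adj\<close> is harmless there.\<close>

lemma adjoint_formula:
  assumes g: "A2 g" and v: "A2 v" and w: "adjoint_rel g v w" and z: "z \<in> disc"
  shows "w z = (\<integral>\<zeta>. cnj (g \<zeta>) * v \<zeta> / (1 - cnj \<zeta> * z)\<^sup>2 \<partial>dA)"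
proof -
  define u where "u \<zeta> = 1 / (1 - \<zeta> * cnj z)\<^sup>2" for \<zeta>
  have cu: "cnj (u \<zeta>) = 1 / (1 - cnj \<zeta> * z)\<^sup>2" for \<zeta> by (simp add: u_def)
  have nz: "\<zeta> \<in> disc \<Longrightarrow> 1 - \<zeta> * cnj z \<noteq> 0" for \<zeta>
    using one_minus_nonzero[of \<zeta> z] z by (simp add: mult.commute)
  have "u holomorphic_on disc"
    unfolding u_def using nz by (intro holomorphic_intros) auto
  moreover have "cmod (u \<zeta>) \<le> 1 / (1 - cmod z)\<^sup>2" if "\<zeta> \<in> disc" for \<zeta>
    using kernel_square_bound'[OF that z] by (simp flip: cu)
  ultimately have u: "u \<in> toeplitz_dom g" by (rule bounded_in_toeplitz_dom[OF g])
  have wA: "A2 w" and "l2inner (toeplitz g u) v = l2inner u w"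
    using w u by (auto simp: adjoint_rel_def)
  then have "cnj (l2inner u w) = cnj (l2inner (toeplitz g u) v)" by simp
  also have "l2inner (toeplitz g u) v = (\<integral>\<zeta>. g \<zeta> * u \<zeta> * cnj (v \<zeta>) \<partial>dA)"
    unfolding l2inner_def by (rule Bochner_Integration.integral_cong) (auto simp: toeplitz_eq[OF g u])
  also have "cnj \<dots> = (\<integral>\<zeta>. cnj (g \<zeta>) * v \<zeta> / (1 - cnj \<zeta> * z)\<^sup>2 \<partial>dA)"
    unfolding cnj_integral by (simp del: Bochner_Integration.integral_cnj add: cu mult_ac)
  finally have "cnj (l2inner u w) = (\<integral>\<zeta>. cnj (g \<zeta>) * v \<zeta> / (1 - cnj \<zeta> * z)\<^sup>2 \<partial>dA)" .
  moreover have "cnj (l2inner u w) = (\<integral>\<zeta>. w \<zeta> / (1 - cnj \<zeta> * z)\<^sup>2 \<partial>dA)"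
    unfolding l2inner_def cnj_integral by (simp del: Bochner_Integration.integral_cnj add: cu mult_ac)
  ultimately show ?thesis
    using reproducing_formula[OF A2_holomorphic[OF wA] A2_integrable[OF wA] z] by simp
qed

lemma prod_dom_adjoint:
  assumes "v \<in> prod_dom f g"
  shows "A2 v" "adjoint_rel g v (toeplitz_adj g v)" "toeplitz_adj g v \<in> toeplitz_dom f"
  using assms someI_ex[of "adjoint_rel g v"] by (auto simp: prod_dom_def toeplitz_adj_dom_def toeplitz_adj_def)

text \<open>Taking absolute values inside the integral of \<open>adjoint_formula\<close> bounds
  \<open>|f * w|\<close> by the positive operator applied to \<open>|v|\<close>.\<close>

lemma Pplus_bounded_imp:
  assumes f: "A2 f" and g: "A2 g" and P: "Pplus_bounded f g"
  shows "TfTgstar_bounded f g"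
proof -
  obtain C where C: "\<And>u. L2 u \<Longrightarrow> L2 (Pplus f g u) \<and> l2norm (Pplus f g u) \<le> C * l2norm u"
    using P by (auto simp: Pplus_bounded_def)
  show ?thesis
    unfolding TfTgstar_bounded_def
  proof (intro exI ballI)
    fix v assume vd: "v \<in> prod_dom f g"
    define w where "w = toeplitz_adj g v"
    have v: "A2 v" and w: "adjoint_rel g v w" and wd: "w \<in> toeplitz_dom f"
      using prod_dom_adjoint[OF vd] by (auto simp: w_def)
    define u where "u z = complex_of_real (cmod (v z))" for z
    have u: "L2 u" using A2_L2[OF v] by (auto simp: u_def[abs_def] L2_def)
    have "sqn (toeplitz f w) = sqn (\<lambda>z. f z * w z)"
      by (rule sqn_cong) (simp add: toeplitz_eq[OF f wd])
    also have "\<dots> \<le> sqn (Pplus f g u)"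
    proof (rule L2_bound(2))
      show "L2 (Pplus f g u)" using C[OF u] by simp
      show "(\<lambda>z. f z * w z) \<in> borel_measurable dA" using wd by (simp add: toeplitz_dom_def L2_def)
      fix z assume z: "z \<in> disc"
      have "cmod (w z) \<le> (\<integral>\<zeta>. cmod (cnj (g \<zeta>) * v \<zeta> / (1 - cnj \<zeta> * z)\<^sup>2) \<partial>dA)"
        unfolding adjoint_formula[OF g v w z] by (rule integral_norm_bound)
      also have "\<dots> = (\<integral>\<zeta>. cmod (g \<zeta>) * cmod (v \<zeta>) / (cmod (1 - cnj \<zeta> * z))\<^sup>2 \<partial>dA)"
        by (simp add: norm_mult norm_divide norm_power)
      finally have "cmod (w z) \<le> cmod (complex_of_real (\<integral>\<zeta>. cmod (g \<zeta>) * cmod (v \<zeta>) / (cmod (1 - cnj \<zeta> * z))\<^sup>2 \<partial>dA))"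
        by simp
      also have "complex_of_real (\<integral>\<zeta>. cmod (g \<zeta>) * cmod (v \<zeta>) / (cmod (1 - cnj \<zeta> * z))\<^sup>2 \<partial>dA)
         = (\<integral>\<zeta>. complex_of_real (cmod (g \<zeta>)) * u \<zeta> / complex_of_real ((cmod (1 - cnj \<zeta> * z))\<^sup>2) \<partial>dA)"
        by (simp add: u_def flip: integral_complex_of_real)
      finally show "cmod (f z * w z) \<le> cmod (Pplus f g u z)"
        unfolding Pplus_def norm_mult by (simp add: mult_left_mono)
    qed
    finally have "l2norm (toeplitz f w) \<le> l2norm (Pplus f g u)" by (simp add: l2norm_eq)
    also have "\<dots> \<le> C * l2norm u" using C[OF u] by simp
    also have "l2norm u = l2norm v" by (simp add: l2norm_def u_def)
    finally show "l2norm (toeplitz f (toeplitz_adj g v)) \<le> C * l2norm v" by (simp add: w_def)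
  qed
qed

text \<open>On bounded densities of compact support, \<open>T_f T_g^*\<close> composed with the Bergman projection is given by
  this explicit formula, which avoids all questions of domain.\<close>

definition Fbd :: "(complex \<Rightarrow> complex) \<Rightarrow> (complex \<Rightarrow> complex) \<Rightarrow> real \<Rightarrow> bool" where
  "Fbd f g C \<longleftrightarrow> (\<forall>s h. bcs s h \<longrightarrow> sqn (\<lambda>z. f z * bergman_proj (\<lambda>\<zeta>. cnj (g \<zeta>) * h \<zeta>) z) \<le> C * sqn h)"

lemma bcs_cnj_holo: "A2 g \<Longrightarrow> bcs s h \<Longrightarrow> bcs s (\<lambda>\<zeta>. cnj (g \<zeta>) * h \<zeta>)"
  by (intro bcs_mult_cont continuous_intros holomorphic_on_imp_continuous_on A2_holomorphic)

lemma adjoint_rel_bergman_proj: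
  assumes g: "A2 g" and h: "bcs s h"
  shows "adjoint_rel g (bergman_proj h) (bergman_proj (\<lambda>\<zeta>. cnj (g \<zeta>) * h \<zeta>))"
  unfolding adjoint_rel_def
proof (intro conjI ballI)
  have gh: "bcs s (\<lambda>\<zeta>. cnj (g \<zeta>) * h \<zeta>)" by (rule bcs_cnj_holo[OF g h])
  show "A2 (bergman_proj (\<lambda>\<zeta>. cnj (g \<zeta>) * h \<zeta>))"
    by (rule bergman_proj_A2[OF bcs_csupp[OF gh]])
  fix u assume u: "u \<in> toeplitz_dom g"
  have gu: "A2 (\<lambda>z. g z * u z)"
    using u g by (auto simp: toeplitz_dom_def A2_def intro!: holomorphic_intros)
  have "l2inner (toeplitz g u) (bergman_proj h) = l2inner (\<lambda>z. g z * u z) (bergman_proj h)"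
    unfolding l2inner_def by (rule Bochner_Integration.integral_cong) (auto simp: toeplitz_eq[OF g u])
  also have "\<dots> = (\<integral>z. g z * u z * cnj (h z) \<partial>dA)"
    by (rule l2inner_bergman_proj[OF gu h])
  also have "\<dots> = (\<integral>z. u z * cnj (cnj (g z) * h z) \<partial>dA)"
    by (simp add: mult_ac)
  also have "\<dots> = l2inner u (bergman_proj (\<lambda>\<zeta>. cnj (g \<zeta>) * h \<zeta>))"
    by (rule l2inner_bergman_proj[OF _ gh, symmetric]) (use u in \<open>simp add: toeplitz_dom_def\<close>)
  finally show "l2inner (toeplitz g u) (bergman_proj h) = l2inner u (bergman_proj (\<lambda>\<zeta>. cnj (g \<zeta>) * h \<zeta>))" .
qed

text \<open>The vectors \<open>bergman_proj h\<close> serve as test vectors: the adjoint sends them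
  to bounded functions, which lie in the domain for \<open>f\<close>, and contractivity of the
  projection replaces their norm by that of \<open>h\<close>.\<close>

lemma TfTgstar_bounded_imp_Fbd:
  assumes f: "A2 f" and g: "A2 g" and b: "TfTgstar_bounded f g"
  shows "\<exists>C\<ge>0. Fbd f g C"
proof -
  obtain C where C: "\<And>v. v \<in> prod_dom f g \<Longrightarrow> l2norm (toeplitz f (toeplitz_adj g v)) \<le> C * l2norm v"
    using b by (auto simp: TfTgstar_bounded_def)
  have "sqn (\<lambda>z. f z * bergman_proj (\<lambda>\<zeta>. cnj (g \<zeta>) * h \<zeta>) z) \<le> C\<^sup>2 * sqn h" if h: "bcs s h" for s h
  proof -
    define v where "v = bergman_proj h"
    define w where "w = bergman_proj (\<lambda>\<zeta>. cnj (g \<zeta>) * h \<zeta>)"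
    define w' where "w' = toeplitz_adj g v"
    have v: "A2 v" unfolding v_def by (rule bergman_proj_A2[OF bcs_csupp[OF h]])
    have w: "adjoint_rel g v w" unfolding v_def w_def by (rule adjoint_rel_bergman_proj[OF g h])
    have w': "adjoint_rel g v w'"
      unfolding w'_def toeplitz_adj_def using w by (rule someI[of "adjoint_rel g v"])
    \<comment> \<open>The vector selected by \<open>SOME\<close> may differ from \<open>w\<close>
      off the disc, but the integral formula identifies the two on it.\<close>
    have eq: "w z = w' z" if "z \<in> disc" for z
      using adjoint_formula[OF g v w that] adjoint_formula[OF g v w' that] by simp
    have gh: "csupp s (\<lambda>\<zeta>. cnj (g \<zeta>) * h \<zeta>)" by (rule bcs_csupp[OF bcs_cnj_holo[OF g h]])
    obtain B where B: "\<And>z. z \<in> disc \<Longrightarrow> cmod (w z) \<le> B"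
      using bergman_proj_A2(2)[OF gh] by (auto simp: w_def)
    have "w' holomorphic_on disc" using w' by (simp add: adjoint_rel_def A2_def)
    then have w'd: "w' \<in> toeplitz_dom f"
      by (rule bounded_in_toeplitz_dom[OF f]) (use B eq in auto)
    have vd: "v \<in> prod_dom f g"
      using v w w'd by (auto simp: prod_dom_def toeplitz_adj_dom_def w'_def)
    have "sqn (\<lambda>z. f z * w z) = sqn (toeplitz f w')"
      by (rule sqn_cong) (simp add: toeplitz_eq[OF f w'd] eq)
    also have "\<dots> = (l2norm (toeplitz f w'))\<^sup>2" by (simp add: l2norm_eq)
    also have "\<dots> \<le> (C * l2norm v)\<^sup>2"
      using C[OF vd] by (intro power_mono) (auto simp: w'_def l2norm_eq)
    also have "\<dots> = C\<^sup>2 * sqn v" by (simp add: l2norm_eq power_mult_distrib)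
    also have "\<dots> \<le> C\<^sup>2 * sqn h"
      unfolding v_def by (intro mult_left_mono bergman_proj_contractive[OF h]) auto
    finally show ?thesis by (simp add: w_def)
  qed
  then show ?thesis unfolding Fbd_def by (intro exI[of _ "C\<^sup>2"]) auto
qed

section \<open>Truncation and passage to the adjoint\<close>

lemma L2_mult_bounded:
  assumes f: "L2 f" and w: "w \<in> borel_measurable dA" "\<And>z. z \<in> disc \<Longrightarrow> cmod (w z) \<le> B"
  shows "L2 (\<lambda>z. f z * w z)"
proof (rule L2_bound(1))
  show "L2 (\<lambda>z. of_real \<bar>B\<bar> * f z)" using f by (auto simp: L2_def norm_mult power_mult_distrib)
  show "(\<lambda>z. f z * w z) \<in> borel_measurable dA" using w(1) f by (auto simp: L2_def)
  fix z assume "z \<in> disc"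
  from w(2)[OF this] have "cmod (w z) \<le> \<bar>B\<bar>" by simp
  from mult_left_mono[OF this norm_ge_zero[of "f z"]]
  show "cmod (f z * w z) \<le> cmod (of_real \<bar>B\<bar> * f z)" by (simp add: norm_mult mult.commute)
qed

lemma Fbd_L2:
  assumes f: "A2 f" and g: "A2 g" and h: "bcs s h"
  shows "L2 (\<lambda>z. f z * bergman_proj (\<lambda>\<zeta>. cnj (g \<zeta>) * h \<zeta>) z)"
proof -
  have gh: "csupp s (\<lambda>\<zeta>. cnj (g \<zeta>) * h \<zeta>)" by (rule bcs_csupp[OF bcs_cnj_holo[OF g h]])
  then obtain B where "\<And>z. z \<in> disc \<Longrightarrow> cmod (bergman_proj (\<lambda>\<zeta>. cnj (g \<zeta>) * h \<zeta>) z) \<le> B"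
    using bergman_proj_A2(2) by blast
  then show ?thesis
    using bergman_proj_A2(1)[OF gh] by (intro L2_mult_bounded[OF A2_L2[OF f]]) (auto simp: A2_def L2_def)
qed

lemma bergman_proj_symmetric:
  assumes h: "bcs s h" and k: "bcs s' k"
  shows "(\<integral>z. bergman_proj h z * cnj (k z) \<partial>dA) = (\<integral>z. h z * cnj (bergman_proj k z) \<partial>dA)"
proof -
  have A: "A2 (bergman_proj h)" "A2 (bergman_proj k)"
    by (intro bergman_proj_A2 bcs_csupp h k; fact)+
  have "(\<integral>z. bergman_proj h z * cnj (k z) \<partial>dA) = l2inner (bergman_proj h) (bergman_proj k)"
    by (rule l2inner_bergman_proj[OF A(1) k, symmetric])
  also have "\<dots> = cnj (l2inner (bergman_proj k) (bergman_proj h))"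
    unfolding l2inner_def cnj_integral by (simp del: Bochner_Integration.integral_cnj add: mult.commute)
  also have "l2inner (bergman_proj k) (bergman_proj h) = (\<integral>z. bergman_proj k z * cnj (h z) \<partial>dA)"
    by (rule l2inner_bergman_proj[OF A(2) h])
  also have "cnj \<dots> = (\<integral>z. h z * cnj (bergman_proj k z) \<partial>dA)"
    unfolding cnj_integral by (simp del: Bochner_Integration.integral_cnj add: mult.commute)
  finally show ?thesis .
qed

definition cut :: "real \<Rightarrow> (complex \<Rightarrow> complex) \<Rightarrow> complex \<Rightarrow> complex" where
  "cut s u z = (if cmod z \<le> s then u z else 0)"

lemma measurable_cut:
  assumes [measurable]: "u \<in> borel_measurable dA" shows "cut s u \<in> borel_measurable dA"
proof -
  have [measurable]: "(\<lambda>z. cmod z) \<in> borel_measurable dA"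
    by (rule measurable_dA_borel) simp
  show ?thesis unfolding cut_def[abs_def] by measurable
qed

text \<open>Lets truncations of a function serve as test densities even if the function itself has
  no compact support.\<close>

lemma sqn_le_of_cut:
  assumes u: "L2 u" and b: "\<And>s. 0 \<le> s \<Longrightarrow> s < 1 \<Longrightarrow> sqn (cut s u) \<le> C"
  shows "sqn u \<le> C"
proof -
  define s where "s n = 1 - 1 / real (n + 1)" for n
  have s: "0 \<le> s n" "s n < 1" for n by (auto simp: s_def)
  have "(\<lambda>n. sqn (cut (s n) u)) \<longlonglongrightarrow> sqn u"
    unfolding sqn_def
  proof (rule integral_dominated_convergence[where w = "\<lambda>z. (cmod (u z))\<^sup>2"])
    show "AE z in dA. (\<lambda>n. (cmod (cut (s n) u z))\<^sup>2) \<longlonglongrightarrow> (cmod (u z))\<^sup>2"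
    proof (rule AE_I2)
      fix z assume "z \<in> space dA"
      then have "cmod z < 1" by (simp add: disc_iff)
      moreover have "s \<longlonglongrightarrow> 1 - 0"
        unfolding s_def using LIMSEQ_Suc[OF lim_1_over_n] by (intro tendsto_diff) auto
      ultimately have "\<forall>\<^sub>F n in sequentially. cmod z < s n" by (intro order_tendstoD) auto
      then have "\<forall>\<^sub>F n in sequentially. (cmod (cut (s n) u z))\<^sup>2 = (cmod (u z))\<^sup>2"
        by eventually_elim (simp add: cut_def)
      then show "(\<lambda>n. (cmod (cut (s n) u z))\<^sup>2) \<longlonglongrightarrow> (cmod (u z))\<^sup>2"
        by (rule tendsto_eventually)
    qed
    show "(\<lambda>z. (cmod (cut (s n) u z))\<^sup>2) \<in> borel_measurable dA" for n
      using measurable_cut[OF L2_measurable[OF u]] by simp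
    show "AE z in dA. norm ((cmod (cut (s n) u z))\<^sup>2) \<le> (cmod (u z))\<^sup>2" for n
      by (intro AE_I2) (simp add: cut_def)
  qed (use u in \<open>auto simp: L2_def\<close>)
  then show ?thesis
    by (rule LIMSEQ_le_const2) (use b s in auto)
qed

lemma bcs_cut:
  assumes "continuous_on disc u" "s < 1"
  shows "bcs s (cut s u)"
proof -
  have "bcs s (cut s (\<lambda>_. 1))"
    unfolding bcs_def
  proof (intro conjI)
    show "cut s (\<lambda>_. 1) \<in> borel_measurable dA" by (rule measurable_cut) simp
    show "\<exists>B. \<forall>\<zeta>\<in>disc. cmod (cut s (\<lambda>_. 1) \<zeta>) \<le> B" by (rule exI[of _ 1]) (simp add: cut_def)
    show "\<forall>\<zeta>. s < cmod \<zeta> \<longrightarrow> cut s (\<lambda>_. 1) \<zeta> = 0" by (simp add: cut_def)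
  qed (rule assms(2))
  from bcs_mult_cont[OF this assms(1)] show ?thesis
    by (rule back_subst[of "bcs s"]) (auto simp: cut_def fun_eq_iff)
qed

text \<open>Duality, with the truncation \<open>u\<close> of the function \<open>G\<close> to be
  estimated as test density: by symmetry of the projection \<open>sqn u\<close> becomes a pairing of
  \<open>k\<close> with \<open>f * bergman_proj (cnj g * u)\<close>, whose norm the hypothesis
  bounds by that of \<open>u\<close>.\<close>

lemma Fbd_swap:
  assumes f: "A2 f" and g: "A2 g" and C: "C \<ge> 0" and F: "Fbd f g C"
  shows "Fbd g f C"
  unfolding Fbd_def
proof (intro allI impI)
  fix r k assume k: "bcs r k"
  define q where "q = bergman_proj (\<lambda>\<zeta>. cnj (f \<zeta>) * k \<zeta>)"
  define G where "G z = g z * q z" for z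
  have fk: "bcs r (\<lambda>\<zeta>. cnj (f \<zeta>) * k \<zeta>)" by (rule bcs_cnj_holo[OF f k])
  have GL: "L2 G" unfolding G_def[abs_def] q_def by (rule Fbd_L2[OF g f k])
  have qA: "A2 q" unfolding q_def by (rule bergman_proj_A2[OF bcs_csupp[OF fk]])
  have Gc: "continuous_on disc G"
    unfolding G_def[abs_def] by (intro continuous_intros holomorphic_on_imp_continuous_on A2_holomorphic g qA)
  have "sqn G \<le> C * sqn k"
  proof (rule sqn_le_of_cut[OF GL])
    fix s :: real assume s: "0 \<le> s" "s < 1"
    define u where "u = cut s G"
    have u: "bcs s u" unfolding u_def by (rule bcs_cut[OF Gc s(2)])
    have gu: "bcs s (\<lambda>\<zeta>. cnj (g \<zeta>) * u \<zeta>)" by (rule bcs_cnj_holo[OF g u])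
    have "complex_of_real (sqn u) = (\<integral>z. u z * cnj (u z) \<partial>dA)"
      using l2inner_self[OF bcs_L2[OF u]] by (simp add: l2inner_def)
    also have "\<dots> = (\<integral>z. q z * cnj (cnj (g z) * u z) \<partial>dA)"
      by (rule Bochner_Integration.integral_cong) (auto simp: u_def cut_def G_def)
    also have "\<dots> = (\<integral>z. cnj (f z) * k z * cnj (bergman_proj (\<lambda>\<zeta>. cnj (g \<zeta>) * u \<zeta>) z) \<partial>dA)"
      unfolding q_def by (rule bergman_proj_symmetric[OF fk gu])
    also have "\<dots> = (\<integral>z. k z * cnj (f z * bergman_proj (\<lambda>\<zeta>. cnj (g \<zeta>) * u \<zeta>) z) \<partial>dA)"
      by (simp add: mult_ac)
    finally have "complex_of_real (sqn u) = (\<integral>z. k z * cnj (f z * bergman_proj (\<lambda>\<zeta>. cnj (g \<zeta>) * u \<zeta>) z) \<partial>dA)" .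
    from arg_cong[OF this, of cmod]
    have "sqn u = cmod (\<integral>z. k z * cnj (f z * bergman_proj (\<lambda>\<zeta>. cnj (g \<zeta>) * u \<zeta>) z) \<partial>dA)"
      by (simp only: norm_of_real abs_of_nonneg[OF sqn_nonneg])
    then have "(sqn u)\<^sup>2 \<le> sqn k * sqn (\<lambda>z. cnj (f z * bergman_proj (\<lambda>\<zeta>. cnj (g \<zeta>) * u \<zeta>) z))"
      using L2_Cauchy_Schwarz[OF bcs_L2[OF k] L2_cnj[OF Fbd_L2[OF f g u]]] by simp
    also have "sqn (\<lambda>z. cnj (f z * bergman_proj (\<lambda>\<zeta>. cnj (g \<zeta>) * u \<zeta>) z)) = sqn (\<lambda>z. f z * bergman_proj (\<lambda>\<zeta>. cnj (g \<zeta>) * u \<zeta>) z)"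
      by (rule sqn_cong) (simp only: complex_mod_cnj)
    also have "sqn k * \<dots> \<le> sqn k * (C * sqn u)"
      using F u by (intro mult_left_mono) (auto simp: Fbd_def)
    finally have "(sqn u)\<^sup>2 \<le> sqn u * (C * sqn k)" by (simp add: mult_ac)
    then show "sqn (cut s G) \<le> C * sqn k"
      unfolding u_def[symmetric] using C by (intro le_of_square_le_mult[OF sqn_nonneg]) simp_all
  qed
  then show "sqn (\<lambda>z. g z * bergman_proj (\<lambda>\<zeta>. cnj (f \<zeta>) * k \<zeta>) z) \<le> C * sqn k"
    by (simp add: G_def[abs_def] q_def)
qed

section \<open>A pointwise bound and a weighted Hardy inequality\<close>

lemma sqn_kern_square:
  assumes w: "w \<in> disc"
  shows "L2 (\<lambda>\<zeta>. kern w \<zeta> ^ 2)" "sqn (\<lambda>\<zeta>. kern w \<zeta> ^ 2) = 1 / (rho w)\<^sup>2"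
proof -
  define u where "u \<zeta> = 1 / (1 - \<zeta> * cnj w)\<^sup>2" for \<zeta>
  have cu: "cnj (u \<zeta>) = kern w \<zeta> ^ 2" for \<zeta> by (simp add: u_def kern_def power_divide)
  have nz: "\<zeta> \<in> disc \<Longrightarrow> 1 - \<zeta> * cnj w \<noteq> 0" for \<zeta>
    using one_minus_nonzero[of \<zeta> w] w by (simp add: mult.commute)
  have u: "u holomorphic_on disc"
    unfolding u_def using nz by (intro holomorphic_intros) auto
  have b: "cmod (kern w \<zeta> ^ 2) \<le> 1 / (1 - cmod w)\<^sup>2" if "\<zeta> \<in> disc" for \<zeta>
    using kernel_square_bound'[OF that w] by (simp add: kern_def power_divide)
  have m: "(\<lambda>\<zeta>. kern w \<zeta> ^ 2) \<in> borel_measurable dA"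
    using measurable_kern[OF w] by simp
  show L: "L2 (\<lambda>\<zeta>. kern w \<zeta> ^ 2)" by (rule L2_bounded[OF m b])
  have "L2 u" using L2_cnj[OF L] by (simp flip: cu)
  have "u w = (\<integral>\<zeta>. u \<zeta> / (1 - cnj \<zeta> * w)\<^sup>2 \<partial>dA)"
    by (rule reproducing_formula[OF u L2_integrable[OF \<open>L2 u\<close>] w, symmetric])
  also have "\<dots> = (\<integral>\<zeta>. of_real ((cmod (kern w \<zeta> ^ 2))\<^sup>2) \<partial>dA)"
    by (rule Bochner_Integration.integral_cong)
       (auto simp only: complex_norm_square cu[symmetric] complex_cnj_cnj, simp add: u_def)
  also have "\<dots> = of_real (sqn (\<lambda>\<zeta>. kern w \<zeta> ^ 2))"
    unfolding sqn_def by (rule integral_complex_of_real)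
  finally have "of_real (sqn (\<lambda>\<zeta>. kern w \<zeta> ^ 2)) = 1 / (1 - w * cnj w)\<^sup>2" by (simp add: u_def)
  also have "\<dots> = of_real (1 / (rho w)\<^sup>2)"
    by (simp add: rho_def flip: complex_norm_square)
  finally show "sqn (\<lambda>\<zeta>. kern w \<zeta> ^ 2) = 1 / (rho w)\<^sup>2" by (simp only: of_real_eq_iff)
qed

text \<open>Cauchy-Schwarz against the reproducing kernel, whose norm is
  \<open>1 / rho w\<close>.\<close>

lemma point_evaluation:
  assumes G: "A2 G" and w: "w \<in> disc"
  shows "(rho w)\<^sup>2 * (cmod (G w))\<^sup>2 \<le> sqn G"
proof -
  have "G w = (\<integral>\<zeta>. G \<zeta> * kern w \<zeta> ^ 2 \<partial>dA)"
    using reproducing_formula[OF A2_holomorphic[OF G] A2_integrable[OF G] w]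
    by (simp add: kern_def power_divide)
  then have "(cmod (G w))\<^sup>2 \<le> sqn G * (1 / (rho w)\<^sup>2)"
    using L2_Cauchy_Schwarz[OF A2_L2[OF G] sqn_kern_square(1)[OF w]] by (simp only: sqn_kern_square(2)[OF w])
  then show ?thesis using rho_pos[OF w] by (simp add: field_simps)
qed

text \<open>A one-sided form of Sarason's condition: \<open>rho^2 * sqn (g * kern^2)\<close> is the
  Berezin transform of \<open>|g|^2\<close>, while \<open>|f|^2\<close> enters with its value at
  \<open>w\<close>. The test density is a truncation \<open>h\<close> of
  \<open>g * cnj (kern w)^2\<close>, chosen so that \<open>bergman_proj (cnj g * h)\<close> has the
  value \<open>sqn h\<close> at \<open>w\<close>.\<close>

lemma sarason_condition:
  assumes f: "A2 f" and g: "A2 g" and C: "C \<ge> 0" "Fbd f g C" and w: "w \<in> disc"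
  shows "L2 (\<lambda>\<zeta>. g \<zeta> * kern w \<zeta> ^ 2)"
    and "(cmod (f w))\<^sup>2 * ((rho w)\<^sup>2 * sqn (\<lambda>\<zeta>. g \<zeta> * kern w \<zeta> ^ 2)) \<le> C"
proof -
  define u where "u \<zeta> = g \<zeta> * cnj (kern w \<zeta>) ^ 2" for \<zeta>
  have "cmod (kern w \<zeta> ^ 2) \<le> 1 / (1 - cmod w)\<^sup>2" if "\<zeta> \<in> disc" for \<zeta>
    using kernel_square_bound'[OF that w] by (simp add: kern_def power_divide)
  then show "L2 (\<lambda>\<zeta>. g \<zeta> * kern w \<zeta> ^ 2)"
    using measurable_kern[OF w] by (intro L2_mult_bounded[OF A2_L2[OF g]]) auto
  then have uL: "L2 u"
    by (rule L2_bound(1)) (use L2_measurable[OF A2_L2[OF g]] measurable_cnj[OF measurable_kern[OF w]] in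
         \<open>auto simp: u_def[abs_def] norm_mult norm_power\<close>)
  have su: "sqn u = sqn (\<lambda>\<zeta>. g \<zeta> * kern w \<zeta> ^ 2)"
    by (rule sqn_cong) (simp add: u_def norm_mult norm_power)
  have uc: "continuous_on disc u"
    unfolding u_def kern_def using one_minus_nonzero[OF w]
    by (intro continuous_intros holomorphic_on_imp_continuous_on A2_holomorphic g) auto
  have fw: "(cmod (f w))\<^sup>2 * (rho w)\<^sup>2 * sqn (cut s u) \<le> C" if s: "s < 1" for s
  proof -
    define h where "h = cut s u"
    have h: "bcs s h" unfolding h_def by (rule bcs_cut[OF uc s])
    define G where "G z = f z * bergman_proj (\<lambda>\<zeta>. cnj (g \<zeta>) * h \<zeta>) z" for z
    have "A2 (bergman_proj (\<lambda>\<zeta>. cnj (g \<zeta>) * h \<zeta>))"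
      by (rule bergman_proj_A2[OF bcs_csupp[OF bcs_cnj_holo[OF g h]]])
    then have G: "A2 G"
      using Fbd_L2[OF f g h] f by (auto simp: A2_def G_def[abs_def] intro!: holomorphic_intros)
    have "bergman_proj (\<lambda>\<zeta>. cnj (g \<zeta>) * h \<zeta>) w = (\<integral>\<zeta>. of_real ((cmod (h \<zeta>))\<^sup>2) \<partial>dA)"
      unfolding bergman_proj_def
    proof (rule Bochner_Integration.integral_cong[OF refl])
      fix \<zeta>
      have "cnj (g \<zeta>) * h \<zeta> / (1 - cnj \<zeta> * w)\<^sup>2 = cnj (g \<zeta>) * h \<zeta> * kern w \<zeta> ^ 2"
        by (simp add: kern_def power_divide)
      also have "\<dots> = h \<zeta> * cnj (h \<zeta>)"
        by (simp add: h_def cut_def u_def)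
      finally show "cnj (g \<zeta>) * h \<zeta> / (1 - cnj \<zeta> * w)\<^sup>2 = of_real ((cmod (h \<zeta>))\<^sup>2)"
        by (simp only: complex_norm_square)
    qed
    then have "bergman_proj (\<lambda>\<zeta>. cnj (g \<zeta>) * h \<zeta>) w = of_real (sqn h)"
      unfolding sqn_def by (simp only: integral_complex_of_real)
    then have "(cmod (G w))\<^sup>2 = (cmod (f w))\<^sup>2 * (sqn h)\<^sup>2"
      by (simp add: G_def norm_mult power_mult_distrib)
    then have "(rho w)\<^sup>2 * ((cmod (f w))\<^sup>2 * (sqn h)\<^sup>2) \<le> sqn G"
      using point_evaluation[OF G w] by simp
    also have "sqn G \<le> C * sqn h" using C(2) h by (auto simp: Fbd_def G_def[abs_def])
    finally have "((cmod (f w))\<^sup>2 * (rho w)\<^sup>2 * sqn h) * sqn h \<le> C * sqn h"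
      by (simp add: power2_eq_square mult_ac)
    \<comment> \<open>The point evaluation is quadratic in \<open>sqn h\<close> and the operator
      bound linear; one factor cancels.\<close>
    then have "sqn h = 0 \<or> (cmod (f w))\<^sup>2 * (rho w)\<^sup>2 * sqn h \<le> C"
      using sqn_nonneg[of h] by (metis mult_le_cancel_right_pos less_le)
    then show ?thesis using C(1) by (auto simp: h_def)
  qed
  show "(cmod (f w))\<^sup>2 * ((rho w)\<^sup>2 * sqn (\<lambda>\<zeta>. g \<zeta> * kern w \<zeta> ^ 2)) \<le> C"
  proof (cases "f w = 0")
    case False
    define a where "a = (cmod (f w))\<^sup>2 * (rho w)\<^sup>2"
    have a: "a > 0" using False rho_pos[OF w] by (simp add: a_def)
    have "sqn u \<le> C / a"
    proof (rule sqn_le_of_cut[OF uL])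
      fix s :: real assume "0 \<le> s" "s < 1"
      from fw[OF this(2)] show "sqn (cut s u) \<le> C / a"
        using a unfolding a_def[symmetric] by (simp add: pos_le_divide_eq mult.commute)
    qed
    then show ?thesis using a by (simp add: su a_def field_simps)
  qed (use C in simp)
qed

section \<open>Comparison of the positive kernel with the squared analytic kernel\<close>

lemma two_Re_kernel: "2 * Re (1 - cnj \<zeta> * z) = rho z + rho \<zeta> + (cmod (z - \<zeta>))\<^sup>2"
  unfolding rho_def cmod_power2 by (simp add: power2_eq_square algebra_simps)

text \<open>The left side is \<open>(2 Re c)^2 / |c|^4\<close> for
  \<open>c = 1 - cnj \<zeta> * z\<close>, and \<open>2 Re c\<close> is the sum of both heights and a
  squared distance, hence small compared with \<open>|c|\<close> unless a height is comparable to
  \<open>|c|\<close> or the points are far apart.\<close>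

lemma kernel_inequality:
  assumes z: "z \<in> disc" and \<zeta>: "\<zeta> \<in> disc"
  shows "2 * (cmod (kern z \<zeta>))\<^sup>2 + 2 * Re (kern z \<zeta> ^ 2)
    \<le> 5/4 * (rho z)\<^sup>2 * (cmod (kern z \<zeta>))^4 + 10 * ((rho \<zeta>)\<^sup>2 * (cmod (kern z \<zeta>))^4 + 1)"
proof -
  define c where "c = 1 - cnj \<zeta> * z"
  define D where "D = cmod c"
  define e where "e = (cmod (z - \<zeta>))\<^sup>2"
  have D: "D > 0" using dd_pos[OF z \<zeta>] by (simp add: D_def c_def dd_def)
  have e: "0 \<le> e" "e \<le> D\<^sup>2"
    using norm_diff_le_dd[OF z \<zeta>] by (auto simp: e_def D_def c_def dd_def power_mono)
  have k: "kern z \<zeta> = cnj c / of_real (D\<^sup>2)"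
    unfolding kern_def c_def[symmetric] D_def complex_div_cnj[of 1 c] by simp
  have "Re (kern z \<zeta> ^ 2) = (2 * (Re c)\<^sup>2 - D\<^sup>2) / D^4"
  proof -
    have "kern z \<zeta> ^ 2 = (cnj c)\<^sup>2 / of_real (D^4)" by (simp add: k power_divide power_mult[symmetric])
    then have "Re (kern z \<zeta> ^ 2) = Re ((cnj c)\<^sup>2) / D^4" by (simp only: Re_divide_of_real)
    moreover have "Re ((cnj c)\<^sup>2) = 2 * (Re c)\<^sup>2 - D\<^sup>2" unfolding D_def cmod_power2 by (simp add: power2_eq_square)
    ultimately show ?thesis by simp
  qed
  note re = this
  have nk: "cmod (kern z \<zeta>) = 1 / D" by (simp add: kern_def D_def c_def norm_divide)
  have "2 * (cmod (kern z \<zeta>))\<^sup>2 + 2 * Re (kern z \<zeta> ^ 2) = (2 * Re c)\<^sup>2 / D^4"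
    unfolding re nk using D by (simp add: field_simps power2_eq_square power4_eq_xxxx)
  also have "(2 * Re c)\<^sup>2 = (rho z + (rho \<zeta> + e))\<^sup>2"
    unfolding c_def two_Re_kernel e_def by (simp add: add.assoc)
  \<comment> \<open>Young's inequality with the factors \<open>1 + 1/4\<close> and
    \<open>1 + 4\<close>. The first has to stay below 2: twice its reciprocal is the gain 8/5 of
    \<open>variance_bound\<close>, which must exceed the coefficient 1 lost when integrating by
    parts.\<close>
  also have "\<dots> \<le> 5/4 * (rho z)\<^sup>2 + 5 * (rho \<zeta> + e)\<^sup>2"
    using zero_le_power2[of "rho z / 2 - 2 * (rho \<zeta> + e)"] by (simp add: power2_eq_square algebra_simps)
  also have "\<dots> \<le> 5/4 * (rho z)\<^sup>2 + 10 * ((rho \<zeta>)\<^sup>2 + e\<^sup>2)"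
    using zero_le_power2[of "rho \<zeta> - e"] by (simp add: power2_eq_square algebra_simps)
  also have "e\<^sup>2 \<le> (D\<^sup>2)\<^sup>2" using e by (intro power_mono)
  also have "(D\<^sup>2)\<^sup>2 = D^4" by simp
  finally have "2 * (cmod (kern z \<zeta>))\<^sup>2 + 2 * Re (kern z \<zeta> ^ 2) \<le> (5/4 * (rho z)\<^sup>2 + 10 * ((rho \<zeta>)\<^sup>2 + D^4)) / D^4"
    using D by (simp add: divide_right_mono)
  also have "\<dots> = 5/4 * (rho z)\<^sup>2 * (cmod (kern z \<zeta>))^4 + 10 * ((rho \<zeta>)\<^sup>2 * (cmod (kern z \<zeta>))^4 + 1)"
    using D by (simp add: nk power_divide field_simps)
  finally show ?thesis .
qed

section \<open>Positive potentials and the variance bound\<close>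

definition rcsupp :: "real \<Rightarrow> (complex \<Rightarrow> real) \<Rightarrow> bool" where
  "rcsupp s \<nu> \<longleftrightarrow> csupp s (\<lambda>\<zeta>. of_real (\<nu> \<zeta>)) \<and> (\<forall>\<zeta>. 0 \<le> \<nu> \<zeta>)"

text \<open>The exponent \<open>2 * n\<close> makes this the diagonal case
  \<open>pot (cr \<nu>) n n\<close>, which gives access to its derivatives.\<close>

definition rpot :: "(complex \<Rightarrow> real) \<Rightarrow> nat \<Rightarrow> complex \<Rightarrow> real" where
  "rpot \<nu> n z = (\<integral>\<zeta>. \<nu> \<zeta> * (cmod (kern z \<zeta>)) ^ (2 * n) \<partial>dA)"

abbreviation cr :: "(complex \<Rightarrow> real) \<Rightarrow> complex \<Rightarrow> complex" where
  "cr \<nu> \<equiv> \<lambda>\<zeta>. complex_of_real (\<nu> \<zeta>)"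

lemma rcsupp_csupp: "rcsupp s \<nu> \<Longrightarrow> csupp s (cr \<nu>)"
  and rcsupp_nonneg: "rcsupp s \<nu> \<Longrightarrow> 0 \<le> \<nu> \<zeta>"
  by (simp_all add: rcsupp_def)

lemma rcsupp_integrable: "rcsupp s \<nu> \<Longrightarrow> integrable dA \<nu>"
  using integrable_Re[OF csupp_integrable[OF rcsupp_csupp]] by simp

lemma kern_norm_power: "kern z \<zeta> ^ n * cnj (kern z \<zeta>) ^ n = of_real ((cmod (kern z \<zeta>)) ^ (2 * n))"
  by (simp add: power_mult_distrib[symmetric] power_mult complex_norm_square[symmetric])

lemma pot_rpot: "pot (cr \<nu>) n n z = of_real (rpot \<nu> n z)"
  unfolding pot_def rpot_def kern_norm_power of_real_mult[symmetric] by (rule integral_complex_of_real)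

lemma integrable_rpot:
  assumes "rcsupp s \<nu>" "z \<in> disc"
  shows "integrable dA (\<lambda>\<zeta>. \<nu> \<zeta> * (cmod (kern z \<zeta>)) ^ n)"
  using integrable_norm[OF integrable_pot[OF rcsupp_csupp[OF assms(1)] assms(2), of n 0]] rcsupp_nonneg[OF assms(1)]
  by (simp add: norm_mult norm_power)

lemma rpot_nonneg: "rcsupp s \<nu> \<Longrightarrow> 0 \<le> rpot \<nu> n z"
  unfolding rpot_def using rcsupp_nonneg by (intro integral_nonneg_AE AE_I2) auto

lemma rcsupp_mult:
  assumes \<nu>: "rcsupp s \<nu>" and h: "h \<in> borel_measurable dA" "\<And>\<zeta>. 0 \<le> h \<zeta>" "\<And>\<zeta>. \<zeta> \<in> disc \<Longrightarrow> h \<zeta> \<le> C"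
  shows "rcsupp s (\<lambda>\<zeta>. h \<zeta> * \<nu> \<zeta>)"
proof -
  have "csupp s (\<lambda>\<zeta>. of_real (h \<zeta>) * of_real (\<nu> \<zeta>))"
    by (rule csupp_mult[OF rcsupp_csupp[OF \<nu>], where C = C]) (use h in auto)
  then show ?thesis using h(2) rcsupp_nonneg[OF \<nu>] by (simp add: rcsupp_def)
qed

lemma measurable_rho: "rho \<in> borel_measurable dA"
  by (rule measurable_dA_continuous[where F = rho]) (rule continuous_on_rho)

text \<open>Turns \<open>rpot\<close> with index 2 into the potential with kernel
  \<open>rho^2 / dd^4\<close>, which by \<open>rho <= 2 * dd\<close> is at most 4 times the positive
  kernel.\<close>

definition eta2 :: "(complex \<Rightarrow> real) \<Rightarrow> complex \<Rightarrow> real" where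
  "eta2 \<nu> \<zeta> = (rho \<zeta>)\<^sup>2 * \<nu> \<zeta>"

lemma rcsupp_eta2: "rcsupp s \<nu> \<Longrightarrow> rcsupp s (eta2 \<nu>)"
  unfolding eta2_def
  by (rule rcsupp_mult[where C = 1])
     (use measurable_rho power_le_one[OF less_imp_le[OF rho_pos] rho_le_1] in simp_all)

lemma kernel_inequality_integrated:
  assumes \<nu>: "rcsupp s \<nu>" and z: "z \<in> disc"
  defines "N \<equiv> rpot \<nu> 1 z" and "F \<equiv> cmod (pot (cr \<nu>) 2 0 z)"
    and "H \<equiv> rpot (eta2 \<nu>) 2 z" and "m \<equiv> (\<integral>\<zeta>. \<nu> \<zeta> \<partial>dA)"
    and "K2 \<equiv> rpot \<nu> 2 z"
  shows "2 * (N - F) - 10 * (H + m) \<le> 5/4 * (rho z)\<^sup>2 * K2"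
proof -
  define k where "k = kern z"
  have nn: "0 \<le> \<nu> \<zeta>" for \<zeta> by (rule rcsupp_nonneg[OF \<nu>])
  have N: "N = (\<integral>\<zeta>. \<nu> \<zeta> * (cmod (k \<zeta>))\<^sup>2 \<partial>dA)" by (simp add: N_def rpot_def k_def)
  have K2: "K2 = (\<integral>\<zeta>. \<nu> \<zeta> * (cmod (k \<zeta>))^4 \<partial>dA)" by (simp add: K2_def rpot_def k_def)
  have ck: "integrable dA (\<lambda>\<zeta>. of_real (\<nu> \<zeta>) * (k \<zeta> ^ i * cnj (k \<zeta>) ^ j))" for i j
    unfolding k_def by (rule integrable_pot[OF rcsupp_csupp[OF \<nu>] z])
  have rk: "integrable dA (\<lambda>\<zeta>. \<nu> \<zeta> * (cmod (k \<zeta>)) ^ n)" for n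
    unfolding k_def by (rule integrable_rpot[OF \<nu> z])
  have iH: "integrable dA (\<lambda>\<zeta>. eta2 \<nu> \<zeta> * (cmod (k \<zeta>))^4)"
    unfolding k_def by (rule integrable_rpot[OF rcsupp_eta2[OF \<nu>] z])
  have iR: "integrable dA (\<lambda>\<zeta>. Re (of_real (\<nu> \<zeta>) * (k \<zeta> ^ 2 * cnj (k \<zeta>) ^ 0)))" by (rule integrable_Re[OF ck])
  have im: "integrable dA \<nu>" by (rule rcsupp_integrable[OF \<nu>])
  have "2 * (N - F) \<le> 2 * (N + Re (pot (cr \<nu>) 2 0 z))"
    using abs_Re_le_cmod[of "pot (cr \<nu>) 2 0 z"] by (simp add: F_def)
  also have "\<dots> = (\<integral>\<zeta>. 2 * (\<nu> \<zeta> * (cmod (k \<zeta>))\<^sup>2) + 2 * Re (of_real (\<nu> \<zeta>) * (k \<zeta> ^ 2 * cnj (k \<zeta>) ^ 0)) \<partial>dA)"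
    unfolding N pot_def k_def[symmetric] integral_Re[OF ck, symmetric] using rk[of 2] iR by simp
  also have "\<dots> \<le> (\<integral>\<zeta>. 5/4 * (rho z)\<^sup>2 * (\<nu> \<zeta> * (cmod (k \<zeta>))^4) + 10 * (eta2 \<nu> \<zeta> * (cmod (k \<zeta>))^4 + \<nu> \<zeta>) \<partial>dA)"
  proof (rule integral_mono)
    fix \<zeta> assume "\<zeta> \<in> space dA"
    then have "2 * (cmod (k \<zeta>))\<^sup>2 + 2 * Re (k \<zeta> ^ 2)
  \<le> 5/4 * (rho z)\<^sup>2 * (cmod (k \<zeta>))^4 + 10 * ((rho \<zeta>)\<^sup>2 * (cmod (k \<zeta>))^4 + 1)"
      using kernel_inequality[OF z, of \<zeta>] by (simp add: k_def)
    from mult_left_mono[OF this nn[of \<zeta>]]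
    show "2 * (\<nu> \<zeta> * (cmod (k \<zeta>))\<^sup>2) + 2 * Re (of_real (\<nu> \<zeta>) * (k \<zeta> ^ 2 * cnj (k \<zeta>) ^ 0)) \<le> 5/4 * (rho z)\<^sup>2 * (\<nu> \<zeta> * (cmod (k \<zeta>))^4) + 10 * (eta2 \<nu> \<zeta> * (cmod (k \<zeta>))^4 + \<nu> \<zeta>)"
      by (simp add: eta2_def algebra_simps)
  qed (use rk[of 2] rk[of 4] iR iH im in auto)
  also have "\<dots> = 5/4 * (rho z)\<^sup>2 * K2 + 10 * (H + m)"
    unfolding K2 H_def m_def rpot_def k_def[symmetric] using rk[of 4] iH im by simp
  finally show ?thesis by simp
qed

text \<open>\<open>N * A2' - |A1|^2\<close> is \<open>N^2\<close> times the variance of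
  \<open>cnj \<zeta> * k\<close> for the measure with density proportional to
  \<open>\<nu> * |k|^2\<close>. Multiplied by \<open>|z|^2\<close> it is the same expression for
  \<open>k\<close>, namely \<open>N * K2 - |K1|^2\<close>, which is at least
  \<open>K2 * (N - F) / 2\<close>. The lower bound for \<open>rho^2 * K2\<close> comes from
  \<open>kernel_inequality_integrated\<close>.\<close>

lemma variance_bound:
  assumes \<nu>: "rcsupp s \<nu>" and z: "z \<in> disc"
  defines "N \<equiv> rpot \<nu> 1 z" and "F \<equiv> cmod (pot (cr \<nu>) 2 0 z)"
    and "H \<equiv> rpot (eta2 \<nu>) 2 z" and "m \<equiv> (\<integral>\<zeta>. \<nu> \<zeta> \<partial>dA)"
    and "A1 \<equiv> pot (\<lambda>\<zeta>. cnj \<zeta> * of_real (\<nu> \<zeta>)) 2 1 z"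
    and "A2' \<equiv> rpot (\<lambda>\<zeta>. (cmod \<zeta>)\<^sup>2 * \<nu> \<zeta>) 2 z"
  shows "16/10 * N\<^sup>2 - 32/10 * N * F - 8 * N * (H + m) \<le> 2 * (rho z)\<^sup>2 * (N * A2' - (cmod A1)\<^sup>2)"
proof -
  define k where "k = kern z"
  define K1 where "K1 = pot (cr \<nu>) 2 1 z"
  define K2 where "K2 = rpot \<nu> 2 z"
  have nn: "0 \<le> \<nu> \<zeta>" for \<zeta> by (rule rcsupp_nonneg[OF \<nu>])
  have [measurable]: "\<nu> \<in> borel_measurable dA" using rcsupp_integrable[OF \<nu>] by auto
  have [measurable]: "k \<in> borel_measurable dA" unfolding k_def by (rule measurable_kern[OF z])
  have [measurable]: "(\<lambda>\<zeta>. cmod \<zeta>) \<in> borel_measurable dA" by (rule measurable_dA_borel) simp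
  have N: "N = (\<integral>\<zeta>. \<nu> \<zeta> * (cmod (k \<zeta>))\<^sup>2 \<partial>dA)" by (simp add: N_def rpot_def k_def)
  have K2: "K2 = (\<integral>\<zeta>. \<nu> \<zeta> * (cmod (k \<zeta>))^4 \<partial>dA)" by (simp add: K2_def rpot_def k_def)
  have N0: "0 \<le> N" and K20: "0 \<le> K2" and H0: "0 \<le> H" and m0: "0 \<le> m"
    unfolding N_def K2_def H_def m_def
    using rpot_nonneg[OF \<nu>] rpot_nonneg[OF rcsupp_eta2[OF \<nu>]] nn by (auto intro!: integral_nonneg_AE)
  have ck: "integrable dA (\<lambda>\<zeta>. of_real (\<nu> \<zeta>) * (k \<zeta> ^ i * cnj (k \<zeta>) ^ j))" for i j
    unfolding k_def by (rule integrable_pot[OF rcsupp_csupp[OF \<nu>] z])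
  have rk: "integrable dA (\<lambda>\<zeta>. \<nu> \<zeta> * (cmod (k \<zeta>)) ^ n)" for n
    unfolding k_def by (rule integrable_rpot[OF \<nu> z])
  have rA: "rcsupp s (\<lambda>\<zeta>. (cmod \<zeta>)\<^sup>2 * \<nu> \<zeta>)"
    by (rule rcsupp_mult[OF \<nu>, where C = 1]) (auto simp: disc_iff intro!: power_le_one)
  have FN: "F \<le> N"
  proof -
    have "F \<le> (\<integral>\<zeta>. cmod (of_real (\<nu> \<zeta>) * (k \<zeta> ^ 2 * cnj (k \<zeta>) ^ 0)) \<partial>dA)"
      unfolding F_def pot_def k_def by (rule integral_norm_bound)
    also have "\<dots> = N" unfolding N by (rule Bochner_Integration.integral_cong) (use nn in \<open>auto simp: norm_mult norm_power\<close>)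
    finally show ?thesis .
  qed
  have K1sq: "(cmod K1)\<^sup>2 \<le> K2 * ((N + F) / 2)"
  proof (cases "K1 = 0")
    case True
    then show ?thesis using K20 N0 by (simp add: F_def)
  next
    case False
    \<comment> \<open>The rotation makes \<open>e * K1\<close> real, so Cauchy-Schwarz is needed
      only for \<open>Re (e * k)\<close>. Its mean square is half of
      \<open>N + Re (e^2 * pot (cr \<nu>) 2 0 z)\<close>, whereas \<open>|k|\<close> would give
      \<open>N\<close> and no gain.\<close>
    define e where "e = cnj K1 / of_real (cmod K1)"
    have e1: "cmod e = 1" using False by (simp add: e_def norm_divide)
    have eK: "e * K1 = of_real (cmod K1)"
    proof -
      have "e * K1 = of_real ((cmod K1)\<^sup>2) / of_real (cmod K1)"
        unfolding complex_norm_square by (simp add: e_def mult.commute)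
      then show ?thesis using False by (simp add: power2_eq_square)
    qed
    define x where "x \<zeta> = sqrt (\<nu> \<zeta>) * (cmod (k \<zeta>))\<^sup>2" for \<zeta>
    define y where "y \<zeta> = sqrt (\<nu> \<zeta>) * Re (e * k \<zeta>)" for \<zeta>
    have [measurable]: "x \<in> borel_measurable dA" "y \<in> borel_measurable dA"
      unfolding x_def[abs_def] y_def[abs_def] by measurable
    have x2: "(\<lambda>\<zeta>. (x \<zeta>)\<^sup>2) = (\<lambda>\<zeta>. \<nu> \<zeta> * (cmod (k \<zeta>))^4)"
      using nn by (simp add: x_def power_mult_distrib fun_eq_iff flip: power_mult)
    have re: "(Re (e * c))\<^sup>2 = ((cmod c)\<^sup>2 + Re (e\<^sup>2 * c\<^sup>2)) / 2" for c
    proof -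
      have "(cmod c)\<^sup>2 = (cmod (e * c))\<^sup>2" by (simp add: norm_mult e1)
      then show ?thesis
        unfolding power_mult_distrib[of e c 2, symmetric] cmod_power2 by (simp add: power2_eq_square)
    qed
    have y2: "(\<lambda>\<zeta>. (y \<zeta>)\<^sup>2) = (\<lambda>\<zeta>. (\<nu> \<zeta> * (cmod (k \<zeta>))\<^sup>2 + Re (e\<^sup>2 * (of_real (\<nu> \<zeta>) * (k \<zeta> ^ 2 * cnj (k \<zeta>) ^ 0)))) / 2)"
    proof
      fix \<zeta>
      have "Re (e\<^sup>2 * (of_real (\<nu> \<zeta>) * (k \<zeta> ^ 2 * cnj (k \<zeta>) ^ 0))) = \<nu> \<zeta> * Re (e\<^sup>2 * (k \<zeta>)\<^sup>2)"
        by (simp add: algebra_simps)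
      moreover have "(y \<zeta>)\<^sup>2 = \<nu> \<zeta> * (Re (e * k \<zeta>))\<^sup>2"
        using nn[of \<zeta>] by (simp only: y_def power_mult_distrib real_sqrt_pow2)
      ultimately show "(y \<zeta>)\<^sup>2 = (\<nu> \<zeta> * (cmod (k \<zeta>))\<^sup>2 + Re (e\<^sup>2 * (of_real (\<nu> \<zeta>) * (k \<zeta> ^ 2 * cnj (k \<zeta>) ^ 0)))) / 2"
        unfolding re by (simp only: distrib_left times_divide_eq_right)
    qed
    have iy: "integrable dA (\<lambda>\<zeta>. (y \<zeta>)\<^sup>2)"
      unfolding y2 by (intro integrable_divide Bochner_Integration.integrable_add rk integrable_Re integrable_mult_right ck)
    have "(\<integral>\<zeta>. (y \<zeta>)\<^sup>2 \<partial>dA) = (N + Re (e\<^sup>2 * pot (cr \<nu>) 2 0 z)) / 2"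
      unfolding y2 N pot_def k_def[symmetric]
      using rk[of 2] integrable_Re[OF integrable_mult_right[OF ck[of 2 0], of "e\<^sup>2"]]
        integral_Re[OF integrable_mult_right[OF ck[of 2 0], of "e\<^sup>2"]]
      by (simp del: power_0 mult_1_right)
    also have "\<dots> \<le> (N + F) / 2"
    proof -
      have "Re (e\<^sup>2 * pot (cr \<nu>) 2 0 z) \<le> cmod (e\<^sup>2 * pot (cr \<nu>) 2 0 z)" by (rule complex_Re_le_cmod)
      also have "\<dots> = F" by (simp add: F_def norm_mult norm_power e1)
      finally show ?thesis by simp
    qed
    finally have y2N: "(\<integral>\<zeta>. (y \<zeta>)\<^sup>2 \<partial>dA) \<le> (N + F) / 2" .
    have "e * K1 = (\<integral>\<zeta>. e * (of_real (\<nu> \<zeta>) * (k \<zeta> ^ 2 * cnj (k \<zeta>) ^ 1)) \<partial>dA)"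
      unfolding K1_def pot_def k_def[symmetric] by (rule integral_mult_right_zero[symmetric])
    then have "cmod K1 = Re (\<integral>\<zeta>. e * (of_real (\<nu> \<zeta>) * (k \<zeta> ^ 2 * cnj (k \<zeta>) ^ 1)) \<partial>dA)"
      unfolding eK by (metis Re_complex_of_real)
    also have "\<dots> = (\<integral>\<zeta>. Re (e * (of_real (\<nu> \<zeta>) * (k \<zeta> ^ 2 * cnj (k \<zeta>) ^ 1))) \<partial>dA)"
      by (rule integral_Re[symmetric]) (rule integrable_mult_right[OF ck])
    also have "\<dots> = (\<integral>\<zeta>. x \<zeta> * y \<zeta> \<partial>dA)"
    proof (rule Bochner_Integration.integral_cong[OF refl])
      fix \<zeta>
      have "e * (of_real (\<nu> \<zeta>) * (k \<zeta> ^ 2 * cnj (k \<zeta>) ^ 1)) = of_real (\<nu> \<zeta> * (cmod (k \<zeta>))\<^sup>2) * (e * k \<zeta>)"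
        by (simp only: of_real_mult complex_norm_square) (simp add: power2_eq_square)
      then have "Re (e * (of_real (\<nu> \<zeta>) * (k \<zeta> ^ 2 * cnj (k \<zeta>) ^ 1))) = \<nu> \<zeta> * (cmod (k \<zeta>))\<^sup>2 * Re (e * k \<zeta>)"
        by (simp only: Re_complex_of_real Im_complex_of_real times_complex.sel mult_zero_left diff_zero)
      also have "\<dots> = x \<zeta> * y \<zeta>"
        using nn[of \<zeta>] by (simp add: x_def y_def)
      finally show "Re (e * (of_real (\<nu> \<zeta>) * (k \<zeta> ^ 2 * cnj (k \<zeta>) ^ 1))) = x \<zeta> * y \<zeta>" .
    qed
    also have "\<dots> \<le> (\<integral>\<zeta>. \<bar>x \<zeta> * y \<zeta>\<bar> \<partial>dA)"
      by (rule order_trans[OF abs_ge_self]) (use integral_norm_bound[of dA "\<lambda>\<zeta>. x \<zeta> * y \<zeta>"] in simp)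
    finally have "(cmod K1)\<^sup>2 \<le> (\<integral>\<zeta>. \<bar>x \<zeta> * y \<zeta>\<bar> \<partial>dA)\<^sup>2"
      by (rule power_mono) simp
    also have "\<dots> \<le> (\<integral>\<zeta>. (x \<zeta>)\<^sup>2 \<partial>dA) * (\<integral>\<zeta>. (y \<zeta>)\<^sup>2 \<partial>dA)"
      by (rule integral_Cauchy_Schwarz(2)) (use iy rk x2 in auto)
    also have "(\<integral>\<zeta>. (x \<zeta>)\<^sup>2 \<partial>dA) = K2" unfolding x2 K2 ..
    also have "K2 * (\<integral>\<zeta>. (y \<zeta>)\<^sup>2 \<partial>dA) \<le> K2 * ((N + F) / 2)"
      using y2N K20 by (rule mult_left_mono)
    finally show ?thesis .
  qed
  have A1sq: "(cmod A1)\<^sup>2 \<le> N * A2'"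
  proof -
    define x where "x \<zeta> = sqrt (\<nu> \<zeta>) * cmod (k \<zeta>)" for \<zeta>
    define y where "y \<zeta> = sqrt (\<nu> \<zeta>) * cmod \<zeta> * (cmod (k \<zeta>))\<^sup>2" for \<zeta>
    have [measurable]: "x \<in> borel_measurable dA" "y \<in> borel_measurable dA"
      unfolding x_def[abs_def] y_def[abs_def] by measurable
    have x2: "(\<lambda>\<zeta>. (x \<zeta>)\<^sup>2) = (\<lambda>\<zeta>. \<nu> \<zeta> * (cmod (k \<zeta>))\<^sup>2)"
      using nn by (simp add: x_def power_mult_distrib fun_eq_iff)
    have y2: "(\<lambda>\<zeta>. (y \<zeta>)\<^sup>2) = (\<lambda>\<zeta>. ((cmod \<zeta>)\<^sup>2 * \<nu> \<zeta>) * (cmod (k \<zeta>))^(2*2))"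
      using nn by (simp add: y_def power_mult_distrib fun_eq_iff flip: power_mult)
    have "cmod A1 \<le> (\<integral>\<zeta>. cmod (cnj \<zeta> * of_real (\<nu> \<zeta>) * (k \<zeta> ^ 2 * cnj (k \<zeta>) ^ 1)) \<partial>dA)"
      unfolding A1_def pot_def k_def by (rule integral_norm_bound)
    also have "\<dots> = (\<integral>\<zeta>. \<bar>x \<zeta> * y \<zeta>\<bar> \<partial>dA)"
    proof (rule Bochner_Integration.integral_cong[OF refl])
      fix \<zeta>
      have "sqrt (\<nu> \<zeta>) * sqrt (\<nu> \<zeta>) = \<nu> \<zeta>" using nn[of \<zeta>] by simp
      then have "x \<zeta> * y \<zeta> = \<nu> \<zeta> * cmod \<zeta> * (cmod (k \<zeta>) * (cmod (k \<zeta>))\<^sup>2)"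
        by (simp add: x_def y_def)
      then show "cmod (cnj \<zeta> * of_real (\<nu> \<zeta>) * (k \<zeta> ^ 2 * cnj (k \<zeta>) ^ 1)) = \<bar>x \<zeta> * y \<zeta>\<bar>"
        using nn[of \<zeta>] by (simp add: norm_mult norm_power)
    qed
    finally have "(cmod A1)\<^sup>2 \<le> (\<integral>\<zeta>. \<bar>x \<zeta> * y \<zeta>\<bar> \<partial>dA)\<^sup>2"
      by (rule power_mono) simp
    also have "\<dots> \<le> (\<integral>\<zeta>. (x \<zeta>)\<^sup>2 \<partial>dA) * (\<integral>\<zeta>. (y \<zeta>)\<^sup>2 \<partial>dA)"
      by (rule integral_Cauchy_Schwarz(2)) (use rk integrable_rpot[OF rA z, of 4] in \<open>auto simp: x2 y2 k_def\<close>)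
    also have "(\<integral>\<zeta>. (x \<zeta>)\<^sup>2 \<partial>dA) = N" unfolding x2 N ..
    also have "(\<integral>\<zeta>. (y \<zeta>)\<^sup>2 \<partial>dA) = A2'" unfolding y2 A2'_def rpot_def k_def ..
    finally show ?thesis .
  qed
  \<comment> \<open>Up to the factor \<open>z\<close> the function \<open>cnj \<zeta> * k\<close> is
    \<open>k\<close> minus a constant, and a variance ignores constants.\<close>
  have key: "z * (cnj \<zeta> * k \<zeta>) = k \<zeta> - 1" if "\<zeta> \<in> disc" for \<zeta>
    using one_minus_nonzero[OF z that] by (simp add: k_def kern_def field_simps)
  have zA1: "z * A1 = K1 - of_real N"
  proof -
    have "z * A1 = (\<integral>\<zeta>. z * (cnj \<zeta> * of_real (\<nu> \<zeta>) * (k \<zeta> ^ 2 * cnj (k \<zeta>) ^ 1)) \<partial>dA)"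
      unfolding A1_def pot_def k_def[symmetric] by simp
    also have "\<dots> = (\<integral>\<zeta>. of_real (\<nu> \<zeta>) * (k \<zeta> ^ 2 * cnj (k \<zeta>) ^ 1) - of_real (\<nu> \<zeta>) * (k \<zeta> ^ 1 * cnj (k \<zeta>) ^ 1) \<partial>dA)"
    proof (rule Bochner_Integration.integral_cong[OF refl])
      fix \<zeta> assume "\<zeta> \<in> space dA"
      have "z * (cnj \<zeta> * of_real (\<nu> \<zeta>) * (k \<zeta> ^ 2 * cnj (k \<zeta>) ^ 1)) = (z * (cnj \<zeta> * k \<zeta>)) * (of_real (\<nu> \<zeta>) * (k \<zeta> * cnj (k \<zeta>)))"
        by (simp add: power2_eq_square)
      also have "\<dots> = (k \<zeta> - 1) * (of_real (\<nu> \<zeta>) * (k \<zeta> * cnj (k \<zeta>)))"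
        using key \<open>\<zeta> \<in> space dA\<close> by simp
      finally show "z * (cnj \<zeta> * of_real (\<nu> \<zeta>) * (k \<zeta> ^ 2 * cnj (k \<zeta>) ^ 1)) = of_real (\<nu> \<zeta>) * (k \<zeta> ^ 2 * cnj (k \<zeta>) ^ 1) - of_real (\<nu> \<zeta>) * (k \<zeta> ^ 1 * cnj (k \<zeta>) ^ 1)"
        by (simp add: power2_eq_square algebra_simps)
    qed
    also have "\<dots> = K1 - pot (cr \<nu>) 1 1 z"
      unfolding K1_def pot_def k_def[symmetric] by (rule Bochner_Integration.integral_diff[OF ck ck])
    finally show ?thesis by (simp only: pot_rpot N_def)
  qed
  have zA2: "(cmod z)\<^sup>2 * A2' = K2 - 2 * Re K1 + N"
  proof -
    have "(cmod z)\<^sup>2 * A2' = (\<integral>\<zeta>. (cmod z)\<^sup>2 * ((cmod \<zeta>)\<^sup>2 * \<nu> \<zeta> * (cmod (k \<zeta>))^(2*2)) \<partial>dA)"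
      unfolding A2'_def rpot_def k_def by simp
    also have "\<dots> = (\<integral>\<zeta>. \<nu> \<zeta> * (cmod (k \<zeta>))^4 - 2 * Re (of_real (\<nu> \<zeta>) * (k \<zeta> ^ 2 * cnj (k \<zeta>) ^ 1)) + \<nu> \<zeta> * (cmod (k \<zeta>))\<^sup>2 \<partial>dA)"
    proof (rule Bochner_Integration.integral_cong[OF refl])
      fix \<zeta> assume "\<zeta> \<in> space dA"
      have "(cmod z)\<^sup>2 * ((cmod \<zeta>)\<^sup>2 * \<nu> \<zeta> * (cmod (k \<zeta>))^(2*2)) = \<nu> \<zeta> * (cmod (k \<zeta>))\<^sup>2 * (cmod (z * (cnj \<zeta> * k \<zeta>)))\<^sup>2"
        by (simp add: norm_mult power_mult_distrib power2_eq_square power4_eq_xxxx)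
      also have "\<dots> = \<nu> \<zeta> * (cmod (k \<zeta>))\<^sup>2 * (cmod (k \<zeta> - 1))\<^sup>2"
        using key \<open>\<zeta> \<in> space dA\<close> by simp
      also have "(cmod (k \<zeta> - 1))\<^sup>2 = (cmod (k \<zeta>))\<^sup>2 - 2 * Re (k \<zeta>) + 1"
        unfolding cmod_power2 by (simp add: power2_eq_square algebra_simps)
      also have "Re (of_real (\<nu> \<zeta>) * (k \<zeta> ^ 2 * cnj (k \<zeta>) ^ 1)) = \<nu> \<zeta> * (cmod (k \<zeta>))\<^sup>2 * Re (k \<zeta>)"
      proof -
        have "of_real (\<nu> \<zeta>) * (k \<zeta> ^ 2 * cnj (k \<zeta>) ^ 1) = of_real (\<nu> \<zeta> * (cmod (k \<zeta>))\<^sup>2) * k \<zeta>"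
          by (simp only: of_real_mult complex_norm_square) (simp add: power2_eq_square)
        then show ?thesis by (simp only: Re_complex_of_real Im_complex_of_real times_complex.sel mult_zero_left diff_zero)
      qed
      then have "\<nu> \<zeta> * (cmod (k \<zeta>))\<^sup>2 * ((cmod (k \<zeta>))\<^sup>2 - 2 * Re (k \<zeta>) + 1) = \<nu> \<zeta> * (cmod (k \<zeta>))^4 - 2 * Re (of_real (\<nu> \<zeta>) * (k \<zeta> ^ 2 * cnj (k \<zeta>) ^ 1)) + \<nu> \<zeta> * (cmod (k \<zeta>))\<^sup>2"
        by (simp only:) (simp add: algebra_simps power2_eq_square power4_eq_xxxx)
      finally show "(cmod z)\<^sup>2 * ((cmod \<zeta>)\<^sup>2 * \<nu> \<zeta> * (cmod (k \<zeta>))^(2*2)) = \<nu> \<zeta> * (cmod (k \<zeta>))^4 - 2 * Re (of_real (\<nu> \<zeta>) * (k \<zeta> ^ 2 * cnj (k \<zeta>) ^ 1)) + \<nu> \<zeta> * (cmod (k \<zeta>))\<^sup>2" .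
    qed
    also have "\<dots> = K2 - 2 * Re K1 + N"
      unfolding K2 N K1_def pot_def k_def[symmetric] integral_Re[OF ck, symmetric]
      using rk[of 4] rk[of 2] integrable_Re[OF ck[of 2 1]] by simp
    finally show ?thesis .
  qed
  have eqV: "(cmod z)\<^sup>2 * (N * A2' - (cmod A1)\<^sup>2) = N * K2 - (cmod K1)\<^sup>2"
  proof -
    have "(cmod z)\<^sup>2 * (cmod A1)\<^sup>2 = (cmod (K1 - of_real N))\<^sup>2"
      by (simp add: power_mult_distrib[symmetric] norm_mult[symmetric] zA1)
    also have "\<dots> = (cmod K1)\<^sup>2 - 2 * N * Re K1 + N\<^sup>2"
      unfolding cmod_power2 by (simp add: power2_eq_square algebra_simps)
    finally have "(cmod z)\<^sup>2 * (N * A2' - (cmod A1)\<^sup>2) = N * ((cmod z)\<^sup>2 * A2') - ((cmod K1)\<^sup>2 - 2 * N * Re K1 + N\<^sup>2)"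
      by (simp add: algebra_simps)
    then show ?thesis unfolding zA2 by (simp add: algebra_simps power2_eq_square)
  qed
  \<comment> \<open>The variance is nonnegative and \<open>|z| <= 1\<close>, so nothing has to be
    divided by \<open>|z|^2\<close> and \<open>z = 0\<close> is no exception.\<close>
  have V: "N * K2 - (cmod K1)\<^sup>2 \<le> N * A2' - (cmod A1)\<^sup>2"
  proof -
    have "(cmod z)\<^sup>2 \<le> 1" using z by (simp add: disc_iff power_le_one)
    from mult_right_mono[OF this, of "N * A2' - (cmod A1)\<^sup>2"] A1sq show ?thesis by (simp add: eqV)
  qed
  have K2lower: "2 * (N - F) - 10 * (H + m) \<le> 5/4 * (rho z)\<^sup>2 * K2"
    unfolding N_def F_def H_def m_def K2_def by (rule kernel_inequality_integrated[OF \<nu> z])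
  \<comment> \<open>\<open>8/10\<close> is the reciprocal of the \<open>5/4\<close> in
    \<open>kernel_inequality\<close>; the discarded terms in \<open>F\<close> are
    nonnegative.\<close>
  have "16/10 * N\<^sup>2 - 32/10 * N * F - 8 * N * (H + m) \<le> 8/10 * (2 * (N - F) - 10 * (H + m)) * (N - F)"
  proof -
    have "8/10 * (2 * (N - F) - 10 * (H + m)) * (N - F) - (16/10 * N\<^sup>2 - 32/10 * N * F - 8 * N * (H + m)) = 16/10 * F\<^sup>2 + 8 * F * (H + m)"
      by (simp add: power2_eq_square field_simps)
    moreover have "0 \<le> 16/10 * F\<^sup>2 + 8 * F * (H + m)" using H0 m0 by (simp add: F_def)
    ultimately show ?thesis by linarith
  qed
  also have "\<dots> \<le> 8/10 * (5/4 * (rho z)\<^sup>2 * K2) * (N - F)"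
    using K2lower FN by (intro mult_right_mono mult_left_mono) auto
  also have "\<dots> = 2 * (rho z)\<^sup>2 * (N * K2 - K2 * ((N + F) / 2))"
    by (simp add: field_simps)
  also have "\<dots> \<le> 2 * (rho z)\<^sup>2 * (N * A2' - (cmod A1)\<^sup>2)"
    using K1sq V by (intro mult_left_mono) auto
  finally show ?thesis .
qed

section \<open>The Hardy inequality with a cutoff\<close>

lemma integrable_indicator_continuous:
  fixes \<phi> :: "complex \<Rightarrow> real"
  assumes c: "continuous_on disc \<phi>" and A: "{z \<in> disc. P z} \<in> sets dA"
    and R: "R < 1" "\<And>z. z \<in> disc \<Longrightarrow> P z \<Longrightarrow> cmod z \<le> R"
  shows "integrable dA (\<lambda>z. if P z then \<phi> z else 0)"
proof -
  have "bounded (\<phi> ` cball 0 R)"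
    by (intro compact_imp_bounded compact_continuous_image continuous_on_subset[OF c]) (use R in \<open>auto simp: disc_iff\<close>)
  then obtain B where B: "\<And>z. z \<in> cball 0 R \<Longrightarrow> \<bar>\<phi> z\<bar> \<le> B"
    unfolding bounded_iff by fastforce
  have m: "\<phi> \<in> borel_measurable dA" by (rule measurable_dA_continuous[OF c])
  have P: "Measurable.pred dA P" using A by (simp add: pred_def)
  show ?thesis
  proof (rule dA.integrable_const_bound[where B = "\<bar>B\<bar>"])
    show "(\<lambda>z. if P z then \<phi> z else 0) \<in> borel_measurable dA" using m P by measurable
    show "AE z in dA. norm (if P z then \<phi> z else 0) \<le> \<bar>B\<bar>"
    proof (rule AE_I2)
      fix z assume "z \<in> space dA"
      then show "norm (if P z then \<phi> z else 0) \<le> \<bar>B\<bar>"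
        using R(2)[of z] B[of z] by auto
    qed
  qed
qed

lemma quadratic_absorb: "(a::real) * b \<le> 1/10 * a\<^sup>2 + 5/2 * b\<^sup>2"
  using zero_le_power2[of "a - 5 * b"] by (simp add: power2_eq_square algebra_simps)

text \<open>Completing the square in \<open>s\<close> costs \<open>(X + y)^2 * t^2\<close>, at most
  \<open>12/10 * X^2 * t^2 + 6 * y^2 * t^2\<close>. Against the variance gain
  \<open>16/10 * N^2\<close> stand this \<open>12/10\<close> and three absorptions of
  \<open>1/10\<close> each, which leaves \<open>1/10\<close>.\<close>

lemma hardy_pointwise:
  fixes X s t y V N F H m f2 :: real
  assumes "0 \<le> X" "0 \<le> y" "0 \<le> s" "0 \<le> t" "t\<^sup>2 = f2 * N\<^sup>2" "0 \<le> f2"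
    and V: "16/10 * N\<^sup>2 - 32/10 * N * F - 8 * N * (H + m) \<le> V"
    and T: "X\<^sup>2 * (s\<^sup>2 + f2 * V) - 2 * X\<^sup>2 * (s * t) - 2 * X * y * (s * t) \<le> T"
  shows "1/10 * (X\<^sup>2 * f2 * N\<^sup>2) - X\<^sup>2 * f2 * (26 * F\<^sup>2 + 160 * (H\<^sup>2 + m\<^sup>2)) - 6 * (y\<^sup>2 * f2 * N\<^sup>2) \<le> T"
proof -
  have N: "4/10 * N\<^sup>2 \<le> V - 12/10 * N\<^sup>2 + 3/10 * N\<^sup>2 + (26 * F\<^sup>2 + 160 * (H\<^sup>2 + m\<^sup>2))"
  proof -
    have "32/10 * N * F \<le> 1/10 * N\<^sup>2 + 26 * F\<^sup>2"
    proof -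
      have "32/10 * N * F \<le> 1/10 * N\<^sup>2 + 256/10 * F\<^sup>2"
        using quadratic_absorb[of N "32/10 * F"] by (simp add: power_mult_distrib power2_eq_square)
      moreover have "256/10 * F\<^sup>2 \<le> 26 * F\<^sup>2" by (rule mult_right_mono) auto
      ultimately show ?thesis by linarith
    qed
    moreover have "8 * N * H \<le> 1/10 * N\<^sup>2 + 160 * H\<^sup>2"
      using quadratic_absorb[of N "8 * H"] by (simp add: power_mult_distrib power2_eq_square)
    moreover have "8 * N * m \<le> 1/10 * N\<^sup>2 + 160 * m\<^sup>2"
      using quadratic_absorb[of N "8 * m"] by (simp add: power_mult_distrib power2_eq_square)
    ultimately show ?thesis using V by (simp add: distrib_left)
  qed
  have sq: "(X + y)\<^sup>2 \<le> 12/10 * X\<^sup>2 + 6 * y\<^sup>2"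
    using zero_le_power2[of "X / 5 - y"] zero_le_power2[of X] by (simp add: power2_eq_square algebra_simps)
  have "X\<^sup>2 * s\<^sup>2 - 2 * X\<^sup>2 * (s * t) - 2 * X * y * (s * t) \<ge> - ((X + y)\<^sup>2 * t\<^sup>2)"
    using zero_le_power2[of "X * s - (X + y) * t"] by (simp add: power2_eq_square algebra_simps)
  moreover have "(X + y)\<^sup>2 * t\<^sup>2 \<le> (12/10 * X\<^sup>2 + 6 * y\<^sup>2) * t\<^sup>2"
    using sq by (rule mult_right_mono) simp
  ultimately have "X\<^sup>2 * f2 * V - (12/10 * X\<^sup>2 + 6 * y\<^sup>2) * (f2 * N\<^sup>2) \<le> T"
    using T assms(5) by (simp add: algebra_simps)
  moreover have "X\<^sup>2 * f2 * (1/10 * N\<^sup>2) \<le> X\<^sup>2 * f2 * (V - 12/10 * N\<^sup>2 + (26 * F\<^sup>2 + 160 * (H\<^sup>2 + m\<^sup>2)))"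
    using N assms(6) by (intro mult_left_mono) auto
  ultimately show ?thesis by (simp add: algebra_simps)
qed

text \<open>With \<open>Q = q cnj(f) N\<close>, \<open>q = f' N + 2 f A1\<close>, the integral of
  \<open>dbar (X^2 rho^2 Q)\<close> vanishes, while its real part is bounded from below pointwise, the gain being
  the variance term of \<open>variance_bound\<close>.\<close>

lemma hardy_inequality:
  fixes Y :: "complex \<Rightarrow> real"
  assumes f: "A2 f" and \<nu>: "rcsupp s \<nu>"
    and Y: "\<And>z. z \<in> disc \<Longrightarrow> wirt (\<lambda>z. of_real (Y z)) z (cnj (Yq z)) (Yq z)"
    and Yq: "continuous_on disc Yq"
    and R: "0 \<le> R" "R < 1" "\<And>z. z \<in> disc \<Longrightarrow> R < cmod z \<Longrightarrow> 1 \<le> Y z"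
  defines "X \<equiv> \<lambda>z. max 0 (1 - Y z)"
  shows "(\<integral>z. (if Y z < 1 then (X z)\<^sup>2 * (cmod (f z))\<^sup>2 * (rpot \<nu> 1 z)\<^sup>2 else 0) \<partial>dA) \<le>
     260 * (\<integral>z. (if Y z < 1 then (X z)\<^sup>2 * (cmod (f z))\<^sup>2 * (cmod (pot (cr \<nu>) 2 0 z))\<^sup>2 else 0) \<partial>dA) +
     1600 * (\<integral>z. (if Y z < 1 then (X z)\<^sup>2 * (cmod (f z))\<^sup>2 * ((rpot (eta2 \<nu>) 2 z)\<^sup>2 + (\<integral>\<zeta>. \<nu> \<zeta> \<partial>dA)\<^sup>2) else 0) \<partial>dA) +
     60 * (\<integral>z. (if Y z < 1 then (rho z * cmod (Yq z))\<^sup>2 * (cmod (f z))\<^sup>2 * (rpot \<nu> 1 z)\<^sup>2 else 0) \<partial>dA)"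
proof -
  define f' where "f' = deriv f"
  define N where "N = pot (cr \<nu>) 1 1"
  define A1 where "A1 = pot (\<lambda>\<zeta>. cnj \<zeta> * of_real (\<nu> \<zeta>)) 2 1"
  define B1 where "B1 = pot (\<lambda>\<zeta>. \<zeta> * of_real (\<nu> \<zeta>)) 1 2"
  define A2' where "A2' = pot (\<lambda>\<zeta>. \<zeta> * (cnj \<zeta> * of_real (\<nu> \<zeta>))) 2 2"
  define pA1 where "pA1 z = 2 * pot (\<lambda>\<zeta>. cnj \<zeta> * (cnj \<zeta> * of_real (\<nu> \<zeta>))) 3 1 z" for z
  define x where "x z = complex_of_real ((X z)\<^sup>2)" for z
  define xq where "xq z = complex_of_real (- 2 * X z) * Yq z" for z
  define xp where "xp z = complex_of_real (- 2 * X z) * cnj (Yq z)" for z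
  define r where "r z = complex_of_real (rho z)" for z
  define q where "q z = f' z * N z + 2 * f z * A1 z" for z
  define pq where "pq z = deriv f' z * N z + f' z * A1 z + ((0 * f z + 2 * f' z) * A1 z + 2 * f z * pA1 z)" for z
  define qq where "qq z = 0 * N z + f' z * B1 z + ((0 * f z + 2 * 0) * A1 z + 2 * f z * A2' z)" for z
  \<comment> \<open>\<open>Q\<close> is the d/dz derivative of \<open>|f|^2 * N^2\<close>, because
    \<open>A1\<close> is that of \<open>N\<close>; so \<open>qQ\<close> is a quarter of the
    Laplacian of \<open>|f|^2 * N^2\<close>.\<close>
  define Q where "Q z = q z * (cnj (f z) * N z)" for z
  define pQ where "pQ z = pq z * (cnj (f z) * N z) + q z * (cnj 0 * N z + cnj (f z) * A1 z)" for z
  define qQ where "qQ z = qq z * (cnj (f z) * N z) + q z * (cnj (f' z) * N z + cnj (f z) * B1 z)" for z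
  define U where "U z = x z * (r z * r z * Q z)" for z
  define pU where "pU z = xp z * (r z * r z * Q z) + x z * ((- cnj z * r z + r z * - cnj z) * Q z + r z * r z * pQ z)" for z
  define qU where "qU z = xq z * (r z * r z * Q z) + x z * ((- z * r z + r z * - z) * Q z + r z * r z * qQ z)" for z
  note c\<nu> = rcsupp_csupp[OF \<nu>]
  have hf: "f holomorphic_on disc" by (rule A2_holomorphic[OF f])
  have hf': "f' holomorphic_on disc" unfolding f'_def by (intro holomorphic_deriv hf open_disc)
  have wf: "wirt f z (f' z) 0" if "z \<in> disc" for z
    unfolding f'_def by (rule wirt_holo[OF holomorphic_disc_deriv[OF hf that]])
  have wf': "wirt f' z (deriv f' z) 0" if "z \<in> disc" for z
    by (rule wirt_holo[OF holomorphic_disc_deriv[OF hf' that]])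
  have wN: "wirt N z (A1 z) (B1 z)" if "z \<in> disc" for z
    using wirt_pot[OF c\<nu> that, of 1 1] by (simp add: N_def A1_def B1_def numeral_2_eq_2)
  have wA: "wirt A1 z (pA1 z) (A2' z)" if "z \<in> disc" for z
    using wirt_pot[OF csupp_mult_cnj[OF c\<nu>] that, of 2 1] by (simp add: A1_def pA1_def A2'_def numeral_3_eq_3 numeral_2_eq_2)
  have wq: "wirt q z (pq z) (qq z)" if "z \<in> disc" for z
    unfolding q_def[abs_def] pq_def qq_def using that by (intro wirt_add wirt_mult wf wf' wN wA wirt_const)
  have wQ: "wirt Q z (pQ z) (qQ z)" if "z \<in> disc" for z
    unfolding Q_def[abs_def] pQ_def qQ_def using that by (intro wirt_mult wq wirt_cnj wf wN)
  have wx: "wirt x z (xp z) (xq z)" if "z \<in> disc" for z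
  proof -
    have "((\<lambda>t. (max 0 (1 - t))\<^sup>2) has_real_derivative 2 * max 0 (1 - Y z) * (- 1)) (at (Y z))"
      by (rule DERIV_chain2[OF has_derivative_max0_square]) (auto intro!: derivative_eq_intros)
    from wirt_real_compose[OF Y[OF that] this] show ?thesis
      by (simp add: x_def[abs_def] xp_def xq_def X_def)
  qed
  have wr: "wirt r z (- cnj z) (- z)" for z
    unfolding r_def[abs_def] by (rule wirt_rho)
  have wU: "wirt U z (pU z) (qU z)" if "z \<in> disc" for z
    unfolding U_def[abs_def] pU_def qU_def using that by (intro wirt_mult wx wr wQ)
  have cY: "continuous_on disc Y"
  proof -
    have "continuous_on disc (\<lambda>z. Re (of_real (Y z)))"
      by (intro continuous_on_Re wirt_imp_continuous_on[OF Y])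
    then show ?thesis by simp
  qed
  have cX: "continuous_on disc X" unfolding X_def using cY by (intro continuous_intros)
  have cf: "continuous_on disc f" "continuous_on disc f'" "continuous_on disc (deriv f')"
    using hf hf' continuous_on_deriv_disc by (auto intro: holomorphic_on_imp_continuous_on)
  have cp: "continuous_on disc N" "continuous_on disc A1" "continuous_on disc B1" "continuous_on disc A2'" "continuous_on disc pA1"
    unfolding N_def A1_def B1_def A2'_def pA1_def[abs_def]
    by (intro continuous_intros continuous_on_pot[OF c\<nu>] continuous_on_pot[OF csupp_mult_id[OF c\<nu>]]
        continuous_on_pot[OF csupp_mult_cnj[OF c\<nu>]] continuous_on_pot[OF csupp_mult_id[OF csupp_mult_cnj[OF c\<nu>]]]
        continuous_on_pot[OF csupp_mult_cnj[OF csupp_mult_cnj[OF c\<nu>]]])+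
  have cx: "continuous_on disc x" "continuous_on disc xp" "continuous_on disc xq" "continuous_on disc r"
    unfolding x_def[abs_def] xp_def[abs_def] xq_def[abs_def] r_def[abs_def]
    by (intro continuous_intros cX Yq)+
  have cq: "continuous_on disc q" "continuous_on disc pq" "continuous_on disc qq"
    unfolding q_def[abs_def] pq_def[abs_def] qq_def[abs_def] by (intro continuous_intros cf cp)+
  have cQ: "continuous_on disc Q" "continuous_on disc pQ" "continuous_on disc qQ"
    unfolding Q_def[abs_def] pQ_def[abs_def] qQ_def[abs_def] by (intro continuous_intros cf cp cq)+
  have cU: "continuous_on disc pU" "continuous_on disc qU"
    unfolding pU_def[abs_def] qU_def[abs_def] by (intro continuous_intros cx cQ)+
  have X0: "X z = 0" if "z \<in> disc" "R < cmod z" for z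
    using R(3)[OF that] by (simp add: X_def)
  have IBP: "integrable dA qU" "(\<integral>z. qU z \<partial>dA) = 0"
    by (rule integral_dbar_eq_0[OF wU cU R(1,2)];
        use X0 in \<open>auto simp: disc_iff U_def pU_def qU_def x_def xp_def xq_def\<close>)+
  define N' where "N' = rpot \<nu> 1"
  define F where "F z = cmod (pot (cr \<nu>) 2 0 z)" for z
  define H where "H = rpot (eta2 \<nu>) 2"
  define m where "m = (\<integral>\<zeta>. \<nu> \<zeta> \<partial>dA)"
  define f2 where "f2 z = (cmod (f z))\<^sup>2" for z
  define y where "y z = rho z * cmod (Yq z)" for z
  have NN: "N z = of_real (N' z)" for z by (simp only: N_def N'_def pot_rpot)
  have BA: "B1 z = cnj (A1 z)" for z
    unfolding A1_def B1_def pot_def cnj_integral by (simp add: mult_ac del: Bochner_Integration.integral_cnj)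
  have AA: "A2' z = of_real (rpot (\<lambda>\<zeta>. (cmod \<zeta>)\<^sup>2 * \<nu> \<zeta>) 2 z)" for z
    unfolding A2'_def pot_rpot[symmetric] of_real_mult complex_norm_square by (simp add: mult_ac)
  have N'0: "0 \<le> N' z" for z unfolding N'_def by (rule rpot_nonneg[OF \<nu>])
  have pw: "1/10 * ((X z)\<^sup>2 * f2 z * (N' z)\<^sup>2) - (X z)\<^sup>2 * f2 z * (26 * (F z)\<^sup>2 + 160 * ((H z)\<^sup>2 + m\<^sup>2)) - 6 * ((y z)\<^sup>2 * f2 z * (N' z)\<^sup>2)
     \<le> Re (qU z)" if z: "z \<in> disc" for z
  proof (rule hardy_pointwise)
    define V where "V = 2 * (rho z)\<^sup>2 * (N' z * rpot (\<lambda>\<zeta>. (cmod \<zeta>)\<^sup>2 * \<nu> \<zeta>) 2 z - (cmod (A1 z))\<^sup>2)"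
    define s where "s = rho z * cmod (q z)"
    define t where "t = cmod (f z) * N' z"
    show "16/10 * (N' z)\<^sup>2 - 32/10 * N' z * F z - 8 * N' z * (H z + m) \<le> V"
      unfolding N'_def F_def H_def m_def V_def A1_def by (rule variance_bound[OF \<nu> z])
    have r0: "0 < rho z" by (rule rho_pos[OF z])
    show "0 \<le> X z" by (simp add: X_def)
    show "0 \<le> y z" "0 \<le> s" "0 \<le> t" using r0 N'0[of z] by (auto simp: y_def s_def t_def)
    show "t\<^sup>2 = f2 z * (N' z)\<^sup>2" "0 \<le> f2 z" by (auto simp: t_def f2_def power_mult_distrib)
    \<comment> \<open>The mixed terms combine, by \<open>B1 = cnj A1\<close>, into the square of
      \<open>|q|\<close> plus twice \<open>|f|^2\<close> times the variance expression.\<close>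
    have qQ: "qQ z = of_real ((cmod (q z))\<^sup>2 + 2 * f2 z * (N' z * rpot (\<lambda>\<zeta>. (cmod \<zeta>)\<^sup>2 * \<nu> \<zeta>) 2 z - (cmod (A1 z))\<^sup>2))"
      unfolding of_real_add of_real_diff of_real_mult complex_norm_square f2_def NN[symmetric] AA[symmetric]
      by (simp add: qQ_def qq_def q_def BA NN algebra_simps)
    have cQn: "cmod (Q z) = cmod (q z) * t"
      using N'0[of z] by (simp add: Q_def NN norm_mult t_def)
    \<comment> \<open>The two subtracted terms stem from the derivatives of \<open>rho^2\<close> and
      of \<open>X^2\<close>.\<close>
    have "Re (qU z) = (X z)\<^sup>2 * (s\<^sup>2 + f2 z * V) - 2 * ((X z)\<^sup>2 * rho z * Re (z * Q z)) - 2 * (X z * (rho z)\<^sup>2 * Re (Yq z * Q z))"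
    proof -
      have "qU z = of_real ((X z)\<^sup>2 * (s\<^sup>2 + f2 z * V)) - of_real (2 * ((X z)\<^sup>2 * rho z)) * (z * Q z) - of_real (2 * (X z * (rho z)\<^sup>2)) * (Yq z * Q z)"
        unfolding qU_def qQ by (simp add: x_def xq_def r_def s_def V_def power_mult_distrib) (simp add: algebra_simps power2_eq_square)
      then show ?thesis
        by (simp only: minus_complex.sel times_complex.sel Re_complex_of_real Im_complex_of_real mult_zero_left diff_zero mult.assoc)
    qed
    moreover have "(X z)\<^sup>2 * rho z * Re (z * Q z) \<le> (X z)\<^sup>2 * (s * t)"
    proof -
      have "Re (z * Q z) \<le> cmod (z * Q z)" by (rule complex_Re_le_cmod)
      also have "\<dots> \<le> 1 * cmod (Q z)"
        unfolding norm_mult using z by (intro mult_right_mono) (auto simp: disc_iff)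
      finally have "(X z)\<^sup>2 * rho z * Re (z * Q z) \<le> (X z)\<^sup>2 * rho z * cmod (Q z)"
        using r0 by (intro mult_left_mono) auto
      then show ?thesis by (simp add: cQn s_def mult_ac)
    qed
    moreover have "X z * (rho z)\<^sup>2 * Re (Yq z * Q z) \<le> X z * y z * (s * t)"
    proof -
      have "X z * (rho z)\<^sup>2 * Re (Yq z * Q z) \<le> X z * (rho z)\<^sup>2 * cmod (Yq z * Q z)"
        using complex_Re_le_cmod[of "Yq z * Q z"] by (intro mult_left_mono) (auto simp: X_def)
      also have "\<dots> = X z * y z * (s * t)" by (simp add: norm_mult cQn y_def s_def power2_eq_square)
      finally show ?thesis .
    qed
    ultimately show "(X z)\<^sup>2 * (s\<^sup>2 + f2 z * V) - 2 * (X z)\<^sup>2 * (s * t) - 2 * X z * y z * (s * t) \<le> Re (qU z)"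
      by simp
  qed
  have ReqU: "Re (qU z) = 0" if "\<not> Y z < 1" for z
  proof -
    have "X z = 0" using that by (simp add: X_def)
    then show ?thesis by (simp add: qU_def x_def xq_def)
  qed
  have Pm: "{z \<in> disc. Y z < 1} \<in> sets dA"
  proof -
    have "Y \<in> borel_measurable dA" by (rule measurable_dA_continuous[OF cY])
    then have "{z \<in> space dA. Y z < 1} \<in> sets dA" by measurable
    then show ?thesis by simp
  qed
  have cN': "continuous_on disc N'"
  proof -
    have "continuous_on disc (\<lambda>z. Re (N z))" by (intro continuous_on_Re cp)
    then show ?thesis by (simp add: NN)
  qed
  have cH: "continuous_on disc H"
  proof -
    have "continuous_on disc (\<lambda>z. Re (pot (cr (eta2 \<nu>)) 2 2 z))"
      by (intro continuous_on_Re continuous_on_pot[OF rcsupp_csupp[OF rcsupp_eta2[OF \<nu>]]])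
    then show ?thesis by (simp add: pot_rpot H_def)
  qed
  have cF: "continuous_on disc F" unfolding F_def[abs_def] by (intro continuous_intros continuous_on_pot[OF c\<nu>])
  have cy: "continuous_on disc y" unfolding y_def[abs_def] by (intro continuous_intros Yq)
  have cf2: "continuous_on disc f2" unfolding f2_def[abs_def] by (intro continuous_intros cf)
  have RY: "z \<in> disc \<Longrightarrow> Y z < 1 \<Longrightarrow> cmod z \<le> R" for z using R(3)[of z] by force
  note I = integrable_indicator_continuous[OF _ Pm R(2) RY]
  define g1 where "g1 z = (if Y z < 1 then (X z)\<^sup>2 * f2 z * (N' z)\<^sup>2 else 0)" for z
  define g2 where "g2 z = (if Y z < 1 then (X z)\<^sup>2 * f2 z * (F z)\<^sup>2 else 0)" for z
  define g3 where "g3 z = (if Y z < 1 then (X z)\<^sup>2 * f2 z * ((H z)\<^sup>2 + m\<^sup>2) else 0)" for z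
  define g4 where "g4 z = (if Y z < 1 then (y z)\<^sup>2 * f2 z * (N' z)\<^sup>2 else 0)" for z
  have ig: "integrable dA g1" "integrable dA g2" "integrable dA g3" "integrable dA g4"
    unfolding g1_def[abs_def] g2_def[abs_def] g3_def[abs_def] g4_def[abs_def]
    by (intro I continuous_intros cX cf2 cN' cF cH cy; simp)+
  have "(\<integral>z. 1/10 * g1 z - 26 * g2 z - 160 * g3 z - 6 * g4 z \<partial>dA) \<le> (\<integral>z. Re (qU z) \<partial>dA)"
  proof (rule integral_mono)
    show "integrable dA (\<lambda>z. 1/10 * g1 z - 26 * g2 z - 160 * g3 z - 6 * g4 z)" using ig by simp
    show "integrable dA (\<lambda>z. Re (qU z))" using IBP by simp
    fix z assume "z \<in> space dA"
    then have z: "z \<in> disc" by simp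
    show "1/10 * g1 z - 26 * g2 z - 160 * g3 z - 6 * g4 z \<le> Re (qU z)"
    proof (cases "Y z < 1")
      case True
      then show ?thesis using pw[OF z] by (simp add: g1_def g2_def g3_def g4_def algebra_simps)
    next
      case False
      then show ?thesis using ReqU[OF False] by (simp add: g1_def g2_def g3_def g4_def)
    qed
  qed
  also have "\<dots> = 0" using IBP integral_Re[OF IBP(1)] by simp
  finally have "1/10 * (\<integral>z. g1 z \<partial>dA) - 26 * (\<integral>z. g2 z \<partial>dA) - 160 * (\<integral>z. g3 z \<partial>dA) - 6 * (\<integral>z. g4 z \<partial>dA) \<le> 0"
    using ig by simp
  then have "(\<integral>z. g1 z \<partial>dA) \<le> 260 * (\<integral>z. g2 z \<partial>dA) + 1600 * (\<integral>z. g3 z \<partial>dA) + 60 * (\<integral>z. g4 z \<partial>dA)"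
    by simp
  then show ?thesis
    unfolding g1_def g2_def g3_def g4_def f2_def N'_def F_def H_def m_def y_def .
qed

section \<open>Removal of the boundary cutoff\<close>

lemma integrable_square_mult_bounded:
  fixes \<phi> :: "complex \<Rightarrow> real"
  assumes f: "L2 f" and \<phi>: "\<phi> \<in> borel_measurable dA" "\<And>z. z \<in> disc \<Longrightarrow> \<bar>\<phi> z\<bar> \<le> B"
  shows "integrable dA (\<lambda>z. (cmod (f z))\<^sup>2 * \<phi> z)"
proof (rule Bochner_Integration.integrable_bound)
  show "integrable dA (\<lambda>z. (cmod (f z))\<^sup>2 * B)" using L2_integrable_square[OF f] by auto
  show "(\<lambda>z. (cmod (f z))\<^sup>2 * \<phi> z) \<in> borel_measurable dA" using \<phi>(1) L2_measurable[OF f] by simp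
  show "AE z in dA. norm ((cmod (f z))\<^sup>2 * \<phi> z) \<le> norm ((cmod (f z))\<^sup>2 * B)"
    using \<phi>(2) by (intro AE_I2) (auto simp: abs_mult intro!: mult_left_mono order_trans[OF _ abs_ge_self])
qed

lemma continuous_on_rpot:
  assumes "rcsupp s \<nu>"
  shows "continuous_on disc (rpot \<nu> n)"
proof -
  have "continuous_on disc (\<lambda>z. Re (pot (cr \<nu>) n n z))"
    by (intro continuous_on_Re continuous_on_pot[OF rcsupp_csupp[OF assms]])
  then show ?thesis by (simp add: pot_rpot)
qed

lemma measurable_rpot: "rcsupp s \<nu> \<Longrightarrow> rpot \<nu> n \<in> borel_measurable dA"
  by (rule measurable_dA_continuous[OF continuous_on_rpot])

lemma rpot_bounded:
  assumes "rcsupp s \<nu>"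
  shows "\<exists>B. \<forall>z\<in>disc. \<bar>rpot \<nu> n z\<bar> \<le> B"
proof -
  have "\<bar>rpot \<nu> n z\<bar> \<le> (1 / (1 - s)) ^ (n + n) * (\<integral>\<zeta>. cmod (cr \<nu> \<zeta>) \<partial>dA)" if "z \<in> disc" for z
    using norm_pot_le[OF rcsupp_csupp[OF assms] that, of n n] by (simp only: pot_rpot norm_of_real)
  then show ?thesis by blast
qed

lemma measurable_pot: "csupp s \<nu> \<Longrightarrow> pot \<nu> i j \<in> borel_measurable dA"
  by (rule measurable_dA_continuous[OF continuous_on_pot])

lemma wirt_inverse_rho:
  assumes "z \<in> disc"
  shows "wirt (\<lambda>z. of_real (\<epsilon> / rho z)) z (of_real (\<epsilon> / (rho z)\<^sup>2) * cnj z) (of_real (\<epsilon> / (rho z)\<^sup>2) * z)"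
proof -
  have r: "rho z \<noteq> 0" using rho_pos[OF assms] by simp
  have "((\<lambda>t. \<epsilon> / t) has_real_derivative (- (\<epsilon> / (rho z)\<^sup>2))) (at (rho z))"
    using r by (auto intro!: derivative_eq_intros simp: power2_eq_square)
  from wirt_real_compose[OF wirt_rho this] show ?thesis by simp
qed

text \<open>\<open>hardy_inequality\<close> wants a cutoff function that is at least 1 near the
  circle. Adding \<open>\<epsilon> n / rho\<close> to \<open>S / 2\<close> achieves this; the
  additional gradient term is bounded where the cutoff is active and tends to 0 pointwise, so it
  disappears in the limit. \<open>D\<close> makes the last integrand integrable.\<close>

lemma hardy_limit:
  fixes S :: "complex \<Rightarrow> real"
  assumes f: "A2 f" and \<nu>: "rcsupp s \<nu>"
    and S: "\<And>z. z \<in> disc \<Longrightarrow> wirt (\<lambda>z. of_real (S z)) z (cnj (Sq z)) (Sq z)"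
    and Sq: "continuous_on disc Sq" and S0: "\<And>z. z \<in> disc \<Longrightarrow> 0 \<le> S z"
    and D: "\<And>z. z \<in> disc \<Longrightarrow> S z < 2 \<Longrightarrow> rho z * cmod (Sq z) \<le> B"
  defines "X \<equiv> \<lambda>z. max 0 (1 - S z / 2)"
  shows "(\<integral>z. (cmod (f z))\<^sup>2 * ((X z)\<^sup>2 * (rpot \<nu> 1 z)\<^sup>2) \<partial>dA) \<le>
     260 * (\<integral>z. (cmod (f z))\<^sup>2 * ((X z)\<^sup>2 * (cmod (pot (cr \<nu>) 2 0 z))\<^sup>2) \<partial>dA) +
     1600 * (\<integral>z. (cmod (f z))\<^sup>2 * ((X z)\<^sup>2 * ((rpot (eta2 \<nu>) 2 z)\<^sup>2 + (\<integral>\<zeta>. \<nu> \<zeta> \<partial>dA)\<^sup>2)) \<partial>dA) +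
     30 * (\<integral>z. (cmod (f z))\<^sup>2 * (if S z < 2 then (rho z * cmod (Sq z))\<^sup>2 * (rpot \<nu> 1 z)\<^sup>2 else 0) \<partial>dA)"
proof -
  define \<epsilon> where "\<epsilon> n = 1 / real (n + 2)" for n
  have \<epsilon>: "0 < \<epsilon> n" "\<epsilon> n < 1" for n by (auto simp: \<epsilon>_def)
  have \<epsilon>0: "\<epsilon> \<longlonglongrightarrow> 0"
    unfolding \<epsilon>_def using LIMSEQ_ignore_initial_segment[OF lim_1_over_n, of 2] by simp
  define Y where "Y n z = S z / 2 + \<epsilon> n / rho z" for n z
  define Yq where "Yq n z = Sq z / 2 + of_real (\<epsilon> n / (rho z)\<^sup>2) * z" for n z
  define Xn where "Xn n z = max 0 (1 - Y n z)" for n z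
  define N where "N = rpot \<nu> 1"
  define F where "F z = cmod (pot (cr \<nu>) 2 0 z)" for z
  define H where "H z = (rpot (eta2 \<nu>) 2 z)\<^sup>2 + (\<integral>\<zeta>. \<nu> \<zeta> \<partial>dA)\<^sup>2" for z
  define f2 where "f2 z = (cmod (f z))\<^sup>2" for z
  define E where "E z = (if S z < 2 then (rho z * cmod (Sq z))\<^sup>2 * (N z)\<^sup>2 else 0)" for z
  define e where "e n z = (if \<epsilon> n < rho z then (\<epsilon> n / rho z)\<^sup>2 * (N z)\<^sup>2 else 0)" for n z
  note fL = A2_L2[OF f]
  have cS: "continuous_on disc S"
  proof -
    have "continuous_on disc (\<lambda>z. Re (of_real (S z)))"
      by (intro continuous_on_Re wirt_imp_continuous_on[OF S])
    then show ?thesis by simp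
  qed
  have mS [measurable]: "S \<in> borel_measurable dA" by (rule measurable_dA_continuous[OF cS])
  have mSq [measurable]: "Sq \<in> borel_measurable dA" by (rule measurable_dA_continuous[OF Sq])
  have mr [measurable]: "rho \<in> borel_measurable dA" by (rule measurable_rho)
  have mN [measurable]: "N \<in> borel_measurable dA" unfolding N_def by (rule measurable_rpot[OF \<nu>])
  have mF [measurable]: "F \<in> borel_measurable dA" unfolding F_def
    using measurable_pot[OF rcsupp_csupp[OF \<nu>]] by simp
  have mH [measurable]: "H \<in> borel_measurable dA" unfolding H_def
    using measurable_rpot[OF rcsupp_eta2[OF \<nu>]] by simp
  have mX [measurable]: "X \<in> borel_measurable dA" unfolding X_def by measurable
  have mXn [measurable]: "Xn n \<in> borel_measurable dA" for n unfolding Xn_def Y_def by measurable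
  have me [measurable]: "e n \<in> borel_measurable dA" for n unfolding e_def by measurable
  have mE [measurable]: "E \<in> borel_measurable dA" unfolding E_def by measurable
  obtain BN where BN: "\<And>z. z \<in> disc \<Longrightarrow> \<bar>N z\<bar> \<le> BN" using rpot_bounded[OF \<nu>, of 1] unfolding N_def by blast
  obtain BF where BF: "\<And>z. z \<in> disc \<Longrightarrow> F z \<le> BF"
    using norm_pot_le[OF rcsupp_csupp[OF \<nu>], of _ 2 0] by (auto simp: F_def)
  obtain BH where BH: "\<And>z. z \<in> disc \<Longrightarrow> \<bar>rpot (eta2 \<nu>) 2 z\<bar> \<le> BH"
    using rpot_bounded[OF rcsupp_eta2[OF \<nu>], of 2] by blast
  have N2: "(N z)\<^sup>2 \<le> BN\<^sup>2" if "z \<in> disc" for z using power_mono[OF BN[OF that], of 2] by simp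
  have F2: "(F z)\<^sup>2 \<le> BF\<^sup>2" if "z \<in> disc" for z using power_mono[OF BF[OF that], of 2] by (simp add: F_def)
  have H2: "\<bar>H z\<bar> \<le> BH\<^sup>2 + (\<integral>\<zeta>. \<nu> \<zeta> \<partial>dA)\<^sup>2" if "z \<in> disc" for z using power_mono[OF BH[OF that], of 2] by (simp add: H_def)
  have XX: "0 \<le> Xn n z" "Xn n z \<le> X z" "X z \<le> 1" if "z \<in> disc" for n z
    using S0[OF that] divide_nonneg_pos[OF less_imp_le[OF \<epsilon>(1)[of n]] rho_pos[OF that]]
    by (auto simp: Xn_def X_def Y_def)
  have X2: "(Xn n z)\<^sup>2 \<le> (X z)\<^sup>2" "(X z)\<^sup>2 \<le> 1" if "z \<in> disc" for n z
  proof -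
    have "0 \<le> X z" by (simp add: X_def)
    then show "(Xn n z)\<^sup>2 \<le> (X z)\<^sup>2" "(X z)\<^sup>2 \<le> 1"
      using XX[OF that] by (auto intro: power_mono power_le_one)
  qed
  have prod1: "0 \<le> a \<Longrightarrow> a \<le> 1 \<Longrightarrow> 0 \<le> b \<Longrightarrow> b \<le> c \<Longrightarrow> \<bar>a * b\<bar> \<le> c" for a b c :: real
    using mult_mono[of a 1 b c] by simp
  have iF: "integrable dA (\<lambda>z. f2 z * ((X z)\<^sup>2 * (F z)\<^sup>2))"
    unfolding f2_def by (rule integrable_square_mult_bounded[OF fL, where B = "BF\<^sup>2"]) (measurable, intro prod1 F2 zero_le_power2 X2(2))
  have iFn: "integrable dA (\<lambda>z. f2 z * ((Xn n z)\<^sup>2 * (F z)\<^sup>2))" for n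
    unfolding f2_def by (rule integrable_square_mult_bounded[OF fL, where B = "BF\<^sup>2"]) (measurable, intro prod1 F2 zero_le_power2 order_trans[OF X2(1) X2(2)])
  have H0: "0 \<le> H z" for z by (simp add: H_def)
  have iH: "integrable dA (\<lambda>z. f2 z * ((X z)\<^sup>2 * H z))"
    unfolding f2_def by (rule integrable_square_mult_bounded[OF fL, where B = "BH\<^sup>2 + (\<integral>\<zeta>. \<nu> \<zeta> \<partial>dA)\<^sup>2"]) (measurable, intro prod1 order_trans[OF abs_ge_self H2] H0 zero_le_power2 X2(2))
  have iHn: "integrable dA (\<lambda>z. f2 z * ((Xn n z)\<^sup>2 * H z))" for n
    unfolding f2_def by (rule integrable_square_mult_bounded[OF fL, where B = "BH\<^sup>2 + (\<integral>\<zeta>. \<nu> \<zeta> \<partial>dA)\<^sup>2"]) (measurable, intro prod1 order_trans[OF abs_ge_self H2] H0 zero_le_power2 order_trans[OF X2(1) X2(2)])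
  have iE: "integrable dA (\<lambda>z. f2 z * E z)"
    unfolding f2_def
  proof (rule integrable_square_mult_bounded[OF fL])
    fix z assume z: "z \<in> disc"
    show "\<bar>E z\<bar> \<le> B\<^sup>2 * BN\<^sup>2"
    proof (cases "S z < 2")
      case True
      have "(rho z * cmod (Sq z))\<^sup>2 \<le> B\<^sup>2"
        using D[OF z True] rho_pos[OF z] by (intro power_mono) auto
      then show ?thesis using True N2[OF z] by (simp add: E_def mult_mono)
    qed (simp add: E_def)
  qed measurable
  have eb: "\<bar>e n z\<bar> \<le> BN\<^sup>2" if "z \<in> disc" for n z
  proof (cases "\<epsilon> n < rho z")
    case True
    have "(\<epsilon> n / rho z)\<^sup>2 \<le> 1"
      using True \<epsilon>[of n] rho_pos[OF that] by (intro power_le_one) auto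
    then show ?thesis using True N2[OF that] prod1 by (simp add: e_def)
  qed (simp add: e_def)
  have ie: "integrable dA (\<lambda>z. f2 z * e n z)" for n
    unfolding f2_def by (rule integrable_square_mult_bounded[OF fL, where B = "BN\<^sup>2"]) (measurable, rule eb)
  have main: "(\<integral>z. f2 z * ((Xn n z)\<^sup>2 * (N z)\<^sup>2) \<partial>dA) \<le>
     260 * (\<integral>z. f2 z * ((X z)\<^sup>2 * (F z)\<^sup>2) \<partial>dA) + 1600 * (\<integral>z. f2 z * ((X z)\<^sup>2 * H z) \<partial>dA) + 30 * (\<integral>z. f2 z * E z \<partial>dA)
     + 120 * (\<integral>z. f2 z * e n z \<partial>dA)" for n
  proof -
    have wY: "wirt (\<lambda>z. of_real (Y n z)) z (cnj (Yq n z)) (Yq n z)" if "z \<in> disc" for z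
      using wirt_add[OF wirt_mult[OF wirt_const[of "1/2"] S[OF that]] wirt_inverse_rho[OF that, of "\<epsilon> n"]]
      by (simp add: Y_def Yq_def)
    have rn: "z \<in> disc \<Longrightarrow> rho z \<noteq> 0" for z using rho_pos[of z] by auto
    have cYq: "continuous_on disc (Yq n)"
      unfolding Yq_def[abs_def] using rn by (intro continuous_intros Sq) auto
    define R where "R = sqrt (1 - \<epsilon> n)"
    have R: "0 \<le> R" "R < 1" using \<epsilon>[of n] by (auto simp: R_def)
    have Y1: "1 \<le> Y n z" if "z \<in> disc" "R < cmod z" for z
    proof -
      have "R\<^sup>2 < (cmod z)\<^sup>2" using that(2) R by (intro power_strict_mono) auto
      then have "rho z < \<epsilon> n" using \<epsilon>[of n] by (simp add: rho_def R_def)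
      then have "1 \<le> \<epsilon> n / rho z" using rho_pos[OF that(1)] by simp
      then show ?thesis using S0[OF that(1)] by (simp add: Y_def)
    qed
    have eq1: "(if Y n z < 1 then (max 0 (1 - Y n z))\<^sup>2 * (cmod (f z))\<^sup>2 * c else 0) = f2 z * ((Xn n z)\<^sup>2 * c)" for z c
      by (auto simp: Xn_def f2_def)
    have H: "(\<integral>z. f2 z * ((Xn n z)\<^sup>2 * (N z)\<^sup>2) \<partial>dA) \<le>
     260 * (\<integral>z. f2 z * ((Xn n z)\<^sup>2 * (F z)\<^sup>2) \<partial>dA) + 1600 * (\<integral>z. f2 z * ((Xn n z)\<^sup>2 * H z) \<partial>dA)
      + 60 * (\<integral>z. (if Y n z < 1 then (rho z * cmod (Yq n z))\<^sup>2 * (cmod (f z))\<^sup>2 * (N z)\<^sup>2 else 0) \<partial>dA)"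
      using hardy_inequality[OF f \<nu> wY cYq R Y1] unfolding eq1 N_def F_def H_def by simp
    have "(\<integral>z. f2 z * ((Xn n z)\<^sup>2 * (F z)\<^sup>2) \<partial>dA) \<le> (\<integral>z. f2 z * ((X z)\<^sup>2 * (F z)\<^sup>2) \<partial>dA)"
      by (rule integral_mono[OF iFn iF]) (auto simp: f2_def intro!: mult_left_mono mult_right_mono X2)
    moreover have "(\<integral>z. f2 z * ((Xn n z)\<^sup>2 * H z) \<partial>dA) \<le> (\<integral>z. f2 z * ((X z)\<^sup>2 * H z) \<partial>dA)"
      by (rule integral_mono[OF iHn iH]) (auto simp: f2_def intro!: mult_left_mono mult_right_mono X2 H0)
    moreover have "(\<integral>z. (if Y n z < 1 then (rho z * cmod (Yq n z))\<^sup>2 * (cmod (f z))\<^sup>2 * (N z)\<^sup>2 else 0) \<partial>dA)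
       \<le> (\<integral>z. 1/2 * (f2 z * E z) + 2 * (f2 z * e n z) \<partial>dA)"
    proof (rule integral_mono_AE')
      show "integrable dA (\<lambda>z. 1/2 * (f2 z * E z) + 2 * (f2 z * e n z))" using iE ie by simp
      have pos: "0 \<le> 1/2 * (f2 z * E z) + 2 * (f2 z * e n z)" for z
        by (simp add: f2_def E_def e_def)
      show "AE z in dA. 0 \<le> 1/2 * (f2 z * E z) + 2 * (f2 z * e n z)" using pos by simp
      show "AE z in dA. (if Y n z < 1 then (rho z * cmod (Yq n z))\<^sup>2 * (cmod (f z))\<^sup>2 * (N z)\<^sup>2 else 0) \<le> 1/2 * (f2 z * E z) + 2 * (f2 z * e n z)"
      proof (rule AE_I2)
        fix z assume "z \<in> space dA"
        then have z: "z \<in> disc" by simp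
        have r: "0 < rho z" by (rule rho_pos[OF z])
        show "(if Y n z < 1 then (rho z * cmod (Yq n z))\<^sup>2 * (cmod (f z))\<^sup>2 * (N z)\<^sup>2 else 0) \<le> 1/2 * (f2 z * E z) + 2 * (f2 z * e n z)"
        proof (cases "Y n z < 1")
          case True
          have er: "\<epsilon> n / rho z < 1" "S z < 2"
            using True S0[OF z] divide_pos_pos[OF \<epsilon>(1)[of n] r] unfolding Y_def by linarith+
          then have er': "\<epsilon> n < rho z" using r by simp
          define b where "b = rho z * cmod (Sq z)"
          define c where "c = \<epsilon> n / rho z"
          have "cmod (Yq n z) \<le> cmod (Sq z) / 2 + \<epsilon> n / (rho z)\<^sup>2 * cmod z"
            unfolding Yq_def using norm_triangle_ineq[of "Sq z / 2" "of_real (\<epsilon> n / (rho z)\<^sup>2) * z"] \<epsilon>[of n]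
            by (simp add: norm_mult norm_divide del: of_real_divide of_real_power)
          also have "\<epsilon> n / (rho z)\<^sup>2 * cmod z \<le> \<epsilon> n / (rho z)\<^sup>2 * 1"
            using z \<epsilon>[of n] by (intro mult_left_mono) (auto simp: disc_iff)
          finally have "rho z * cmod (Yq n z) \<le> rho z * (cmod (Sq z) / 2 + \<epsilon> n / (rho z)\<^sup>2 * 1)"
            using r by (intro mult_left_mono) auto
          also have "\<dots> = b / 2 + c" using r by (simp add: b_def c_def field_simps power2_eq_square)
          finally have "(rho z * cmod (Yq n z))\<^sup>2 \<le> (b / 2 + c)\<^sup>2" using r by (intro power_mono) auto
          \<comment> \<open>The gradient of \<open>S\<close> keeps the coefficient
            \<open>60 / 2 = 30\<close>; the rest is put on the term that vanishes in the
            limit.\<close>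
          also have "\<dots> \<le> 1/2 * b\<^sup>2 + 2 * c\<^sup>2"
            using zero_le_power2[of "b / 2 - c"] by (simp add: power2_eq_square field_simps)
          finally have "(rho z * cmod (Yq n z))\<^sup>2 * (f2 z * (N z)\<^sup>2) \<le> (1/2 * b\<^sup>2 + 2 * c\<^sup>2) * (f2 z * (N z)\<^sup>2)"
            by (rule mult_right_mono) (simp add: f2_def)
          then show ?thesis using True er er' by (simp add: E_def e_def b_def c_def f2_def algebra_simps)
        next
          case False
          then show ?thesis using pos by simp
        qed
      qed
    qed
    moreover have "(\<integral>z. 1/2 * (f2 z * E z) + 2 * (f2 z * e n z) \<partial>dA) = 1/2 * (\<integral>z. f2 z * E z \<partial>dA) + 2 * (\<integral>z. f2 z * e n z \<partial>dA)"
      using iE ie[of n] by (simp add: integral_add)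
    ultimately show ?thesis using H by simp
  qed
  have l1: "(\<lambda>n. \<integral>z. f2 z * ((Xn n z)\<^sup>2 * (N z)\<^sup>2) \<partial>dA) \<longlonglongrightarrow> (\<integral>z. f2 z * ((X z)\<^sup>2 * (N z)\<^sup>2) \<partial>dA)"
  proof (rule integral_dominated_convergence[where w = "\<lambda>z. f2 z * BN\<^sup>2"])
    show "integrable dA (\<lambda>z. f2 z * BN\<^sup>2)" unfolding f2_def using L2_integrable_square[OF fL] by simp
    have [measurable]: "f2 \<in> borel_measurable dA" unfolding f2_def using L2_measurable[OF fL] by simp
    show "(\<lambda>z. f2 z * ((X z)\<^sup>2 * (N z)\<^sup>2)) \<in> borel_measurable dA" by measurable
    show "(\<lambda>z. f2 z * ((Xn n z)\<^sup>2 * (N z)\<^sup>2)) \<in> borel_measurable dA" for n by measurable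
    show "AE z in dA. (\<lambda>n. f2 z * ((Xn n z)\<^sup>2 * (N z)\<^sup>2)) \<longlonglongrightarrow> f2 z * ((X z)\<^sup>2 * (N z)\<^sup>2)"
    proof (rule AE_I2)
      fix z assume "z \<in> space dA"
      then have "rho z \<noteq> 0" using rho_pos[of z] by auto
      then have "(\<lambda>n. f2 z * ((Xn n z)\<^sup>2 * (N z)\<^sup>2)) \<longlonglongrightarrow> f2 z * ((max 0 (1 - (S z / 2 + 0 / rho z)))\<^sup>2 * (N z)\<^sup>2)"
        unfolding Xn_def Y_def by (intro tendsto_intros \<epsilon>0)
      then show "(\<lambda>n. f2 z * ((Xn n z)\<^sup>2 * (N z)\<^sup>2)) \<longlonglongrightarrow> f2 z * ((X z)\<^sup>2 * (N z)\<^sup>2)" by (simp add: X_def)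
    qed
    show "AE z in dA. norm (f2 z * ((Xn n z)\<^sup>2 * (N z)\<^sup>2)) \<le> f2 z * BN\<^sup>2" for n
    proof (rule AE_I2)
      fix z assume "z \<in> space dA"
      then have z: "z \<in> disc" by simp
      have "\<bar>(Xn n z)\<^sup>2 * (N z)\<^sup>2\<bar> \<le> BN\<^sup>2" by (intro prod1 N2[OF z] zero_le_power2 order_trans[OF X2(1)[OF z] X2(2)[OF z]])
      then show "norm (f2 z * ((Xn n z)\<^sup>2 * (N z)\<^sup>2)) \<le> f2 z * BN\<^sup>2"
        by (simp add: abs_mult f2_def mult_left_mono)
    qed
  qed
  have l2: "(\<lambda>n. \<integral>z. f2 z * e n z \<partial>dA) \<longlonglongrightarrow> (\<integral>z. 0 \<partial>dA)"
  proof (rule integral_dominated_convergence[where w = "\<lambda>z. f2 z * BN\<^sup>2"])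
    show "integrable dA (\<lambda>z. f2 z * BN\<^sup>2)" unfolding f2_def using L2_integrable_square[OF fL] by simp
    have [measurable]: "f2 \<in> borel_measurable dA" unfolding f2_def using L2_measurable[OF fL] by simp
    show "(\<lambda>z. f2 z * e n z) \<in> borel_measurable dA" for n by measurable
    show "AE z in dA. (\<lambda>n. f2 z * e n z) \<longlonglongrightarrow> 0"
    proof (rule AE_I2)
      fix z assume "z \<in> space dA"
      then have r: "rho z > 0" using rho_pos[of z] by auto
      then have "(\<lambda>n. f2 z * ((\<epsilon> n / rho z)\<^sup>2 * (N z)\<^sup>2)) \<longlonglongrightarrow> f2 z * ((0 / rho z)\<^sup>2 * (N z)\<^sup>2)"
        by (intro tendsto_intros \<epsilon>0) auto
      moreover have "\<forall>\<^sub>F n in sequentially. \<epsilon> n < rho z" using \<epsilon>0 r by (rule order_tendstoD)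
      then have "\<forall>\<^sub>F n in sequentially. f2 z * ((\<epsilon> n / rho z)\<^sup>2 * (N z)\<^sup>2) = f2 z * e n z"
        by eventually_elim (simp add: e_def)
      ultimately show "(\<lambda>n. f2 z * e n z) \<longlonglongrightarrow> 0" by (simp add: tendsto_cong)
    qed
    show "AE z in dA. norm (f2 z * e n z) \<le> f2 z * BN\<^sup>2" for n
      using eb by (intro AE_I2) (simp add: abs_mult f2_def mult_left_mono)
  qed simp
  have "(\<integral>z. f2 z * ((X z)\<^sup>2 * (N z)\<^sup>2) \<partial>dA) \<le>
     260 * (\<integral>z. f2 z * ((X z)\<^sup>2 * (F z)\<^sup>2) \<partial>dA) + 1600 * (\<integral>z. f2 z * ((X z)\<^sup>2 * H z) \<partial>dA) + 30 * (\<integral>z. f2 z * E z \<partial>dA)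
     + 120 * (\<integral>z. 0 \<partial>dA)"
    by (rule LIMSEQ_le[OF l1 tendsto_add[OF tendsto_const tendsto_mult[OF tendsto_const l2]]]) (use main in auto)
  then show ?thesis
    unfolding f2_def N_def F_def H_def E_def by simp
qed

lemma hardy_global:
  assumes f: "A2 f" and \<nu>: "rcsupp s \<nu>"
  shows "(\<integral>z. (cmod (f z))\<^sup>2 * (rpot \<nu> 1 z)\<^sup>2 \<partial>dA) \<le>
     260 * (\<integral>z. (cmod (f z))\<^sup>2 * (cmod (pot (cr \<nu>) 2 0 z))\<^sup>2 \<partial>dA) +
     1600 * (\<integral>z. (cmod (f z))\<^sup>2 * ((rpot (eta2 \<nu>) 2 z)\<^sup>2 + (\<integral>\<zeta>. \<nu> \<zeta> \<partial>dA)\<^sup>2) \<partial>dA)"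
  using hardy_limit[OF f \<nu>, of "\<lambda>_. 0" "\<lambda>_. 0" 0] by (simp add: wirt_const)

section \<open>Interaction of separated level sets\<close>

lemma dyadic_below:
  fixes x :: real
  assumes "0 < x" "x < 1"
  shows "\<exists>n. (1/2) ^ Suc n \<le> x \<and> x < (1/2) ^ n"
proof -
  obtain m where "(1/2::real) ^ m < x" using real_arch_pow_inv[OF assms(1), of "1/2"] by auto
  then have ex: "\<exists>m. (1/2::real) ^ m \<le> x" by (auto intro: less_imp_le)
  define M where "M = (LEAST m. (1/2::real) ^ m \<le> x)"
  have M: "(1/2) ^ M \<le> x" unfolding M_def by (rule LeastI_ex[OF ex])
  then have "M \<noteq> 0" using assms(2) by (cases M) auto
  then obtain n where n: "M = Suc n" by (cases M) auto
  then have "\<not> (1/2) ^ n \<le> x" unfolding M_def using not_less_Least[of n "\<lambda>m. (1/2::real) ^ m \<le> x"] by simp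
  with M n show ?thesis by auto
qed

lemma dyadic_above:
  fixes x :: real
  assumes "1 \<le> x"
  shows "\<exists>n. 2 ^ n \<le> x \<and> x < 2 ^ Suc n"
proof -
  have ex: "\<exists>m. x < 2 ^ m" using real_arch_pow[of 2 x] by auto
  define M where "M = (LEAST m. x < 2 ^ m)"
  have M: "x < 2 ^ M" unfolding M_def by (rule LeastI_ex[OF ex])
  then have "M \<noteq> 0" using assms by (cases M) auto
  then obtain n where n: "M = Suc n" by (cases M) auto
  then have "\<not> x < 2 ^ n" unfolding M_def using not_less_Least[of n "\<lambda>m. x < 2 ^ m"] by simp
  with M n show ?thesis by (auto intro!: exI[of _ n])
qed

lemma ennreal_le_suminf: "(f n :: ennreal) \<le> (\<Sum>n. f n)"
  using sum_le_suminf[of f "{n}"] by simp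

text \<open>The set where \<open>T < t n\<close> lies in a disc of radius \<open>t n\<close> about
  \<open>c\<close>, whose normalized area is at most \<open>(t n)^2\<close>.\<close>

lemma nn_integral_layers:
  assumes T: "T \<in> borel_measurable dA" "\<And>z. z \<in> disc \<Longrightarrow> cmod (z - c) \<le> T z"
    and h: "\<And>n. 0 \<le> h n" "\<And>n. 0 \<le> t n" and sm: "(\<lambda>n. h n * (t n)\<^sup>2) sums x"
  shows "(\<integral>\<^sup>+z. (\<Sum>n. ennreal (h n) * indicator {z. T z < t n} z) \<partial>dA) \<le> ennreal x"
proof -
  have Tm: "{z \<in> disc. T z < t n} \<in> sets dA" for n
  proof -
    have "{z \<in> space dA. T z < t n} \<in> sets dA" using T(1) by measurable
    then show ?thesis by simp
  qed
  have eq: "(\<integral>\<^sup>+z. ennreal (h n) * indicator {z. T z < t n} z \<partial>dA) = (\<integral>\<^sup>+z. ennreal (h n) * indicator {z \<in> disc. T z < t n} z \<partial>dA)" for n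
    by (rule nn_integral_cong) (auto simp: indicator_def)
  have "(\<integral>\<^sup>+z. (\<Sum>n. ennreal (h n) * indicator {z. T z < t n} z) \<partial>dA) = (\<Sum>n. \<integral>\<^sup>+z. ennreal (h n) * indicator {z. T z < t n} z \<partial>dA)"
    using T(1) by (intro nn_integral_suminf) measurable
  also have "\<dots> \<le> (\<Sum>n. ennreal (h n * (t n)\<^sup>2))"
  proof (intro suminf_le summableI)
    fix n
    have "(\<integral>\<^sup>+z. ennreal (h n) * indicator {z \<in> disc. T z < t n} z \<partial>dA) = ennreal (h n) * emeasure dA {z \<in> disc. T z < t n}"
      by (rule nn_integral_cmult_indicator[OF Tm])
    also have "emeasure dA {z \<in> disc. T z < t n} \<le> emeasure dA (ball c (t n) \<inter> disc)"
    proof (rule emeasure_mono)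
      show "{z \<in> disc. T z < t n} \<subseteq> ball c (t n) \<inter> disc"
        using T(2) by (force simp: dist_norm norm_minus_commute)
      show "ball c (t n) \<inter> disc \<in> sets dA" by (simp add: sets_dA sets_restrict_space_iff)
    qed
    also have "\<dots> \<le> ennreal ((t n)\<^sup>2)" by (rule emeasure_dA_ball[OF h(2)])
    finally show "(\<integral>\<^sup>+z. ennreal (h n) * indicator {z. T z < t n} z \<partial>dA) \<le> ennreal (h n * (t n)\<^sup>2)"
      unfolding eq using h(1)[of n] by (simp add: ennreal_mult mult_left_mono)
  qed
  also have "\<dots> = ennreal x"
    by (rule suminf_ennreal_eq[OF _ sm]) (simp add: h)
  finally show ?thesis .
qed

text \<open>Dyadic layers: below \<delta> the integrand is of size
  \<open>1 / (T * \<delta>^3)\<close>, above it of size \<open>1 / T^4\<close>. The two geometric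
  series sum to \<open>4 / \<delta>^2\<close> and \<open>(16/3) / \<delta>^2\<close>.\<close>

lemma radial_integral_bound:
  assumes T: "T \<in> borel_measurable dA" "\<And>z. z \<in> disc \<Longrightarrow> cmod (z - c) \<le> T z" "\<And>z. z \<in> disc \<Longrightarrow> 0 < T z"
    and \<delta>: "\<delta> > 0"
  shows "(\<integral>\<^sup>+z. ennreal (1 / (T z * (\<delta> + T z)^3)) \<partial>dA) \<le> ennreal (10 / \<delta>\<^sup>2)"
proof -
  let ?A = "\<lambda>z. \<Sum>n. ennreal (2 ^ Suc n / \<delta>^4) * indicator {z. T z < \<delta> * (1/2) ^ n} z :: ennreal"
  let ?B = "\<lambda>z. \<Sum>n. ennreal (1 / (\<delta> * 2 ^ n)^4) * indicator {z. T z < \<delta> * 2 ^ Suc n} z :: ennreal"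
  have pw: "ennreal (1 / (T z * (\<delta> + T z)^3)) \<le> ?A z + ?B z" if z: "z \<in> disc" for z
  proof (cases "T z < \<delta>")
    case True
    obtain n where n: "(1/2) ^ Suc n \<le> T z / \<delta>" "T z / \<delta> < (1/2) ^ n"
      using dyadic_below[of "T z / \<delta>"] T(3)[OF z] True \<delta> by auto
    have "1 / (T z * (\<delta> + T z)^3) \<le> 1 / ((\<delta> * (1/2) ^ Suc n) * \<delta>^3)"
      using n(1) \<delta> T(3)[OF z] by (intro divide_left_mono mult_mono power_mono mult_pos_pos) (auto simp: field_simps)
    also have "\<dots> = 2 ^ Suc n / \<delta>^4" using \<delta> by (simp add: field_simps power_one_over power3_eq_cube power4_eq_xxxx)
    finally have "ennreal (1 / (T z * (\<delta> + T z)^3)) \<le> ennreal (2 ^ Suc n / \<delta>^4) * indicator {z. T z < \<delta> * (1/2) ^ n} z"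
      using n(2) \<delta> by (simp add: field_simps indicator_def ennreal_leI)
    also have "\<dots> \<le> ?A z" by (rule ennreal_le_suminf)
    finally show ?thesis by (simp add: add_increasing2)
  next
    case False
    obtain n where n: "2 ^ n \<le> T z / \<delta>" "T z / \<delta> < 2 ^ Suc n"
      using dyadic_above[of "T z / \<delta>"] False \<delta> by auto
    have n1: "\<delta> * 2 ^ n \<le> T z" using n(1) \<delta> by (simp add: field_simps)
    have "1 / (T z * (\<delta> + T z)^3) \<le> 1 / ((\<delta> * 2 ^ n) * (\<delta> * 2 ^ n)^3)"
      using n1 \<delta> T(3)[OF z] by (intro divide_left_mono mult_mono power_mono mult_pos_pos) auto
    also have "\<dots> = 1 / (\<delta> * 2 ^ n)^4" by (simp add: power3_eq_cube power4_eq_xxxx mult_ac)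
    finally have "ennreal (1 / (T z * (\<delta> + T z)^3)) \<le> ennreal (1 / (\<delta> * 2 ^ n)^4) * indicator {z. T z < \<delta> * 2 ^ Suc n} z"
      using n(2) \<delta> by (simp add: field_simps indicator_def ennreal_leI)
    also have "\<dots> \<le> ?B z" by (rule ennreal_le_suminf)
    finally show ?thesis by (simp add: add_increasing)
  qed
  have sA: "(\<lambda>n. 2 ^ Suc n / \<delta>^4 * (\<delta> * (1/2) ^ n)\<^sup>2) sums (4 / \<delta>\<^sup>2)"
  proof -
    have "(\<lambda>n. 2 / \<delta>\<^sup>2 * (1/2) ^ n) sums (2 / \<delta>\<^sup>2 * (1 / (1 - 1/2)))" by (intro sums_mult geometric_sums) simp
    moreover have "2 ^ Suc n / \<delta>^4 * (\<delta> * (1/2) ^ n)\<^sup>2 = 2 / \<delta>\<^sup>2 * (1/2) ^ n" for n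
      using \<delta> by (simp add: power_one_over field_simps power2_eq_square power4_eq_xxxx)
    ultimately show ?thesis by simp
  qed
  have sB: "(\<lambda>n. 1 / (\<delta> * 2 ^ n)^4 * (\<delta> * 2 ^ Suc n)\<^sup>2) sums (16/3 / \<delta>\<^sup>2)"
  proof -
    have "(\<lambda>n. 4 / \<delta>\<^sup>2 * (1/4) ^ n) sums (4 / \<delta>\<^sup>2 * (1 / (1 - 1/4)))" by (intro sums_mult geometric_sums) simp
    moreover have "1 / (\<delta> * 2 ^ n)^4 * (\<delta> * 2 ^ Suc n)\<^sup>2 = 4 / \<delta>\<^sup>2 * (1/4) ^ n" for n
    proof -
      have "(4::real) ^ n = 2 ^ n * 2 ^ n" by (simp flip: power_mult_distrib)
      then show ?thesis using \<delta> by (simp add: power_one_over field_simps power2_eq_square power4_eq_xxxx)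
    qed
    moreover have "4 / \<delta>\<^sup>2 * (1 / (1 - 1/4)) = 16/3 / \<delta>\<^sup>2" by simp
    ultimately show ?thesis by (simp only:)
  qed
  have mT [measurable]: "T \<in> borel_measurable dA" by (rule T(1))
  have "(\<integral>\<^sup>+z. ennreal (1 / (T z * (\<delta> + T z)^3)) \<partial>dA) \<le> (\<integral>\<^sup>+z. ?A z + ?B z \<partial>dA)"
    by (rule nn_integral_mono) (use pw in simp)
  also have "\<dots> = (\<integral>\<^sup>+z. ?A z \<partial>dA) + (\<integral>\<^sup>+z. ?B z \<partial>dA)"
    by (rule nn_integral_add) measurable
  also have "\<dots> \<le> ennreal (4 / \<delta>\<^sup>2) + ennreal (16/3 / \<delta>\<^sup>2)"
    using \<delta> by (intro add_mono nn_integral_layers[OF T(1,2) _ _ sA] nn_integral_layers[OF T(1,2) _ _ sB]) auto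
  also have "\<dots> = ennreal (28/3 / \<delta>\<^sup>2)" by (simp flip: ennreal_plus add: field_simps)
  also have "\<dots> \<le> ennreal (10 / \<delta>\<^sup>2)" by (intro ennreal_leI divide_right_mono) auto
  finally show ?thesis .
qed

lemma measurable_dd: "(\<lambda>z. dd z w) \<in> borel_measurable dA"
  unfolding dd_def by (intro measurable_dA_continuous continuous_intros)

text \<open>The heights are spent by \<open>rho <= 2 * dd\<close>: \<open>rho z^3\<close> on the
  nearer of \<zeta> and \<open>w\<close>, \<open>rho w^2\<close> on \<open>w\<close>. This leaves at
  most 32 over the smaller distance times the cube of the larger one, and the larger is at least a
  third of \<delta> plus the smaller. So \<open>radial_integral_bound\<close> applies about each
  point; \<open>864 = 32 * 27\<close> and \<open>17280 = 2 * 10 * 864\<close>.\<close>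

lemma kernel_composition:
  assumes \<zeta>: "\<zeta> \<in> disc" and w: "w \<in> disc"
  shows "(\<integral>\<^sup>+z. ennreal ((rho z)^3 * (rho w)\<^sup>2 * (cmod (kern z \<zeta>))^4 * (cmod (kern z w))^5) \<partial>dA)
    \<le> ennreal (17280 * (cmod (kern \<zeta> w))\<^sup>2)"
proof -
  define \<delta> where "\<delta> = dd w \<zeta>"
  have \<delta>: "\<delta> > 0" unfolding \<delta>_def by (rule dd_pos[OF w \<zeta>])
  have [measurable]: "(\<lambda>z. dd z v) \<in> borel_measurable dA" for v by (rule measurable_dd)
  have pw: "(rho z)^3 * (rho w)\<^sup>2 * (cmod (kern z \<zeta>))^4 * (cmod (kern z w))^5
      \<le> 864 * (1 / (dd z \<zeta> * (\<delta> + dd z \<zeta>)^3)) + 864 * (1 / (dd z w * (\<delta> + dd z w)^3))" if z: "z \<in> disc" for z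
  proof -
    define p where "p = dd z \<zeta>"
    define q where "q = dd z w"
    have pq: "p > 0" "q > 0" unfolding p_def q_def using dd_pos z \<zeta> w by auto
    have r: "0 < rho z" "rho z \<le> 2 * p" "rho z \<le> 2 * q" "0 < rho w" "rho w \<le> 2 * q"
      unfolding p_def q_def using rho_pos z w \<zeta> rho_le_dd rho_le_dd' by auto
    have tri: "\<delta> \<le> p + q" unfolding \<delta>_def p_def q_def using dd_triangle[OF w z \<zeta>] by (simp add: dd_commute)
    have n0: "0 \<le> 864 * (1 / (p * (\<delta> + p)^3))" "0 \<le> 864 * (1 / (q * (\<delta> + q)^3))" using pq \<delta> by auto
    have "(rho z)^3 * (rho w)\<^sup>2 * (1 / p)^4 * (1 / q)^5 \<le> 864 * (1 / (p * (\<delta> + p)^3)) + 864 * (1 / (q * (\<delta> + q)^3))"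
    proof (cases "p \<le> q")
      case True
      have "(rho z)^3 * (rho w)\<^sup>2 \<le> (2 * p)^3 * (2 * q)\<^sup>2"
        using r by (intro mult_mono power_mono) auto
      then have "(rho z)^3 * (rho w)\<^sup>2 * ((1 / p)^4 * (1 / q)^5) \<le> (2 * p)^3 * (2 * q)\<^sup>2 * ((1 / p)^4 * (1 / q)^5)"
        using pq by (intro mult_right_mono) auto
      also have "\<dots> = 32 * (1 / (p * q^3))" using pq by (simp add: field_simps eval_nat_numeral)
      also have "\<dots> \<le> 32 * (1 / (p * ((\<delta> + p) / 3)^3))"
        using pq \<delta> True tri by (intro mult_left_mono divide_left_mono power_mono mult_pos_pos) auto
      also have "\<dots> = 864 * (1 / (p * (\<delta> + p)^3))" using pq \<delta> by (simp add: power_divide)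
      finally show ?thesis using add_increasing2[OF n0(2)] by (simp only: mult.assoc)
    next
      case False
      have "(rho z)^3 * (rho w)\<^sup>2 \<le> (2 * q)^3 * (2 * q)\<^sup>2"
        using r by (intro mult_mono power_mono) auto
      then have "(rho z)^3 * (rho w)\<^sup>2 * ((1 / p)^4 * (1 / q)^5) \<le> (2 * q)^3 * (2 * q)\<^sup>2 * ((1 / p)^4 * (1 / q)^5)"
        using pq by (intro mult_right_mono) auto
      also have "\<dots> = 32 * (1 / (p * p^3))" using pq by (simp add: field_simps eval_nat_numeral)
      also have "\<dots> \<le> 32 * (1 / (q * ((\<delta> + q) / 3)^3))"
        using pq \<delta> False tri by (intro mult_left_mono divide_left_mono mult_mono power_mono mult_pos_pos) auto
      also have "\<dots> = 864 * (1 / (q * (\<delta> + q)^3))" using pq \<delta> by (simp add: power_divide)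
      finally show ?thesis using add_increasing[OF n0(1)] by (simp only: mult.assoc)
    qed
    then show ?thesis by (simp add: norm_kern p_def q_def)
  qed
  have e2: "ennreal (864 * A + 864 * B) = ennreal 864 * ennreal A + ennreal 864 * ennreal B" if "0 \<le> A" "0 \<le> B" for A B
    using that by (simp add: ennreal_plus ennreal_mult)
  have i: "(\<integral>\<^sup>+z. ennreal (1 / (dd z v * (\<delta> + dd z v)^3)) \<partial>dA) \<le> ennreal (10 / \<delta>\<^sup>2)" if v: "v \<in> disc" for v
    by (rule radial_integral_bound[OF measurable_dd norm_diff_le_dd dd_pos \<delta>]) (use v in auto)
  have "(\<integral>\<^sup>+z. ennreal ((rho z)^3 * (rho w)\<^sup>2 * (cmod (kern z \<zeta>))^4 * (cmod (kern z w))^5) \<partial>dA)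
    \<le> (\<integral>\<^sup>+z. ennreal 864 * ennreal (1 / (dd z \<zeta> * (\<delta> + dd z \<zeta>)^3)) + ennreal 864 * ennreal (1 / (dd z w * (\<delta> + dd z w)^3)) \<partial>dA)"
  proof (rule nn_integral_mono)
    fix z assume "z \<in> space dA"
    then have z: "z \<in> disc" by simp
    have n0: "0 \<le> 1 / (dd z v * (\<delta> + dd z v)^3)" for v using \<delta> by auto
    show "ennreal ((rho z)^3 * (rho w)\<^sup>2 * (cmod (kern z \<zeta>))^4 * (cmod (kern z w))^5)
      \<le> ennreal 864 * ennreal (1 / (dd z \<zeta> * (\<delta> + dd z \<zeta>)^3)) + ennreal 864 * ennreal (1 / (dd z w * (\<delta> + dd z w)^3))"
      using ennreal_leI[OF pw[OF z]] unfolding e2[OF n0 n0] .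
  qed
  also have "\<dots> = ennreal 864 * (\<integral>\<^sup>+z. ennreal (1 / (dd z \<zeta> * (\<delta> + dd z \<zeta>)^3)) \<partial>dA) + ennreal 864 * (\<integral>\<^sup>+z. ennreal (1 / (dd z w * (\<delta> + dd z w)^3)) \<partial>dA)"
    by (subst nn_integral_add; (subst nn_integral_cmult)?; measurable?; (subst nn_integral_cmult)?; measurable?; simp?)
  also have "\<dots> \<le> ennreal 864 * ennreal (10 / \<delta>\<^sup>2) + ennreal 864 * ennreal (10 / \<delta>\<^sup>2)"
    by (intro add_mono mult_left_mono i \<zeta> w) auto
  also have "\<dots> = ennreal (17280 / \<delta>\<^sup>2)"
    using e2[of "10 / \<delta>\<^sup>2" "10 / \<delta>\<^sup>2"] by simp
  also have "17280 / \<delta>\<^sup>2 = 17280 * (cmod (kern \<zeta> w))\<^sup>2"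
    by (simp add: norm_kern \<delta>_def dd_commute[of \<zeta>] power_divide)
  finally show ?thesis .
qed

lemma nn_integral_rpot:
  assumes "rcsupp s \<nu>" "z \<in> disc" "0 \<le> c"
  shows "(\<integral>\<^sup>+\<zeta>. ennreal (c * (\<nu> \<zeta> * (cmod (kern z \<zeta>)) ^ n)) \<partial>dA) = ennreal (c * (\<integral>\<zeta>. \<nu> \<zeta> * (cmod (kern z \<zeta>)) ^ n \<partial>dA))"
  using nn_integral_eq_integral[of dA "\<lambda>\<zeta>. c * (\<nu> \<zeta> * (cmod (kern z \<zeta>)) ^ n)"] integrable_rpot[OF assms(1,2), of n] rcsupp_nonneg[OF assms(1)] assms(3)
  by simp

lemma measurable_kern_pair: "(\<lambda>(z, \<zeta>). kern z \<zeta>) \<in> borel_measurable (dA \<Otimes>\<^sub>M dA)"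
  unfolding kern_def case_prod_unfold
  by (intro borel_measurable_divide borel_measurable_diff borel_measurable_times
      measurable_cnj measurable_dA_fst measurable_dA_snd borel_measurable_const)

text \<open>With the integral over z carried out first, \<open>kernel_composition\<close> returns
  the positive kernel between the points of \<nu> and the sources of \<open>a\<close>; integrating
  over the latter gives \<open>rpot a 1\<close>, which is at most \<Lambda> on the support of
  \<nu>.\<close>

lemma nn_integral_composition:
  assumes \<nu>: "rcsupp s \<nu>" and a: "rcsupp r a"
    and P: "\<And>\<zeta>. \<nu> \<zeta> \<noteq> 0 \<Longrightarrow> \<zeta> \<in> disc \<Longrightarrow> rpot a 1 \<zeta> \<le> \<Lambda>" and \<Lambda>: "0 \<le> \<Lambda>"
  shows "(\<integral>\<^sup>+z. ennreal (((rho z)\<^sup>2 * rpot \<nu> 2 z) * (rho z * (\<integral>w. eta2 a w * (cmod (kern z w))^5 \<partial>dA))) \<partial>dA)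
    \<le> ennreal (17280 * \<Lambda> * (\<integral>\<zeta>. \<nu> \<zeta> \<partial>dA))"
proof -
  define \<alpha> where "\<alpha> z \<zeta> = ennreal ((rho z)\<^sup>2 * (\<nu> \<zeta> * (cmod (kern z \<zeta>))^4))" for z \<zeta>
  define \<beta> where "\<beta> z w = ennreal (rho z * (eta2 a w * (cmod (kern z w))^5))" for z w
  have e: "rcsupp r (eta2 a)" by (rule rcsupp_eta2[OF a])
  have [measurable]: "\<nu> \<in> borel_measurable dA" "eta2 a \<in> borel_measurable dA" "rho \<in> borel_measurable dA"
    using rcsupp_integrable[OF \<nu>] rcsupp_integrable[OF e] measurable_rho by auto
  have [measurable]: "case_prod kern \<in> borel_measurable (dA \<Otimes>\<^sub>M dA)" using measurable_kern_pair by simp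
  have \<alpha>m [measurable]: "case_prod \<alpha> \<in> borel_measurable (dA \<Otimes>\<^sub>M dA)" unfolding \<alpha>_def by measurable
  have \<beta>m [measurable]: "case_prod \<beta> \<in> borel_measurable (dA \<Otimes>\<^sub>M dA)" unfolding \<beta>_def by measurable
  have \<alpha>z: "\<alpha> z \<in> borel_measurable dA" if "z \<in> disc" for z
    using measurable_compose[OF measurable_Pair1'[of z dA dA] \<alpha>m] that by simp
  have \<beta>z: "\<beta> z \<in> borel_measurable dA" if "z \<in> disc" for z
    using measurable_compose[OF measurable_Pair1'[of z dA dA] \<beta>m] that by simp
  have \<alpha>\<zeta>: "(\<lambda>z. \<alpha> z \<zeta>) \<in> borel_measurable dA" if "\<zeta> \<in> disc" for \<zeta>
    using measurable_compose[OF measurable_Pair2'[of \<zeta> dA dA] \<alpha>m] that by simp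
  have r0: "0 \<le> rho z" if "z \<in> disc" for z using rho_pos[OF that] by simp
  have "(\<integral>\<^sup>+z. ennreal (((rho z)\<^sup>2 * rpot \<nu> 2 z) * (rho z * (\<integral>w. eta2 a w * (cmod (kern z w))^5 \<partial>dA))) \<partial>dA)
     = (\<integral>\<^sup>+z. (\<integral>\<^sup>+\<zeta>. (\<integral>\<^sup>+w. \<alpha> z \<zeta> * \<beta> z w \<partial>dA) \<partial>dA) \<partial>dA)"
  proof (rule nn_integral_cong)
    fix z assume "z \<in> space dA"
    then have z: "z \<in> disc" by simp
    have 1: "(\<integral>\<^sup>+\<zeta>. \<alpha> z \<zeta> \<partial>dA) = ennreal ((rho z)\<^sup>2 * rpot \<nu> 2 z)"
      unfolding \<alpha>_def rpot_def using nn_integral_rpot[OF \<nu> z, of "(rho z)\<^sup>2" 4] by simp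
    have 2: "(\<integral>\<^sup>+w. \<beta> z w \<partial>dA) = ennreal (rho z * (\<integral>w. eta2 a w * (cmod (kern z w))^5 \<partial>dA))"
      unfolding \<beta>_def by (rule nn_integral_rpot[OF e z r0[OF z]])
    have "(\<integral>\<^sup>+\<zeta>. (\<integral>\<^sup>+w. \<alpha> z \<zeta> * \<beta> z w \<partial>dA) \<partial>dA) = (\<integral>\<^sup>+\<zeta>. \<alpha> z \<zeta> * (\<integral>\<^sup>+w. \<beta> z w \<partial>dA) \<partial>dA)"
      by (intro nn_integral_cong nn_integral_cmult \<beta>z z)
    also have "\<dots> = (\<integral>\<^sup>+\<zeta>. \<alpha> z \<zeta> \<partial>dA) * (\<integral>\<^sup>+w. \<beta> z w \<partial>dA)"
      by (intro nn_integral_multc \<alpha>z z)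
    also have "\<dots> = ennreal (((rho z)\<^sup>2 * rpot \<nu> 2 z) * (rho z * (\<integral>w. eta2 a w * (cmod (kern z w))^5 \<partial>dA)))"
      unfolding 1 2 using rpot_nonneg[OF \<nu>] by (intro ennreal_mult'[symmetric] mult_nonneg_nonneg zero_le_power2)
    finally show "ennreal (((rho z)\<^sup>2 * rpot \<nu> 2 z) * (rho z * (\<integral>w. eta2 a w * (cmod (kern z w))^5 \<partial>dA)))
       = (\<integral>\<^sup>+\<zeta>. (\<integral>\<^sup>+w. \<alpha> z \<zeta> * \<beta> z w \<partial>dA) \<partial>dA)"
      by (rule sym)
  qed
  also have "\<dots> = (\<integral>\<^sup>+\<zeta>. (\<integral>\<^sup>+z. (\<integral>\<^sup>+w. \<alpha> z \<zeta> * \<beta> z w \<partial>dA) \<partial>dA) \<partial>dA)"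
    by (rule dA2.Fubini'[symmetric]) measurable
  also have "\<dots> = (\<integral>\<^sup>+\<zeta>. (\<integral>\<^sup>+w. (\<integral>\<^sup>+z. \<alpha> z \<zeta> * \<beta> z w \<partial>dA) \<partial>dA) \<partial>dA)"
  proof (rule nn_integral_cong)
    fix \<zeta> assume "\<zeta> \<in> space dA"
    then have [measurable]: "(\<lambda>z. \<alpha> z \<zeta>) \<in> borel_measurable dA" using \<alpha>\<zeta> by simp
    show "(\<integral>\<^sup>+z. (\<integral>\<^sup>+w. \<alpha> z \<zeta> * \<beta> z w \<partial>dA) \<partial>dA) = (\<integral>\<^sup>+w. (\<integral>\<^sup>+z. \<alpha> z \<zeta> * \<beta> z w \<partial>dA) \<partial>dA)"
      by (rule dA2.Fubini'[symmetric]) measurable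
  qed
  also have "\<dots> \<le> (\<integral>\<^sup>+\<zeta>. ennreal (17280 * \<Lambda> * \<nu> \<zeta>) \<partial>dA)"
  proof (rule nn_integral_mono)
    fix \<zeta> assume "\<zeta> \<in> space dA"
    then have \<zeta>: "\<zeta> \<in> disc" by simp
    have \<nu>0: "0 \<le> \<nu> \<zeta>" by (rule rcsupp_nonneg[OF \<nu>])
    have a0: "0 \<le> a w" for w by (rule rcsupp_nonneg[OF a])
    have "(\<integral>\<^sup>+w. (\<integral>\<^sup>+z. \<alpha> z \<zeta> * \<beta> z w \<partial>dA) \<partial>dA) \<le> (\<integral>\<^sup>+w. ennreal (17280 * \<nu> \<zeta> * (a w * (cmod (kern \<zeta> w))\<^sup>2)) \<partial>dA)"
    proof (rule nn_integral_mono)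
      fix w assume "w \<in> space dA"
      then have w: "w \<in> disc" by simp
      have "(\<integral>\<^sup>+z. \<alpha> z \<zeta> * \<beta> z w \<partial>dA) = (\<integral>\<^sup>+z. ennreal (\<nu> \<zeta> * a w) * ennreal ((rho z)^3 * (rho w)\<^sup>2 * (cmod (kern z \<zeta>))^4 * (cmod (kern z w))^5) \<partial>dA)"
      proof (rule nn_integral_cong)
        fix z assume "z \<in> space dA"
        then have "0 \<le> rho z" using r0 by simp
        then show "\<alpha> z \<zeta> * \<beta> z w = ennreal (\<nu> \<zeta> * a w) * ennreal ((rho z)^3 * (rho w)\<^sup>2 * (cmod (kern z \<zeta>))^4 * (cmod (kern z w))^5)"
          unfolding \<alpha>_def \<beta>_def using \<nu>0 a0[of w] r0[OF w]
          by (simp add: eta2_def power3_eq_cube power2_eq_square mult_ac flip: ennreal_mult)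
      qed
      also have "\<dots> = ennreal (\<nu> \<zeta> * a w) * (\<integral>\<^sup>+z. ennreal ((rho z)^3 * (rho w)\<^sup>2 * (cmod (kern z \<zeta>))^4 * (cmod (kern z w))^5) \<partial>dA)"
      proof (rule nn_integral_cmult)
        have [measurable]: "(\<lambda>z. kern z v) \<in> borel_measurable dA" if "v \<in> disc" for v
          using measurable_compose[OF measurable_Pair2'[of v dA dA] measurable_kern_pair] that by simp
        show "(\<lambda>z. ennreal ((rho z)^3 * (rho w)\<^sup>2 * (cmod (kern z \<zeta>))^4 * (cmod (kern z w))^5)) \<in> borel_measurable dA"
          using \<zeta> w by measurable
      qed
      also have "\<dots> \<le> ennreal (\<nu> \<zeta> * a w) * ennreal (17280 * (cmod (kern \<zeta> w))\<^sup>2)"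
        by (intro mult_left_mono kernel_composition \<zeta> w) auto
      also have "\<dots> = ennreal (17280 * \<nu> \<zeta> * (a w * (cmod (kern \<zeta> w))\<^sup>2))"
        using \<nu>0 a0[of w] by (simp add: mult_ac flip: ennreal_mult)
      finally show "(\<integral>\<^sup>+z. \<alpha> z \<zeta> * \<beta> z w \<partial>dA) \<le> ennreal (17280 * \<nu> \<zeta> * (a w * (cmod (kern \<zeta> w))\<^sup>2))" .
    qed
    also have "\<dots> = ennreal (17280 * \<nu> \<zeta> * rpot a 1 \<zeta>)"
      unfolding rpot_def using nn_integral_rpot[OF a \<zeta>, of "17280 * \<nu> \<zeta>" 2] \<nu>0 by simp
    also have "\<dots> \<le> ennreal (17280 * \<Lambda> * \<nu> \<zeta>)"
    proof (cases "\<nu> \<zeta> = 0")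
      case False
      from mult_left_mono[OF P[OF False \<zeta>] \<nu>0] show ?thesis by (intro ennreal_leI) (simp add: mult_ac)
    qed simp
    finally show "(\<integral>\<^sup>+w. (\<integral>\<^sup>+z. \<alpha> z \<zeta> * \<beta> z w \<partial>dA) \<partial>dA) \<le> ennreal (17280 * \<Lambda> * \<nu> \<zeta>)" .
  qed
  also have "\<dots> = ennreal (17280 * \<Lambda> * (\<integral>\<zeta>. \<nu> \<zeta> \<partial>dA))"
    using nn_integral_eq_integral[of dA "\<lambda>\<zeta>. 17280 * \<Lambda> * \<nu> \<zeta>"] rcsupp_integrable[OF \<nu>] rcsupp_nonneg[OF \<nu>] \<Lambda> by simp
  finally show ?thesis .
qed

section \<open>Harnack comparison, separation of levels, and the estimate of one block\<close>

lemma rpot_compare: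
  assumes \<nu>: "rcsupp s \<nu>" and z: "z \<in> disc" and \<zeta>: "\<zeta> \<in> disc" and c: "0 < c"
    and d: "\<And>w. w \<in> disc \<Longrightarrow> \<nu> w \<noteq> 0 \<Longrightarrow> dd z w \<le> c * dd \<zeta> w"
  shows "rpot \<nu> n \<zeta> \<le> c ^ (2 * n) * rpot \<nu> n z"
proof -
  have "rpot \<nu> n \<zeta> \<le> (\<integral>w. c ^ (2 * n) * (\<nu> w * (cmod (kern z w)) ^ (2 * n)) \<partial>dA)"
    unfolding rpot_def
  proof (rule integral_mono)
    fix w assume "w \<in> space dA"
    then have w: "w \<in> disc" by simp
    show "\<nu> w * (cmod (kern \<zeta> w)) ^ (2 * n) \<le> c ^ (2 * n) * (\<nu> w * (cmod (kern z w)) ^ (2 * n))"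
    proof (cases "\<nu> w = 0")
      case False
      have "1 / dd \<zeta> w \<le> c * (1 / dd z w)"
        using d[OF w False] dd_pos[OF z w] dd_pos[OF \<zeta> w] by (simp add: field_simps)
      then have "(cmod (kern \<zeta> w)) ^ (2 * n) \<le> (c * cmod (kern z w)) ^ (2 * n)"
        unfolding norm_kern by (rule power_mono) simp
      from mult_left_mono[OF this rcsupp_nonneg[OF \<nu>, of w]] show ?thesis
        by (simp only: power_mult_distrib mult_ac)
    qed simp
  qed (use integrable_rpot[OF \<nu> \<zeta>] integrable_rpot[OF \<nu> z] in auto)
  then show ?thesis by (simp add: rpot_def)
qed

text \<open>If \<open>rho \<zeta>\<close> were larger, then
  \<open>dd z \<zeta> < 16 * dd \<zeta> w\<close> for every source \<open>w\<close>, so z would see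
  each source within 17 times its distance from \<zeta>. The potential at \<zeta> would be at most
  \<open>17^4\<close> times that at z, which is less than \<open>2 * 17^4\<close>.\<close>

lemma separated_levels:
  assumes a: "rcsupp r a" and z: "z \<in> disc" and \<zeta>: "\<zeta> \<in> disc"
    and S: "rpot a 2 z < 2" "2 * 17^4 < rpot a 2 \<zeta>"
  shows "rho \<zeta> \<le> dd z \<zeta> / 8"
proof (rule ccontr)
  assume n: "\<not> rho \<zeta> \<le> dd z \<zeta> / 8"
  have "rpot a 2 \<zeta> \<le> 17 ^ (2 * 2) * rpot a 2 z"
  proof (rule rpot_compare[OF a z \<zeta>])
    fix w assume w: "w \<in> disc"
    have "dd z w \<le> dd z \<zeta> + dd \<zeta> w" by (rule dd_triangle[OF z \<zeta> w])
    moreover have "rho \<zeta> \<le> 2 * dd \<zeta> w" by (rule rho_le_dd'[OF \<zeta> w])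
    ultimately show "dd z w \<le> 17 * dd \<zeta> w" using n by simp
  qed simp
  with S show False by simp
qed

lemma integral_le_of_nn_integral_le:
  fixes u :: "'a \<Rightarrow> real"
  assumes "u \<in> borel_measurable M" "AE x in M. 0 \<le> u x" "(\<integral>\<^sup>+x. ennreal (u x) \<partial>M) \<le> ennreal c" "0 \<le> c"
  shows "integrable M u" "(\<integral>x. u x \<partial>M) \<le> c"
proof -
  show i: "integrable M u"
    by (rule integrableI_nonneg[OF assms(1,2) le_less_trans[OF assms(3)]]) simp
  show "(\<integral>x. u x \<partial>M) \<le> c"
    using nn_integral_eq_integral[OF i assms(2)] assms(3,4) integral_nonneg_AE[OF assms(2)] by simp
qed

lemma bcs_indicator:
  assumes "Z \<in> sets dA" "\<And>\<zeta>. \<zeta> \<in> Z \<Longrightarrow> cmod \<zeta> \<le> s" "s < 1"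
  shows "bcs s (\<lambda>\<zeta>. indicator Z \<zeta>)"
  unfolding bcs_def
proof (intro conjI)
  show "(\<lambda>\<zeta>. indicator Z \<zeta> :: complex) \<in> borel_measurable dA" using assms(1) by simp
  show "\<exists>B. \<forall>\<zeta>\<in>disc. cmod (indicator Z \<zeta>) \<le> B" by (rule exI[of _ 1]) (simp add: indicator_def)
  show "\<forall>\<zeta>. s < cmod \<zeta> \<longrightarrow> indicator Z \<zeta> = (0::complex)" using assms(2) by (force simp: indicator_def)
qed (rule assms(3))

text \<open>\<open>Z\<close> lies where the potential \<open>S = rpot (eta2 a) 2\<close> is large. Cutting off to \<open>S < 2\<close> separates \<open>Z\<close>
  from the region of integration hyperbolically, so that the lower order terms of the Hardy inequality are
  absorbed, and the error from the cutoff is bounded by composition of kernels together with Sarason's condition.\<close>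

lemma block_estimate:
  assumes f: "A2 f" and g: "A2 g" and C: "0 \<le> C" "Fbd f g C" and a: "rcsupp r a"
    and Z: "Z \<in> sets dA" "\<And>\<zeta>. \<zeta> \<in> Z \<Longrightarrow> cmod \<zeta> \<le> s" "s < 1"
    and ZS: "\<And>\<zeta>. \<zeta> \<in> Z \<Longrightarrow> 2 * 17^4 < rpot (eta2 a) 2 \<zeta>"
    and ZP: "\<And>\<zeta>. \<zeta> \<in> Z \<Longrightarrow> rpot a 1 \<zeta> \<le> \<Lambda>" and \<Lambda>: "0 \<le> \<Lambda>"
  defines "\<nu> \<equiv> \<lambda>\<zeta>. indicator Z \<zeta> * (cmod (g \<zeta>))\<^sup>2"
  shows "rcsupp s \<nu>"
    and "(\<integral>z. (cmod (f z))\<^sup>2 * (if rpot (eta2 a) 2 z \<le> 1 then (rpot \<nu> 1 z)\<^sup>2 else 0) \<partial>dA)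
      \<le> 10^9 * (C + sqn f * sqn g) * (1 + \<Lambda>) * (\<integral>\<zeta>. \<nu> \<zeta> \<partial>dA)"
proof -
  note fL = A2_L2[OF f] and gL = A2_L2[OF g]
  have cg: "continuous_on disc g" by (rule holomorphic_on_imp_continuous_on[OF A2_holomorphic[OF g]])
  have bI: "bcs s (\<lambda>\<zeta>. indicator Z \<zeta>)" by (rule bcs_indicator[OF Z])
  define h where "h \<zeta> = g \<zeta> * indicator Z \<zeta>" for \<zeta>
  have h: "bcs s h" unfolding h_def[abs_def] by (rule bcs_mult_cont[OF bI cg])
  have "bcs s (\<lambda>\<zeta>. (g \<zeta> * cnj (g \<zeta>)) * indicator Z \<zeta>)"
    by (intro bcs_mult_cont[OF bI] continuous_intros cg)
  moreover have "(\<lambda>\<zeta>. (g \<zeta> * cnj (g \<zeta>)) * indicator Z \<zeta>) = cr \<nu>"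
    unfolding complex_norm_square[symmetric] by (auto simp: \<nu>_def fun_eq_iff indicator_def)
  ultimately have "csupp s (cr \<nu>)" using bcs_csupp by simp
  then show \<nu>: "rcsupp s \<nu>" by (simp add: rcsupp_def \<nu>_def)
  define S where "S = rpot (eta2 a) 2"
  define N where "N = rpot \<nu> 1"
  define F where "F z = cmod (pot (cr \<nu>) 2 0 z)" for z
  define H where "H = rpot (eta2 \<nu>) 2"
  define m where "m = (\<integral>\<zeta>. \<nu> \<zeta> \<partial>dA)"
  \<comment> \<open>The Berezin transform of \<nu>.\<close>
  define b where "b z = (rho z)\<^sup>2 * rpot \<nu> 2 z" for z
  define E5 where "E5 z = (\<integral>w. eta2 a w * (cmod (kern z w))^5 \<partial>dA)" for z
  define D where "D z = rho z * E5 z" for z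
  define f2 where "f2 z = (cmod (f z))\<^sup>2" for z
  define X where "X z = max 0 (1 - S z / 2)" for z
  have e: "rcsupp r (eta2 a)" by (rule rcsupp_eta2[OF a])
  have m0: "0 \<le> m" unfolding m_def using rcsupp_nonneg[OF \<nu>] by (intro integral_nonneg_AE) auto
  have mg: "m \<le> sqn g"
    unfolding m_def sqn_def by (rule integral_mono[OF rcsupp_integrable[OF \<nu>] L2_integrable_square[OF gL]]) (simp add: \<nu>_def indicator_def)
  have sh: "sqn h = m" unfolding sqn_def m_def by (rule Bochner_Integration.integral_cong) (auto simp: h_def \<nu>_def indicator_def)
  have N0: "0 \<le> N z" and b0: "0 \<le> b z" and S0: "0 \<le> S z" and H0: "0 \<le> H z" for z
    unfolding N_def b_def S_def H_def using rpot_nonneg[OF \<nu>] rpot_nonneg[OF e] rpot_nonneg[OF rcsupp_eta2[OF \<nu>]] by auto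
  have E0: "0 \<le> E5 z" for z unfolding E5_def using rcsupp_nonneg[OF e] by (intro integral_nonneg_AE) auto
  have D0: "0 \<le> D z" if "z \<in> disc" for z using E0 rho_pos[OF that] by (simp add: D_def)
  have f20: "0 \<le> f2 z" for z by (simp add: f2_def)
  have DS: "D z \<le> 2 * S z" if z: "z \<in> disc" for z
  proof -
    have "D z = (\<integral>w. rho z * (eta2 a w * (cmod (kern z w))^5) \<partial>dA)" by (simp add: D_def E5_def)
    also have "\<dots> \<le> (\<integral>w. 2 * (eta2 a w * (cmod (kern z w))^(2*2)) \<partial>dA)"
    proof (rule integral_mono)
      fix w assume "w \<in> space dA"
      then have w: "w \<in> disc" by simp
      have "rho z * cmod (kern z w) \<le> 2"
        using rho_le_dd'[OF z w] dd_pos[OF z w] by (simp add: norm_kern field_simps)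
      then have "rho z * cmod (kern z w) * (eta2 a w * (cmod (kern z w))^4) \<le> 2 * (eta2 a w * (cmod (kern z w))^4)"
        using rcsupp_nonneg[OF e] by (intro mult_right_mono) auto
      then show "rho z * (eta2 a w * (cmod (kern z w))^5) \<le> 2 * (eta2 a w * (cmod (kern z w))^(2*2))"
        by (simp add: eval_nat_numeral mult_ac)
    qed (use integrable_rpot[OF e z] in auto)
    also have "\<dots> = 2 * S z" by (simp add: S_def rpot_def)
    finally show ?thesis .
  qed
  \<comment> \<open>The \<open>dbar\<close>-derivative of \<open>S\<close>. Its invariant size
    \<open>rho * |Sq|\<close> is bounded by \<open>2 * D\<close>, with one more power of the kernel
    than in \<open>S\<close>.\<close>
  define Sq where "Sq z = 2 * pot (\<lambda>\<zeta>. \<zeta> * of_real (eta2 a \<zeta>)) 2 3 z" for z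
  have wS: "wirt (\<lambda>z. of_real (S z)) z (cnj (Sq z)) (Sq z)" if "z \<in> disc" for z
  proof -
    have "pot (\<lambda>\<zeta>. cnj \<zeta> * of_real (eta2 a \<zeta>)) 3 2 z = cnj (pot (\<lambda>\<zeta>. \<zeta> * of_real (eta2 a \<zeta>)) 2 3 z)"
      unfolding pot_def cnj_integral by (simp add: mult_ac del: Bochner_Integration.integral_cnj)
    then show ?thesis
      using wirt_pot[OF rcsupp_csupp[OF e] that, of 2 2]
      by (simp add: Sq_def S_def numeral_3_eq_3 numeral_2_eq_2 flip: pot_rpot)
  qed
  have cSq: "continuous_on disc Sq"
    unfolding Sq_def[abs_def] by (intro continuous_intros continuous_on_pot[OF csupp_mult_id[OF rcsupp_csupp[OF e]]])
  have SqD: "rho z * cmod (Sq z) \<le> 2 * D z" if z: "z \<in> disc" for z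
  proof -
    have "cmod (pot (\<lambda>\<zeta>. \<zeta> * of_real (eta2 a \<zeta>)) 2 3 z) \<le> (\<integral>\<zeta>. cmod (\<zeta> * of_real (eta2 a \<zeta>) * (kern z \<zeta> ^ 2 * cnj (kern z \<zeta>) ^ 3)) \<partial>dA)"
      unfolding pot_def by (rule integral_norm_bound)
    also have "\<dots> \<le> E5 z"
      unfolding E5_def
    proof (rule integral_mono)
      show "integrable dA (\<lambda>\<zeta>. cmod (\<zeta> * of_real (eta2 a \<zeta>) * (kern z \<zeta> ^ 2 * cnj (kern z \<zeta>) ^ 3)))"
        by (rule integrable_norm[OF integrable_pot[OF csupp_mult_id[OF rcsupp_csupp[OF e]] z]])
      show "integrable dA (\<lambda>w. eta2 a w * (cmod (kern z w))^5)" by (rule integrable_rpot[OF e z])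
      fix w assume "w \<in> space dA"
      then have w: "cmod w \<le> 1" by (simp add: disc_iff)
      have "cmod (w * of_real (eta2 a w) * (kern z w ^ 2 * cnj (kern z w) ^ 3)) = cmod w * (eta2 a w * (cmod (kern z w))^5)"
        using rcsupp_nonneg[OF e, of w] by (simp add: norm_mult norm_power eval_nat_numeral)
      also have "\<dots> \<le> 1 * (eta2 a w * (cmod (kern z w))^5)"
        using w rcsupp_nonneg[OF e, of w] by (intro mult_right_mono) auto
      finally show "cmod (w * of_real (eta2 a w) * (kern z w ^ 2 * cnj (kern z w) ^ 3)) \<le> eta2 a w * (cmod (kern z w))^5" by simp
    qed
    finally have "cmod (Sq z) \<le> 2 * E5 z" by (simp add: Sq_def norm_mult)
    from mult_left_mono[OF this less_imp_le[OF rho_pos[OF z]]] show ?thesis by (simp add: D_def)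
  qed
  have D4: "D z \<le> 4" if "z \<in> disc" "S z < 2" for z using DS[OF that(1)] that(2) by simp
  \<comment> \<open>Separation makes every factor \<open>rho \<zeta> * |kern z \<zeta>|\<close> at
    most 1/8, and \<open>H\<close> contains two of them: this is how the source term becomes
    small.\<close>
  have HN: "H z \<le> N z / 64" if z: "z \<in> disc" "S z < 2" for z
  proof -
    have "H z \<le> (\<integral>\<zeta>. 1/64 * (\<nu> \<zeta> * (cmod (kern z \<zeta>))^(2*1)) \<partial>dA)"
      unfolding H_def rpot_def
    proof (rule integral_mono)
      fix \<zeta> assume "\<zeta> \<in> space dA"
      then have \<zeta>: "\<zeta> \<in> disc" by simp
      show "eta2 \<nu> \<zeta> * (cmod (kern z \<zeta>))^(2*2) \<le> 1/64 * (\<nu> \<zeta> * (cmod (kern z \<zeta>))^(2*1))"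
      proof (cases "\<zeta> \<in> Z")
        case True
        have "rho \<zeta> \<le> dd z \<zeta> / 8"
          by (rule separated_levels[OF e z(1) \<zeta>]) (use z(2) ZS[OF True] in \<open>auto simp: S_def\<close>)
        then have "rho \<zeta> * cmod (kern z \<zeta>) \<le> 1/8"
          using dd_pos[OF z(1) \<zeta>] by (simp add: norm_kern field_simps)
        then have "(rho \<zeta> * cmod (kern z \<zeta>))\<^sup>2 \<le> (1/8)\<^sup>2"
          using rho_pos[OF \<zeta>] by (intro power_mono) auto
        then have "(rho \<zeta> * cmod (kern z \<zeta>))\<^sup>2 * (\<nu> \<zeta> * (cmod (kern z \<zeta>))\<^sup>2) \<le> (1/8)\<^sup>2 * (\<nu> \<zeta> * (cmod (kern z \<zeta>))\<^sup>2)"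
          using rcsupp_nonneg[OF \<nu>] by (intro mult_right_mono) auto
        then show ?thesis by (simp add: eta2_def eval_nat_numeral mult_ac)
      qed (simp add: eta2_def \<nu>_def)
    qed (use integrable_rpot[OF rcsupp_eta2[OF \<nu>] z(1)] integrable_rpot[OF \<nu> z(1)] in auto)
    then show ?thesis by (simp add: N_def rpot_def)
  qed
  \<comment> \<open>With \<open>H\<close> absorbed, the integrated kernel inequality bounds the
    positive potential pointwise. It handles the gradient error below, where no factor
    \<open>X\<close> is left.\<close>
  have Nb: "N z \<le> 2 * F z + b z + 6 * m" if z: "z \<in> disc" "S z < 2" for z
  proof -
    have "2 * (N z - F z) - 10 * (H z + m) \<le> 5/4 * b z"
      using kernel_inequality_integrated[OF \<nu> z(1)] by (simp add: N_def F_def H_def m_def b_def)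
    moreover have "0 \<le> F z" by (simp add: F_def)
    moreover have "2 * (n - \<phi>) - 10 * (\<eta> + \<mu>) \<le> 5/4 * \<beta> \<Longrightarrow> 0 \<le> \<phi> \<Longrightarrow> \<eta> \<le> n / 64 \<Longrightarrow> 0 \<le> \<beta> \<Longrightarrow> 0 \<le> \<mu>
      \<Longrightarrow> n \<le> 2 * \<phi> + \<beta> + 6 * \<mu>" for n \<phi> \<eta> \<mu> \<beta> :: real
      by argo
    ultimately show ?thesis using HN[OF z] b0[of z] m0 by blast
  qed
  \<comment> \<open>Sarason's condition, as \<nu> is at most \<open>|g|^2\<close>.\<close>
  have fb: "f2 z * b z \<le> C" if z: "z \<in> disc" for z
  proof -
    have "rpot \<nu> 2 z = sqn (\<lambda>\<zeta>. h \<zeta> * kern z \<zeta> ^ 2)"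
      unfolding rpot_def sqn_def
      by (rule Bochner_Integration.integral_cong) (auto simp: h_def \<nu>_def indicator_def norm_mult norm_power power_mult_distrib simp flip: power_mult)
    also have "\<dots> \<le> sqn (\<lambda>\<zeta>. g \<zeta> * kern z \<zeta> ^ 2)"
    proof (rule L2_bound(2)[OF sarason_condition(1)[OF f g C z]])
      show "(\<lambda>\<zeta>. h \<zeta> * kern z \<zeta> ^ 2) \<in> borel_measurable dA"
        using L2_measurable[OF bcs_L2[OF h]] measurable_kern[OF z] by simp
    qed (auto simp: h_def indicator_def)
    finally have "f2 z * b z \<le> f2 z * ((rho z)\<^sup>2 * sqn (\<lambda>\<zeta>. g \<zeta> * kern z \<zeta> ^ 2))"
      unfolding b_def f2_def by (intro mult_left_mono) auto
    also have "\<dots> \<le> C" unfolding f2_def by (rule sarason_condition(2)[OF f g C z])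
    finally show ?thesis .
  qed
  have [measurable]: "S \<in> borel_measurable dA" "N \<in> borel_measurable dA" "H \<in> borel_measurable dA" "rho \<in> borel_measurable dA"
    "F \<in> borel_measurable dA" "b \<in> borel_measurable dA" "f2 \<in> borel_measurable dA" "Sq \<in> borel_measurable dA"
    unfolding S_def N_def H_def F_def[abs_def] b_def[abs_def] f2_def[abs_def]
    using measurable_rpot[OF e] measurable_rpot[OF \<nu>] measurable_rpot[OF rcsupp_eta2[OF \<nu>]] measurable_rho
      measurable_pot[OF rcsupp_csupp[OF \<nu>]] L2_measurable[OF fL] measurable_dA_continuous[OF cSq] by auto
  have [measurable]: "X \<in> borel_measurable dA" unfolding X_def[abs_def] by measurable
  have [measurable]: "D \<in> borel_measurable dA"
  proof -
    have [measurable]: "eta2 a \<in> borel_measurable dA" using rcsupp_integrable[OF e] by auto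
    have [measurable]: "case_prod kern \<in> borel_measurable (dA \<Otimes>\<^sub>M dA)" using measurable_kern_pair by simp
    show ?thesis unfolding D_def[abs_def] E5_def[abs_def] by measurable
  qed
  \<comment> \<open>Composition of kernels, linear in the mass \<open>m\<close>; the bound
    \<open>ZP\<close> on \<open>Z\<close> supplies \<Lambda>.\<close>
  have ibD: "integrable dA (\<lambda>z. b z * D z)" "(\<integral>z. b z * D z \<partial>dA) \<le> 17280 * \<Lambda> * m"
  proof -
    have *: "(\<integral>\<^sup>+z. ennreal (b z * D z) \<partial>dA) \<le> ennreal (17280 * \<Lambda> * m)"
      unfolding b_def D_def E5_def m_def
      by (rule nn_integral_composition[OF \<nu> a _ \<Lambda>]) (use ZP in \<open>auto simp: \<nu>_def indicator_def\<close>)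
    have "AE z in dA. 0 \<le> b z * D z" using b0 D0 by (intro AE_I2) auto
    note ** = integral_le_of_nn_integral_le[OF _ this *]
    show "integrable dA (\<lambda>z. b z * D z)" "(\<integral>z. b z * D z \<partial>dA) \<le> 17280 * \<Lambda> * m"
      by (rule **; use m0 \<Lambda> in simp)+
  qed
  obtain BN where BN: "\<And>z. z \<in> disc \<Longrightarrow> \<bar>N z\<bar> \<le> BN" using rpot_bounded[OF \<nu>, of 1] unfolding N_def by blast
  have N2: "(N z)\<^sup>2 \<le> BN\<^sup>2" if "z \<in> disc" for z using power_mono[OF BN[OF that], of 2] by simp
  obtain BF where BF: "\<And>z. z \<in> disc \<Longrightarrow> F z \<le> BF"
    using norm_pot_le[OF rcsupp_csupp[OF \<nu>], of _ 2 0] by (auto simp: F_def)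
  have F2: "(F z)\<^sup>2 \<le> BF\<^sup>2" if "z \<in> disc" for z using power_mono[OF BF[OF that], of 2] by (simp add: F_def)
  have X1: "0 \<le> X z" "X z \<le> 1" if "z \<in> disc" for z using S0[of z] by (auto simp: X_def)
  have X2: "0 \<le> (X z)\<^sup>2" "(X z)\<^sup>2 \<le> 1" if "z \<in> disc" for z using X1[OF that] by (auto intro: power_le_one)
  have prod1: "0 \<le> x \<Longrightarrow> x \<le> 1 \<Longrightarrow> 0 \<le> y \<Longrightarrow> y \<le> c \<Longrightarrow> \<bar>x * y\<bar> \<le> c" for x y c :: real
    using mult_mono[of x 1 y c] by simp
  have if2: "integrable dA f2" unfolding f2_def by (rule L2_integrable_square[OF fL])
  have iN: "integrable dA (\<lambda>z. f2 z * ((X z)\<^sup>2 * (N z)\<^sup>2))"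
    unfolding f2_def by (rule integrable_square_mult_bounded[OF fL, where B = "BN\<^sup>2"]) (measurable, intro prod1 N2 zero_le_power2 X2(2))
  have iF: "integrable dA (\<lambda>z. f2 z * (F z)\<^sup>2)"
    unfolding f2_def by (rule integrable_square_mult_bounded[OF fL, where B = "BF\<^sup>2"]) (measurable, simp add: F2)
  have TF: "(\<integral>z. f2 z * (F z)\<^sup>2 \<partial>dA) \<le> C * m"
  proof -
    have "(\<integral>z. f2 z * (F z)\<^sup>2 \<partial>dA) = sqn (\<lambda>z. f z * bergman_proj (\<lambda>\<zeta>. cnj (g \<zeta>) * h \<zeta>) z)"
    proof -
      have "(\<lambda>\<zeta>. cnj (g \<zeta>) * h \<zeta>) = cr \<nu>"
        by (auto simp: h_def \<nu>_def fun_eq_iff indicator_def mult.commute simp flip: complex_norm_square)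
      then show ?thesis
        unfolding sqn_def by (simp add: F_def f2_def bergman_proj_pot norm_mult power_mult_distrib)
    qed
    also have "\<dots> \<le> C * sqn h" using C(2) h by (simp add: Fbd_def)
    finally show ?thesis by (simp add: sh)
  qed
  define T1 where "T1 = (\<integral>z. f2 z * ((X z)\<^sup>2 * (N z)\<^sup>2) \<partial>dA)"
  have main: "T1 \<le> 260 * (\<integral>z. f2 z * ((X z)\<^sup>2 * (F z)\<^sup>2) \<partial>dA) + 1600 * (\<integral>z. f2 z * ((X z)\<^sup>2 * ((H z)\<^sup>2 + m\<^sup>2)) \<partial>dA) +
     30 * (\<integral>z. f2 z * (if S z < 2 then (rho z * cmod (Sq z))\<^sup>2 * (N z)\<^sup>2 else 0) \<partial>dA)"
  proof -
    have "rho z * cmod (Sq z) \<le> 8" if "z \<in> disc" "S z < 2" for z using SqD[OF that(1)] D4[OF that] by simp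
    from hardy_limit[OF f \<nu> wS cSq S0 this] show ?thesis
      unfolding T1_def f2_def X_def N_def F_def H_def m_def .
  qed
  have "(\<integral>z. f2 z * ((X z)\<^sup>2 * (F z)\<^sup>2) \<partial>dA) \<le> (\<integral>z. f2 z * (F z)\<^sup>2 \<partial>dA)"
  proof (rule integral_mono_AE'[OF iF])
    show "AE z in dA. f2 z * ((X z)\<^sup>2 * (F z)\<^sup>2) \<le> f2 z * (F z)\<^sup>2"
      using mult_right_mono[OF X2(2)] f20 by (intro AE_I2 mult_left_mono) auto
  qed (simp add: f2_def)
  with TF have TF': "(\<integral>z. f2 z * ((X z)\<^sup>2 * (F z)\<^sup>2) \<partial>dA) \<le> C * m" by simp
  have sf: "(\<integral>z. f2 z \<partial>dA) = sqn f" by (simp add: f2_def sqn_def)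
  \<comment> \<open>\<open>4096 = 64^2\<close>. Since \<open>1600 / 4096 < 1\<close>, this share of
    \<open>T1\<close> can later be moved to the left side; \<open>T1\<close> is finite.\<close>
  have TH: "(\<integral>z. f2 z * ((X z)\<^sup>2 * ((H z)\<^sup>2 + m\<^sup>2)) \<partial>dA) \<le> 1/4096 * T1 + m\<^sup>2 * sqn f"
  proof -
    have "(\<integral>z. f2 z * ((X z)\<^sup>2 * ((H z)\<^sup>2 + m\<^sup>2)) \<partial>dA) \<le> (\<integral>z. 1/4096 * (f2 z * ((X z)\<^sup>2 * (N z)\<^sup>2)) + m\<^sup>2 * f2 z \<partial>dA)"
    proof (rule integral_mono_AE')
      show "integrable dA (\<lambda>z. 1/4096 * (f2 z * ((X z)\<^sup>2 * (N z)\<^sup>2)) + m\<^sup>2 * f2 z)" using iN if2 by simp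
      show "AE z in dA. f2 z * ((X z)\<^sup>2 * ((H z)\<^sup>2 + m\<^sup>2)) \<le> 1/4096 * (f2 z * ((X z)\<^sup>2 * (N z)\<^sup>2)) + m\<^sup>2 * f2 z"
      proof (rule AE_I2)
        fix z assume "z \<in> space dA"
        then have z: "z \<in> disc" by simp
        have "(X z)\<^sup>2 * (H z)\<^sup>2 \<le> 1/4096 * ((X z)\<^sup>2 * (N z)\<^sup>2)"
        proof (cases "S z < 2")
          case True
          have "(H z)\<^sup>2 \<le> (N z / 64)\<^sup>2" by (rule power_mono[OF HN[OF z True] H0])
          from mult_left_mono[OF this X2(1)[OF z]] show ?thesis by (simp add: power_divide)
        next
          case False
          then have "X z = 0" by (simp add: X_def)
          then show ?thesis by simp
        qed
        moreover have "(X z)\<^sup>2 * m\<^sup>2 \<le> m\<^sup>2" using mult_right_mono[OF X2(2)[OF z], of "m\<^sup>2"] by simp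
        ultimately have "(X z)\<^sup>2 * ((H z)\<^sup>2 + m\<^sup>2) \<le> 1/4096 * ((X z)\<^sup>2 * (N z)\<^sup>2) + m\<^sup>2" by (simp add: distrib_left)
        from mult_left_mono[OF this f20[of z]]
        show "f2 z * ((X z)\<^sup>2 * ((H z)\<^sup>2 + m\<^sup>2)) \<le> 1/4096 * (f2 z * ((X z)\<^sup>2 * (N z)\<^sup>2)) + m\<^sup>2 * f2 z"
          by (simp add: algebra_simps)
      qed
    qed (simp add: f2_def)
    also have "\<dots> = 1/4096 * T1 + m\<^sup>2 * sqn f" using iN if2 by (simp add: T1_def sf)
    finally show ?thesis .
  qed
  have TE: "(\<integral>z. f2 z * (if S z < 2 then (rho z * cmod (Sq z))\<^sup>2 * (N z)\<^sup>2 else 0) \<partial>dA) \<le> 768 * (C * m) + 6912 * (m\<^sup>2 * sqn f) + 48 * C * (17280 * \<Lambda> * m)"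
  proof -
    have "(\<integral>z. f2 z * (if S z < 2 then (rho z * cmod (Sq z))\<^sup>2 * (N z)\<^sup>2 else 0) \<partial>dA)
       \<le> (\<integral>z. 768 * (f2 z * (F z)\<^sup>2) + 6912 * m\<^sup>2 * f2 z + 48 * C * (b z * D z) \<partial>dA)"
    proof (rule integral_mono_AE')
      show "integrable dA (\<lambda>z. 768 * (f2 z * (F z)\<^sup>2) + 6912 * m\<^sup>2 * f2 z + 48 * C * (b z * D z))"
        using iF if2 ibD(1) by simp
      show "AE z in dA. f2 z * (if S z < 2 then (rho z * cmod (Sq z))\<^sup>2 * (N z)\<^sup>2 else 0) \<le> 768 * (f2 z * (F z)\<^sup>2) + 6912 * m\<^sup>2 * f2 z + 48 * C * (b z * D z)"
      proof (rule AE_I2)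
        fix z assume "z \<in> space dA"
        then have z: "z \<in> disc" by simp
        show "f2 z * (if S z < 2 then (rho z * cmod (Sq z))\<^sup>2 * (N z)\<^sup>2 else 0) \<le> 768 * (f2 z * (F z)\<^sup>2) + 6912 * m\<^sup>2 * f2 z + 48 * C * (b z * D z)"
        proof (cases "S z < 2")
          case True
          have d: "0 \<le> D z" "D z \<le> 4" using D0[OF z] D4[OF z True] by auto
          have "(rho z * cmod (Sq z))\<^sup>2 \<le> (2 * D z)\<^sup>2"
            using SqD[OF z] rho_pos[OF z] by (intro power_mono) auto
          then have Dq: "(rho z * cmod (Sq z))\<^sup>2 \<le> 4 * (D z)\<^sup>2" by (simp add: power_mult_distrib)
          have "(N z)\<^sup>2 \<le> (2 * F z + b z + 6 * m)\<^sup>2" by (rule power_mono[OF Nb[OF z True] N0])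
          also have "\<dots> \<le> 12 * (F z)\<^sup>2 + 3 * (b z)\<^sup>2 + 108 * m\<^sup>2"
            using zero_le_power2[of "2 * F z - b z"] zero_le_power2[of "2 * F z - 6 * m"] zero_le_power2[of "b z - 6 * m"]
            by (simp add: power2_eq_square algebra_simps)
          finally have Nq: "(N z)\<^sup>2 \<le> 12 * (F z)\<^sup>2 + 3 * (b z)\<^sup>2 + 108 * m\<^sup>2" .
          have "(rho z * cmod (Sq z))\<^sup>2 * (N z)\<^sup>2 \<le> 4 * (D z)\<^sup>2 * (12 * (F z)\<^sup>2 + 3 * (b z)\<^sup>2 + 108 * m\<^sup>2)"
            using Dq Nq by (intro mult_mono) auto
          also have "\<dots> = 4 * (D z)\<^sup>2 * (12 * (F z)\<^sup>2 + 108 * m\<^sup>2) + 12 * (D z * D z) * (b z)\<^sup>2"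
            by (simp add: algebra_simps power2_eq_square)
          also have "\<dots> \<le> 4 * 4\<^sup>2 * (12 * (F z)\<^sup>2 + 108 * m\<^sup>2) + 12 * (4 * D z) * (b z)\<^sup>2"
            using d by (intro add_mono mult_right_mono mult_left_mono power_mono) auto
          finally have "f2 z * ((rho z * cmod (Sq z))\<^sup>2 * (N z)\<^sup>2) \<le> f2 z * (4 * 4\<^sup>2 * (12 * (F z)\<^sup>2 + 108 * m\<^sup>2) + 12 * (4 * D z) * (b z)\<^sup>2)"
            by (rule mult_left_mono[OF _ f20])
          also have "\<dots> = 768 * (f2 z * (F z)\<^sup>2) + 6912 * m\<^sup>2 * f2 z + 48 * (f2 z * b z) * (b z * D z)"
            by (simp add: algebra_simps power2_eq_square)
          \<comment> \<open>Of \<open>b^2 * D^2\<close>, one \<open>b\<close> is used up together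
            with \<open>|f|^2\<close> in Sarason's condition, one \<open>D\<close> has been bounded
            by 4, and the product \<open>b * D\<close> is left for \<open>ibD\<close>.\<close>
          also have "48 * (f2 z * b z) * (b z * D z) \<le> 48 * C * (b z * D z)"
            using fb[OF z] b0[of z] d by (intro mult_right_mono mult_left_mono) auto
          finally show ?thesis using True by simp
        next
          case False
          then show ?thesis using C(1) b0[of z] D0[OF z] f20[of z] by simp
        qed
      qed
      show "AE z in dA. 0 \<le> 768 * (f2 z * (F z)\<^sup>2) + 6912 * m\<^sup>2 * f2 z + 48 * C * (b z * D z)"
        using C(1) b0 D0 f20 by (intro AE_I2) simp
    qed
    also have "\<dots> = 768 * (\<integral>z. f2 z * (F z)\<^sup>2 \<partial>dA) + 6912 * m\<^sup>2 * sqn f + 48 * C * (\<integral>z. b z * D z \<partial>dA)"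
      using iF if2 ibD(1) by (simp add: sf)
    also have "\<dots> \<le> 768 * (C * m) + 6912 * m\<^sup>2 * sqn f + 48 * C * (17280 * \<Lambda> * m)"
      using TF ibD(2) C(1) by (intro add_mono mult_left_mono) auto
    finally show ?thesis by (simp add: mult.assoc)
  qed
  have m2: "m\<^sup>2 * sqn f \<le> sqn f * sqn g * m"
    using mult_left_mono[OF mg, of "m * sqn f"] m0 by (simp add: power2_eq_square mult_ac)
  define G where "G = C + sqn f * sqn g"
  have Cm: "0 \<le> C * m" "0 \<le> sqn f * sqn g * m" "0 \<le> C * (\<Lambda> * m)" "0 \<le> sqn f * sqn g * (\<Lambda> * m)" using C(1) m0 \<Lambda> by auto
  have arith: "4 * t \<le> 10^9 * (c + d + e + d')"
    if "t \<le> 260 * x + 1600 * y + 30 * w" "x \<le> c" "y \<le> 1/4096 * t + q" "w \<le> 768 * c + 6912 * q + 829440 * e"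
      "q \<le> d" "0 \<le> c" "0 \<le> d" "0 \<le> e" "0 \<le> d'" for t x y w c q d e d' :: real
    using that by simp
  have TE': "(\<integral>z. f2 z * (if S z < 2 then (rho z * cmod (Sq z))\<^sup>2 * (N z)\<^sup>2 else 0) \<partial>dA) \<le> 768 * (C * m) + 6912 * (m\<^sup>2 * sqn f) + 829440 * (C * (\<Lambda> * m))"
    using TE by simp
  have T1: "4 * T1 \<le> 10^9 * (C * m + sqn f * sqn g * m + C * (\<Lambda> * m) + sqn f * sqn g * (\<Lambda> * m))"
    by (rule arith[OF main TF' TH TE' m2 Cm])
  have "(\<integral>z. f2 z * (if S z \<le> 1 then (N z)\<^sup>2 else 0) \<partial>dA) \<le> (\<integral>z. 4 * (f2 z * ((X z)\<^sup>2 * (N z)\<^sup>2)) \<partial>dA)"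
  proof (rule integral_mono_AE')
    show "integrable dA (\<lambda>z. 4 * (f2 z * ((X z)\<^sup>2 * (N z)\<^sup>2)))" using iN by simp
    show "AE z in dA. f2 z * (if S z \<le> 1 then (N z)\<^sup>2 else 0) \<le> 4 * (f2 z * ((X z)\<^sup>2 * (N z)\<^sup>2))"
    proof (rule AE_I2)
      fix z
      have "(if S z \<le> 1 then (N z)\<^sup>2 else 0) \<le> 4 * ((X z)\<^sup>2 * (N z)\<^sup>2)"
      proof (cases "S z \<le> 1")
        case True
        \<comment> \<open>The cutoff is at least 1/2 on \<open>S <= 1\<close>, hence the factor
          4.\<close>
        then have "(1/2)\<^sup>2 \<le> (X z)\<^sup>2" by (intro power_mono) (auto simp: X_def)
        from mult_right_mono[OF this, of "(N z)\<^sup>2"] show ?thesis using True by (simp add: power2_eq_square)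
      qed simp
      from mult_left_mono[OF this f20[of z]]
      show "f2 z * (if S z \<le> 1 then (N z)\<^sup>2 else 0) \<le> 4 * (f2 z * ((X z)\<^sup>2 * (N z)\<^sup>2))" by (simp only: mult_ac)
    qed
  qed (simp add: f2_def)
  also have "\<dots> = 4 * T1" by (simp add: T1_def)
  also note T1
  also have "10^9 * (C * m + sqn f * sqn g * m + C * (\<Lambda> * m) + sqn f * sqn g * (\<Lambda> * m)) = 10^9 * (C + sqn f * sqn g) * (1 + \<Lambda>) * m"
    by (simp add: algebra_simps)
  finally show "(\<integral>z. (cmod (f z))\<^sup>2 * (if rpot (eta2 a) 2 z \<le> 1 then (rpot \<nu> 1 z)\<^sup>2 else 0) \<partial>dA)
      \<le> 10^9 * (C + sqn f * sqn g) * (1 + \<Lambda>) * (\<integral>\<zeta>. \<nu> \<zeta> \<partial>dA)"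
    unfolding f2_def S_def N_def m_def .
qed

section \<open>Levels of the sources of a potential\<close>

lemma rcsupp_if:
  assumes \<nu>: "rcsupp s \<nu>" and [measurable]: "Measurable.pred dA T"
  shows "rcsupp s (\<lambda>w. if T w then \<nu> w else 0)"
proof -
  have "rcsupp s (\<lambda>w. (if T w then 1 else 0) * \<nu> w)"
    by (rule rcsupp_mult[OF \<nu>, where C = 1]) (auto intro: measurable_If)
  moreover have "(\<lambda>w. (if T w then 1 else 0) * \<nu> w) = (\<lambda>w. if T w then \<nu> w else 0)" by auto
  ultimately show ?thesis by simp
qed

text \<open>For \<open>x = cnj w * \<zeta>\<close>, passing from \<open>1 - t * x\<close> to
  \<open>1 - x\<close> adds at most \<open>(1 - t) * |x|\<close>, and this is at most
  \<open>1 - t * |x|\<close>, hence at most \<open>|1 - t * x|\<close>.\<close>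

lemma dd_radial:
  assumes \<zeta>: "\<zeta> \<in> disc" and w: "w \<in> disc" and t: "0 \<le> t" "t \<le> 1"
  shows "dd \<zeta> w \<le> 2 * dd (of_real t * \<zeta>) w"
proof -
  define x where "x = cnj w * \<zeta>"
  have "cmod x \<le> 1 * 1"
    unfolding x_def norm_mult using \<zeta> w by (intro mult_mono) (auto simp: disc_iff)
  have "1 - x = (1 - of_real t * x) - of_real (1 - t) * x" by (simp add: algebra_simps)
  then have "cmod (1 - x) \<le> cmod (1 - of_real t * x) + cmod (of_real (1 - t) * x)"
    by (simp only: norm_triangle_ineq4)
  moreover have "cmod (of_real (1 - t) * x) = (1 - t) * cmod x" using t by (simp add: norm_mult del: of_real_diff)
  moreover have "1 - t * cmod x \<le> cmod (1 - of_real t * x)"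
    using norm_triangle_ineq2[of 1 "of_real t * x"] t by (simp add: norm_mult)
  moreover have "(1 - t) * cmod x \<le> 1 - t * cmod x" using \<open>cmod x \<le> 1 * 1\<close> by (simp add: algebra_simps)
  ultimately have "cmod (1 - x) \<le> 2 * cmod (1 - of_real t * x)" by linarith
  then show ?thesis by (simp add: dd_def x_def mult_ac)
qed

lemma continuous_attains_level:
  assumes "continuous_on disc S" "\<zeta> \<in> disc" "S 0 \<le> y" "y \<le> (S \<zeta> :: real)"
  shows "\<exists>t. 0 \<le> t \<and> t \<le> 1 \<and> of_real t * \<zeta> \<in> disc \<and> S (of_real t * \<zeta>) = y"
proof -
  have d: "of_real t * \<zeta> \<in> disc" if "0 \<le> t" "t \<le> 1" for t
    using assms(2) mult_right_mono[of t 1 "cmod \<zeta>"] that by (simp add: disc_iff norm_mult)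
  have "continuous_on {0..1} (S \<circ> (\<lambda>t. of_real t * \<zeta>))"
    by (rule continuous_on_compose) (use d in \<open>auto intro!: continuous_intros continuous_on_subset[OF assms(1)]\<close>)
  from IVT'[of "S \<circ> (\<lambda>t. of_real t * \<zeta>)" 0 y 1, OF _ _ _ this] assms(3,4) d show ?thesis by auto
qed

text \<open>A weak maximum principle, by comparison with a point of the support almost nearest to \<open>p\<close>.\<close>

lemma rpot_le_of_le_on_support:
  assumes \<nu>: "rcsupp r \<nu>" and \<nu>2: "rcsupp r' \<nu>2" and le: "\<And>w. \<nu> w \<le> \<nu>2 w"
    and e: "\<And>w. w \<in> disc \<Longrightarrow> \<nu> w \<noteq> 0 \<Longrightarrow> rpot \<nu>2 n w \<le> e" "0 \<le> e" and p: "p \<in> disc"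
  shows "rpot \<nu> n p \<le> 3 ^ (2 * n) * e"
proof (cases "\<exists>w\<in>disc. \<nu> w \<noteq> 0")
  case True
  define A where "A = {w \<in> disc. \<nu> w \<noteq> 0}"
  have bdd: "bdd_below (dd p ` A)" by (rule bdd_belowI[of _ 0]) auto
  have "1 - cmod p \<le> (INF w\<in>A. dd p w)"
  proof (rule cINF_greatest)
    show "A \<noteq> {}" using True by (auto simp: A_def)
    fix w assume "w \<in> A"
    then show "1 - cmod p \<le> dd p w"
      using dd_ge_1_minus[of w p "cmod p"] by (auto simp: A_def disc_iff dd_commute)
  qed
  \<comment> \<open>A positive infimum, attained or not, admits a point \<open>w0\<close> within a
    factor 2 of it; then \<open>dd w0 w <= 2 * dd p w + dd p w\<close>, which explains the constant
    3.\<close>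
  then have I: "0 < (INF w\<in>A. dd p w)" using p by (simp add: disc_iff)
  then have "(INF w\<in>A. dd p w) < 2 * (INF w\<in>A. dd p w)" by simp
  then obtain w0 where w0: "w0 \<in> A" "dd p w0 < 2 * (INF w\<in>A. dd p w)"
    using True by (subst (asm) cINF_less_iff[OF _ bdd]) (auto simp: A_def)
  then have w0': "w0 \<in> disc" "\<nu> w0 \<noteq> 0" by (auto simp: A_def)
  have "rpot \<nu> n p \<le> 3 ^ (2 * n) * rpot \<nu> n w0"
  proof (rule rpot_compare[OF \<nu> w0'(1) p])
    fix w assume w: "w \<in> disc" "\<nu> w \<noteq> 0"
    then have "(INF w\<in>A. dd p w) \<le> dd p w" by (intro cINF_lower[OF bdd]) (simp add: A_def)
    moreover have "dd w0 w \<le> dd w0 p + dd p w" by (rule dd_triangle[OF w0'(1) p w(1)])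
    ultimately show "dd w0 w \<le> 3 * dd p w" using w0(2) dd_commute[of w0 p] by linarith
  qed simp
  also have "rpot \<nu> n w0 \<le> rpot \<nu>2 n w0"
    unfolding rpot_def
    by (intro integral_mono integrable_rpot[OF \<nu> w0'(1)] integrable_rpot[OF \<nu>2 w0'(1)] mult_right_mono le) simp
  also have "\<dots> \<le> e" by (rule e(1)[OF w0'])
  finally show ?thesis by simp
next
  case False
  then have "rpot \<nu> n p = (\<integral>w. 0 \<partial>dA)" unfolding rpot_def by (intro Bochner_Integration.integral_cong) auto
  then show ?thesis using e(2) by simp
qed

text \<open>Sources \<open>u\<close> that \<open>p\<close> sees at a distance comparable to that
  from \<open>w\<close> contribute a multiple of the potential at \<open>p\<close>. All others are
  so close to \<open>w\<close> that they fill only a small area, and there the potential of the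
  squared density \<open>a^2\<close> controls them.\<close>

lemma potential_near_source:
  assumes a: "rcsupp r a" and a2: "rcsupp r (\<lambda>w. (a w)\<^sup>2)"
    and w: "w \<in> disc" and p: "p \<in> disc" and \<zeta>: "\<zeta> \<in> disc" and K: "0 < K"
    and rad: "\<And>u. u \<in> disc \<Longrightarrow> dd \<zeta> u \<le> 2 * dd p u"
    and near: "dd p w \<le> K * rho w"
    and Sp: "rpot (eta2 a) 2 p \<le> 1/162"
    and Q: "20736 * K^6 * rpot (eta2 (\<lambda>w. (a w)\<^sup>2)) 2 \<zeta> \<le> 1"
  shows "rpot (eta2 a) 2 w \<le> 1"
proof -
  note ea = rcsupp_eta2[OF a] and ea2 = rcsupp_eta2[OF a2]
  \<comment> \<open>The weight in Young's inequality. With \<open>648 * K^6\<close> the area term is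
    at most 1/4, and the bound \<open>Q\<close> makes the term with the squared density at most 1/4
    as well, because \<open>4 * 8 * 648 = 20736\<close>; the factor 81 times \<open>1/162\<close>
    supplies the remaining 1/2.\<close>
  define \<alpha> where "\<alpha> = 648 * K^6"
  have \<alpha>: "0 < \<alpha>" using K by (simp add: \<alpha>_def)
  define V where "V = ball w (K * rho w / 2) \<inter> disc"
  have \<rho>: "0 < rho w" by (rule rho_pos[OF w])
  have V: "V \<in> sets dA" unfolding V_def by (simp add: sets_dA sets_restrict_space_iff)
  have mV: "measure dA V \<le> (K * rho w / 2)\<^sup>2"
  proof -
    have "emeasure dA V \<le> ennreal ((K * rho w / 2)\<^sup>2)"
      unfolding V_def by (rule emeasure_dA_ball) (use K \<rho> in simp)
    then show ?thesis by (simp add: dA.emeasure_eq_measure)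
  qed
  define c where "c = (36 * K\<^sup>2 / rho w)\<^sup>2 / (2 * \<alpha>)"
  have c0: "0 \<le> c" using \<alpha> by (simp add: c_def)
  define B where "B u = 81 * (eta2 a u * (cmod (kern p u))^(2*2)) + 8 * \<alpha> * (eta2 (\<lambda>w. (a w)\<^sup>2) u * (cmod (kern \<zeta> u))^(2*2)) + c * indicator V u" for u
  have iV: "integrable dA (indicator V :: complex \<Rightarrow> real)"
    by (rule integrable_real_indicator[OF V]) (simp add: dA.emeasure_eq_measure)
  have iB: "integrable dA B" "(\<integral>u. B u \<partial>dA) = 81 * rpot (eta2 a) 2 p + 8 * \<alpha> * rpot (eta2 (\<lambda>w. (a w)\<^sup>2)) 2 \<zeta> + c * measure dA V"
    using integrable_rpot[OF ea p, of "2*2"] integrable_rpot[OF ea2 \<zeta>, of "2*2"] iV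
    by (simp_all add: B_def[abs_def] rpot_def V_def)
  have "rpot (eta2 a) 2 w \<le> (\<integral>u. B u \<partial>dA)"
    unfolding rpot_def
  proof (rule integral_mono[OF integrable_rpot[OF ea w] iB(1)])
    fix u assume "u \<in> space dA"
    then have u: "u \<in> disc" by simp
    have a0: "0 \<le> a u" by (rule rcsupp_nonneg[OF a])
    have k0: "0 < dd w u" "0 < dd p u" "0 < dd \<zeta> u" using dd_pos w p \<zeta> u by auto
    have ge: "0 \<le> 81 * (eta2 a u * (cmod (kern p u))^(2*2))" "0 \<le> 8 * \<alpha> * (eta2 (\<lambda>w. (a w)\<^sup>2) u * (cmod (kern \<zeta> u))^(2*2))" "0 \<le> c * indicator V u"
      using \<alpha> a0 c0 by (auto simp: eta2_def)
    show "eta2 a u * (cmod (kern w u))^(2*2) \<le> B u"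
    proof (cases "dd p u \<le> 3 * dd w u")
      case True
      then have "cmod (kern w u) \<le> 3 * cmod (kern p u)" using k0 by (simp add: norm_kern field_simps)
      then have "(cmod (kern w u))^(2*2) \<le> (3 * cmod (kern p u))^(2*2)" by (rule power_mono) simp
      from mult_left_mono[OF this rcsupp_nonneg[OF ea]]
      have "eta2 a u * (cmod (kern w u))^(2*2) \<le> 81 * (eta2 a u * (cmod (kern p u))^(2*2))"
        by (simp add: power_mult_distrib mult_ac)
      then show ?thesis unfolding B_def by (intro add_increasing2 ge)
    next
      \<comment> \<open>Here \<open>u\<close> is Euclidean-close to \<open>w\<close>. Young's
        inequality trades the density for its square: \<open>x\<close> carries \<open>a\<close> and
        its square enters the potential of \<open>a^2\<close> at \<zeta>, while \<open>y\<close> is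
        constant and costs the area of \<open>V\<close>.\<close>
      case False
      have "dd p u \<le> dd p w + dd w u" by (rule dd_triangle[OF p w u])
      with False near have 1: "2 * dd p u \<le> 3 * (K * rho w)" "dd w u < K * rho w / 2" by linarith+
      then have "u \<in> V" using norm_diff_le_dd[OF w u] u by (simp add: V_def dist_norm)
      define x where "x = 4 * (rho u * a u * (cmod (kern \<zeta> u))\<^sup>2)"
      define y where "y = 36 * K\<^sup>2 / rho w"
      have "cmod (kern p u) \<le> 2 * cmod (kern \<zeta> u)" using k0 rad[OF u] by (simp add: norm_kern field_simps)
      then have kp: "(cmod (kern p u))\<^sup>2 \<le> 4 * (cmod (kern \<zeta> u))\<^sup>2"
        using power_mono[of "cmod (kern p u)" "2 * cmod (kern \<zeta> u)" 2] by (simp add: power_mult_distrib)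
      have y1: "rho u * (dd p u)\<^sup>2 * (cmod (kern w u))^4 \<le> y"
      proof -
        have 2: "rho u * cmod (kern w u) \<le> 2" using rho_le_dd[OF w u] k0 by (simp add: norm_kern field_simps)
        have 3: "cmod (kern w u) \<le> 2 / rho w" using rho_le_dd'[OF w u] k0 \<rho> by (simp add: norm_kern field_simps)
        have "rho u * (dd p u)\<^sup>2 * (cmod (kern w u))^4 = (rho u * cmod (kern w u)) * (dd p u)\<^sup>2 * (cmod (kern w u))^3"
          by (simp add: eval_nat_numeral)
        also have "\<dots> \<le> 2 * (3/2 * (K * rho w))\<^sup>2 * (2 / rho w)^3"
          using 1 2 3 K \<rho> rho_pos[OF u] by (intro mult_mono power_mono mult_nonneg_nonneg) auto
        also have "\<dots> = y" using \<rho> by (simp add: y_def power2_eq_square power3_eq_cube field_simps)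
        finally show ?thesis .
      qed
      have "eta2 a u * (cmod (kern w u))^(2*2) = (rho u * a u * (cmod (kern p u))\<^sup>2) * (rho u * (dd p u)\<^sup>2 * (cmod (kern w u))^4)"
        using k0 by (simp add: eta2_def norm_kern[of p u] power2_eq_square)
      also have "\<dots> \<le> x * y"
      proof (rule mult_mono)
        show "rho u * a u * (cmod (kern p u))\<^sup>2 \<le> x"
          using mult_left_mono[OF kp, of "rho u * a u"] a0 rho_pos[OF u] by (simp add: x_def mult_ac)
      qed (use y1 a0 rho_pos[OF u] in \<open>auto simp: x_def\<close>)
      also have "x * y \<le> \<alpha> * x\<^sup>2 / 2 + y\<^sup>2 / (2 * \<alpha>)"
      proof -
        have "2 * \<alpha> * (x * y) \<le> \<alpha>\<^sup>2 * x\<^sup>2 + y\<^sup>2"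
          using zero_le_power2[of "\<alpha> * x - y"] by (simp add: power2_eq_square algebra_simps)
        then show ?thesis using \<alpha> by (simp add: field_simps power2_eq_square)
      qed
      also have "\<alpha> * x\<^sup>2 / 2 = 8 * \<alpha> * (eta2 (\<lambda>w. (a w)\<^sup>2) u * (cmod (kern \<zeta> u))^(2*2))"
        by (simp add: x_def eta2_def power2_eq_square eval_nat_numeral)
      also have "y\<^sup>2 / (2 * \<alpha>) = c * indicator V u" using \<open>u \<in> V\<close> by (simp add: y_def c_def)
      finally show ?thesis unfolding B_def add.assoc by (rule add_increasing[OF ge(1)])
    qed
  qed
  also have "\<dots> \<le> 1/2 + 1/4 + 1/4"
    unfolding iB(2)
  proof (intro add_mono)
    have "c * measure dA V \<le> c * (K * rho w / 2)\<^sup>2" by (rule mult_left_mono[OF mV c0])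
    also have "\<dots> = 1/4" using K \<rho> by (simp add: c_def \<alpha>_def field_simps eval_nat_numeral)
    finally show "c * measure dA V \<le> 1/4" .
  qed (use Sp Q in \<open>simp_all add: \<alpha>_def\<close>)
  finally show ?thesis by simp
qed

text \<open>On the radius to \<open>\<zeta>\<close> there is a point \<open>p\<close> with \<open>S p = 1/162\<close>. Its potential can come neither from sources
  at lower levels (maximum principle) nor from sources far away from \<open>p\<close> (bound on \<open>rpot a 1\<close>), and
  the remaining ones lie at levels at most 1.\<close>

lemma good_point:
  assumes a: "rcsupp r a" and a2: "rcsupp r (\<lambda>w. (a w)\<^sup>2)" and \<zeta>: "\<zeta> \<in> disc" and K: "0 < K"
  defines "S \<equiv> rpot (eta2 a) 2"
  assumes S: "S 0 \<le> 1/162" "1/162 \<le> S \<zeta>"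
    and Q: "20736 * K^6 * rpot (eta2 (\<lambda>w. (a w)\<^sup>2)) 2 \<zeta> \<le> 1"
    and P: "2592 * rpot a 1 \<zeta> \<le> K\<^sup>2"
  shows "1 \<le> 5184 * rpot (\<lambda>w. if 1/52488 < S w \<and> S w \<le> 1 then a w else 0) 1 \<zeta>"
proof -
  note ea = rcsupp_eta2[OF a]
  obtain t where t: "0 \<le> t" "t \<le> 1" "of_real t * \<zeta> \<in> disc" "S (of_real t * \<zeta>) = 1/162"
    using continuous_attains_level[OF _ \<zeta> S] continuous_on_rpot[OF ea] by (auto simp: S_def)
  define p where "p = of_real t * \<zeta>"
  have p: "p \<in> disc" and Sp: "S p = 1/162" using t by (auto simp: p_def)
  have rad: "dd \<zeta> u \<le> 2 * dd p u" if "u \<in> disc" for u unfolding p_def by (rule dd_radial[OF \<zeta> that t(1,2)])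
  have [measurable]: "S \<in> borel_measurable dA" unfolding S_def by (rule measurable_rpot[OF ea])
  \<comment> \<open>\<open>52488 = 81 * 648\<close>: the maximum principle loses
    \<open>3^4 = 81\<close>, so the low sources supply at most 1/648, a quarter of
    \<open>S p\<close>.\<close>
  define lo where "lo w = (if S w \<le> 1/52488 then eta2 a w else 0)" for w
  define mid where "mid w = (if 1/52488 < S w \<and> S w \<le> 1 then a w else 0)" for w
  have lo: "rcsupp r lo" unfolding lo_def[abs_def] by (rule rcsupp_if[OF ea]) measurable
  have mid: "rcsupp r mid" unfolding mid_def[abs_def] by (rule rcsupp_if[OF a]) measurable
  have "rpot lo 2 p \<le> 3 ^ (2 * 2) * (1/52488)"
    by (rule rpot_le_of_le_on_support[OF lo ea _ _ _ p]) (auto simp: lo_def S_def rcsupp_nonneg[OF ea] split: if_splits)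
  then have L: "rpot lo 2 p \<le> 1/648" by simp
  have "S p \<le> (\<integral>w. lo w * (cmod (kern p w))^(2*2) + 4 / K\<^sup>2 * (a w * (cmod (kern \<zeta> w))^(2*1)) + 16 * (mid w * (cmod (kern \<zeta> w))^(2*1)) \<partial>dA)"
    unfolding S_def rpot_def[of "eta2 a"]
  proof (rule integral_mono[OF integrable_rpot[OF ea p]])
    show "integrable dA (\<lambda>w. lo w * (cmod (kern p w))^(2*2) + 4 / K\<^sup>2 * (a w * (cmod (kern \<zeta> w))^(2*1)) + 16 * (mid w * (cmod (kern \<zeta> w))^(2*1)))"
      by (intro Bochner_Integration.integrable_add integrable_mult_right integrable_rpot[OF lo p] integrable_rpot[OF a \<zeta>] integrable_rpot[OF mid \<zeta>])
    fix w assume "w \<in> space dA"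
    then have w: "w \<in> disc" by simp
    have k0: "0 < dd p w" "0 < dd \<zeta> w" using dd_pos p \<zeta> w by auto
    have a0: "0 \<le> a w" by (rule rcsupp_nonneg[OF a])
    have ge: "0 \<le> lo w * (cmod (kern p w))^(2*2)" "0 \<le> 4 / K\<^sup>2 * (a w * (cmod (kern \<zeta> w))^(2*1))" "0 \<le> 16 * (mid w * (cmod (kern \<zeta> w))^(2*1))"
      using a0 rcsupp_nonneg[OF lo] rcsupp_nonneg[OF mid] by auto
    have "cmod (kern p w) \<le> 2 * cmod (kern \<zeta> w)" using k0 rad[OF w] by (simp add: norm_kern field_simps)
    then have kp: "(cmod (kern p w))\<^sup>2 \<le> 4 * (cmod (kern \<zeta> w))\<^sup>2"
      using power_mono[of "cmod (kern p w)" "2 * cmod (kern \<zeta> w)" 2] by (simp add: power_mult_distrib)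
    have eq: "eta2 a w * (cmod (kern p w))^(2*2) = (rho w * cmod (kern p w))\<^sup>2 * (a w * (cmod (kern p w))\<^sup>2)"
      by (simp add: eta2_def eval_nat_numeral)
    have bd: "eta2 a w * (cmod (kern p w))^(2*2) \<le> c\<^sup>2 * 4 * (a w * (cmod (kern \<zeta> w))^(2*1))" if c: "rho w * cmod (kern p w) \<le> c" for c
    proof -
      have "(rho w * cmod (kern p w))\<^sup>2 * (a w * (cmod (kern p w))\<^sup>2) \<le> c\<^sup>2 * (a w * (4 * (cmod (kern \<zeta> w))\<^sup>2))"
        using c kp a0 rho_pos[OF w] by (intro mult_mono power_mono) auto
      then show ?thesis unfolding eq by (simp add: mult_ac)
    qed
    consider "S w \<le> 1/52488" | "K * rho w < dd p w" | "1/52488 < S w" "dd p w \<le> K * rho w" by linarith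
    then show "eta2 a w * (cmod (kern p w))^(2*2) \<le> lo w * (cmod (kern p w))^(2*2) + 4 / K\<^sup>2 * (a w * (cmod (kern \<zeta> w))^(2*1)) + 16 * (mid w * (cmod (kern \<zeta> w))^(2*1))"
    proof cases
      case 1
      then have "lo w = eta2 a w" by (simp add: lo_def)
      then show ?thesis using ge by simp
    next
      case 2
      then have "rho w * cmod (kern p w) \<le> 1 / K" using k0 K by (simp add: norm_kern field_simps)
      from bd[OF this] show ?thesis using ge by (simp add: power_divide)
    next
      case 3
      have "rpot (eta2 a) 2 w \<le> 1"
        by (rule potential_near_source[OF a a2 w p \<zeta> K rad 3(2) _ Q]) (use Sp in \<open>simp_all add: S_def\<close>)
      then have "mid w = a w" using 3 by (simp add: mid_def S_def)
      moreover have "rho w * cmod (kern p w) \<le> 2" using rho_le_dd[OF p w] k0 by (simp add: norm_kern field_simps)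
      from bd[OF this] have "eta2 a w * (cmod (kern p w))^(2*2) \<le> 16 * (a w * (cmod (kern \<zeta> w))^(2*1))" by simp
      ultimately have "eta2 a w * (cmod (kern p w))^(2*2) \<le> 16 * (mid w * (cmod (kern \<zeta> w))^(2*1))" by simp
      then show ?thesis by (rule order_trans[OF _ add_increasing[OF add_nonneg_nonneg[OF ge(1,2)] order_refl]])
    qed
  qed
  also have "\<dots> = rpot lo 2 p + 4 / K\<^sup>2 * rpot a 1 \<zeta> + 16 * rpot mid 1 \<zeta>"
    using integrable_rpot[OF lo p, of "2*2"] integrable_rpot[OF a \<zeta>, of "2*1"] integrable_rpot[OF mid \<zeta>, of "2*1"]
    by (simp add: rpot_def)
  \<comment> \<open>Low and far sources take at most 1/648 each from \<open>1/162 = 4/648\<close>.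
    The intermediate ones must supply \<open>1/324\<close>, and
    \<open>16 * 324 = 5184\<close>.\<close>
  finally have "1/162 \<le> 1/648 + 4 / K\<^sup>2 * rpot a 1 \<zeta> + 16 * rpot mid 1 \<zeta>" using L Sp by linarith
  moreover have "4 / K\<^sup>2 * rpot a 1 \<zeta> \<le> 1/648" using P K by (simp add: field_simps)
  ultimately show ?thesis by (simp add: mid_def[abs_def])
qed

section \<open>Duality and the estimate of one band\<close>

lemma rpot_duality:
  assumes \<nu>: "rcsupp s \<nu>" and \<mu>: "rcsupp r \<mu>"
  shows "(\<integral>z. \<nu> z * rpot \<mu> n z \<partial>dA) = (\<integral>w. \<mu> w * rpot \<nu> n w \<partial>dA)"
proof -
  have r: "r < 1" "\<And>w. r < cmod w \<Longrightarrow> \<mu> w = 0" using \<mu> by (auto simp: rcsupp_def csupp_def)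
  define K where "K z w = complex_of_real ((cmod (kern z w)) ^ (2 * n))" for z w
  have [measurable]: "case_prod kern \<in> borel_measurable (dA \<Otimes>\<^sub>M dA)" using measurable_kern_pair by simp
  have KM: "case_prod K \<in> borel_measurable (dA \<Otimes>\<^sub>M dA)" unfolding K_def[abs_def] by measurable
  have Kb: "cmod (K z w) \<le> (1 / (1 - r)) ^ (2 * n)" if z: "z \<in> disc" and w: "w \<in> disc" "cr \<mu> w \<noteq> 0" for z w
  proof -
    have "cmod w \<le> r" using r(2)[of w] w(2) by force
    then have "1 - r \<le> dd z w" using z by (intro dd_ge_1_minus) (auto simp: disc_iff)
    then have "cmod (kern z w) \<le> 1 / (1 - r)" using r(1) by (simp add: norm_kern frac_le)
    then show ?thesis unfolding K_def by (simp add: norm_power power_mono)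
  qed
  have e1: "cr \<nu> z * (\<integral>w. cr \<mu> w * K z w \<partial>dA) = of_real (\<nu> z * rpot \<mu> n z)" for z
    by (simp only: K_def rpot_def of_real_mult[symmetric] integral_complex_of_real)
  have e2: "cr \<mu> w * (\<integral>z. cr \<nu> z * K z w \<partial>dA) = of_real (\<mu> w * rpot \<nu> n w)" for w
  proof -
    have "cmod (kern z w) = cmod (kern w z)" for z by (simp add: norm_kern dd_commute)
    then show ?thesis by (simp only: K_def rpot_def of_real_mult[symmetric] integral_complex_of_real)
  qed
  have "(\<integral>z. cr \<nu> z * (\<integral>w. cr \<mu> w * K z w \<partial>dA) \<partial>dA) = (\<integral>w. cr \<mu> w * (\<integral>z. cr \<nu> z * K z w \<partial>dA) \<partial>dA)"
    by (rule fubini_kernel[OF _ _ KM Kb])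
      (use rcsupp_integrable[OF \<nu>] rcsupp_integrable[OF \<mu>] in \<open>auto intro: integrable_of_real\<close>)
  then show ?thesis unfolding e1 e2 by (simp only: integral_complex_of_real of_real_eq_iff)
qed

lemma bcs_real_measurable: "bcs r (cr k) \<Longrightarrow> k \<in> borel_measurable dA"
  using csupp_integrable[OF bcs_csupp, of r "cr k"] by (auto simp: complex_of_real_integrable_eq)

lemma bcs_power2:
  assumes "bcs r (cr k)"
  shows "bcs r (cr (\<lambda>w. (k w)\<^sup>2))"
  unfolding bcs_def
proof (intro conjI)
  have "k \<in> borel_measurable dA" by (rule bcs_real_measurable[OF assms])
  then show "cr (\<lambda>w. (k w)\<^sup>2) \<in> borel_measurable dA" by simp
  obtain B where "\<And>w. w \<in> disc \<Longrightarrow> \<bar>k w\<bar> \<le> B" using assms by (auto simp: bcs_def)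
  then have "\<forall>w\<in>disc. cmod (cr (\<lambda>w. (k w)\<^sup>2) w) \<le> B\<^sup>2"
    by (metis abs_ge_zero norm_of_real power_abs power_mono)
  then show "\<exists>B. \<forall>w\<in>disc. cmod (cr (\<lambda>w. (k w)\<^sup>2) w) \<le> B" by blast
qed (use assms in \<open>auto simp: bcs_def\<close>)

lemma rcsupp_weight:
  assumes f: "A2 f" and k: "bcs r (cr k)" "\<And>w. 0 \<le> k w"
  shows "rcsupp r (\<lambda>w. cmod (f w) * k w)" and "rcsupp r (\<lambda>w. (cmod (f w) * k w)\<^sup>2)"
proof -
  have c: "continuous_on disc (\<lambda>w. complex_of_real ((cmod (f w))^n))" for n
    by (intro continuous_intros holomorphic_on_imp_continuous_on[OF A2_holomorphic[OF f]])
  from bcs_csupp[OF bcs_mult_cont[OF k(1) c[of 1]]] bcs_csupp[OF bcs_mult_cont[OF bcs_power2[OF k(1)] c[of 2]]]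
  show "rcsupp r (\<lambda>w. cmod (f w) * k w)" "rcsupp r (\<lambda>w. (cmod (f w) * k w)\<^sup>2)"
    using k(2) by (simp_all add: rcsupp_def power_mult_distrib)
qed

lemma rpot_scale: "rpot (\<lambda>w. c * \<nu> w) n z = c * rpot \<nu> n z"
  unfolding rpot_def by (simp add: mult.assoc)

text \<open>On the band, \<open>good_point\<close> bounds a multiple of the potential of the sources
  at levels just below \<tau> from below by 1. Integrating against \<open>|g|^2\<close> and
  dualizing moves the potential to \<nu> and the integration to those sources, where Cauchy-Schwarz
  separates \<open>k\<close> from \<open>|f| * N\<close> and \<open>block_estimate\<close> bounds
  the latter.\<close>

lemma band_estimate:
  assumes f: "A2 f" and g: "A2 g" and C: "0 \<le> C" "Fbd f g C" and k: "bcs r (cr k)" "\<And>w. 0 \<le> k w"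
    and a_def: "a = (\<lambda>w. cmod (f w) * k w)" and S_def: "S = rpot (eta2 a) 2"
    and Z: "Z \<in> sets dA" "\<And>\<zeta>. \<zeta> \<in> Z \<Longrightarrow> cmod \<zeta> \<le> s" "s < 1" and \<tau>: "0 < \<tau>" and S0: "S 0 \<le> \<tau> / 162"
    and ZS: "\<And>\<zeta>. \<zeta> \<in> Z \<Longrightarrow> 167042 * \<tau> < S \<zeta>" "\<And>\<zeta>. \<zeta> \<in> Z \<Longrightarrow> S \<zeta> \<le> 334084 * \<tau>"
    and ZP: "\<And>\<zeta>. \<zeta> \<in> Z \<Longrightarrow> rpot a 1 \<zeta> \<le> 60 * S \<zeta>"
    and ZQ: "\<And>\<zeta>. \<zeta> \<in> Z \<Longrightarrow> 20736 * 228000^6 * 334084\<^sup>2 * rpot (eta2 (\<lambda>w. (a w)\<^sup>2)) 2 \<zeta> \<le> (S \<zeta>)\<^sup>2"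
  shows "\<tau>\<^sup>2 * (\<integral>\<zeta>. indicator Z \<zeta> * (cmod (g \<zeta>))\<^sup>2 \<partial>dA)
    \<le> 10^24 * (C + sqn f * sqn g) * (\<integral>w. (if \<tau> / 52488 < S w \<and> S w \<le> \<tau> then (k w)\<^sup>2 else 0) \<partial>dA)"
proof -
  have a: "rcsupp r a" and a2: "rcsupp r (\<lambda>w. (a w)\<^sup>2)" unfolding a_def by (rule rcsupp_weight[OF f k])+
  \<comment> \<open>Division by \<tau> brings the levels to the normalization of
    \<open>block_estimate\<close> and \<open>good_point\<close>. The threshold is
    \<open>167042 = 2 * 17^4\<close>, the one of \<open>separated_levels\<close>, and the band is
    dyadic with upper end 334084.\<close>
  define b where "b w = 1 / \<tau> * a w" for w
  have b: "rcsupp r b" unfolding b_def[abs_def] by (rule rcsupp_mult[OF a, where C = "1/\<tau>"]) (use \<tau> in auto)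
  have "rcsupp r (\<lambda>w. (1 / \<tau>)\<^sup>2 * (a w)\<^sup>2)" by (rule rcsupp_mult[OF a2, where C = "(1/\<tau>)\<^sup>2"]) auto
  then have b2: "rcsupp r (\<lambda>w. (b w)\<^sup>2)" by (simp add: b_def power_divide)
  have "eta2 b = (\<lambda>w. 1 / \<tau> * eta2 a w)" by (simp add: eta2_def b_def fun_eq_iff)
  then have Sb: "rpot (eta2 b) 2 z = S z / \<tau>" for z by (simp only: rpot_scale S_def) simp
  have Pb: "rpot b 1 z = rpot a 1 z / \<tau>" for z unfolding b_def[abs_def] rpot_scale by simp
  have "eta2 (\<lambda>w. (b w)\<^sup>2) = (\<lambda>w. 1 / \<tau>\<^sup>2 * eta2 (\<lambda>w. (a w)\<^sup>2) w)"
    by (simp add: eta2_def b_def fun_eq_iff power_mult_distrib power_divide)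
  then have Qb: "rpot (eta2 (\<lambda>w. (b w)\<^sup>2)) 2 z = rpot (eta2 (\<lambda>w. (a w)\<^sup>2)) 2 z / \<tau>\<^sup>2" for z by (simp only: rpot_scale) simp
  have Zd: "\<zeta> \<in> disc" if "\<zeta> \<in> Z" for \<zeta> using sets.sets_into_space[OF Z(1)] that by auto
  have ZP': "rpot b 1 \<zeta> \<le> 20045040" if "\<zeta> \<in> Z" for \<zeta>
    unfolding Pb using ZP[OF that] ZS(2)[OF that] \<tau> by (simp add: field_simps)
  define \<nu> where "\<nu> \<zeta> = indicator Z \<zeta> * (cmod (g \<zeta>))\<^sup>2" for \<zeta>
  define \<sigma> where "\<sigma> = (\<integral>\<zeta>. \<nu> \<zeta> \<partial>dA)"
  define G where "G = C + sqn f * sqn g"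
  define N where "N = rpot \<nu> 1"
  define T where "T w \<longleftrightarrow> \<tau> / 52488 < S w \<and> S w \<le> \<tau>" for w
  define \<kappa> where "\<kappa> = (\<integral>w. (if T w then (k w)\<^sup>2 else 0) \<partial>dA)"
  have \<nu>: "rcsupp s \<nu>" and blk: "(\<integral>z. (cmod (f z))\<^sup>2 * (if rpot (eta2 b) 2 z \<le> 1 then (N z)\<^sup>2 else 0) \<partial>dA)
      \<le> 10^9 * G * (1 + 20045040) * \<sigma>"
  proof -
    have "2 * 17^4 < rpot (eta2 b) 2 \<zeta>" if "\<zeta> \<in> Z" for \<zeta>
      using ZS(1)[OF that] \<tau> by (simp add: Sb field_simps)
    note * = block_estimate[OF f g C b Z this ZP']
    show "rcsupp s \<nu>" "(\<integral>z. (cmod (f z))\<^sup>2 * (if rpot (eta2 b) 2 z \<le> 1 then (N z)\<^sup>2 else 0) \<partial>dA)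
        \<le> 10^9 * G * (1 + 20045040) * \<sigma>"
      unfolding \<nu>_def[abs_def] G_def N_def \<sigma>_def by (rule *; simp)+
  qed
  have N0: "0 \<le> N z" for z unfolding N_def by (rule rpot_nonneg[OF \<nu>])
  have G0: "0 \<le> G" using C(1) by (simp add: G_def)
  have \<sigma>0: "0 \<le> \<sigma>" unfolding \<sigma>_def using rcsupp_nonneg[OF \<nu>] by (intro integral_nonneg_AE) auto
  have \<kappa>0: "0 \<le> \<kappa>" unfolding \<kappa>_def by (intro integral_nonneg_AE) auto
  have [measurable]: "S \<in> borel_measurable dA" "N \<in> borel_measurable dA"
    unfolding S_def N_def by (rule measurable_rpot[OF rcsupp_eta2[OF a]] measurable_rpot[OF \<nu>])+
  have [measurable]: "f \<in> borel_measurable dA" by (rule L2_measurable[OF A2_L2[OF f]])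
  have [measurable]: "k \<in> borel_measurable dA" by (rule bcs_real_measurable[OF k(1)])
  have [measurable]: "Measurable.pred dA T" unfolding T_def by measurable
  define mid where "mid w = (if T w then b w else 0)" for w
  have mid: "rcsupp r mid" unfolding mid_def[abs_def] by (rule rcsupp_if[OF b]) measurable
  have mid_eq: "mid = (\<lambda>w. if 1/52488 < rpot (eta2 b) 2 w \<and> rpot (eta2 b) 2 w \<le> 1 then b w else 0)"
    unfolding mid_def[abs_def] T_def Sb using \<tau> by (auto simp: fun_eq_iff field_simps)
  have low: "1 \<le> 5184 * rpot mid 1 \<zeta>" if \<zeta>: "\<zeta> \<in> Z" for \<zeta>
    unfolding mid_eq
  \<comment> \<open>The rescaled positive potential is at most \<open>20045040 = 60 * 334084\<close>
    on \<open>Z\<close>, and 228000 satisfies \<open>2592 * 20045040 <= 228000^2\<close>.\<close>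
  proof (rule good_point[OF b b2 Zd[OF \<zeta>], where K = 228000])
    show "rpot (eta2 b) 2 0 \<le> 1/162" "1/162 \<le> rpot (eta2 b) 2 \<zeta>"
      unfolding Sb using S0 ZS(1)[OF \<zeta>] \<tau> by (simp_all add: field_simps)
    show "2592 * rpot b 1 \<zeta> \<le> 228000\<^sup>2" using ZP'[OF \<zeta>] by simp
    have "(S \<zeta>)\<^sup>2 \<le> (334084 * \<tau>)\<^sup>2" using ZS[OF \<zeta>] \<tau> by (intro power_mono) auto
    with ZQ[OF \<zeta>] have "334084\<^sup>2 * (20736 * 228000^6 * rpot (eta2 (\<lambda>w. (a w)\<^sup>2)) 2 \<zeta>) \<le> 334084\<^sup>2 * \<tau>\<^sup>2"
      by (simp add: power_mult_distrib)
    then have "20736 * 228000^6 * rpot (eta2 (\<lambda>w. (a w)\<^sup>2)) 2 \<zeta> \<le> \<tau>\<^sup>2" by simp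
    then show "20736 * 228000^6 * rpot (eta2 (\<lambda>w. (b w)\<^sup>2)) 2 \<zeta> \<le> 1"
      unfolding Qb using \<tau> by (simp add: field_simps)
  qed simp
  \<comment> \<open>The two factors for Cauchy-Schwarz: \<open>k\<close> on the narrow window of
    levels, and \<open>|f| * N\<close> on the larger set \<open>S <= \<tau>\<close>, which is where
    \<open>block_estimate\<close> holds.\<close>
  define u where "u w = (if T w then k w else 0)" for w
  define v where "v w = (if S w \<le> \<tau> then cmod (f w) * N w else 0)" for w
  obtain BN where BN: "\<And>z. z \<in> disc \<Longrightarrow> \<bar>N z\<bar> \<le> BN" using rpot_bounded[OF \<nu>, of 1] unfolding N_def by blast
  have v2: "(v w)\<^sup>2 = (cmod (f w))\<^sup>2 * (if rpot (eta2 b) 2 w \<le> 1 then (N w)\<^sup>2 else 0)" for w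
    unfolding v_def Sb using \<tau> by (simp add: power_mult_distrib)
  have vI: "integrable dA (\<lambda>w. (v w)\<^sup>2)"
    unfolding v2 Sb
  proof (rule integrable_square_mult_bounded[OF A2_L2[OF f], where B = "BN\<^sup>2"])
    fix z assume "z \<in> disc"
    from power_mono[OF BN[OF this], of 2] show "\<bar>if S z / \<tau> \<le> 1 then (N z)\<^sup>2 else 0\<bar> \<le> BN\<^sup>2" by simp
  qed measurable
  have u2: "(u w)\<^sup>2 = (if T w then (k w)\<^sup>2 else 0)" for w by (simp add: u_def)
  have uI: "integrable dA (\<lambda>w. (u w)\<^sup>2)"
  proof (rule Bochner_Integration.integrable_bound)
    show "integrable dA (\<lambda>w. (k w)\<^sup>2)" using L2_integrable_square[OF bcs_L2[OF k(1)]] by simp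
    show "(\<lambda>w. (u w)\<^sup>2) \<in> borel_measurable dA" unfolding u2 by measurable
  qed (auto simp: u_def)
  \<comment> \<open>The lower bound \<open>low\<close> inserts a potential into the mass of \<nu>;
    \<open>rpot_duality\<close> then exchanges the roles of \<nu> and \<open>mid\<close>.\<close>
  have "\<sigma> \<le> (\<integral>\<zeta>. 5184 * (\<nu> \<zeta> * rpot mid 1 \<zeta>) \<partial>dA)"
    unfolding \<sigma>_def
  proof (rule integral_mono_AE')
    obtain B where B: "\<And>z. z \<in> disc \<Longrightarrow> \<bar>rpot mid 1 z\<bar> \<le> B" using rpot_bounded[OF mid, of 1] by blast
    have "integrable dA (\<lambda>\<zeta>. (cmod (g \<zeta>))\<^sup>2 * (indicator Z \<zeta> * rpot mid 1 \<zeta>))"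
    proof (rule integrable_square_mult_bounded[OF A2_L2[OF g], where B = B])
      show "(\<lambda>\<zeta>. indicator Z \<zeta> * rpot mid 1 \<zeta>) \<in> borel_measurable dA" using Z(1) measurable_rpot[OF mid] by simp
      fix z assume "z \<in> disc"
      from B[OF this] show "\<bar>indicator Z z * rpot mid 1 z\<bar> \<le> B" by (auto simp: indicator_def)
    qed
    from integrable_mult_right[OF this, of 5184] show "integrable dA (\<lambda>\<zeta>. 5184 * (\<nu> \<zeta> * rpot mid 1 \<zeta>))" by (simp only: \<nu>_def mult_ac)
    show "AE \<zeta> in dA. \<nu> \<zeta> \<le> 5184 * (\<nu> \<zeta> * rpot mid 1 \<zeta>)"
    proof (rule AE_I2)
      fix \<zeta>
      show "\<nu> \<zeta> \<le> 5184 * (\<nu> \<zeta> * rpot mid 1 \<zeta>)"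
      proof (cases "\<zeta> \<in> Z")
        case True
        from mult_left_mono[OF low[OF True] rcsupp_nonneg[OF \<nu>, of \<zeta>]] show ?thesis by (simp add: mult_ac)
      qed (simp add: \<nu>_def)
    qed
  qed (use rcsupp_nonneg[OF \<nu>] rpot_nonneg[OF mid] in auto)
  also have "\<dots> = 5184 * (\<integral>w. mid w * N w \<partial>dA)"
    using rpot_duality[OF \<nu> mid, of 1] by (simp add: N_def)
  also have "(\<integral>w. mid w * N w \<partial>dA) = (\<integral>w. \<bar>u w * v w\<bar> / \<tau> \<partial>dA)"
    using N0 k(2) by (intro Bochner_Integration.integral_cong) (auto simp: mid_def u_def v_def T_def b_def a_def)
  also have "\<dots> = (\<integral>w. \<bar>u w * v w\<bar> \<partial>dA) / \<tau>" by simp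
  finally have "\<tau> * \<sigma> \<le> 5184 * (\<integral>w. \<bar>u w * v w\<bar> \<partial>dA)" using \<tau> by (simp add: field_simps)
  then have "(\<tau> * \<sigma>)\<^sup>2 \<le> (5184 * (\<integral>w. \<bar>u w * v w\<bar> \<partial>dA))\<^sup>2" using \<tau> \<sigma>0 by (intro power_mono) auto
  also have "\<dots> = 5184\<^sup>2 * (\<integral>w. \<bar>u w * v w\<bar> \<partial>dA)\<^sup>2" by (simp add: power_mult_distrib)
  also have "\<dots> \<le> 5184\<^sup>2 * ((\<integral>w. (u w)\<^sup>2 \<partial>dA) * (\<integral>w. (v w)\<^sup>2 \<partial>dA))"
    by (intro mult_left_mono integral_Cauchy_Schwarz(2) uI vI) (unfold u_def v_def, measurable)
  also have "\<dots> \<le> 5184\<^sup>2 * (\<kappa> * (10^9 * G * (1 + 20045040) * \<sigma>))"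
    using blk \<kappa>0 unfolding u2 v2 \<kappa>_def[symmetric] by (intro mult_left_mono) auto
  also have "\<dots> \<le> 10^24 * G * \<kappa> * \<sigma>"
  proof -
    have "5184\<^sup>2 * 10^9 * (1 + 20045040) * (G * \<kappa> * \<sigma>) \<le> 10^24 * (G * \<kappa> * \<sigma>)"
      using G0 \<kappa>0 \<sigma>0 by (intro mult_right_mono mult_nonneg_nonneg) auto
    then show ?thesis by (simp only: mult_ac)
  qed
  \<comment> \<open>The mass \<sigma> occurs squared on the left and once on the right, so one
    factor cancels unless it is 0.\<close>
  finally have "\<sigma> * (\<tau>\<^sup>2 * \<sigma>) \<le> \<sigma> * (10^24 * G * \<kappa>)" by (simp only: power2_eq_square mult_ac)
  then have "\<tau>\<^sup>2 * \<sigma> \<le> 10^24 * G * \<kappa>"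
    using \<sigma>0 G0 \<kappa>0 by (cases "\<sigma> = 0") (simp_all add: mult_le_cancel_left)
  then show ?thesis unfolding \<sigma>_def \<nu>_def[abs_def] G_def \<kappa>_def T_def .
qed

section \<open>Summation over the levels\<close>

text \<open>Since \<open>52488 < 2^16\<close>, the windows containing a given \<open>x\<close> have
  indices among 16 consecutive ones.\<close>

lemma dyadic_overlap:
  fixes x y \<mu> :: real
  assumes "0 < \<mu>" "0 \<le> y"
  shows "(\<Sum>j<n. if 2^j * \<mu> / 52488 < x \<and> x \<le> 2^j * \<mu> then y else 0) \<le> 16 * y"
proof -
  define J where "J = {j\<in>{..<n}. 2^j * \<mu> / 52488 < x \<and> x \<le> 2^j * \<mu>}"
  have fin: "finite J" by (simp add: J_def)
  have "card J \<le> 16"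
  proof (cases "J = {}")
    case False
    have "J \<subseteq> {Min J..<Min J + 16}"
    proof
      fix j assume j: "j \<in> J"
      have m: "Min J \<in> J" by (rule Min_in[OF fin False])
      have "j < Min J + 16"
      proof (rule ccontr)
        assume "\<not> j < Min J + 16"
        then have "(2::real) ^ (Min J + 16) \<le> 2 ^ j" by (intro power_increasing) auto
        then have "65536 * 2 ^ Min J * \<mu> \<le> 2 ^ j * \<mu>" using assms(1) by (simp add: power_add)
        moreover have "2 ^ j * \<mu> < 52488 * (2 ^ Min J * \<mu>)" using j m by (auto simp: J_def)
        moreover have "0 < 2 ^ Min J * \<mu>" using assms(1) by simp
        ultimately show False by linarith
      qed
      then show "j \<in> {Min J..<Min J + 16}" using Min_le[OF fin j] by simp
    qed
    then show ?thesis using card_mono[of "{Min J..<Min J + 16}" J] by simp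
  qed simp
  have "(\<Sum>j<n. if 2^j * \<mu> / 52488 < x \<and> x \<le> 2^j * \<mu> then y else 0) = (\<Sum>j\<in>J. y)"
    unfolding J_def by (rule sum.inter_filter[symmetric]) simp
  also have "\<dots> \<le> 16 * y" using mult_right_mono[OF _ assms(2), of "real (card J)" 16] \<open>card J \<le> 16\<close> by simp
  finally show ?thesis .
qed

text \<open>The intervals are open below and closed above, so an exact dyadic multiple of \<mu>
  belongs to the preceding interval; \<open>\<mu> < x\<close> guarantees that there is one.\<close>

lemma dyadic_level:
  fixes x \<mu> :: real
  assumes "0 < \<mu>" "\<mu> < x"
  shows "\<exists>j. 2^j * \<mu> < x \<and> x \<le> 2 * (2^j * \<mu>)"
proof -
  have "\<exists>j. 2^j \<le> x / \<mu> \<and> x / \<mu> < 2 ^ Suc j" by (rule dyadic_above) (use assms in simp)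
  then obtain j where j: "2^j * \<mu> \<le> x" "x < 2 * (2^j * \<mu>)" using assms by (auto simp: field_simps)
  show ?thesis
  proof (cases "x = 2^j * \<mu>")
    case True
    have "j \<noteq> 0"
    proof
      assume "j = 0"
      with True assms show False by simp
    qed
    then obtain i where "j = Suc i" using not0_implies_Suc by blast
    then show ?thesis using True assms by (intro exI[of _ i]) simp
  next
    case False
    then show ?thesis using j by (intro exI[of _ j]) simp
  qed
qed

text \<open>On the band \<open>Y j\<close> the size of \<open>S\<close> is \<open>t j\<close> up to
  a constant, so the integral is a sum of the terms that \<open>band_estimate\<close> controls. The
  windows of levels on the right overlap at most 16 times, so their sum costs only a
  constant.\<close>

lemma good_set_estimate:
  assumes f: "A2 f" and g: "A2 g" and C: "0 \<le> C" "Fbd f g C" and k: "bcs r (cr k)" "\<And>w. 0 \<le> k w"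
    and a_def: "a = (\<lambda>w. cmod (f w) * k w)" and S_def: "S = rpot (eta2 a) 2"
    and Z: "Z \<in> sets dA" "\<And>\<zeta>. \<zeta> \<in> Z \<Longrightarrow> cmod \<zeta> \<le> s" "s < 1" and \<tau>: "0 < \<tau>" and S0: "S 0 \<le> \<tau> / 162"
    and ZS: "\<And>\<zeta>. \<zeta> \<in> Z \<Longrightarrow> 167042 * \<tau> < S \<zeta>"
    and ZP: "\<And>\<zeta>. \<zeta> \<in> Z \<Longrightarrow> rpot a 1 \<zeta> \<le> 60 * S \<zeta>"
    and ZQ: "\<And>\<zeta>. \<zeta> \<in> Z \<Longrightarrow> 20736 * 228000^6 * 334084\<^sup>2 * rpot (eta2 (\<lambda>w. (a w)\<^sup>2)) 2 \<zeta> \<le> (S \<zeta>)\<^sup>2"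
  shows "(\<integral>\<zeta>. (cmod (g \<zeta>))\<^sup>2 * (indicator Z \<zeta> * (S \<zeta>)\<^sup>2) \<partial>dA) \<le> 10^37 * (C + sqn f * sqn g) * (\<integral>w. (k w)\<^sup>2 \<partial>dA)"
proof -
  have a: "rcsupp r a" unfolding a_def by (rule rcsupp_weight[OF f k])
  define G where "G = C + sqn f * sqn g"
  have G0: "0 \<le> G" using C(1) by (simp add: G_def)
  have [measurable]: "S \<in> borel_measurable dA" unfolding S_def by (rule measurable_rpot[OF rcsupp_eta2[OF a]])
  have [measurable]: "k \<in> borel_measurable dA" by (rule bcs_real_measurable[OF k(1)])
  have [measurable]: "Z \<in> sets dA" by (rule Z(1))
  have Zd: "\<zeta> \<in> disc" if "\<zeta> \<in> Z" for \<zeta> using sets.sets_into_space[OF Z(1)] that by auto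
  obtain B where B: "\<And>z. z \<in> disc \<Longrightarrow> \<bar>S z\<bar> \<le> B" using rpot_bounded[OF rcsupp_eta2[OF a]] unfolding S_def by blast
  \<comment> \<open>\<open>S\<close> is bounded, so finitely many bands cover
    \<open>Z\<close>.\<close>
  obtain n where n: "B / \<tau> < 2 ^ n" using real_arch_pow[of 2 "B / \<tau>"] by auto
  define t where "t j = 2^j * \<tau>" for j :: nat
  have t: "0 < t j" "\<tau> \<le> t j" for j using \<tau> by (simp_all add: t_def)
  define Y where "Y j = {\<zeta> \<in> Z. 167042 * t j < S \<zeta> \<and> S \<zeta> \<le> 334084 * t j}" for j
  have Y: "Y j \<in> sets dA" for j
  proof -
    have "Y j = Z \<inter> {\<zeta> \<in> space dA. 167042 * t j < S \<zeta> \<and> S \<zeta> \<le> 334084 * t j}" using Zd by (auto simp: Y_def)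
    also have "\<dots> \<in> sets dA" by measurable
    finally show ?thesis .
  qed
  define u where "u j w = (if t j / 52488 < S w \<and> S w \<le> t j then (k w)\<^sup>2 else 0)" for j w
  have band: "(t j)\<^sup>2 * (\<integral>\<zeta>. indicator (Y j) \<zeta> * (cmod (g \<zeta>))\<^sup>2 \<partial>dA) \<le> 10^24 * G * (\<integral>w. u j w \<partial>dA)" for j
    unfolding u_def G_def
    by (rule band_estimate[OF f g C k a_def S_def Y, where s = s]) (use ZP ZQ S0 t[of j] Z(2,3) in \<open>auto simp: Y_def\<close>)
  have ik: "integrable dA (\<lambda>w. (k w)\<^sup>2)" using L2_integrable_square[OF bcs_L2[OF k(1)]] by simp
  have iu: "integrable dA (u j)" for j
  proof (rule Bochner_Integration.integrable_bound[OF ik])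
    have [measurable]: "Measurable.pred dA (\<lambda>w. t j / 52488 < S w \<and> S w \<le> t j)" by measurable
    show "u j \<in> borel_measurable dA" unfolding u_def[abs_def] by measurable
  qed (simp add: u_def)
  have iY: "integrable dA (\<lambda>\<zeta>. indicator (Y j) \<zeta> * (cmod (g \<zeta>))\<^sup>2)" for j
    using integrable_real_mult_indicator[OF Y L2_integrable_square[OF A2_L2[OF g]], of j] by (simp add: mult.commute)
  have "(\<integral>\<zeta>. (cmod (g \<zeta>))\<^sup>2 * (indicator Z \<zeta> * (S \<zeta>)\<^sup>2) \<partial>dA)
      \<le> (\<integral>\<zeta>. (\<Sum>j<n. 334084\<^sup>2 * (t j)\<^sup>2 * (indicator (Y j) \<zeta> * (cmod (g \<zeta>))\<^sup>2)) \<partial>dA)"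
  proof (rule integral_mono_AE')
    show "integrable dA (\<lambda>\<zeta>. \<Sum>j<n. 334084\<^sup>2 * (t j)\<^sup>2 * (indicator (Y j) \<zeta> * (cmod (g \<zeta>))\<^sup>2))"
      by (intro Bochner_Integration.integrable_sum integrable_mult_right iY)
    show "AE \<zeta> in dA. (cmod (g \<zeta>))\<^sup>2 * (indicator Z \<zeta> * (S \<zeta>)\<^sup>2) \<le> (\<Sum>j<n. 334084\<^sup>2 * (t j)\<^sup>2 * (indicator (Y j) \<zeta> * (cmod (g \<zeta>))\<^sup>2))"
    proof (rule AE_I2)
      fix \<zeta>
      show "(cmod (g \<zeta>))\<^sup>2 * (indicator Z \<zeta> * (S \<zeta>)\<^sup>2) \<le> (\<Sum>j<n. 334084\<^sup>2 * (t j)\<^sup>2 * (indicator (Y j) \<zeta> * (cmod (g \<zeta>))\<^sup>2))"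
      proof (cases "\<zeta> \<in> Z")
        case True
        obtain j where j: "2^j * (167042 * \<tau>) < S \<zeta>" "S \<zeta> \<le> 2 * (2^j * (167042 * \<tau>))"
          using dyadic_level[OF _ ZS[OF True]] \<tau> by auto
        have "2^j * \<tau> \<le> S \<zeta>" using j(1) t(1)[of j] by (simp add: t_def)
        also have "S \<zeta> \<le> B" using B[OF Zd[OF True]] by simp
        also have "B < 2^n * \<tau>" using n \<tau> by (simp add: field_simps)
        finally have "j < n" using \<tau> by simp
        have jY: "\<zeta> \<in> Y j" using j True by (simp add: Y_def t_def)
        have "(S \<zeta>)\<^sup>2 \<le> (334084 * t j)\<^sup>2" using jY t(1)[of j] by (intro power_mono) (auto simp: Y_def)
        then have "(S \<zeta>)\<^sup>2 * (cmod (g \<zeta>))\<^sup>2 \<le> (334084 * t j)\<^sup>2 * (cmod (g \<zeta>))\<^sup>2" by (rule mult_right_mono) simp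
        then have "(cmod (g \<zeta>))\<^sup>2 * (indicator Z \<zeta> * (S \<zeta>)\<^sup>2) \<le> 334084\<^sup>2 * (t j)\<^sup>2 * (indicator (Y j) \<zeta> * (cmod (g \<zeta>))\<^sup>2)"
          using True jY by (simp add: power_mult_distrib mult_ac)
        also have "\<dots> \<le> (\<Sum>j<n. 334084\<^sup>2 * (t j)\<^sup>2 * (indicator (Y j) \<zeta> * (cmod (g \<zeta>))\<^sup>2))"
          using \<open>j < n\<close> by (intro member_le_sum[of j "{..<n}"]) auto
        finally show ?thesis .
      next
        case False
        then show ?thesis by (simp add: sum_nonneg)
      qed
    qed
  qed (auto intro!: sum_nonneg)
  also have "\<dots> = (\<Sum>j<n. 334084\<^sup>2 * ((t j)\<^sup>2 * (\<integral>\<zeta>. indicator (Y j) \<zeta> * (cmod (g \<zeta>))\<^sup>2 \<partial>dA)))"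
    by (subst Bochner_Integration.integral_sum) (intro integrable_mult_right iY, simp add: mult.assoc)
  also have "\<dots> \<le> (\<Sum>j<n. 334084\<^sup>2 * (10^24 * G * (\<integral>w. u j w \<partial>dA)))"
    by (intro sum_mono mult_left_mono band) simp
  also have "\<dots> = 334084\<^sup>2 * (10^24 * G * (\<integral>w. (\<Sum>j<n. u j w) \<partial>dA))"
    using iu by (simp only: Bochner_Integration.integral_sum sum_distrib_left)
  also have "\<dots> \<le> 334084\<^sup>2 * (10^24 * G * (\<integral>w. 16 * (k w)\<^sup>2 \<partial>dA))"
  proof (intro mult_left_mono integral_mono)
    fix w show "(\<Sum>j<n. u j w) \<le> 16 * (k w)\<^sup>2" unfolding u_def t_def by (rule dyadic_overlap[OF \<tau>]) simp
  qed (use G0 iu ik in auto)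
  also have "\<dots> = 334084\<^sup>2 * 10^24 * 16 * (G * (\<integral>w. (k w)\<^sup>2 \<partial>dA))" by simp
  also have "\<dots> \<le> 10^37 * (G * (\<integral>w. (k w)\<^sup>2 \<partial>dA))"
    using G0 by (intro mult_right_mono mult_nonneg_nonneg integral_nonneg_AE) auto
  finally show ?thesis by (simp only: G_def mult.assoc)
qed

text \<open>The Hardy inequality without cutoff reduces the claim to a bound for \<open>S\<close> in place of \<open>P\<close>. Points
  outside \<open>Z\<close> are controlled by \<open>Q\<close>, by \<open>S 0\<close>, or by a small multiple of \<open>P\<close>, which is absorbed; this is
  legitimate because the left-hand side is finite for a bounded compactly supported \<open>k\<close>.\<close>

lemma positive_operator_estimate:
  assumes f: "A2 f" and g: "A2 g" and C: "0 \<le> C" "Fbd f g C" and k: "bcs r (cr k)" "\<And>w. 0 \<le> k w"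
  shows "(\<integral>\<zeta>. (cmod (g \<zeta>))\<^sup>2 * (rpot (\<lambda>w. cmod (f w) * k w) 1 \<zeta>)\<^sup>2 \<partial>dA)
    \<le> 10^52 * (C + sqn f * sqn g) * (\<integral>w. (k w)\<^sup>2 \<partial>dA)"
proof -
  note fL = A2_L2[OF f] and gL = A2_L2[OF g]
  define a where "a w = cmod (f w) * k w" for w
  have a: "rcsupp r a" and a2: "rcsupp r (\<lambda>w. (a w)\<^sup>2)" unfolding a_def[abs_def] by (rule rcsupp_weight[OF f k])+
  note ea = rcsupp_eta2[OF a] and ea2 = rcsupp_eta2[OF a2]
  define S where "S = rpot (eta2 a) 2"
  define P where "P = rpot a 1"
  define Q where "Q = rpot (eta2 (\<lambda>w. (a w)\<^sup>2)) 2"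
  define m where "m = (\<integral>w. a w \<partial>dA)"
  define \<kappa> where "\<kappa> = (\<integral>w. (k w)\<^sup>2 \<partial>dA)"
  define G where "G = C + sqn f * sqn g"
  have G0: "0 \<le> G" "C \<le> G" "sqn f * sqn g \<le> G" using C(1) by (simp_all add: G_def)
  have \<kappa>0: "0 \<le> \<kappa>" unfolding \<kappa>_def by (intro integral_nonneg_AE) auto
  have G\<kappa>: "0 \<le> G * \<kappa>" "C * \<kappa> \<le> G * \<kappa>" "sqn f * sqn g * \<kappa> \<le> G * \<kappa>"
    using G0 \<kappa>0 by (auto intro: mult_right_mono)
  have m0: "0 \<le> m" unfolding m_def using rcsupp_nonneg[OF a] by (intro integral_nonneg_AE) auto
  have km: "k \<in> borel_measurable dA" by (rule bcs_real_measurable[OF k(1)])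
  have ik: "integrable dA (\<lambda>w. (k w)\<^sup>2)" using L2_integrable_square[OF bcs_L2[OF k(1)]] by simp
  have m2: "m\<^sup>2 \<le> sqn f * \<kappa>"
  proof -
    have "(\<integral>w. \<bar>cmod (f w) * k w\<bar> \<partial>dA)\<^sup>2 \<le> (\<integral>w. (cmod (f w))\<^sup>2 \<partial>dA) * (\<integral>w. (k w)\<^sup>2 \<partial>dA)"
      by (rule integral_Cauchy_Schwarz(2)[OF _ km L2_integrable_square[OF fL] ik]) (use L2_measurable[OF fL] in measurable)
    then show ?thesis using k(2) by (simp add: m_def a_def \<kappa>_def sqn_def abs_mult)
  qed
  have mg: "m\<^sup>2 * sqn g \<le> G * \<kappa>"
    using mult_right_mono[OF m2, of "sqn g"] G\<kappa>(3) by (simp add: mult_ac)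
  have [measurable]: "S \<in> borel_measurable dA" "P \<in> borel_measurable dA" "Q \<in> borel_measurable dA" "g \<in> borel_measurable dA"
    unfolding S_def P_def Q_def by (rule measurable_rpot[OF ea] measurable_rpot[OF a] measurable_rpot[OF ea2] L2_measurable[OF gL])+
  have nonneg: "0 \<le> S z" "0 \<le> P z" "0 \<le> Q z" for z
    unfolding S_def P_def Q_def by (rule rpot_nonneg[OF ea] rpot_nonneg[OF a] rpot_nonneg[OF ea2])+
  obtain BP where BP: "\<And>z. z \<in> disc \<Longrightarrow> \<bar>P z\<bar> \<le> BP" using rpot_bounded[OF a] unfolding P_def by blast
  obtain BS where BS: "\<And>z. z \<in> disc \<Longrightarrow> \<bar>S z\<bar> \<le> BS" using rpot_bounded[OF ea] unfolding S_def by blast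
  have BP2: "(P z)\<^sup>2 \<le> BP\<^sup>2" and BS2: "(S z)\<^sup>2 \<le> BS\<^sup>2" if "z \<in> disc" for z
    using power_mono[OF BP[OF that], of 2] power_mono[OF BS[OF that], of 2] by simp_all
  have iP: "integrable dA (\<lambda>z. (cmod (g z))\<^sup>2 * (P z)\<^sup>2)"
    by (rule integrable_square_mult_bounded[OF gL, where B = "BP\<^sup>2"]) (measurable, use BP2 in simp)
  have iS: "integrable dA (\<lambda>z. (cmod (g z))\<^sup>2 * (S z)\<^sup>2)"
    by (rule integrable_square_mult_bounded[OF gL, where B = "BS\<^sup>2"]) (measurable, use BS2 in simp)
  have ig: "integrable dA (\<lambda>z. (cmod (g z))\<^sup>2)" by (rule L2_integrable_square[OF gL])
  define I where "I = (\<integral>z. (cmod (g z))\<^sup>2 * (P z)\<^sup>2 \<partial>dA)"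
  define J where "J = (\<integral>z. (cmod (g z))\<^sup>2 * (S z)\<^sup>2 \<partial>dA)"
  have IJ: "I \<le> 260 * (C * \<kappa>) + 1600 * (J + m\<^sup>2 * sqn g)"
  proof -
    \<comment> \<open>The phase of \<open>f\<close> makes \<open>cnj f * h\<close> equal to the
      positive density \<open>a\<close>, so that \<open>Fbd g f\<close> estimates the analytic
      potential of \<open>a\<close>.\<close>
    define h where "h z = sgn (f z) * cr k z" for z
    have hk: "cmod (h z) \<le> cmod (cr k z)" for z by (simp add: h_def norm_mult norm_sgn)
    have h: "bcs r h"
      unfolding bcs_def
    proof (intro conjI)
      have "f \<in> borel_measurable dA" by (rule L2_measurable[OF fL])
      then show "h \<in> borel_measurable dA" unfolding h_def[abs_def] sgn_div_norm using km by measurable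
      show "r < 1" "\<forall>\<zeta>. r < cmod \<zeta> \<longrightarrow> h \<zeta> = 0" using k(1) by (auto simp: bcs_def h_def)
      obtain B where "\<forall>z\<in>disc. cmod (cr k z) \<le> B" using k(1) by (auto simp: bcs_def)
      then show "\<exists>B. \<forall>z\<in>disc. cmod (h z) \<le> B" using order_trans[OF hk] by blast
    qed
    have e: "(\<lambda>\<zeta>. cnj (f \<zeta>) * h \<zeta>) = cr a"
    proof
      fix \<zeta>
      have "f \<zeta> * cnj (f \<zeta>) = of_real (cmod (f \<zeta>)) * of_real (cmod (f \<zeta>))"
        by (simp only: complex_norm_square[symmetric] power2_eq_square of_real_mult)
      then have "cnj (f \<zeta>) * sgn (f \<zeta>) = of_real (cmod (f \<zeta>))"
        by (cases "f \<zeta> = 0") (simp_all add: sgn_eq mult.commute field_simps)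
      then show "cnj (f \<zeta>) * h \<zeta> = cr a \<zeta>" by (simp add: h_def a_def flip: mult.assoc)
    qed
    have "sqn (\<lambda>z. g z * bergman_proj (\<lambda>\<zeta>. cnj (f \<zeta>) * h \<zeta>) z) \<le> C * sqn h"
      using Fbd_swap[OF f g C] h by (simp add: Fbd_def)
    also have "\<dots> \<le> C * sqn (cr k)"
      using L2_bound(2)[OF bcs_L2[OF k(1)] L2_measurable[OF bcs_L2[OF h]] hk] C(1) by (rule mult_left_mono)
    also have "sqn (cr k) = \<kappa>" by (simp add: sqn_def \<kappa>_def)
    finally have 1: "(\<integral>z. (cmod (g z))\<^sup>2 * (cmod (pot (cr a) 2 0 z))\<^sup>2 \<partial>dA) \<le> C * \<kappa>"
      by (simp add: e sqn_def bergman_proj_pot norm_mult power_mult_distrib)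
    have 2: "(\<integral>z. (cmod (g z))\<^sup>2 * ((S z)\<^sup>2 + m\<^sup>2) \<partial>dA) = J + m\<^sup>2 * sqn g"
      using iS ig by (simp add: distrib_left J_def sqn_def mult.commute)
    have "I \<le> 260 * (\<integral>z. (cmod (g z))\<^sup>2 * (cmod (pot (cr a) 2 0 z))\<^sup>2 \<partial>dA)
        + 1600 * (\<integral>z. (cmod (g z))\<^sup>2 * ((S z)\<^sup>2 + m\<^sup>2) \<partial>dA)"
      using hardy_global[OF g a] unfolding I_def P_def S_def m_def .
    also have "\<dots> \<le> 260 * (C * \<kappa>) + 1600 * (J + m\<^sup>2 * sqn g)"
      unfolding 2 by (intro add_mono mult_left_mono 1) auto
    finally show ?thesis .
  qed
  have "I \<le> 10^52 * (G * \<kappa>)"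
  proof (cases "m = 0")
    \<comment> \<open>Separated because the levels start at a positive \<tau>; a density without
      mass has no potential.\<close>
    case True
    have P0: "P z = 0" if z: "z \<in> disc" for z
    proof -
      have r: "r < 1" "\<And>w. r < cmod w \<Longrightarrow> a w = 0" using a by (auto simp: rcsupp_def csupp_def)
      have "P z \<le> (\<integral>w. (1 / (1 - r))\<^sup>2 * a w \<partial>dA)"
        unfolding P_def rpot_def
      proof (rule integral_mono[OF integrable_rpot[OF a z]])
        show "integrable dA (\<lambda>w. (1 / (1 - r))\<^sup>2 * a w)" by (intro integrable_mult_right rcsupp_integrable[OF a])
        fix w assume "w \<in> space dA"
        show "a w * (cmod (kern z w))^(2*1) \<le> (1 / (1 - r))\<^sup>2 * a w"
        proof (cases "cmod w \<le> r")
          case True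
          then have "1 - r \<le> dd z w" using z by (intro dd_ge_1_minus) (auto simp: disc_iff)
          then have "(cmod (kern z w))\<^sup>2 \<le> (1 / (1 - r))\<^sup>2" using r(1) by (intro power_mono) (simp_all add: norm_kern frac_le)
          from mult_right_mono[OF this rcsupp_nonneg[OF a, of w]] show ?thesis by (simp add: mult.commute)
        qed (use r(2)[of w] in simp)
      qed
      also have "\<dots> = 0" using True by (simp add: m_def)
      finally show ?thesis using nonneg(2)[of z] by simp
    qed
    have "I = (\<integral>z. 0 \<partial>dA)" unfolding I_def by (rule Bochner_Integration.integral_cong) (auto simp: P0)
    then show ?thesis using G\<kappa>(1) by simp
  next
    case False
    with m0 have mpos: "0 < m" by simp
    \<comment> \<open>At the centre the kernel is 1 and \<open>rho <= 1\<close>, so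
      \<open>S 0 <= m\<close>; this choice of \<tau> meets the condition
      \<open>S 0 <= \<tau> / 162\<close> of the bands.\<close>
    define \<tau> where "\<tau> = 162 * m"
    have \<tau>: "0 < \<tau>" using mpos by (simp add: \<tau>_def)
    have S0: "S 0 \<le> \<tau> / 162"
    proof -
      have "S 0 \<le> (\<integral>w. a w \<partial>dA)"
        unfolding S_def rpot_def
      proof (rule integral_mono[OF integrable_rpot[OF ea] rcsupp_integrable[OF a]])
        fix w assume "w \<in> space dA"
        then have "0 < rho w" "rho w \<le> 1" by (auto simp: rho_pos rho_le_1)
        then have "(rho w)\<^sup>2 * a w \<le> 1 * a w"
          using rcsupp_nonneg[OF a] by (intro mult_right_mono power_le_one) auto
        then show "eta2 a w * (cmod (kern 0 w))^(2*2) \<le> a w" by (simp add: eta2_def kern_def)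
      qed (simp add: disc_iff)
      then show ?thesis by (simp add: \<tau>_def m_def)
    qed
    \<comment> \<open>Here \<open>20736 * K^6\<close> with \<open>K = 228000\<close> is the
      requirement of \<open>good_point\<close>, and 334084 compares \<tau> with the level of the
      point.\<close>
    define q :: real where "q = 20736 * 228000^6 * 334084\<^sup>2"
    \<comment> \<open>One term for each reason to lie outside \<open>Z\<close>, and one for
      \<open>Z\<close>. As \<open>3600 = 60^2\<close>, the coefficient 1600 of \<open>J\<close>
      returns only \<open>4/9\<close> of \<open>I\<close>, which can be absorbed.\<close>
    define E where "E = q * (C * \<kappa>) + I / 3600 + (167042 * \<tau>)\<^sup>2 * sqn g + 10^37 * (G * \<kappa>)"
    have "sqn (\<lambda>z. g z * cr S z) \<le> E"
    proof (rule sqn_le_of_cut)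
      show "L2 (\<lambda>z. g z * cr S z)" by (rule L2_mult_bounded[OF gL, where B = BS]) (use BS in auto)
      fix s :: real assume s: "0 \<le> s" "s < 1"
      \<comment> \<open>The band estimates need sets inside a smaller disc; \<open>E\<close> does
        not depend on \<open>s\<close>.\<close>
      define D where "D = {\<zeta> \<in> disc. cmod \<zeta> \<le> s}"
      have [measurable]: "(\<lambda>z. z) \<in> borel_measurable dA" by (rule measurable_dA_id)
      have "{\<zeta> \<in> space dA. cmod \<zeta> \<le> s} \<in> sets dA" by measurable
      then have D: "D \<in> sets dA" by (simp add: D_def)
      define Z where "Z = {\<zeta> \<in> D. 167042 * \<tau> < S \<zeta> \<and> P \<zeta> \<le> 60 * S \<zeta> \<and> q * Q \<zeta> \<le> (S \<zeta>)\<^sup>2}"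
      have "Z = D \<inter> {\<zeta> \<in> space dA. 167042 * \<tau> < S \<zeta> \<and> P \<zeta> \<le> 60 * S \<zeta> \<and> q * Q \<zeta> \<le> (S \<zeta>)\<^sup>2}"
        by (auto simp: Z_def D_def)
      also have "\<dots> \<in> sets dA" using D by measurable
      finally have Z: "Z \<in> sets dA" .
      have ZE: "(\<integral>\<zeta>. (cmod (g \<zeta>))\<^sup>2 * (indicator Z \<zeta> * (S \<zeta>)\<^sup>2) \<partial>dA) \<le> 10^37 * (G * \<kappa>)"
      proof -
        have a_eq: "a = (\<lambda>w. cmod (f w) * k w)" by (simp add: a_def fun_eq_iff)
        have "(\<integral>\<zeta>. (cmod (g \<zeta>))\<^sup>2 * (indicator Z \<zeta> * (S \<zeta>)\<^sup>2) \<partial>dA) \<le> 10^37 * G * \<kappa>"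
          unfolding G_def \<kappa>_def
          by (rule good_set_estimate[OF f g C k a_eq S_def Z, where s = s and \<tau> = \<tau>])
            (fold P_def Q_def q_def, use s \<tau> S0 in \<open>auto simp: Z_def D_def\<close>)
        then show ?thesis by (simp only: mult.assoc)
      qed
      define \<nu> where "\<nu> \<zeta> = indicator D \<zeta> * (cmod (g \<zeta>))\<^sup>2" for \<zeta>
      have "bcs s (\<lambda>\<zeta>. complex_of_real ((cmod (g \<zeta>))\<^sup>2) * indicator D \<zeta>)"
        by (intro bcs_mult_cont bcs_indicator[OF D _ s(2)] continuous_intros
            holomorphic_on_imp_continuous_on[OF A2_holomorphic[OF g]]) (simp add: D_def)
      from bcs_csupp[OF this] have \<nu>: "rcsupp s \<nu>"
        by (simp add: rcsupp_def \<nu>_def mult.commute of_real_indicator)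
      \<comment> \<open>Duality puts the weight \<open>|f|^2 * rho^2 * rpot \<nu> 2\<close> on
        \<open>k^2\<close>, and Sarason's condition bounds this weight by \<open>C\<close>. Hence
        points where \<open>Q\<close> dominates \<open>S^2\<close> are harmless.\<close>
      have QE: "(\<integral>\<zeta>. \<nu> \<zeta> * Q \<zeta> \<partial>dA) \<le> C * \<kappa>"
      proof -
        have "(\<integral>\<zeta>. \<nu> \<zeta> * Q \<zeta> \<partial>dA) = (\<integral>w. eta2 (\<lambda>w. (a w)\<^sup>2) w * rpot \<nu> 2 w \<partial>dA)"
          unfolding Q_def by (rule rpot_duality[OF \<nu> ea2])
        also have "\<dots> \<le> (\<integral>w. C * (k w)\<^sup>2 \<partial>dA)"
        proof (rule integral_mono_AE')
          show "integrable dA (\<lambda>w. C * (k w)\<^sup>2)" using ik by simp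
          show "AE w in dA. eta2 (\<lambda>w. (a w)\<^sup>2) w * rpot \<nu> 2 w \<le> C * (k w)\<^sup>2"
          proof (rule AE_I2)
            fix w assume "w \<in> space dA"
            then have w: "w \<in> disc" by simp
            have "rpot \<nu> 2 w \<le> sqn (\<lambda>\<zeta>. g \<zeta> * kern w \<zeta> ^ 2)"
              unfolding rpot_def sqn_def
              by (rule integral_mono[OF integrable_rpot[OF \<nu> w] L2_integrable_square[OF sarason_condition(1)[OF f g C w]]])
                (auto simp: \<nu>_def indicator_def norm_mult norm_power power_mult_distrib simp flip: power_mult)
            then have "(k w)\<^sup>2 * ((cmod (f w))\<^sup>2 * ((rho w)\<^sup>2 * rpot \<nu> 2 w)) \<le> (k w)\<^sup>2 * ((cmod (f w))\<^sup>2 * ((rho w)\<^sup>2 * sqn (\<lambda>\<zeta>. g \<zeta> * kern w \<zeta> ^ 2)))"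
              by (intro mult_left_mono) auto
            also have "\<dots> \<le> (k w)\<^sup>2 * C" by (rule mult_left_mono[OF sarason_condition(2)[OF f g C w]]) simp
            finally show "eta2 (\<lambda>w. (a w)\<^sup>2) w * rpot \<nu> 2 w \<le> C * (k w)\<^sup>2"
              by (simp add: eta2_def a_def power_mult_distrib mult_ac)
          qed
          show "AE w in dA. 0 \<le> C * (k w)\<^sup>2" using C(1) by simp
        qed
        also have "\<dots> = C * \<kappa>" by (simp add: \<kappa>_def)
        finally show ?thesis .
      qed
      have iQ: "integrable dA (\<lambda>\<zeta>. \<nu> \<zeta> * Q \<zeta>)"
      proof -
        obtain BQ where BQ: "\<And>z. z \<in> disc \<Longrightarrow> \<bar>Q z\<bar> \<le> BQ" using rpot_bounded[OF ea2] unfolding Q_def by blast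
        have "integrable dA (\<lambda>\<zeta>. (cmod (g \<zeta>))\<^sup>2 * (indicator D \<zeta> * Q \<zeta>))"
        proof (rule integrable_square_mult_bounded[OF gL, where B = BQ])
          show "(\<lambda>\<zeta>. indicator D \<zeta> * Q \<zeta>) \<in> borel_measurable dA" using D by simp
          fix z assume "z \<in> disc"
          from BQ[OF this] show "\<bar>indicator D z * Q z\<bar> \<le> BQ" by (auto simp: indicator_def)
        qed
        then show ?thesis by (simp only: \<nu>_def mult_ac)
      qed
      have iZ: "integrable dA (\<lambda>\<zeta>. (cmod (g \<zeta>))\<^sup>2 * (indicator Z \<zeta> * (S \<zeta>)\<^sup>2))"
      proof (rule integrable_square_mult_bounded[OF gL, where B = "BS\<^sup>2"])
        show "(\<lambda>\<zeta>. indicator Z \<zeta> * (S \<zeta>)\<^sup>2) \<in> borel_measurable dA" using Z by simp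
        fix z assume "z \<in> disc"
        from BS2[OF this] show "\<bar>indicator Z z * (S z)\<^sup>2\<bar> \<le> BS\<^sup>2" by (auto simp: indicator_def)
      qed
      have "sqn (cut s (\<lambda>z. g z * cr S z)) \<le> (\<integral>\<zeta>. q * (\<nu> \<zeta> * Q \<zeta>) + 1/3600 * ((cmod (g \<zeta>))\<^sup>2 * (P \<zeta>)\<^sup>2) + (167042 * \<tau>)\<^sup>2 * (cmod (g \<zeta>))\<^sup>2
          + (cmod (g \<zeta>))\<^sup>2 * (indicator Z \<zeta> * (S \<zeta>)\<^sup>2) \<partial>dA)"
        unfolding sqn_def
      proof (rule integral_mono_AE')
        show "integrable dA (\<lambda>\<zeta>. q * (\<nu> \<zeta> * Q \<zeta>) + 1/3600 * ((cmod (g \<zeta>))\<^sup>2 * (P \<zeta>)\<^sup>2) + (167042 * \<tau>)\<^sup>2 * (cmod (g \<zeta>))\<^sup>2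
          + (cmod (g \<zeta>))\<^sup>2 * (indicator Z \<zeta> * (S \<zeta>)\<^sup>2))"
          by (intro Bochner_Integration.integrable_add integrable_mult_right iQ iP ig iZ)
        have q0: "0 \<le> q" by (simp add: q_def)
        have pw: "(cmod (cut s (\<lambda>z. g z * cr S z) \<zeta>))\<^sup>2 \<le> q * (\<nu> \<zeta> * Q \<zeta>) + 1/3600 * ((cmod (g \<zeta>))\<^sup>2 * (P \<zeta>)\<^sup>2) + (167042 * \<tau>)\<^sup>2 * (cmod (g \<zeta>))\<^sup>2
          + (cmod (g \<zeta>))\<^sup>2 * (indicator Z \<zeta> * (S \<zeta>)\<^sup>2)" if \<zeta>: "\<zeta> \<in> disc" for \<zeta>
        proof (cases "\<zeta> \<in> D")
          case True
          have "(S \<zeta>)\<^sup>2 \<le> q * Q \<zeta> + 1/3600 * (P \<zeta>)\<^sup>2 + (167042 * \<tau>)\<^sup>2 + indicator Z \<zeta> * (S \<zeta>)\<^sup>2"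
          proof -
            have nn: "0 \<le> q * Q \<zeta>" "0 \<le> (P \<zeta>)\<^sup>2" "0 \<le> (167042 * \<tau>)\<^sup>2" "0 \<le> indicator Z \<zeta> * (S \<zeta>)\<^sup>2"
              using q0 nonneg by auto
            consider "\<zeta> \<in> Z" | "S \<zeta> \<le> 167042 * \<tau>" | "60 * S \<zeta> < P \<zeta>" | "(S \<zeta>)\<^sup>2 < q * Q \<zeta>"
              using True by (force simp: Z_def)
            then show ?thesis
            proof cases
              case 1
              then show ?thesis using nn by simp
            next
              case 2
              then have "(S \<zeta>)\<^sup>2 \<le> (167042 * \<tau>)\<^sup>2" using nonneg by (intro power_mono) auto
              then show ?thesis using nn by linarith
            next
              case 3
              then have "(60 * S \<zeta>)\<^sup>2 \<le> (P \<zeta>)\<^sup>2" using nonneg(1)[of \<zeta>] by (intro power_mono) auto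
              then have "(S \<zeta>)\<^sup>2 \<le> 1/3600 * (P \<zeta>)\<^sup>2" by (simp add: power_mult_distrib)
              then show ?thesis using nn by linarith
            next
              case 4
              then show ?thesis using nn by linarith
            qed
          qed
          from mult_left_mono[OF this, of "(cmod (g \<zeta>))\<^sup>2"] show ?thesis
            using True by (simp add: cut_def D_def \<nu>_def norm_mult power_mult_distrib algebra_simps)
        next
          case False
          then show ?thesis using \<zeta> q0 nonneg by (simp add: cut_def D_def \<nu>_def)
        qed
        then show "AE \<zeta> in dA. (cmod (cut s (\<lambda>z. g z * cr S z) \<zeta>))\<^sup>2 \<le> q * (\<nu> \<zeta> * Q \<zeta>) + 1/3600 * ((cmod (g \<zeta>))\<^sup>2 * (P \<zeta>)\<^sup>2) + (167042 * \<tau>)\<^sup>2 * (cmod (g \<zeta>))\<^sup>2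
          + (cmod (g \<zeta>))\<^sup>2 * (indicator Z \<zeta> * (S \<zeta>)\<^sup>2)" by (intro AE_I2) simp
        show "AE \<zeta> in dA. 0 \<le> q * (\<nu> \<zeta> * Q \<zeta>) + 1/3600 * ((cmod (g \<zeta>))\<^sup>2 * (P \<zeta>)\<^sup>2) + (167042 * \<tau>)\<^sup>2 * (cmod (g \<zeta>))\<^sup>2
          + (cmod (g \<zeta>))\<^sup>2 * (indicator Z \<zeta> * (S \<zeta>)\<^sup>2)" using order_trans[OF zero_le_power2 pw] by (intro AE_I2) simp
      qed
      also have "\<dots> = q * (\<integral>\<zeta>. \<nu> \<zeta> * Q \<zeta> \<partial>dA) + 1/3600 * I + (167042 * \<tau>)\<^sup>2 * sqn g + (\<integral>\<zeta>. (cmod (g \<zeta>))\<^sup>2 * (indicator Z \<zeta> * (S \<zeta>)\<^sup>2) \<partial>dA)"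
        using iQ iP ig iZ by (simp add: I_def sqn_def)
      also have "\<dots> \<le> E" using QE ZE by (simp add: E_def q_def)
      finally show "sqn (cut s (\<lambda>z. g z * cr S z)) \<le> E" .
    qed
    moreover have "sqn (\<lambda>z. g z * cr S z) = J" by (simp add: sqn_def J_def norm_mult power_mult_distrib)
    ultimately have JE: "J \<le> E" by simp
    have e1: "(167042 * \<tau>)\<^sup>2 * sqn g = 732287113126416 * (m\<^sup>2 * sqn g)" by (simp add: \<tau>_def power_mult_distrib)
    have arith: "I \<le> 10^52 * t"
      if "I \<le> 260 * c + 1600 * (J + x)" "J \<le> 20736 * 228000^6 * 334084\<^sup>2 * c + I / 3600 + 732287113126416 * x + 10^37 * t" "c \<le> t" "x \<le> t" "0 \<le> t"
      for c x t :: real using that by simp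
    show ?thesis
      by (rule arith[OF IJ _ G\<kappa>(2) mg G\<kappa>(1)]) (use JE in \<open>simp only: E_def q_def e1\<close>)
  qed
  then show ?thesis by (simp only: I_def P_def a_def[abs_def] G_def \<kappa>_def mult.assoc)
qed

section \<open>From truncations to arbitrary square integrable functions\<close>

lemma truncation:
  assumes u: "L2 u"
  defines "k \<equiv> \<lambda>n w. if cmod w \<le> 1 - 1 / real (n + 1) then min (cmod (u w)) (real n) else 0"
  shows "bcs (1 - 1 / real (n + 1)) (cr (k n))" and "0 \<le> k n w" and "k n w \<le> cmod (u w)"
    and "w \<in> disc \<Longrightarrow> (\<lambda>n. k n w) \<longlonglongrightarrow> cmod (u w)"
proof -
  have [measurable]: "(\<lambda>z. z) \<in> borel_measurable dA" "u \<in> borel_measurable dA"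
    by (rule measurable_dA_id L2_measurable[OF u])+
  show "bcs (1 - 1 / real (n + 1)) (cr (k n))"
    unfolding bcs_def
  proof (intro conjI)
    show "cr (k n) \<in> borel_measurable dA" unfolding k_def by measurable
    show "\<exists>B. \<forall>w\<in>disc. cmod (cr (k n) w) \<le> B" by (rule exI[of _ "real n"]) (auto simp: k_def)
  qed (auto simp: k_def)
  show "0 \<le> k n w" "k n w \<le> cmod (u w)" by (auto simp: k_def)
  assume "w \<in> disc"
  then have w: "0 < 1 - cmod w" by (simp add: disc_iff)
  obtain N1 where N1: "1 / (1 - cmod w) < real N1" using reals_Archimedean2 by blast
  obtain N2 where N2: "cmod (u w) < real N2" using reals_Archimedean2 by blast
  have "k n w = cmod (u w)" if n: "n \<ge> max N1 N2" for n
  proof -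
    have "1 / (1 - cmod w) < real (n + 1)" using N1 n by simp
    then have "cmod w \<le> 1 - 1 / real (n + 1)" using w by (simp add: field_simps)
    then show ?thesis using N2 n by (simp add: k_def)
  qed
  then show "(\<lambda>n. k n w) \<longlonglongrightarrow> cmod (u w)"
    by (intro tendsto_eventually eventually_sequentiallyI[of "max N1 N2"])
qed

text \<open>\<open>positive_operator_estimate\<close> is used with \<open>f\<close> and
  \<open>g\<close> interchanged, which puts \<open>|g|\<close> inside the integral and
  \<open>|f|\<close> outside. It suffices to treat \<open>|u|\<close>, since
  \<open>|Pplus f g u|\<close> is at most \<open>|f| * R\<close>.\<close>

lemma Fbd_imp_Pplus_bounded:
  assumes f: "A2 f" and g: "A2 g" and C: "0 \<le> C" "Fbd f g C"
  shows "Pplus_bounded f g"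
proof -
  define K where "K = 10^52 * (C + sqn g * sqn f)"
  have K0: "0 \<le> K" using C(1) by (simp add: K_def)
  have fL: "L2 f" and gL: "L2 g" using f g by (auto intro: A2_L2)
  have "L2 (Pplus f g u) \<and> l2norm (Pplus f g u) \<le> sqrt K * l2norm u" if u: "L2 u" for u
  proof -
    have [measurable]: "f \<in> borel_measurable dA" "g \<in> borel_measurable dA" "u \<in> borel_measurable dA"
      by (rule L2_measurable fL gL u)+
    define k where "k n w = (if cmod w \<le> 1 - 1 / real (n + 1) then min (cmod (u w)) (real n) else 0)" for n w
    have bk: "bcs (1 - 1 / real (n + 1)) (cr (k n))" and k0: "0 \<le> k n w" and ku: "k n w \<le> cmod (u w)"
      and kl: "w \<in> disc \<Longrightarrow> (\<lambda>n. k n w) \<longlonglongrightarrow> cmod (u w)" for n w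
      unfolding k_def[abs_def] using truncation[OF u] by auto
    have [measurable]: "k n \<in> borel_measurable dA" for n by (rule bcs_real_measurable[OF bk])
    define R where "R z = (\<integral>\<zeta>. cmod (g \<zeta>) * cmod (u \<zeta>) * (cmod (kern z \<zeta>))\<^sup>2 \<partial>dA)" for z
    define Rn where "Rn n = rpot (\<lambda>w. cmod (g w) * k n w) 1" for n
    have int: "integrable dA (\<lambda>\<zeta>. cmod (g \<zeta>) * cmod (u \<zeta>) * (cmod (kern z \<zeta>))\<^sup>2)" if z: "z \<in> disc" for z
    proof -
      have "integrable dA (\<lambda>\<zeta>. (g \<zeta> * u \<zeta>) * (1 / (1 - cnj \<zeta> * z)\<^sup>2))"
        by (rule integrable_mult_bounded[OF L2_integrable_mult[OF gL u] measurable_kernel_square[OF z] kernel_square_bound'[OF _ z]])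
      from integrable_norm[OF this] show ?thesis
        by (simp add: kern_def norm_mult norm_divide norm_power power_divide)
    qed
    have Rlim: "(\<lambda>n. Rn n z) \<longlonglongrightarrow> R z" if z: "z \<in> disc" for z
      unfolding Rn_def rpot_def R_def
    proof (rule integral_dominated_convergence[where w = "\<lambda>\<zeta>. cmod (g \<zeta>) * cmod (u \<zeta>) * (cmod (kern z \<zeta>))\<^sup>2"])
      have [measurable]: "kern z \<in> borel_measurable dA" by (rule measurable_kern[OF z])
      show "(\<lambda>\<zeta>. cmod (g \<zeta>) * cmod (u \<zeta>) * (cmod (kern z \<zeta>))\<^sup>2) \<in> borel_measurable dA" by measurable
      show "(\<lambda>\<zeta>. cmod (g \<zeta>) * k n \<zeta> * (cmod (kern z \<zeta>))^(2*1)) \<in> borel_measurable dA" for n by measurable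
      show "AE \<zeta> in dA. (\<lambda>n. cmod (g \<zeta>) * k n \<zeta> * (cmod (kern z \<zeta>))^(2*1)) \<longlonglongrightarrow> cmod (g \<zeta>) * cmod (u \<zeta>) * (cmod (kern z \<zeta>))\<^sup>2"
        using kl by (intro AE_I2) (auto intro!: tendsto_intros)
      show "AE \<zeta> in dA. norm (cmod (g \<zeta>) * k n \<zeta> * (cmod (kern z \<zeta>))^(2*1)) \<le> cmod (g \<zeta>) * cmod (u \<zeta>) * (cmod (kern z \<zeta>))\<^sup>2" for n
        using k0 ku by (intro AE_I2) (auto simp: abs_mult intro!: mult_right_mono mult_left_mono)
    qed (rule int[OF z])
    have [measurable]: "Rn n \<in> borel_measurable dA" for n
      unfolding Rn_def by (rule measurable_rpot[OF rcsupp_weight(1)[OF g bk k0]])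
    have [measurable]: "R \<in> borel_measurable dA"
      by (rule borel_measurable_LIMSEQ_real[where u = Rn]) (use Rlim in auto)
    have Rn_int: "(\<integral>\<^sup>+z. ennreal ((cmod (f z))\<^sup>2 * (Rn n z)\<^sup>2) \<partial>dA) \<le> ennreal (K * sqn u)" for n
    proof -
      have w: "rcsupp (1 - 1 / real (n + 1)) (\<lambda>w. cmod (g w) * k n w)" by (rule rcsupp_weight(1)[OF g bk k0])
      obtain B where B: "\<And>z. z \<in> disc \<Longrightarrow> \<bar>Rn n z\<bar> \<le> B" using rpot_bounded[OF w, of 1] unfolding Rn_def by blast
      have i: "integrable dA (\<lambda>z. (cmod (f z))\<^sup>2 * (Rn n z)\<^sup>2)"
      proof (rule integrable_square_mult_bounded[OF fL, where B = "B\<^sup>2"])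
        fix z assume "z \<in> disc"
        from power_mono[OF B[OF this], of 2] show "\<bar>(Rn n z)\<^sup>2\<bar> \<le> B\<^sup>2" by simp
      qed measurable
      have "(\<integral>\<^sup>+z. ennreal ((cmod (f z))\<^sup>2 * (Rn n z)\<^sup>2) \<partial>dA) = ennreal (\<integral>z. (cmod (f z))\<^sup>2 * (Rn n z)\<^sup>2 \<partial>dA)"
        by (rule nn_integral_eq_integral[OF i]) simp
      also have "(\<integral>z. (cmod (f z))\<^sup>2 * (Rn n z)\<^sup>2 \<partial>dA) \<le> K * (\<integral>w. (k n w)\<^sup>2 \<partial>dA)"
        using positive_operator_estimate[OF g f C(1) Fbd_swap[OF f g C] bk k0] unfolding Rn_def K_def .
      also have "\<dots> \<le> K * sqn u"
        unfolding sqn_def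
      proof (intro mult_left_mono[OF _ K0] integral_mono)
        show "integrable dA (\<lambda>w. (k n w)\<^sup>2)" using L2_integrable_square[OF bcs_L2[OF bk]] by simp
        show "integrable dA (\<lambda>w. (cmod (u w))\<^sup>2)" by (rule L2_integrable_square[OF u])
        show "(k n w)\<^sup>2 \<le> (cmod (u w))\<^sup>2" for w by (rule power_mono[OF ku k0])
      qed
      finally show ?thesis by (simp add: ennreal_leI)
    qed
    have "(\<integral>\<^sup>+z. ennreal ((cmod (f z))\<^sup>2 * (R z)\<^sup>2) \<partial>dA) = (\<integral>\<^sup>+z. liminf (\<lambda>n. ennreal ((cmod (f z))\<^sup>2 * (Rn n z)\<^sup>2)) \<partial>dA)"
    proof (rule nn_integral_cong)
      fix z assume "z \<in> space dA"
      then have "(\<lambda>n. ennreal ((cmod (f z))\<^sup>2 * (Rn n z)\<^sup>2)) \<longlonglongrightarrow> ennreal ((cmod (f z))\<^sup>2 * (R z)\<^sup>2)"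
        using Rlim by (intro tendsto_intros) auto
      then show "ennreal ((cmod (f z))\<^sup>2 * (R z)\<^sup>2) = liminf (\<lambda>n. ennreal ((cmod (f z))\<^sup>2 * (Rn n z)\<^sup>2))"
        by (intro lim_imp_Liminf[symmetric]) auto
    qed
    \<comment> \<open>Fatou's lemma: the square integrability of the limit is part of the claim and
      cannot be presupposed.\<close>
    also have "\<dots> \<le> liminf (\<lambda>n. \<integral>\<^sup>+z. ennreal ((cmod (f z))\<^sup>2 * (Rn n z)\<^sup>2) \<partial>dA)"
      by (rule nn_integral_liminf) measurable
    also have "\<dots> \<le> ennreal (K * sqn u)"
      by (rule order_trans[OF Liminf_le_Limsup Limsup_bounded]) (use Rn_int in auto)
    finally have nn: "(\<integral>\<^sup>+z. ennreal ((cmod (f z))\<^sup>2 * (R z)\<^sup>2) \<partial>dA) \<le> ennreal (K * sqn u)" .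
    note * = integral_le_of_nn_integral_le[OF _ _ nn]
    have sq: "(cmod (cr (\<lambda>z. cmod (f z) * R z) z))\<^sup>2 = (cmod (f z))\<^sup>2 * (R z)\<^sup>2" for z by (simp add: norm_mult power_mult_distrib)
    have RL: "L2 (cr (\<lambda>z. cmod (f z) * R z))"
      unfolding L2_def sq by (intro conjI *(1)) (use K0 in auto)
    have RK: "sqn (cr (\<lambda>z. cmod (f z) * R z)) \<le> K * sqn u"
      unfolding sqn_def[of "cr _"] sq by (intro *(2)) (use K0 in auto)
    have PM: "Pplus f g u \<in> borel_measurable dA"
    proof -
      have [measurable]: "case_prod kern \<in> borel_measurable (dA \<Otimes>\<^sub>M dA)" using measurable_kern_pair by simp
      have "(\<lambda>z. complex_of_real (cmod (f z)) * (\<integral>\<zeta>. complex_of_real (cmod (g \<zeta>)) * u \<zeta> * complex_of_real ((cmod (kern z \<zeta>))\<^sup>2) \<partial>dA)) \<in> borel_measurable dA"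
        by measurable
      then show ?thesis by (simp add: Pplus_def[abs_def] kern_def norm_divide power_divide)
    qed
    have PR: "cmod (Pplus f g u z) \<le> cmod (cr (\<lambda>z. cmod (f z) * R z) z)" if z: "z \<in> disc" for z
    proof -
      have R0: "0 \<le> R z" unfolding R_def by (intro integral_nonneg_AE) auto
      have "cmod (\<integral>\<zeta>. complex_of_real (cmod (g \<zeta>)) * u \<zeta> / complex_of_real ((cmod (1 - cnj \<zeta> * z))\<^sup>2) \<partial>dA) \<le> R z"
        unfolding R_def
        by (rule order_trans[OF integral_norm_bound])
          (simp add: norm_mult norm_divide norm_power kern_def power_divide)
      from mult_left_mono[OF this, of "cmod (f z)"] show ?thesis using R0 by (simp add: Pplus_def norm_mult)
    qed
    have "L2 (Pplus f g u)" by (rule L2_bound(1)[OF RL PM PR])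
    moreover have "sqn (Pplus f g u) \<le> K * sqn u" by (rule order_trans[OF L2_bound(2)[OF RL PM PR] RK])
    then have "l2norm (Pplus f g u) \<le> sqrt K * l2norm u" unfolding l2norm_eq by (simp flip: real_sqrt_mult)
    ultimately show ?thesis ..
  qed
  then show ?thesis unfolding Pplus_bounded_def by blast
qed

theorem theorem4p1:
  fixes f g :: "complex \<Rightarrow> complex"
  assumes "A2 f" and "A2 g"
  shows "TfTgstar_bounded f g \<longleftrightarrow> Pplus_bounded f g"
  using assms TfTgstar_bounded_imp_Fbd Fbd_imp_Pplus_bounded Pplus_bounded_imp by blast

end
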